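(* Let $K\subset\mathbb{R}^{n+1}$ be a smooth strictly convex body. If $E$ is any anisotropic minimizer in $\mathbb{R}^{n+1}$, then $\partial E=p_0+\lambda(\partial K)$ for some $p_0\in\mathbb{R}^{n+1}$ and $\lambda>0$.
   Context: Here $n\geq 1$ and $V$ is Euclidean volume in $\mathbb{R}^{n+1}$. A convex body is a compact convex set $K\subset\mathbb{R}^{n+1}$ with $0$ in its interior. It is smooth and strictly convex if $\partial K$ is a $C^\infty$ hypersurface containing no segments and its outer unit normal map $\eta_K:\partial K\to\mathbb{S}^n$ is a diffeomorphism. The anisotropic perimeter in $\mathbb{R}^{n+1}$ of a Borel set $E$ is $\mathcal{P}_K(E,\mathbb{R}^{n+1}):=\sup\{\int_E\mathrm{div}\,X\,dV\}$, where $X$ ranges over smooth compactly supported vector fields on $\mathbb{R}^{n+1}$ with values in $K$. An anisotropic minimizer in $\mathbb{R}^{n+1}$ is a Borel set $E$ with $V(E)=v\in(0,\infty)$, finite anisotropic perimeter, and $\mathcal{P}_K(E,\mathbb{R}^{n+1})\le\mathcal{P}_K(E',\mathbb{R}^{n+1})$ for any Borel $E'$ with $V(E')=v$. Minimizers are considered up to sets of volume zero, and one always chooses an open representative with $0<V(E\cap B)<V(B)$ for any open ball $B$ centered at $\partial E$. *)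

theory Defs
  imports "HOL-Analysis.Analysis"
begin

text \<open>
  On an open set of a finite-dimensional space, \<open>Ck_on k f U\<close> says that the iterated directional
  derivatives of \<open>f\<close> up to order \<open>k\<close> exist and are continuous on \<open>U\<close>; it is only meant to be used
  for open \<open>U\<close>.
\<close>

primrec Ck_on :: "nat \<Rightarrow> ('a::real_normed_vector \<Rightarrow> 'b::real_normed_vector) \<Rightarrow> 'a set \<Rightarrow> bool" where
  "Ck_on 0 f U \<longleftrightarrow> continuous_on U f"
| "Ck_on (Suc k) f U \<longleftrightarrow>
     (\<forall>x\<in>U. f differentiable (at x)) \<and> (\<forall>v. Ck_on k (\<lambda>x. frechet_derivative f (at x) v) U)"

definition smooth_on :: "('a::real_normed_vector \<Rightarrow> 'b::real_normed_vector) \<Rightarrow> 'a set \<Rightarrow> bool" where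
  "smooth_on f U \<longleftrightarrow> (\<forall>k. Ck_on k f U)"

text \<open>Embedded hypersurfaces, given by local defining functions.\<close>

definition smooth_hypersurface :: "'a::euclidean_space set \<Rightarrow> bool" where
  "smooth_hypersurface M \<longleftrightarrow>
     (\<forall>p\<in>M. \<exists>U (g :: 'a \<Rightarrow> real). open U \<and> p \<in> U \<and> smooth_on g U \<and>
        (\<forall>x\<in>U. frechet_derivative g (at x) \<noteq> (\<lambda>_. 0)) \<and> M \<inter> U = {x\<in>U. g x = 0})"

definition tangent_space :: "'a::euclidean_space set \<Rightarrow> 'a \<Rightarrow> 'a set" where
  "tangent_space M p =
     {v. \<exists>(c :: real \<Rightarrow> 'a) e. e > 0 \<and> smooth_on c {-e<..<e} \<and> c ` {-e<..<e} \<subseteq> M \<and>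
           c 0 = p \<and> (c has_vector_derivative v) (at 0)}"

text \<open>Smooth maps between subsets of Euclidean spaces: locally restrictions of smooth maps defined
  on open sets of the ambient space.\<close>

definition smooth_map_on ::
    "('a::euclidean_space \<Rightarrow> 'b::euclidean_space) \<Rightarrow> 'a set \<Rightarrow> bool" where
  "smooth_map_on f M \<longleftrightarrow>
     (\<forall>p\<in>M. \<exists>U g. open U \<and> p \<in> U \<and> smooth_on g U \<and> (\<forall>x\<in>M \<inter> U. g x = f x))"

definition diffeomorphism_between ::
    "('a::euclidean_space \<Rightarrow> 'b::euclidean_space) \<Rightarrow> 'a set \<Rightarrow> 'b set \<Rightarrow> bool" where
  "diffeomorphism_between f M N \<longleftrightarrow>
     bij_betw f M N \<and> smooth_map_on f M \<and> smooth_map_on (inv_into M f) N"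

text \<open>The unit vector normal to the boundary at \<open>p\<close> that points out of \<open>K\<close>; it is unique when \<open>K\<close>
  is a convex set with interior points whose boundary is a smooth hypersurface.\<close>

definition outer_unit_normal :: "'a::euclidean_space set \<Rightarrow> 'a \<Rightarrow> 'a" where
  "outer_unit_normal K p =
     (THE \<nu>. norm \<nu> = 1 \<and> (\<forall>v\<in>tangent_space (frontier K) p. \<nu> \<bullet> v = 0) \<and>
            (\<exists>e>0. \<forall>t\<in>{0<..<e}. p + t *\<^sub>R \<nu> \<notin> K))"

definition convex_body :: "'a::euclidean_space set \<Rightarrow> bool" where
  "convex_body K \<longleftrightarrow> compact K \<and> convex K \<and> 0 \<in> interior K"

definition smooth_strictly_convex_body :: "'a::euclidean_space set \<Rightarrow> bool" where
  "smooth_strictly_convex_body K \<longleftrightarrow>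
     convex_body K \<and> smooth_hypersurface (frontier K) \<and>
     (\<forall>a b. a \<noteq> b \<longrightarrow> \<not> closed_segment a b \<subseteq> frontier K) \<and>
     diffeomorphism_between (outer_unit_normal K) (frontier K) (sphere 0 1)"

definition div_field :: "('a::euclidean_space \<Rightarrow> 'a) \<Rightarrow> 'a \<Rightarrow> real" where
  "div_field X x = (\<Sum>b\<in>Basis. frechet_derivative X (at x) b \<bullet> b)"

definition admissible_field :: "'a::euclidean_space set \<Rightarrow> ('a \<Rightarrow> 'a) \<Rightarrow> bool" where
  "admissible_field K X \<longleftrightarrow>
     smooth_on X UNIV \<and> compact (closure {x. X x \<noteq> 0}) \<and> range X \<subseteq> K"

definition aniso_perimeter :: "'a::euclidean_space set \<Rightarrow> 'a set \<Rightarrow> ereal" where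
  "aniso_perimeter K E =
     (SUP X\<in>{X. admissible_field K X}. ereal (set_lebesgue_integral lborel E (div_field X)))"

definition aniso_minimizer :: "'a::euclidean_space set \<Rightarrow> 'a set \<Rightarrow> bool" where
  "aniso_minimizer K E \<longleftrightarrow>
     E \<in> sets borel \<and> 0 < emeasure lborel E \<and> emeasure lborel E < \<infinity> \<and>
     aniso_perimeter K E < \<infinity> \<and>
     (\<forall>E'\<in>sets borel. emeasure lborel E' = emeasure lborel E \<longrightarrow>
        aniso_perimeter K E \<le> aniso_perimeter K E')"

text \<open>The properties required of the representative of a minimizer, which is otherwise only
  determined up to sets of volume zero.\<close>

definition normalized_set :: "'a::euclidean_space set \<Rightarrow> bool" where
  "normalized_set E \<longleftrightarrow> open E \<and>
     (\<forall>p\<in>frontier E. \<forall>r>0. 0 < emeasure lborel (E \<inter> ball p r) \<and>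
        emeasure lborel (E \<inter> ball p r) < emeasure lborel (ball p r))"

end

theory Submission
  imports Defs "HOL-Probability.Probability"
begin

text \<open>
  With \<open>W = \<lambda>K\<close> scaled to the volume \<open>V\<close> of \<open>E\<close>, comparison with \<open>W\<close> shows that the perimeter
  of \<open>E\<close> with respect to \<open>W\<close> is at most \<open>N V\<close>, where \<open>N\<close> is the dimension. Mollified indicators
  thus provide smooth \<open>u\<close> close to the indicator of \<open>E\<close> such that \<open>- Du x k \<le> H x\<close> for \<open>k \<in> W\<close>
  and \<open>\<integral>H \<le> N V + \<eta>\<close>. The reverse inequality follows by induction on the dimension:
  transport the marginal of \<open>E\<close> on one axis monotonically to that of \<open>W\<close>, apply the inequality
  to the slices in the remaining \<open>N - 1\<close> directions, and combine with the inequality of the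
  arithmetic and geometric means. Near equality forces the derivative of the monotone transport to
  be close to \<open>1\<close>, so the two marginals are translates of each other. By shear coordinates this
  holds for the marginals along every linear functional \<open>e\<close>, with a shift \<open>c e\<close> that is linear
  in \<open>e\<close> because it is the difference of the barycentres. A set whose marginals along all
  directions agree with those of the convex set \<open>p + W\<close> lies in every half-space containing
  \<open>p + W\<close>, hence equals it up to a null set.
\<close>

section \<open>Monotone transport on the line\<close>

text \<open>No structure theory of sets of finite perimeter (derivative measures, traces, coarea)
  enters: the perimeter is seen only through an integrable \<open>H\<close> that dominates all
  \<open>- Du x k\<close>, a substitute for the support function of the body at minus the gradient.
  Transports on the line replace an optimal map of the whole space. The price is that equality
  speaks about one axis at a time, hence the passage through all linear functionals; shears instead
  of rotations keep the product structure and preserve volume for an elementary reason. Two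
  obstacles shape the equality case. Equality gives nothing where the marginal of \<open>E\<close>
  vanishes, and there the transport could jump, so gaps have to be excluded by a separate strict
  inequality. And \<open>E\<close> is not known to be bounded: its approximants are cut off at
  infinity, and its barycentre is used only after the translations along the coordinate axes have
  bounded \<open>E\<close>.\<close>

lemma integral_halfline_derivative:
  fixes v v' :: "real \<Rightarrow> real"
  assumes der: "\<And>s. (v has_real_derivative v' s) (at s)"
    and [measurable]: "v' \<in> borel_measurable borel"
    and bnd: "\<And>s. \<bar>v' s\<bar> \<le> C"
    and supp: "\<And>s. \<bar>s\<bar> > R \<Longrightarrow> v s = 0" "\<And>s. \<bar>s\<bar> > R \<Longrightarrow> v' s = 0"
  shows "integrable lborel v'"
    and "(\<integral>s. v' s * indicator {x<..} s \<partial>lborel) = - v x"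
    and "(\<integral>s. v' s \<partial>lborel) = 0"
proof -
  define L where "L = max \<bar>R\<bar> \<bar>x\<bar> + 1"
  have L: "-L \<le> L" "x \<le> L" "L > R" by (auto simp: L_def)
  have int: "set_integrable lborel {y..z} v'" for y z
  proof (rule set_integrable_bound[where f="\<lambda>_. C"])
    show "set_integrable lborel {y..z} (\<lambda>_. C)"
      unfolding set_integrable_def by (simp add: integrable_real_mult_indicator emeasure_lborel_Icc_eq)
  qed (use bnd in \<open>auto simp: set_borel_measurable_def intro!: order.trans[OF _ abs_ge_self]\<close>)
  have eq: "(\<integral>s\<in>{y..z}. v' s \<partial>lborel) = v z - v y" if "y \<le> z" for y z
  proof -
    have "(v' has_integral (v z - v y)) {y..z}"
      by (rule fundamental_theorem_of_calculus[OF that])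
        (use der in \<open>auto simp: has_real_derivative_iff_has_vector_derivative[symmetric] intro: DERIV_subset\<close>)
    then show ?thesis
      using set_borel_integral_eq_integral(2)[OF int] by (simp add: integral_unique)
  qed
  have full: "v' s = indicator {-L..L} s *\<^sub>R v' s" for s
  proof (cases "s \<in> {-L..L}")
    case False
    then have "\<bar>s\<bar> > R" using L by auto
    then show ?thesis using supp(2) by simp
  qed simp
  show "integrable lborel v'"
    using int[of "-L" L] unfolding set_integrable_def full[symmetric] .
  have z: "v L = 0" "v (-L) = 0"
    by (rule supp(1), simp add: L_def)+
  have "(\<integral>s. v' s \<partial>lborel) = (\<integral>s\<in>{-L..L}. v' s \<partial>lborel)"
    unfolding set_lebesgue_integral_def full[symmetric] ..
  also have "\<dots> = 0" using eq[OF L(1)] z by simp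
  finally show "(\<integral>s. v' s \<partial>lborel) = 0" .
  have ind: "v' s * indicator {x<..} s = indicator {x..L} s *\<^sub>R v' s" if "s \<noteq> x" for s
  proof (cases "s \<le> L")
    case True
    then show ?thesis using that by (simp add: indicator_def)
  next
    case False
    then have "\<bar>s\<bar> > R" using L by linarith
    then show ?thesis using supp(2) by simp
  qed
  have m1: "(\<lambda>s. v' s * indicator {x<..} s) \<in> borel_measurable lborel"
    by (rule borel_measurable_times) simp_all
  have m2: "(\<lambda>s. indicator {x..L} s *\<^sub>R v' s) \<in> borel_measurable lborel"
    by (rule borel_measurable_scaleR) simp_all
  have "AE s in lborel. v' s * indicator {x<..} s = indicator {x..L} s *\<^sub>R v' s"
    using AE_lborel_singleton[of x] ind by (auto elim!: eventually_mono)
  then have "(\<integral>s. v' s * indicator {x<..} s \<partial>lborel) = (\<integral>s\<in>{x..L}. v' s \<partial>lborel)"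
    unfolding set_lebesgue_integral_def by (rule integral_cong_AE[OF m1 m2])
  also have "\<dots> = - v x" using eq[OF L(2)] z by simp
  finally show "(\<integral>s. v' s * indicator {x<..} s \<partial>lborel) = - v x" .
qed

text \<open>Bounded support of the target makes the transport map bounded. The source may spread
  over the whole line, as the marginal of a set not yet known to be bounded does.\<close>

locale density_transport =
  fixes p q :: "real \<Rightarrow> real" and a b :: real
  assumes p_meas[measurable]: "p \<in> borel_measurable borel"
    and q_meas[measurable]: "q \<in> borel_measurable borel"
    and p_nonneg: "\<And>s. 0 \<le> p s" and q_nonneg: "\<And>s. 0 \<le> q s"
    and p_mass: "(\<integral>\<^sup>+s. p s \<partial>lborel) = 1" and q_mass: "(\<integral>\<^sup>+s. q s \<partial>lborel) = 1"
    and q_supp: "\<And>t. t \<notin> {a..b} \<Longrightarrow> q t = 0"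
begin

definition P :: "real measure" where "P = density lborel (\<lambda>s. ennreal (p s))"
definition Q :: "real measure" where "Q = density lborel (\<lambda>s. ennreal (q s))"

lemma emeasure_P: "A \<in> sets borel \<Longrightarrow> emeasure P A = (\<integral>\<^sup>+s. p s * indicator A s \<partial>lborel)"
  unfolding P_def by (subst emeasure_density) (auto simp: p_nonneg ennreal_mult' ennreal_indicator)

lemma emeasure_Q: "A \<in> sets borel \<Longrightarrow> emeasure Q A = (\<integral>\<^sup>+s. q s * indicator A s \<partial>lborel)"
  unfolding Q_def by (subst emeasure_density) (auto simp: q_nonneg ennreal_mult' ennreal_indicator)

sublocale P: real_distribution P
proof -
  have "prob_space P"
    by (rule prob_spaceI) (simp add: P_def emeasure_density p_mass)
  then show "real_distribution P"
    by (simp add: real_distribution_def real_distribution_axioms_def P_def)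
qed

sublocale Q: real_distribution Q
proof -
  have "prob_space Q"
    by (rule prob_spaceI) (simp add: Q_def emeasure_density q_mass)
  then show "real_distribution Q"
    by (simp add: real_distribution_def real_distribution_axioms_def Q_def)
qed

abbreviation "F \<equiv> cdf P"
abbreviation "G \<equiv> cdf Q"

lemma AE_P_iff: "{s. R s} \<in> sets borel \<Longrightarrow> (AE s in P. R s) \<longleftrightarrow> (AE s in lborel. p s > 0 \<longrightarrow> R s)"
  unfolding P_def by (subst AE_density) auto

lemma AE_Q_iff: "{s. R s} \<in> sets borel \<Longrightarrow> (AE s in Q. R s) \<longleftrightarrow> (AE s in lborel. q s > 0 \<longrightarrow> R s)"
  unfolding Q_def by (subst AE_density) auto

lemma P_singleton: "emeasure P {x} = 0"
proof -
  have "absolutely_continuous lborel P"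
    unfolding P_def by (rule absolutely_continuousI_density) simp
  moreover have "{x} \<in> null_sets lborel" by (simp add: null_sets_def)
  ultimately show ?thesis unfolding absolutely_continuous_def by auto
qed

lemma Q_singleton: "emeasure Q {x} = 0"
proof -
  have "absolutely_continuous lborel Q"
    unfolding Q_def by (rule absolutely_continuousI_density) simp
  moreover have "{x} \<in> null_sets lborel" by (simp add: null_sets_def)
  ultimately show ?thesis unfolding absolutely_continuous_def by auto
qed

lemma isCont_F: "isCont F x" by (simp add: P.isCont_cdf measure_def P_singleton)
lemma isCont_G: "isCont G x" by (simp add: Q.isCont_cdf measure_def Q_singleton)

lemma F_range: "0 \<le> F s" "F s \<le> 1" by (auto simp: P.cdf_nonneg P.cdf_bounded_prob)
lemma G_range: "0 \<le> G s" "G s \<le> 1" by (auto simp: Q.cdf_nonneg Q.cdf_bounded_prob)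

lemma continuous_F: "continuous_on S F"
  by (rule continuous_at_imp_continuous_on) (simp add: isCont_F)
lemma continuous_G: "continuous_on S G"
  by (rule continuous_at_imp_continuous_on) (simp add: isCont_G)

lemma F_mono: "s \<le> t \<Longrightarrow> F s \<le> F t" by (rule P.cdf_nondecreasing)
lemma G_mono: "s \<le> t \<Longrightarrow> G s \<le> G t" by (rule Q.cdf_nondecreasing)

lemma G_below: assumes "t \<le> a" shows "G t = 0"
proof -
  have q0: "ennreal (q s * indicator {..t} s) = 0" if "s \<noteq> a" for s
  proof (cases "s \<le> t")
    case True
    then have "s \<notin> {a..b}" using that assms by auto
    then show ?thesis using q_supp by simp
  qed simp
  have "emeasure Q {..t} = (\<integral>\<^sup>+s. q s * indicator {..t} s \<partial>lborel)" by (simp add: emeasure_Q)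
  also have "\<dots> = (\<integral>\<^sup>+(s::real). 0 \<partial>lborel)"
  proof (rule nn_integral_cong_AE)
    show "AE s in lborel. ennreal (q s * indicator {..t} s) = 0"
      using AE_lborel_singleton[of a] by eventually_elim (rule q0)
  qed
  finally show ?thesis by (simp add: cdf_def measure_def)
qed

lemma G_above: assumes "b \<le> t" shows "G t = 1"
proof -
  have q0: "q s * indicator {..t} s = q s" for s
  proof (cases "s \<le> t")
    case False
    then have "s \<notin> {a..b}" using assms by auto
    then show ?thesis using q_supp by simp
  qed simp
  have "emeasure Q {..t} = (\<integral>\<^sup>+s. q s * indicator {..t} s \<partial>lborel)" by (simp add: emeasure_Q)
  then show ?thesis by (simp add: cdf_def measure_def q_mass q0)
qed

lemma a_less_b: "a < b"
proof (rule ccontr)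
  assume "\<not> a < b"
  then have "G b = 0" by (intro G_below) simp
  with G_above[of b] show False by simp
qed

text \<open>The generalised inverse of \<open>G\<close> composed with \<open>F\<close>. Restricting
  the infimum to \<open>{a..b}\<close> makes it attained and gives the value \<open>a\<close>,
  instead of minus infinity, where \<open>F\<close> vanishes.\<close>

definition T :: "real \<Rightarrow> real" where "T s = Inf {t\<in>{a..b}. F s \<le> G t}"

lemma T_mem: "T s \<in> {t\<in>{a..b}. F s \<le> G t}"
  unfolding T_def
proof (rule closed_contains_Inf)
  show "{t\<in>{a..b}. F s \<le> G t} \<noteq> {}"
  proof -
    have "b \<in> {t\<in>{a..b}. F s \<le> G t}" using G_above[of b] F_range(2)[of s] a_less_b by simp
    then show ?thesis by blast
  qed
  show "bdd_below {t\<in>{a..b}. F s \<le> G t}" by (rule bdd_belowI[of _ a]) auto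
  have "{t\<in>{a..b}. F s \<le> G t} = {a..b} \<inter> {t. F s \<le> G t}" by blast
  then show "closed {t\<in>{a..b}. F s \<le> G t}"
    using closed_Collect_le[OF continuous_on_const continuous_G] by (simp add: closed_Int)
qed

lemma T_range: "a \<le> T s" "T s \<le> b" using T_mem[of s] by auto

lemma T_le: "t \<in> {a..b} \<Longrightarrow> F s \<le> G t \<Longrightarrow> T s \<le> t"
  unfolding T_def by (rule cInf_lower) (auto intro: bdd_belowI[of _ a])

text \<open>Continuity of \<open>G\<close> excludes overshooting: if \<open>G (T s)\<close> exceeded
  \<open>F s\<close>, the intermediate value theorem would give an admissible point to the left of
  \<open>T s\<close>.\<close>

lemma G_T: "G (T s) = F s"
proof (rule antisym)
  show "F s \<le> G (T s)" using T_mem by auto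
  show "G (T s) \<le> F s"
  proof (rule ccontr)
    assume neg: "\<not> G (T s) \<le> F s"
    have "G a \<le> F s" using G_below[of a] F_range(1)[of s] by simp
    then obtain t where t: "a \<le> t" "t \<le> T s" "G t = F s"
      using IVT'[of G a "F s" "T s"] neg T_range(1)[of s] continuous_G by (meson linear)
    then have "T s \<le> t" using T_range[of s] by (intro T_le) auto
    with t neg show False by auto
  qed
qed

text \<open>The Galois connection between \<open>T\<close> and \<open>G\<close>; through it order
  statements about \<open>T\<close> become order statements about \<open>F\<close> and
  \<open>G\<close>.\<close>

lemma T_le_iff: "t \<in> {a..b} \<Longrightarrow> T s \<le> t \<longleftrightarrow> F s \<le> G t"
  using G_mono[of "T s" t] T_le[of t s] by (auto simp only: G_T)

lemma T_mono: "s \<le> s' \<Longrightarrow> T s \<le> T s'"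
  using T_le_iff[of "T s'" s] T_range[of s'] F_mono[of s s'] by (simp add: G_T)

lemma T_meas[measurable]: "T \<in> borel_measurable borel"
  by (rule borel_measurable_mono) (simp add: mono_def T_mono)

lemma T_eq_a: "F s = 0 \<Longrightarrow> T s = a"
  by (rule antisym[OF T_le T_range(1)]) (use a_less_b G_range(1)[of a] in simp_all)

lemma T_cong: "F s = F s' \<Longrightarrow> T s = T s'" by (simp add: T_def)

text \<open>The probability integral transform: \<open>F\<close> is uniformly distributed under
  \<open>P\<close>. For \<open>t < 1\<close>, continuity makes a nonempty sublevel set a closed
  half-line whose end point has \<open>F\<close>-value exactly \<open>t\<close>.\<close>

lemma prob_F_le:
  assumes "0 \<le> t" "t \<le> 1"
  shows "measure P {s. F s \<le> t} = t"
proof (cases "t = 1")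
  case True
  then have "{s. F s \<le> t} = UNIV" using F_range(2) by blast
  then show ?thesis using True P.prob_space by simp
next
  case False
  with assms have t1: "t < 1" by simp
  let ?A = "{s. F s \<le> t}"
  obtain z where z: "F z > t"
    using order_tendstoD(1)[OF P.cdf_lim_at_top_prob t1] eventually_happens'[OF trivial_limit_at_top_linorder] by blast
  have bdd: "bdd_above ?A"
  proof (rule bdd_aboveI[of _ z])
    fix s assume "s \<in> ?A"
    then show "s \<le> z" using z F_mono[of z s] by (cases "s \<le> z") auto
  qed
  have closed: "closed ?A" by (rule closed_Collect_le[OF continuous_F continuous_on_const])
  have low: "\<exists>y. F y < t" if "t > 0"
    using order_tendstoD(2)[OF P.cdf_lim_at_bot that] eventually_happens'[OF trivial_limit_at_bot_linorder] by blast
  show ?thesis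
  proof (cases "?A = {}")
    case True
    have "\<not> t > 0"
    proof
      assume "t > 0"
      from low[OF this] obtain y where "F y < t" by blast
      then have "y \<in> ?A" by simp
      with True show False by blast
    qed
    then show ?thesis using True assms(1) by simp
  next
    case False
    define x where "x = Sup ?A"
    have x: "F x \<le> t" using closed_contains_Sup[OF False bdd closed] unfolding x_def by blast
    have up: "s \<le> x" if "F s \<le> t" for s unfolding x_def by (rule cSup_upper[OF _ bdd]) (use that in simp)
    have A: "?A = {..x}"
    proof (rule set_eqI)
      fix s show "s \<in> ?A \<longleftrightarrow> s \<in> {..x}" using up[of s] x F_mono[of s x] by auto
    qed
    have "F x = t"
    proof (cases "t = 0")
      case True then show ?thesis using x F_range(1)[of x] by simp
    next
      case False
      then obtain y where y: "F y < t" using low assms by force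
      have "y \<le> z" using y z F_mono[of z y] by linarith
      then obtain w where w: "F w = t"
        using IVT'[of F y t z] y z continuous_F by (meson less_imp_le)
      then have "w \<le> x" by (intro up) simp
      then show ?thesis using F_mono[of w x] w x by simp
    qed
    then show ?thesis unfolding A by (simp add: cdf_def)
  qed
qed

lemma distr_T: "distr P borel T = Q"
proof (rule measure_eqI_lessThan)
  fix x :: real
  show "emeasure (distr P borel T) {x<..} < \<infinity>"
    by (subst emeasure_distr) (auto simp: less_top[symmetric])
  have Pc: "measure P {s. T s > x} = 1 - measure P {s. T s \<le> x}"
  proof -
    have "{s. T s > x} = space P - {s. T s \<le> x}" by auto
    then show ?thesis using P.prob_compl[of "{s. T s \<le> x}"] by simp
  qed
  have Qc: "measure Q {x<..} = 1 - G x"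
  proof -
    have "{x<..} = space Q - {..x}" by auto
    then show ?thesis using Q.prob_compl[of "{..x}"] by (simp add: cdf_def)
  qed
  have "measure P {s. T s \<le> x} = G x"
  proof -
    consider "x < a" | "x > b" | "x \<in> {a..b}" by force
    then show ?thesis
    proof cases
      case 1
      then have "{s. T s \<le> x} = {}" using T_range by (auto simp: not_le intro: less_le_trans)
      then show ?thesis using G_below[of x] 1 by simp
    next
      case 2
      then have "{s. T s \<le> x} = UNIV" using order.trans[OF T_range(2) less_imp_le[OF 2]] by auto
      then show ?thesis using G_above[of x] 2 P.prob_space by simp
    next
      case 3
      then show ?thesis using prob_F_le[of "G x"] G_range[of x] by (simp add: T_le_iff)
    qed
  qed
  then have "measure P {s. T s > x} = measure Q {x<..}" using Pc Qc by simp
  then show "emeasure (distr P borel T) {x<..} = emeasure Q {x<..}"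
    by (subst emeasure_distr) (auto simp: P.emeasure_eq_measure Q.emeasure_eq_measure vimage_def)
qed simp_all

lemma nn_integral_T:
  assumes [measurable]: "g \<in> borel_measurable borel"
  shows "(\<integral>\<^sup>+s. ennreal (p s) * g (T s) \<partial>lborel) = (\<integral>\<^sup>+t. ennreal (q t) * g t \<partial>lborel)"
proof -
  have "(\<integral>\<^sup>+t. ennreal (q t) * g t \<partial>lborel) = (\<integral>\<^sup>+t. g t \<partial>Q)"
    unfolding Q_def by (subst nn_integral_density) auto
  also have "\<dots> = (\<integral>\<^sup>+s. g (T s) \<partial>P)"
    unfolding distr_T[symmetric] by (subst nn_integral_distr) auto
  also have "\<dots> = (\<integral>\<^sup>+s. ennreal (p s) * g (T s) \<partial>lborel)"
    unfolding P_def by (subst nn_integral_density) auto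
  finally show ?thesis by simp
qed

lemma AE_q_T_pos: "AE s in lborel. p s > 0 \<longrightarrow> q (T s) > 0"
proof -
  have "AE t in Q. q t > 0" by (subst AE_Q_iff) auto
  then have "AE s in P. q (T s) > 0"
    unfolding distr_T[symmetric] by (subst (asm) AE_distr_iff) auto
  then show ?thesis by (subst (asm) AE_P_iff) auto
qed

text \<open>If \<open>F\<close> is flat to the right of \<open>s\<close>, some rational
  \<open>r\<close> lies in the flat piece, and then \<open>s \<le> r\<close> with
  \<open>F s = F r\<close>. For each fixed \<open>r\<close> such points carry no mass, because
  \<open>F\<close> does not grow along them; countably many \<open>r\<close> suffice.\<close>

lemma AE_F_strict: "AE s in P. \<forall>s'>s. F s < F s'"
proof -
  have null: "emeasure P {s. s \<le> r \<and> F s = F r} = 0" for r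
  proof -
    let ?A = "{s. s \<le> r \<and> F s = F r}"
    have "?A = {..r} \<inter> {s. F s = F r}" by auto
    then have closed: "closed ?A"
      using closed_Int[OF closed_atMost closed_Collect_eq[OF continuous_F continuous_on_const]] by simp
    have A_meas: "?A \<in> sets P" using borel_closed[OF closed] by simp
    have "measure P ?A = 0"
    proof (cases "bdd_below ?A")
      case True
      define y where "y = Inf ?A"
      have y: "y \<in> ?A" unfolding y_def by (rule closed_contains_Inf[OF _ True closed]) auto
      have "y \<le> s" if "s \<in> ?A" for s unfolding y_def by (rule cInf_lower[OF that True])
      then have "?A \<subseteq> {y} \<union> {y<..r}" by fastforce
      then have "measure P ?A \<le> measure P ({y} \<union> {y<..r})" by (rule P.finite_measure_mono) simp
      moreover have "measure P ({y} \<union> {y<..r}) \<le> measure P {y} + measure P {y<..r}"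
        by (rule measure_Un_le) simp_all
      moreover have "measure P {y} + measure P {y<..r} = 0"
      proof (cases "y < r")
        case True
        have "F r = F y" using y by simp
        then have "measure P {y<..r} = 0" using P.cdf_diff_eq[OF True] by linarith
        then show ?thesis using P_singleton[of y] by (simp add: P.emeasure_eq_measure)
      next
        case False
        then have "{y<..r} = {}" by simp
        then show ?thesis using P_singleton[of y] by (simp add: P.emeasure_eq_measure)
      qed
      ultimately show ?thesis using measure_nonneg[of P ?A] by linarith
    next
      case False
      have "F r = 0"
      proof (rule ccontr)
        assume "F r \<noteq> 0"
        then have "F r > 0" using F_range[of r] by simp
        from order_tendstoD(2)[OF P.cdf_lim_at_bot this]
        obtain N where N: "\<And>s. s \<le> N \<Longrightarrow> F s < F r" by (auto simp: eventually_at_bot_linorder)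
        have "bdd_below ?A"
        proof (rule bdd_belowI[of _ N])
          fix s assume "s \<in> ?A"
          then have "\<not> s \<le> N" using N[of s] by auto
          then show "N \<le> s" by simp
        qed
        with False show False by simp
      qed
      then have "measure P {..r} = 0" by (simp add: cdf_def)
      moreover have "measure P ?A \<le> measure P {..r}" by (rule P.finite_measure_mono) auto
      ultimately show ?thesis using measure_nonneg[of P ?A] by linarith
    qed
    then show ?thesis by (simp add: P.emeasure_eq_measure)
  qed
  have "AE s in P. \<forall>r::rat. \<not> (s \<le> of_rat r \<and> F s = F (of_rat r))"
  proof (subst AE_all_countable, rule allI)
    fix r :: rat
    have "{s. s \<le> of_rat r \<and> F s = F (of_rat r)} = {..of_rat r} \<inter> {s. F s = F (of_rat r)}" by auto
    then have "closed {s. s \<le> of_rat r \<and> F s = F (of_rat r)}"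
      using closed_Int[OF closed_atMost closed_Collect_eq[OF continuous_F continuous_on_const]] by simp
    then have "{s. s \<le> of_rat r \<and> F s = F (of_rat r)} \<in> sets P"
      using borel_closed by simp
    then have "{s. s \<le> of_rat r \<and> F s = F (of_rat r)} \<in> null_sets P"
      using null[of "of_rat r"] by (rule null_setsI[rotated])
    then show "AE s in P. \<not> (s \<le> of_rat r \<and> F s = F (of_rat r))"
      by (rule AE_I') simp
  qed
  then show ?thesis
  proof eventually_elim
    case (elim s)
    show ?case
    proof (intro allI impI)
      fix s' assume "s < s'"
      then obtain r where r: "s < of_rat r" "of_rat r < s'" by (rule of_rat_dense[THEN exE]) (erule conjE)
      have "F s \<le> F (of_rat r)" "F (of_rat r) \<le> F s'"
        by (rule F_mono, rule less_imp_le, rule r)+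
      moreover have "F s \<noteq> F (of_rat r)" using elim[rule_format, of r] less_imp_le[OF r(1)] by (rule_tac notI) simp
      ultimately show "F s < F s'" by linarith
    qed
  qed
qed

text \<open>Where \<open>F\<close> increases strictly to the right, so does \<open>T\<close>; hence
  the superlevel set of \<open>T\<close> at its own value \<open>T s\<close> is exactly the
  half-line beyond \<open>s\<close>.\<close>

lemma AE_T_less_iff: "AE s in lborel. p s > 0 \<longrightarrow> (\<forall>s'. T s < T s' \<longleftrightarrow> s < s')"
proof -
  have "AE s in P. \<forall>s'. T s < T s' \<longleftrightarrow> s < s'"
    using AE_F_strict
  proof eventually_elim
    case (elim s)
    have "T s < T s' \<longleftrightarrow> F s < F s'" for s'
      using T_le_iff[of "T s" s'] T_range[of s] by (simp add: G_T not_le[symmetric])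
    moreover have "F s < F s' \<longleftrightarrow> s < s'" for s'
      using elim[rule_format, of s'] F_mono[of s' s] by linarith
    ultimately show ?case by simp
  qed
  then show ?thesis unfolding P_def by (subst (asm) AE_density) auto
qed

text \<open>Integrating the layer cake decomposition of the monotone map by parts avoids
  differentiating it.\<close>

lemma transport_by_parts:
  fixes v v' :: "real \<Rightarrow> real"
  assumes der: "\<And>s. (v has_real_derivative v' s) (at s)"
    and v'_meas[measurable]: "v' \<in> borel_measurable borel"
    and bnd: "\<And>s. \<bar>v' s\<bar> \<le> C"
    and supp: "\<And>s. \<bar>s\<bar> > R \<Longrightarrow> v s = 0" "\<And>s. \<bar>s\<bar> > R \<Longrightarrow> v' s = 0"
    and v_nonneg: "\<And>s. 0 \<le> v s"
  shows "0 \<le> - (\<integral>s. T s * v' s \<partial>lborel)"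
    and "(\<integral>\<^sup>+s. ennreal (v s * p s / q (T s)) \<partial>lborel) \<le> ennreal (- (\<integral>s. T s * v' s \<partial>lborel))"
proof -
  have v_meas[measurable]: "v \<in> borel_measurable borel"
    by (intro borel_measurable_continuous_onI continuous_at_imp_continuous_on ballI)
       (use der in \<open>auto intro: DERIV_isCont\<close>)
  have half1: "integrable lborel v'"
    by (rule integral_halfline_derivative(1)[OF der v'_meas bnd]) (fact supp)+
  have half2: "(\<integral>s. v' s * indicator {x<..} s \<partial>lborel) = - v x" for x
    by (rule integral_halfline_derivative(2)[OF der v'_meas bnd]) (fact supp)+
  have half3: "(\<integral>s. v' s \<partial>lborel) = 0"
    by (rule integral_halfline_derivative(3)[OF der v'_meas bnd]) (fact supp)+
  \<comment> \<open>By monotonicity \<open>{s. T s > t}\<close> is empty, the whole line, or a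
    half-line up to its end point. In the last case \<open>L t\<close> is the value of
    \<open>v\<close> at the end point, formally \<open>v\<close> at the preimage of \<open>t\<close>
    under \<open>T\<close>; in the other two it is 0.\<close>
  define L where "L t = - (\<integral>s. v' s * indicator {s. T s > t} s \<partial>lborel)" for t
  have intv: "integrable lborel v'" by (rule half1)
  have L_half: "L t = v x" if "AE s in lborel. T s > t \<longleftrightarrow> s > x" for t x
  proof -
    have "(\<integral>s. v' s * indicator {s. T s > t} s \<partial>lborel) = (\<integral>s. v' s * indicator {x<..} s \<partial>lborel)"
      by (rule integral_cong_AE) (use that in \<open>auto simp: indicator_def elim!: eventually_mono\<close>)
    then show ?thesis using half2[of x] by (simp add: L_def)
  qed
  have L_nonneg: "0 \<le> L t" for t
  proof -
    consider "\<forall>s. T s \<le> t" | "\<forall>s. T s > t" | "\<exists>s. T s \<le> t" "\<exists>s. T s > t"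
      by (meson not_le)
    then show ?thesis
    proof cases
      case 1
      then have "{s. T s > t} = {}" by (auto simp: not_less)
      then show ?thesis by (simp add: L_def)
    next
      case 2
      then show ?thesis using half3 by (simp add: L_def)
    next
      case 3
      then obtain y z where yz: "T y \<le> t" "T z > t" by auto
      let ?S = "{s. T s \<le> t}"
      have bdd: "bdd_above ?S"
      proof (rule bdd_aboveI[of _ z])
        fix s assume "s \<in> ?S"
        then show "s \<le> z" using yz T_mono[of z s] by (cases "s \<le> z") auto
      qed
      have ne: "?S \<noteq> {}" using yz by auto
      define x where "x = Sup ?S"
      have "T s > t \<longleftrightarrow> s > x" if "s \<noteq> x" for s
      proof
        assume "T s > t"
        have "\<not> s < x"
        proof
          assume "s < x"
          then obtain s' where "s' \<in> ?S" "s < s'" unfolding x_def using less_cSup_iff[OF ne bdd] by auto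
          then show False using T_mono[of s s'] \<open>T s > t\<close> by auto
        qed
        then show "s > x" using that by auto
      next
        assume "s > x"
        then show "T s > t" unfolding x_def using cSup_upper[OF _ bdd, of s] by force
      qed
      then have "AE s in lborel. T s > t \<longleftrightarrow> s > x"
        using AE_lborel_singleton[of x] by (auto elim!: eventually_mono)
      from L_half[OF this] show ?thesis by (simp add: v_nonneg)
    qed
  qed
  \<comment> \<open>Layer cake: \<open>T s - a\<close> is the length of \<open>{a..<T s}\<close>.
    Integrating \<open>?h\<close> first over \<open>t\<close> gives \<open>(T s - a) * v' s\<close>,
    and first over \<open>s\<close> gives \<open>- L t\<close> on \<open>{a..b}\<close>; the
    constant \<open>a\<close> drops out since \<open>v'\<close> has integral 0.\<close>
  let ?h = "\<lambda>(t, s). indicator {a..b} t * (v' s * indicator {z. fst z < T (snd z)} (t, s)) :: real"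
  have L_meas[measurable]: "L \<in> borel_measurable borel"
  proof -
    have "(\<lambda>t. \<integral>s. v' s * indicator {z. fst z < T (snd z)} (t, s) \<partial>lborel) \<in> borel_measurable borel"
      by measurable
    moreover have "(\<lambda>t. \<integral>s. v' s * indicator {z. fst z < T (snd z)} (t, s) \<partial>lborel) = (\<lambda>t. - L t)"
      by (auto simp: L_def indicator_def)
    ultimately have "(\<lambda>t. - (- L t)) \<in> borel_measurable borel" by (intro borel_measurable_uminus) simp
    then show ?thesis by simp
  qed
  have h_int: "integrable (lborel \<Otimes>\<^sub>M lborel) ?h"
  proof (rule lborel_pair.Fubini_integrable)
    have "(\<lambda>t. \<integral>s. norm (?h (t, s)) \<partial>lborel) \<in> borel_measurable lborel"
      by measurable
    moreover have "norm (\<integral>s. norm (?h (t, s)) \<partial>lborel) \<le> norm (indicator {a..b} t * (\<integral>s. \<bar>v' s\<bar> \<partial>lborel))" for t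
    proof -
      have "(\<integral>s. norm (?h (t, s)) \<partial>lborel) \<le> (\<integral>s. indicator {a..b} t * \<bar>v' s\<bar> \<partial>lborel)"
        by (rule integral_mono') (auto simp: intv indicator_def)
      then show ?thesis by simp
    qed
    ultimately show "integrable lborel (\<lambda>t. \<integral>s. norm (?h (t, s)) \<partial>lborel)"
      by (rule Bochner_Integration.integrable_bound[rotated, OF _ AE_I2, where f="\<lambda>t. indicator {a..b} t * (\<integral>s. \<bar>v' s\<bar> \<partial>lborel)"])
         (auto simp: emeasure_lborel_Icc_eq)
    show "AE t in lborel. integrable lborel (\<lambda>s. ?h (t, s))"
      by (rule AE_I2, rule Bochner_Integration.integrable_bound[OF intv]) (auto simp: indicator_def)
  qed simp
  have fub1: "(\<integral>z. ?h z \<partial>(lborel \<Otimes>\<^sub>M lborel)) = (\<integral>t. (\<integral>s. ?h (t, s) \<partial>lborel) \<partial>lborel)"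
    by (rule lborel_pair.integral_fst'[symmetric, OF h_int])
  have fub2: "(\<integral>z. ?h z \<partial>(lborel \<Otimes>\<^sub>M lborel)) = (\<integral>s. (\<integral>t. ?h (t, s) \<partial>lborel) \<partial>lborel)"
    using lborel_pair.integral_snd[of "\<lambda>t s. ?h (t, s)"] h_int by (simp add: case_prod_eta)
  have inner1: "(\<integral>s. ?h (t, s) \<partial>lborel) = - (indicator {a..b} t * L t)" for t
    by (simp add: L_def indicator_def)
  have inner2: "(\<integral>t. ?h (t, s) \<partial>lborel) = T s * v' s - a * v' s" for s
  proof -
    have "(\<integral>t. ?h (t, s) \<partial>lborel) = (\<integral>t. v' s * indicator {a..<T s} t \<partial>lborel)"
      by (rule Bochner_Integration.integral_cong) (use T_range[of s] in \<open>auto simp: indicator_def\<close>)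
    also have "\<dots> = v' s * (T s - a)" using T_range(1)[of s] by simp
    finally show ?thesis by (simp add: algebra_simps)
  qed
  have Tv_int: "integrable lborel (\<lambda>s. T s * v' s)"
  proof (rule Bochner_Integration.integrable_bound)
    show "integrable lborel (\<lambda>s. (\<bar>a\<bar> + \<bar>b\<bar>) * v' s)" using intv by simp
    have "\<bar>T s\<bar> \<le> \<bar>a\<bar> + \<bar>b\<bar>" for s using T_range[of s] by auto
    then show "AE s in lborel. norm (T s * v' s) \<le> norm ((\<bar>a\<bar> + \<bar>b\<bar>) * v' s)"
      by (auto simp: abs_mult intro!: mult_right_mono)
  qed simp
  have Lab_int: "integrable lborel (\<lambda>t. indicator {a..b} t * L t)"
    using lborel_pair.integrable_fst'[OF h_int] inner1 by simp
  have main: "- (\<integral>s. T s * v' s \<partial>lborel) = (\<integral>t. indicator {a..b} t * L t \<partial>lborel)"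
  proof -
    have "(\<integral>s. T s * v' s - a * v' s \<partial>lborel) = (\<integral>t. - (indicator {a..b} t * L t) \<partial>lborel)"
      using fub1 fub2 unfolding inner1 inner2 by simp
    moreover have "(\<integral>s. T s * v' s - a * v' s \<partial>lborel) = (\<integral>s. T s * v' s \<partial>lborel) - (\<integral>s. a * v' s \<partial>lborel)"
      by (rule Bochner_Integration.integral_diff[OF Tv_int]) (simp add: intv)
    ultimately show ?thesis using half3 by simp
  qed
  then show "0 \<le> - (\<integral>s. T s * v' s \<partial>lborel)"
    by (simp only: main) (intro Bochner_Integration.integral_nonneg, auto simp: L_nonneg)
  \<comment> \<open>At almost every \<open>s\<close> that carries mass the half-line of level
    \<open>T s\<close> ends at \<open>s\<close> itself. After replacing \<open>v s\<close> by
    \<open>L (T s)\<close> the integrand depends on \<open>s\<close> only through \<open>T s\<close>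
    and the weight \<open>p s\<close>, so \<open>nn_integral_T\<close> applies.\<close>
  have "AE s in lborel. p s > 0 \<longrightarrow> L (T s) = v s"
    using AE_T_less_iff
  proof eventually_elim
    case (elim s)
    then show ?case by (intro impI L_half) auto
  qed
  then have "(\<integral>\<^sup>+s. ennreal (v s * p s / q (T s)) \<partial>lborel)
      = (\<integral>\<^sup>+s. ennreal (p s) * ennreal (L (T s) / q (T s)) \<partial>lborel)"
  proof (intro nn_integral_cong_AE, eventually_elim)
    case (elim s)
    show ?case
    proof (cases "p s = 0")
      case False
      then have "p s > 0" using p_nonneg[of s] by simp
      then have "v s * p s / q (T s) = p s * (L (T s) / q (T s))" using elim by simp
      then show ?thesis unfolding ennreal_mult'[OF p_nonneg, symmetric] by (rule arg_cong)
    qed simp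
  qed
  also have "\<dots> = (\<integral>\<^sup>+t. ennreal (q t) * ennreal (L t / q t) \<partial>lborel)"
    by (rule nn_integral_T) simp
  \<comment> \<open>Only an inequality: where \<open>q\<close> vanishes inside \<open>{a..b}\<close>
    the left integrand is 0, while \<open>L\<close> may be positive.\<close>
  also have "\<dots> \<le> (\<integral>\<^sup>+t. ennreal (indicator {a..b} t * L t) \<partial>lborel)"
  proof (rule nn_integral_mono)
    fix t
    show "ennreal (q t) * ennreal (L t / q t) \<le> ennreal (indicator {a..b} t * L t)"
      using q_supp[of t] q_nonneg[of t] L_nonneg[of t]
      by (cases "q t = 0") (auto simp: ennreal_mult'[symmetric] indicator_def)
  qed
  also have "\<dots> = ennreal (\<integral>t. indicator {a..b} t * L t \<partial>lborel)"
    by (rule nn_integral_eq_integral[OF Lab_int]) (auto simp: L_nonneg)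
  finally show "(\<integral>\<^sup>+s. ennreal (v s * p s / q (T s)) \<partial>lborel) \<le> ennreal (- (\<integral>s. T s * v' s \<partial>lborel))"
    by (simp only: main)
qed

end

section \<open>Slices of Sobolev functions on product spaces\<close>

text \<open>Arithmetic and geometric means of \<open>n + 1\<close> numbers, \<open>r * c\<close>
  once and \<open>r powr (- 1 / n)\<close> taken \<open>n\<close> times, whose product is
  \<open>c\<close>. In the application \<open>r * c\<close> is the derivative of the transport on
  the line, the other number is the ratio of linear sizes of corresponding slices, and
  \<open>c\<close> is a ratio of volumes.\<close>

lemma amgm_powr:
  fixes r c :: real
  assumes "r > 0" "c > 0" "n \<ge> (1::nat)"
  shows "(real n + 1) * c powr (1 / (real n + 1)) \<le> r * c + real n * r powr (- 1 / real n)"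
    and "c = 1 \<Longrightarrow> r \<noteq> 1 \<Longrightarrow> real n + 1 < r + real n * r powr (- 1 / real n)"
proof -
  define l where "l = c powr (1 / (real n + 1))"
  have l: "l > 0" using assms by (simp add: l_def)
  have lnl: "(real n + 1) * ln l = ln c" using assms by (simp add: l_def ln_powr field_simps)
  \<comment> \<open>After division by the geometric mean \<open>l\<close> the logarithms add up to
    0, so that \<open>ln z \<le> z - 1\<close> gives the inequality and its equality case gives
    strictness.\<close>
  define x where "x = r * c / l"
  define y where "y = r powr (- 1 / real n) / l"
  have pos: "x > 0" "y > 0" using assms l by (auto simp: x_def y_def)
  have "ln x = ln r + ln c - ln l" using assms l by (simp add: x_def ln_mult ln_div)
  moreover have "real n * ln y = - ln r - real n * ln l"
    using assms l by (simp add: y_def ln_div ln_powr field_simps)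
  ultimately have sum0: "ln x + real n * ln y = 0" using lnl by (simp add: algebra_simps)
  have lx: "ln x \<le> x - 1" "ln y \<le> y - 1" using pos by (auto intro: ln_le_minus_one)
  have "real n * ln y \<le> real n * (y - 1)" using lx by (intro mult_left_mono) auto
  then have main: "real n + 1 \<le> x + real n * y" using sum0 lx by (simp add: algebra_simps)
  have e: "l * (x + real n * y) = r * c + real n * r powr (- 1 / real n)"
    using l by (simp add: x_def y_def field_simps)
  have "(real n + 1) * l \<le> l * (x + real n * y)" using mult_left_mono[OF main, of l] l by (simp add: mult.commute)
  then show "(real n + 1) * c powr (1 / (real n + 1)) \<le> r * c + real n * r powr (- 1 / real n)"
    by (simp only: e) (simp only: l_def)
  assume c: "c = 1" and r: "r \<noteq> 1"
  then have l1: "l = 1" by (simp add: l_def)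
  then have x: "x = r" using c by (simp add: x_def)
  then have "ln x \<noteq> x - 1" using r pos ln_eq_minus_one[of x] by auto
  then have "ln x < x - 1" using lx by simp
  then have "real n + 1 < x + real n * y"
    using sum0 \<open>real n * ln y \<le> real n * (y - 1)\<close> by (simp add: algebra_simps)
  then show "real n + 1 < r + real n * r powr (- 1 / real n)"
    using e c l1 by simp
qed

section \<open>Product Lebesgue measure with one coordinate split off\<close>

text \<open>Points are functions on a finite index set, so that induction on the dimension stays
  inside one type and consists in inserting an index.\<close>

abbreviation LM :: "'i set \<Rightarrow> ('i \<Rightarrow> real) measure" where
  "LM I \<equiv> Pi\<^sub>M I (\<lambda>_. lborel)"

interpretation LB: product_sigma_finite "\<lambda>_. lborel :: real measure" ..

lemma sigma_finite_LM: "finite I \<Longrightarrow> sigma_finite_measure (LM I)"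
  by (rule LB.sigma_finite)

lemma upd_space: "x \<in> space (LM I) \<Longrightarrow> x(j := s) \<in> space (LM (insert j I))"
  by (auto simp: space_PiM PiE_def extensional_def)

lemma measurable_upd_pair[measurable]:
  "(\<lambda>(s, x). x(j := s)) \<in> measurable (lborel \<Otimes>\<^sub>M LM I) (LM (insert j I))"
proof -
  have "(\<lambda>(x, s). x(j := s)) \<circ> (\<lambda>(s, x). (x, s)) \<in> measurable (lborel \<Otimes>\<^sub>M LM I) (LM (insert j I))"
    by (rule measurable_comp[OF measurable_pair_swap' measurable_add_dim])
  then show ?thesis by (simp add: comp_def case_prod_beta')
qed

lemma measurable_upd_left:
  "x \<in> space (LM I) \<Longrightarrow> j \<notin> I \<Longrightarrow> (\<lambda>s. x(j := s)) \<in> measurable borel (LM (insert j I))"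
  using measurable_component_update[of x I "\<lambda>_. lborel" j] by simp

lemma measurable_upd_right: "(\<lambda>x. x(j := s)) \<in> measurable (LM I) (LM (insert j I))"
  using measurable_comp[OF measurable_Pair1'[of s lborel "LM I"] measurable_upd_pair[where j=j]]
  by (simp add: comp_def)

lemma distr_upd:
  assumes "finite I" "j \<notin> I"
  shows "distr (lborel \<Otimes>\<^sub>M LM I) (LM (insert j I)) (\<lambda>(s, x). x(j := s)) = LM (insert j I)"
proof (rule LB.PiM_eqI)
  interpret sigma_finite_measure "LM I" by (rule sigma_finite_LM[OF assms(1)])
  show "finite (insert j I)" using assms by simp
  fix A :: "_ \<Rightarrow> real set" assume A: "\<And>i. i \<in> insert j I \<Longrightarrow> A i \<in> sets lborel"
  have "(\<lambda>(s, x). x(j := s)) -` (Pi\<^sub>E (insert j I) A) \<inter> space (lborel \<Otimes>\<^sub>M LM I) = A j \<times> Pi\<^sub>E I A"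
  proof -
    have "x(j := s) \<in> Pi\<^sub>E (insert j I) A \<longleftrightarrow> s \<in> A j \<and> x \<in> Pi\<^sub>E I A" if "x \<in> space (LM I)" for s x
      using assms(2) that by (auto simp: space_PiM PiE_iff extensional_def)
    moreover have "Pi\<^sub>E I A \<subseteq> space (LM I)" by (auto simp: space_PiM)
    ultimately show ?thesis by (auto simp: space_pair_measure)
  qed
  then show "emeasure (distr (lborel \<Otimes>\<^sub>M LM I) (LM (insert j I)) (\<lambda>(s, x). x(j := s))) (Pi\<^sub>E (insert j I) A)
      = (\<Prod>i\<in>insert j I. emeasure lborel (A i))"
    using A assms
    by (subst emeasure_distr) (auto simp: emeasure_pair_measure_Times LB.emeasure_PiM sets_PiM_I_finite)
qed simp

context
  fixes I :: "'i set" and j :: 'i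
  assumes fin: "finite I" and j: "j \<notin> I"
begin

lemma pair_sf: "pair_sigma_finite (lborel :: real measure) (LM I)"
  by (simp add: pair_sigma_finite_def sigma_finite_LM[OF fin] sigma_finite_lborel)

lemma integrable_upd_iff:
  fixes f :: "('i \<Rightarrow> real) \<Rightarrow> real"
  assumes "f \<in> borel_measurable (LM (insert j I))"
  shows "integrable (LM (insert j I)) f \<longleftrightarrow> integrable (lborel \<Otimes>\<^sub>M LM I) (\<lambda>(s, x). f (x(j := s)))"
  using assms
  by (subst distr_upd[OF fin j, symmetric], subst integrable_distr_eq) (auto simp: case_prod_beta')

lemma fubini_upd:
  fixes f :: "('i \<Rightarrow> real) \<Rightarrow> real"
  assumes f: "integrable (LM (insert j I)) f"
  shows "AE s in lborel. integrable (LM I) (\<lambda>x. f (x(j := s)))"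
    and "integrable lborel (\<lambda>s. \<integral>x. f (x(j := s)) \<partial>LM I)"
    and "(\<integral>x. f x \<partial>LM (insert j I)) = (\<integral>s. \<integral>x. f (x(j := s)) \<partial>LM I \<partial>lborel)"
    and "integrable (LM I) (\<lambda>x. \<integral>s. f (x(j := s)) \<partial>lborel)"
    and "(\<integral>x. f x \<partial>LM (insert j I)) = (\<integral>x. \<integral>s. f (x(j := s)) \<partial>lborel \<partial>LM I)"
proof -
  interpret pair_sigma_finite "lborel :: real measure" "LM I" by (rule pair_sf)
  have int: "integrable (lborel \<Otimes>\<^sub>M LM I) (\<lambda>(s, x). f (x(j := s)))"
    using f integrable_upd_iff by auto
  have eq: "(\<integral>x. f x \<partial>LM (insert j I)) = (\<integral>z. (\<lambda>(s, x). f (x(j := s))) z \<partial>(lborel \<Otimes>\<^sub>M LM I))"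
    using f by (subst distr_upd[OF fin j, symmetric], subst integral_distr) (auto simp: case_prod_beta')
  show "AE s in lborel. integrable (LM I) (\<lambda>x. f (x(j := s)))"
    using AE_integrable_fst[OF int] by simp
  show "integrable lborel (\<lambda>s. \<integral>x. f (x(j := s)) \<partial>LM I)"
    using integrable_fst[OF int] by simp
  show "(\<integral>x. f x \<partial>LM (insert j I)) = (\<integral>s. \<integral>x. f (x(j := s)) \<partial>LM I \<partial>lborel)"
    unfolding eq using integral_fst[OF int] by simp
  show "integrable (LM I) (\<lambda>x. \<integral>s. f (x(j := s)) \<partial>lborel)"
    using integrable_snd[OF int] by simp
  show "(\<integral>x. f x \<partial>LM (insert j I)) = (\<integral>x. \<integral>s. f (x(j := s)) \<partial>lborel \<partial>LM I)"
    unfolding eq using integral_snd[OF int] by simp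
qed

lemma nn_fubini_upd:
  assumes [measurable]: "f \<in> borel_measurable (LM (insert j I))"
  shows "(\<integral>\<^sup>+x. f x \<partial>LM (insert j I)) = (\<integral>\<^sup>+s. \<integral>\<^sup>+x. f (x(j := s)) \<partial>LM I \<partial>lborel)"
    and "(\<integral>\<^sup>+x. f x \<partial>LM (insert j I)) = (\<integral>\<^sup>+x. \<integral>\<^sup>+s. f (x(j := s)) \<partial>lborel \<partial>LM I)"
  using LB.product_nn_integral_insert_rev[OF fin j assms] LB.product_nn_integral_insert[OF fin j assms] by auto

end

section \<open>Functions with bounded partial derivatives and their slices\<close>

text \<open>Derivatives along coordinate lines are what restriction to a slice inherits and what
  integration by parts on lines consumes. The bounds \<open>C\<close> and \<open>R\<close> only
  secure integrability and appear in no final estimate.\<close>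

definition regular :: "'i set \<Rightarrow> (('i \<Rightarrow> real) \<Rightarrow> real) \<Rightarrow> ('i \<Rightarrow> ('i \<Rightarrow> real) \<Rightarrow> real) \<Rightarrow> bool" where
  "regular I u D \<longleftrightarrow> u \<in> borel_measurable (LM I) \<and> (\<forall>i\<in>I. D i \<in> borel_measurable (LM I)) \<and>
     (\<exists>C R. \<forall>x\<in>space (LM I). 0 \<le> u x \<and> u x \<le> C \<and>
        (\<forall>i\<in>I. \<bar>D i x\<bar> \<le> C \<and> ((\<lambda>s. u (x(i := s))) has_real_derivative D i x) (at (x i))) \<and>
        ((\<exists>i\<in>I. \<bar>x i\<bar> > R) \<longrightarrow> u x = 0 \<and> (\<forall>i\<in>I. D i x = 0)))"

lemma regular_slice:
  assumes "regular (insert j I) u D" "j \<notin> I"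
  shows "regular I (\<lambda>x. u (x(j := s))) (\<lambda>i x. D i (x(j := s)))"
proof -
  from assms(1) obtain C R where CR: "\<And>x. x \<in> space (LM (insert j I)) \<Longrightarrow> 0 \<le> u x \<and> u x \<le> C \<and>
        (\<forall>i\<in>insert j I. \<bar>D i x\<bar> \<le> C \<and> ((\<lambda>s. u (x(i := s))) has_real_derivative D i x) (at (x i))) \<and>
        ((\<exists>i\<in>insert j I. \<bar>x i\<bar> > R) \<longrightarrow> u x = 0 \<and> (\<forall>i\<in>insert j I. D i x = 0))"
    and m: "u \<in> borel_measurable (LM (insert j I))" "\<And>i. i \<in> insert j I \<Longrightarrow> D i \<in> borel_measurable (LM (insert j I))"
    unfolding regular_def by blast
  have "0 \<le> u (x(j := s)) \<and> u (x(j := s)) \<le> C \<and>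
        (\<forall>i\<in>I. \<bar>D i (x(j := s))\<bar> \<le> C \<and> ((\<lambda>t. u ((x(i := t))(j := s))) has_real_derivative D i (x(j := s))) (at (x i))) \<and>
        ((\<exists>i\<in>I. \<bar>x i\<bar> > R) \<longrightarrow> u (x(j := s)) = 0 \<and> (\<forall>i\<in>I. D i (x(j := s)) = 0))"
    if x: "x \<in> space (LM I)" for x
  proof -
    note c = CR[OF upd_space[OF x, of j s]]
    have "((\<lambda>t. u ((x(i := t))(j := s))) has_real_derivative D i (x(j := s))) (at (x i))" if "i \<in> I" for i
    proof -
      have "i \<noteq> j" using that assms(2) by auto
      then have "(x(i := t))(j := s) = (x(j := s))(i := t)" for t by (rule fun_upd_twist)
      moreover have "(x(j := s)) i = x i" using \<open>i \<noteq> j\<close> by simp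
      ultimately show ?thesis using c that by auto
    qed
    moreover have "(\<exists>i\<in>I. \<bar>x i\<bar> > R) \<longrightarrow> (\<exists>i\<in>insert j I. \<bar>(x(j := s)) i\<bar> > R)"
      using assms(2) by (metis fun_upd_other insertI2)
    ultimately show ?thesis using c by blast
  qed
  moreover have "(\<lambda>x. u (x(j := s))) \<in> borel_measurable (LM I)"
    using measurable_comp[OF measurable_upd_right m(1)] by (simp add: comp_def)
  moreover have "(\<lambda>x. D i (x(j := s))) \<in> borel_measurable (LM I)" if "i \<in> I" for i
    using measurable_comp[OF measurable_upd_right m(2)[of i]] that by (simp add: comp_def)
  ultimately show ?thesis unfolding regular_def by blast
qed

lemma regular_integrable_aux:
  fixes f :: "('i \<Rightarrow> real) \<Rightarrow> real"
  assumes "finite I" "f \<in> borel_measurable (LM I)"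
    and "\<And>x. x \<in> space (LM I) \<Longrightarrow> \<bar>f x\<bar> \<le> C"
    and "\<And>x i. x \<in> space (LM I) \<Longrightarrow> i \<in> I \<Longrightarrow> \<bar>x i\<bar> > R \<Longrightarrow> f x = 0"
  shows "integrable (LM I) f"
proof -
  let ?B = "Pi\<^sub>E I (\<lambda>_. {-R..R})"
  have B: "?B \<in> sets (LM I)" using assms(1) by (intro sets_PiM_I_finite) auto
  have "emeasure (LM I) ?B = (\<Prod>i\<in>I. emeasure lborel {-R..R})"
    using assms(1) by (subst LB.emeasure_PiM) auto
  also have "\<dots> < \<infinity>" using assms(1) by (simp add: emeasure_lborel_Icc_eq power_less_top_ennreal)
  finally have fin: "emeasure (LM I) ?B < \<infinity>" .
  show ?thesis
  proof (rule Bochner_Integration.integrable_bound)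
    show "integrable (LM I) (\<lambda>x. C * indicator ?B x)"
      using B fin by (intro integrable_mult_right integrable_real_indicator) auto
    show "AE x in LM I. norm (f x) \<le> norm (C * indicator ?B x)"
    proof (rule AE_I2)
      fix x assume x: "x \<in> space (LM I)"
      show "norm (f x) \<le> norm (C * indicator ?B x)"
      proof (cases "x \<in> ?B")
        case True then show ?thesis using assms(3)[OF x] by simp
      next
        case False
        then obtain i where "i \<in> I" "\<bar>x i\<bar> > R"
          using x by (auto simp: space_PiM PiE_iff abs_le_iff not_le[symmetric])
        then show ?thesis using assms(4)[OF x] by simp
      qed
    qed
  qed fact
qed

lemma regular_integrable:
  assumes "finite I" "regular I u D"
  shows "integrable (LM I) u" and "i \<in> I \<Longrightarrow> integrable (LM I) (D i)"
proof -
  from assms obtain C R where CR: "\<And>x. x \<in> space (LM I) \<Longrightarrow> 0 \<le> u x \<and> u x \<le> C \<and>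
        (\<forall>i\<in>I. \<bar>D i x\<bar> \<le> C) \<and>
        ((\<exists>i\<in>I. \<bar>x i\<bar> > R) \<longrightarrow> u x = 0 \<and> (\<forall>i\<in>I. D i x = 0))"
    and m: "u \<in> borel_measurable (LM I)" "\<And>i. i \<in> I \<Longrightarrow> D i \<in> borel_measurable (LM I)"
    unfolding regular_def by metis
  show "integrable (LM I) u"
    by (rule regular_integrable_aux[OF assms(1) m(1), where C=C and R=R]) (use CR in force)+
  show "i \<in> I \<Longrightarrow> integrable (LM I) (D i)"
    by (rule regular_integrable_aux[OF assms(1) m(2), where C=C and R=R]) (use CR in blast)+
qed

lemma regular_integrable_j:
  assumes "finite I" "regular (insert j I) u D" "j \<notin> I"
  shows "integrable (LM I) (\<lambda>x. D j (x(j := s)))"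
proof -
  from assms obtain C R where CR: "\<And>x. x \<in> space (LM (insert j I)) \<Longrightarrow> \<bar>D j x\<bar> \<le> C \<and>
        ((\<exists>i\<in>insert j I. \<bar>x i\<bar> > R) \<longrightarrow> D j x = 0)"
    and m: "D j \<in> borel_measurable (LM (insert j I))"
    unfolding regular_def by (metis insertI1)
  show ?thesis
  proof (rule regular_integrable_aux[OF assms(1), where C=C and R=R])
    show "(\<lambda>x. D j (x(j := s))) \<in> borel_measurable (LM I)"
      using measurable_comp[OF measurable_upd_right m] by (simp add: comp_def)
    show "\<bar>D j (x(j := s))\<bar> \<le> C" if "x \<in> space (LM I)" for x
      using CR[OF upd_space[OF that, of j s]] by simp
    show "D j (x(j := s)) = 0" if "x \<in> space (LM I)" "i \<in> I" "\<bar>x i\<bar> > R" for x i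
    proof -
      have "i \<noteq> j" using that assms(3) by auto
      then have "\<bar>(x(j := s)) i\<bar> > R" using that by simp
      then show ?thesis using CR[OF upd_space[OF that(1), of j s]] that(2) by blast
    qed
  qed
qed

lemma regular_line:
  assumes "regular (insert j I) u D" "j \<notin> I" "x \<in> space (LM I)"
  obtains C R where "\<And>s. ((\<lambda>s. u (x(j := s))) has_real_derivative D j (x(j := s))) (at s)"
    and "(\<lambda>s. D j (x(j := s))) \<in> borel_measurable borel"
    and "\<And>s. \<bar>D j (x(j := s))\<bar> \<le> C"
    and "\<And>s. \<bar>s\<bar> > R \<Longrightarrow> u (x(j := s)) = 0" "\<And>s. \<bar>s\<bar> > R \<Longrightarrow> D j (x(j := s)) = 0"
    and "\<And>s. 0 \<le> u (x(j := s))"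
proof -
  from assms(1) obtain C R where CR: "\<And>x. x \<in> space (LM (insert j I)) \<Longrightarrow> 0 \<le> u x \<and> \<bar>D j x\<bar> \<le> C \<and> 
     ((\<lambda>s. u (x(j := s))) has_real_derivative D j x) (at (x j)) \<and>
        ((\<exists>i\<in>insert j I. \<bar>x i\<bar> > R) \<longrightarrow> u x = 0 \<and> D j x = 0)"
    and m: "D j \<in> borel_measurable (LM (insert j I))"
    unfolding regular_def by (metis insertI1)
  show thesis
  proof (rule that[of C R])
    fix s :: real
    note c = CR[OF upd_space[OF assms(3), of j s]]
    show "((\<lambda>s. u (x(j := s))) has_real_derivative D j (x(j := s))) (at s)"
      using c by simp
    show "(\<lambda>s. D j (x(j := s))) \<in> borel_measurable borel"
      using measurable_comp[OF measurable_upd_left[OF assms(3,2)] m] by (simp add: comp_def)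
    show "\<bar>D j (x(j := s))\<bar> \<le> C" "0 \<le> u (x(j := s))" using c by auto
    have "(x(j := s)) j = s" by simp
    then show "u (x(j := s)) = 0" "D j (x(j := s)) = 0" if "\<bar>s\<bar> > R"
      using c that by (metis insertI1)+
  qed
qed

lemma bounded_times_partial_integrable:
  assumes "finite I" "j \<notin> I" "regular (insert j I) u D"
    and T: "T \<in> borel_measurable borel" "\<And>s. \<bar>T s\<bar> \<le> c"
  shows "integrable (LM (insert j I)) (\<lambda>x. T (x j) * D j x)"
proof (rule Bochner_Integration.integrable_bound)
  have i: "integrable (LM (insert j I)) (D j)" using regular_integrable(2)[OF _ assms(3)] assms(1) by simp
  then show "integrable (LM (insert j I)) (\<lambda>x. c * D j x)" by simp
  have "(\<lambda>x. T (x j)) \<in> borel_measurable (LM (insert j I))"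
    using T(1) by (intro measurable_compose[OF measurable_component_singleton]) auto
  then show "(\<lambda>x. T (x j) * D j x) \<in> borel_measurable (LM (insert j I))"
    using i by (intro borel_measurable_times) auto
  show "AE x in LM (insert j I). norm (T (x j) * D j x) \<le> norm (c * D j x)"
    using order.trans[OF T(2) abs_ge_self] by (auto simp: abs_mult intro!: mult_right_mono)
qed

section \<open>Convex sets of coordinate functions and their slices\<close>

text \<open>The restriction to \<open>I\<close> keeps convex combinations extensional; otherwise
  they would leave \<open>space (LM I)\<close>.\<close>

definition convex_fun :: "'i set \<Rightarrow> ('i \<Rightarrow> real) set \<Rightarrow> bool" where
  "convex_fun I K \<longleftrightarrow>
     (\<forall>f\<in>K. \<forall>g\<in>K. \<forall>t\<in>{0..1}. (\<lambda>i\<in>I. (1 - t) * f i + t * g i) \<in> K)"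

definition bounded_fun :: "'i set \<Rightarrow> ('i \<Rightarrow> real) set \<Rightarrow> bool" where
  "bounded_fun I K \<longleftrightarrow> (\<exists>C. \<forall>k\<in>K. \<forall>i\<in>I. \<bar>k i\<bar> \<le> C)"

definition slice :: "'i set \<Rightarrow> 'i \<Rightarrow> real \<Rightarrow> ('i \<Rightarrow> real) set \<Rightarrow> ('i \<Rightarrow> real) set" where
  "slice I j s K = {x\<in>space (LM I). x(j := s) \<in> K}"

lemma sets_slice: "K \<in> sets (LM (insert j I)) \<Longrightarrow> slice I j s K \<in> sets (LM I)"
  using measurable_sets[OF measurable_upd_right[of j s I], of K]
  by (simp add: slice_def vimage_def Int_def conj_commute)

lemma convex_slice:
  assumes "convex_fun (insert j I) K" "j \<notin> I"
  shows "convex_fun I (slice I j s K)"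
  unfolding convex_fun_def
proof (intro ballI)
  fix f g t assume f: "f \<in> slice I j s K" and g: "g \<in> slice I j s K" and t: "t \<in> {0..1::real}"
  have "(\<lambda>i\<in>insert j I. (1 - t) * (f(j := s)) i + t * (g(j := s)) i) \<in> K"
    using assms f g t unfolding convex_fun_def slice_def by blast
  moreover have "(\<lambda>i\<in>insert j I. (1 - t) * (f(j := s)) i + t * (g(j := s)) i)
      = (\<lambda>i\<in>I. (1 - t) * f i + t * g i)(j := s)"
    using assms(2) by (auto simp: fun_eq_iff restrict_def algebra_simps)
  ultimately show "(\<lambda>i\<in>I. (1 - t) * f i + t * g i) \<in> slice I j s K"
    by (auto simp: slice_def space_PiM)
qed

lemma bounded_slice: "bounded_fun (insert j I) K \<Longrightarrow> j \<notin> I \<Longrightarrow> bounded_fun I (slice I j s K)"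
  unfolding bounded_fun_def slice_def by (metis (no_types, lifting) fun_upd_other insertI2 mem_Collect_eq)

lemma slice_nonempty:
  assumes "K \<in> sets (LM (insert j I))" "k \<in> K" "j \<notin> I"
  shows "restrict k I \<in> slice I j (k j) K"
proof -
  have "k \<in> space (LM (insert j I))" using assms sets.sets_into_space by blast
  then have "(restrict k I)(j := k j) = k"
    by (auto simp: fun_eq_iff space_PiM PiE_iff extensional_def restrict_def)
  then show ?thesis using assms(2) by (simp add: slice_def space_PiM)
qed

section \<open>The anisotropic isoperimetric inequality by induction on the dimension\<close>

text \<open>A weak functional form of the Wulff inequality: \<open>H\<close> majorises the support
  function of \<open>K\<close> at minus the gradient, and a single superlevel set stands in for the
  coarea formula. For \<open>u\<close> close to the indicator of a set and \<theta> close to 1 it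
  approaches the isoperimetric inequality for that set.\<close>

definition sobolev :: "'i set \<Rightarrow> bool" where
  "sobolev I \<longleftrightarrow> (\<forall>u D K H. \<forall>\<theta>::real. regular I u D \<longrightarrow> K \<in> sets (LM I) \<longrightarrow> K \<noteq> {} \<longrightarrow> convex_fun I K \<longrightarrow>
     bounded_fun I K \<longrightarrow> integrable (LM I) H \<longrightarrow>
     (\<forall>x\<in>space (LM I). \<forall>k\<in>K. - (\<Sum>i\<in>I. k i * D i x) \<le> H x) \<longrightarrow> \<theta> > 0 \<longrightarrow>
     \<theta> * card I * measure (LM I) K powr (1 / card I) *
       measure (LM I) {x\<in>space (LM I). \<theta> \<le> u x} powr (1 - 1 / card I) \<le> (\<integral>x. H x \<partial>LM I))"

context
  fixes I :: "'i set" and j :: 'i and u D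
  assumes fin: "finite I" and j: "j \<notin> I" and reg: "regular (insert j I) u D"
begin

lemma integral_partial_zero: "(\<integral>x. D j x \<partial>LM (insert j I)) = 0"
proof -
  have "integrable (LM (insert j I)) (D j)" using regular_integrable(2)[OF _ reg] fin by simp
  from fubini_upd(5)[OF fin j this]
  have "(\<integral>x. D j x \<partial>LM (insert j I)) = (\<integral>x. \<integral>s. D j (x(j := s)) \<partial>lborel \<partial>LM I)" .
  also have "\<dots> = (\<integral>x. 0 \<partial>LM I)"
  proof (rule Bochner_Integration.integral_cong[OF refl])
    fix x assume "x \<in> space (LM I)"
    from regular_line[OF reg j this] obtain C R where l:
      "\<And>s. ((\<lambda>s. u (x(j := s))) has_real_derivative D j (x(j := s))) (at s)"
      "(\<lambda>s. D j (x(j := s))) \<in> borel_measurable borel"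
      "\<And>s. \<bar>D j (x(j := s))\<bar> \<le> C"
      "\<And>s. \<bar>s\<bar> > R \<Longrightarrow> u (x(j := s)) = 0" "\<And>s. \<bar>s\<bar> > R \<Longrightarrow> D j (x(j := s)) = 0"
      "\<And>s. 0 \<le> u (x(j := s))" by blast
    show "(\<integral>s. D j (x(j := s)) \<partial>lborel) = 0"
      by (rule integral_halfline_derivative(3)[OF l(1,2,3)]) (fact l(4,5))+
  qed
  finally show ?thesis by simp
qed

lemma integral_partial_halfspace:
  "(\<integral>x. indicator {s0<..} (x j) * D j x \<partial>LM (insert j I)) = - (\<integral>x. u (x(j := s0)) \<partial>LM I)"
proof -
  have i: "integrable (LM (insert j I)) (\<lambda>x. indicator {s0<..} (x j) * D j x)"
    by (rule bounded_times_partial_integrable[OF fin j reg, where c=1]) (auto simp: indicator_def)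
  have "(\<integral>x. indicator {s0<..} (x j) * D j x \<partial>LM (insert j I))
     = (\<integral>x. \<integral>s. indicator {s0<..} s * D j (x(j := s)) \<partial>lborel \<partial>LM I)"
    using fubini_upd(5)[OF fin j i] by simp
  also have "\<dots> = (\<integral>x. - u (x(j := s0)) \<partial>LM I)"
  proof (rule Bochner_Integration.integral_cong[OF refl])
    fix x assume "x \<in> space (LM I)"
    from regular_line[OF reg j this] obtain C R where l:
      "\<And>s. ((\<lambda>s. u (x(j := s))) has_real_derivative D j (x(j := s))) (at s)"
      "(\<lambda>s. D j (x(j := s))) \<in> borel_measurable borel"
      "\<And>s. \<bar>D j (x(j := s))\<bar> \<le> C"
      "\<And>s. \<bar>s\<bar> > R \<Longrightarrow> u (x(j := s)) = 0" "\<And>s. \<bar>s\<bar> > R \<Longrightarrow> D j (x(j := s)) = 0"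
      "\<And>s. 0 \<le> u (x(j := s))" by blast
    have "(\<integral>s. D j (x(j := s)) * indicator {s0<..} s \<partial>lborel) = - u (x(j := s0))"
      by (rule integral_halfline_derivative(2)[OF l(1,2,3)]) (fact l(4,5))+
    then show "(\<integral>s. indicator {s0<..} s * D j (x(j := s)) \<partial>lborel) = - u (x(j := s0))"
      by (simp add: mult.commute)
  qed
  finally show ?thesis by simp
qed

text \<open>Fubini over the lines parallel to axis \<open>j\<close> reduces this to
  \<open>transport_by_parts\<close>. The density \<open>p\<close> is not tied to the marginal of
  \<open>u\<close>; in the equality case it is the marginal of the limit set, or of a part of that
  set.\<close>

lemma transport_bound:
  assumes "density_transport p q a b"
  shows "0 \<le> - (\<integral>x. density_transport.T p q a b (x j) * D j x \<partial>LM (insert j I))" (is "0 \<le> - ?I")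
    and "(\<integral>\<^sup>+s. ennreal ((\<integral>x. u (x(j := s)) \<partial>LM I) * p s / q (density_transport.T p q a b s)) \<partial>lborel)
      \<le> ennreal (- (\<integral>x. density_transport.T p q a b (x j) * D j x \<partial>LM (insert j I)))"
proof -
  interpret density_transport p q a b by fact
  have T_abs: "\<bar>T s\<bar> \<le> \<bar>a\<bar> + \<bar>b\<bar>" for s using T_range[of s] by auto
  have i: "integrable (LM (insert j I)) (\<lambda>x. T (x j) * D j x)"
    by (rule bounded_times_partial_integrable[OF fin j reg T_meas T_abs])
  have u_meas: "u \<in> borel_measurable (LM (insert j I))" using reg by (simp add: regular_def)
  have line: "0 \<le> - (\<integral>s. T s * D j (x(j := s)) \<partial>lborel)"
    "(\<integral>\<^sup>+s. ennreal (u (x(j := s)) * p s / q (T s)) \<partial>lborel) \<le> ennreal (- (\<integral>s. T s * D j (x(j := s)) \<partial>lborel))"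
    if "x \<in> space (LM I)" for x
  proof -
    from regular_line[OF reg j that] obtain C R where l:
      "\<And>s. ((\<lambda>s. u (x(j := s))) has_real_derivative D j (x(j := s))) (at s)"
      "(\<lambda>s. D j (x(j := s))) \<in> borel_measurable borel"
      "\<And>s. \<bar>D j (x(j := s))\<bar> \<le> C"
      "\<And>s. \<bar>s\<bar> > R \<Longrightarrow> u (x(j := s)) = 0" "\<And>s. \<bar>s\<bar> > R \<Longrightarrow> D j (x(j := s)) = 0"
      "\<And>s. 0 \<le> u (x(j := s))" by blast
    show "0 \<le> - (\<integral>s. T s * D j (x(j := s)) \<partial>lborel)"
      by (rule transport_by_parts(1)[OF l(1,2,3)]) (fact l(4,5,6))+
    show "(\<integral>\<^sup>+s. ennreal (u (x(j := s)) * p s / q (T s)) \<partial>lborel) \<le> ennreal (- (\<integral>s. T s * D j (x(j := s)) \<partial>lborel))"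
      by (rule transport_by_parts(2)[OF l(1,2,3)]) (fact l(4,5,6))+
  qed
  have eq: "(\<integral>x. T (x j) * D j x \<partial>LM (insert j I)) = (\<integral>x. \<integral>s. T s * D j (x(j := s)) \<partial>lborel \<partial>LM I)"
    using fubini_upd(5)[OF fin j i] by simp
  have i': "integrable (LM I) (\<lambda>x. \<integral>s. T s * D j (x(j := s)) \<partial>lborel)"
    using fubini_upd(4)[OF fin j i] by simp
  have eq': "- (\<integral>x. T (x j) * D j x \<partial>LM (insert j I)) = (\<integral>x. - (\<integral>s. T s * D j (x(j := s)) \<partial>lborel) \<partial>LM I)"
    using eq i' by simp
  show "0 \<le> - ?I"
    unfolding eq' by (rule Bochner_Integration.integral_nonneg) (rule line)
  have f_meas: "(\<lambda>x. ennreal (u x * p (x j) / q (T (x j)))) \<in> borel_measurable (LM (insert j I))"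
  proof -
    have c: "(\<lambda>x. x j) \<in> measurable (LM (insert j I)) borel"
      using measurable_component_singleton[of j "insert j I" "\<lambda>_. lborel :: real measure"] by simp
    have "(\<lambda>x. p (x j)) \<in> borel_measurable (LM (insert j I))" "(\<lambda>x. q (T (x j))) \<in> borel_measurable (LM (insert j I))"
      using measurable_compose[OF c p_meas] measurable_compose[OF measurable_compose[OF c T_meas] q_meas] by auto
    then show ?thesis using u_meas by measurable
  qed
  have "(\<integral>\<^sup>+s. ennreal ((\<integral>x. u (x(j := s)) \<partial>LM I) * p s / q (T s)) \<partial>lborel)
     = (\<integral>\<^sup>+s. \<integral>\<^sup>+x. ennreal (u (x(j := s)) * p s / q (T s)) \<partial>LM I \<partial>lborel)"
  proof (rule nn_integral_cong)
    fix s :: real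
    note rs = regular_slice[OF reg j, of s]
    have iu: "integrable (LM I) (\<lambda>x. u (x(j := s)))" by (rule regular_integrable(1)[OF fin rs])
    have un: "0 \<le> u (x(j := s))" if "x \<in> space (LM I)" for x
      using rs that unfolding regular_def by blast
    have k: "0 \<le> p s / q (T s)" using p_nonneg q_nonneg by simp
    have "(\<integral>\<^sup>+x. ennreal (u (x(j := s)) * p s / q (T s)) \<partial>LM I) = (\<integral>\<^sup>+x. ennreal (p s / q (T s)) * ennreal (u (x(j := s))) \<partial>LM I)"
      unfolding ennreal_mult'[OF k, symmetric] by (simp add: ac_simps)
    also have "\<dots> = ennreal (p s / q (T s)) * (\<integral>\<^sup>+x. ennreal (u (x(j := s))) \<partial>LM I)"
      using iu by (intro nn_integral_cmult) auto
    also have "(\<integral>\<^sup>+x. ennreal (u (x(j := s))) \<partial>LM I) = ennreal (\<integral>x. u (x(j := s)) \<partial>LM I)"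
      using iu un by (intro nn_integral_eq_integral AE_I2) auto
    also have "ennreal (p s / q (T s)) * ennreal (\<integral>x. u (x(j := s)) \<partial>LM I) = ennreal ((\<integral>x. u (x(j := s)) \<partial>LM I) * p s / q (T s))"
      by (simp add: ennreal_mult'[OF k, symmetric] mult.commute)
    finally show "ennreal ((\<integral>x. u (x(j := s)) \<partial>LM I) * p s / q (T s)) = (\<integral>\<^sup>+x. ennreal (u (x(j := s)) * p s / q (T s)) \<partial>LM I)" ..
  qed
  also have "\<dots> = (\<integral>\<^sup>+x. \<integral>\<^sup>+s. ennreal (u (x(j := s)) * p s / q (T s)) \<partial>lborel \<partial>LM I)"
    using nn_fubini_upd(1)[OF fin j f_meas] nn_fubini_upd(2)[OF fin j f_meas] by simp
  also have "\<dots> \<le> (\<integral>\<^sup>+x. ennreal (- (\<integral>s. T s * D j (x(j := s)) \<partial>lborel)) \<partial>LM I)"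
    by (intro nn_integral_mono line)
  also have "\<dots> = ennreal (\<integral>x. - (\<integral>s. T s * D j (x(j := s)) \<partial>lborel) \<partial>LM I)"
    using i' line(1) by (intro nn_integral_eq_integral AE_I2) auto
  finally show "(\<integral>\<^sup>+s. ennreal ((\<integral>x. u (x(j := s)) \<partial>LM I) * p s / q (T s)) \<partial>lborel) \<le> ennreal (- ?I)"
    unfolding eq' .
qed

text \<open>Fixing the \<open>j\<close>-th component of the test vector as \<open>T s\<close> turns
  domination by \<open>H\<close> into domination of the remaining components by
  \<open>H + T s * D j\<close> on the slice at \<open>s\<close>. The inequality for \<open>I\<close>
  then applies with the slice of \<open>K\<close> at height \<open>T s\<close> in the role of
  \<open>K\<close>.\<close>

lemma slice_bound:
  fixes \<theta> :: real
  assumes sob: "sobolev I"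
    and K: "K \<in> sets (LM (insert j I))" "K \<noteq> {}" "convex_fun (insert j I) K" "bounded_fun (insert j I) K"
    and H: "integrable (LM (insert j I)) H"
      "\<And>x k. x \<in> space (LM (insert j I)) \<Longrightarrow> k \<in> K \<Longrightarrow> - (\<Sum>i\<in>insert j I. k i * D i x) \<le> H x"
    and \<theta>: "(\<theta>::real) > 0"
    and T: "T \<in> borel_measurable borel" "\<And>s. T s \<in> closure ((\<lambda>k. k j) ` K)"
  shows "0 \<le> (\<integral>x. H x \<partial>LM (insert j I)) + (\<integral>x. T (x j) * D j x \<partial>LM (insert j I))"
    and "(\<integral>\<^sup>+s. ennreal (\<theta> * card I * measure (LM I) (slice I j (T s) K) powr (1 / card I) *
          measure (LM I) {x\<in>space (LM I). \<theta> \<le> u (x(j := s))} powr (1 - 1 / card I)) \<partial>lborel)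
      \<le> ennreal ((\<integral>x. H x \<partial>LM (insert j I)) + (\<integral>x. T (x j) * D j x \<partial>LM (insert j I)))"
proof -
  let ?P = "(\<lambda>k. k j) ` K"
  obtain C where C: "\<And>k. k \<in> K \<Longrightarrow> \<bar>k j\<bar> \<le> C" using K(4) unfolding bounded_fun_def by auto
  have "closure ?P \<subseteq> {-C..C}" by (rule closure_minimal) (use C in \<open>fastforce simp: abs_le_iff\<close>, simp)
  then have Tb: "\<bar>T s\<bar> \<le> C" for s using T(2)[of s] by (auto simp: abs_le_iff)
  have iT: "integrable (LM (insert j I)) (\<lambda>x. T (x j) * D j x)"
    by (rule bounded_times_partial_integrable[OF fin j reg T(1) Tb])
  let ?G = "\<lambda>x. H x + T (x j) * D j x"
  have iG: "integrable (LM (insert j I)) ?G" using H(1) iT by simp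
  have eqG: "(\<integral>x. ?G x \<partial>LM (insert j I)) = (\<integral>x. H x \<partial>LM (insert j I)) + (\<integral>x. T (x j) * D j x \<partial>LM (insert j I))"
    using H(1) iT by (rule Bochner_Integration.integral_add)
  let ?r = "\<lambda>t s. \<theta> * card I * measure (LM I) (slice I j t K) powr (1 / card I) *
          measure (LM I) {x\<in>space (LM I). \<theta> \<le> u (x(j := s))} powr (1 - 1 / card I)"
  let ?g = "\<lambda>s. \<integral>x. ?G (x(j := s)) \<partial>LM I"
  have slicewise: "?r (T s) s \<le> ?g s" if iHs: "integrable (LM I) (\<lambda>x. H (x(j := s)))" for s
  proof -
    note rs = regular_slice[OF reg j, of s]
    have iD: "integrable (LM I) (\<lambda>x. D j (x(j := s)))" by (rule regular_integrable_j[OF fin reg j])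
    have step: "?r t s \<le> (\<integral>x. H (x(j := s)) + t * D j (x(j := s)) \<partial>LM I)" if t: "t \<in> ?P" for t
    proof -
      obtain k where k: "k \<in> K" "t = k j" using t by auto
      have "slice I j t K \<noteq> {}" using slice_nonempty[OF K(1) k(1) j] k(2) by auto
      moreover have "- (\<Sum>i\<in>I. k i * D i (x(j := s))) \<le> H (x(j := s)) + t * D j (x(j := s))"
        if x: "x \<in> space (LM I)" and k: "k \<in> slice I j t K" for x k
      proof -
        have "(\<Sum>i\<in>I. (k(j := t)) i * D i (x(j := s))) = (\<Sum>i\<in>I. k i * D i (x(j := s)))"
          using j by (intro sum.cong) auto
        then show ?thesis
          using H(2)[OF upd_space[OF x, of j s], of "k(j := t)"] k fin j by (simp add: slice_def)
      qed
      moreover have "integrable (LM I) (\<lambda>x. H (x(j := s)) + t * D j (x(j := s)))"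
        using iHs iD by simp
      ultimately show ?thesis
        using sob[unfolded sobolev_def, THEN spec, THEN spec, THEN spec, THEN spec, THEN spec, THEN mp, THEN mp, THEN mp, THEN mp, THEN mp, THEN mp, THEN mp, THEN mp,
            OF rs sets_slice[OF K(1)] _ convex_slice[OF K(3) j] bounded_slice[OF K(4) j], of t _ \<theta>] \<theta>
        by simp
    qed
    have lin: "(\<integral>x. H (x(j := s)) + t * D j (x(j := s)) \<partial>LM I) = (\<integral>x. H (x(j := s)) \<partial>LM I) + t * (\<integral>x. D j (x(j := s)) \<partial>LM I)" for t
      using iHs iD by simp
    have r_nonneg: "0 \<le> ?r t s" for t using \<theta> by simp
    have g: "?g s = (\<integral>x. H (x(j := s)) + T s * D j (x(j := s)) \<partial>LM I)" by simp
    show ?thesis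
    proof (cases "T s \<in> ?P")
      case True
      then show ?thesis unfolding g by (rule step)
    next
      case False
      \<comment> \<open>\<open>T s\<close> may be an end point of the projection of \<open>K\<close>
        that is not attained. The slice of \<open>K\<close> is then empty, and only nonnegativity of
        the right-hand side is left; it extends from the projection to its closure because the
        right-hand side is affine in the height.\<close>
      have "slice I j (T s) K = {}"
      proof (rule ccontr)
        assume "slice I j (T s) K \<noteq> {}"
        then obtain x where "x(j := T s) \<in> K" unfolding slice_def by blast
        then have "(x(j := T s)) j \<in> ?P" by blast
        then show False using False by simp
      qed
      then have r0: "?r (T s) s = 0" by simp
      have "0 \<le> (\<integral>x. H (x(j := s)) \<partial>LM I) + T s * (\<integral>x. D j (x(j := s)) \<partial>LM I)"
      proof (rule continuous_ge_on_closure[where f="\<lambda>t. (\<integral>x. H (x(j := s)) \<partial>LM I) + t * (\<integral>x. D j (x(j := s)) \<partial>LM I)" and S="?P"])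
        show "continuous_on (closure ?P) (\<lambda>t. (\<integral>x. H (x(j := s)) \<partial>LM I) + t * (\<integral>x. D j (x(j := s)) \<partial>LM I))"
          by (intro continuous_intros)
        show "T s \<in> closure ?P" by (rule T(2))
        show "0 \<le> (\<integral>x. H (x(j := s)) \<partial>LM I) + t * (\<integral>x. D j (x(j := s)) \<partial>LM I)" if "t \<in> ?P" for t
          using order.trans[OF r_nonneg step[OF that]] unfolding lin .
      qed
      then show ?thesis unfolding g lin r0 .
    qed
  qed
  have AE_s: "AE s in lborel. ?r (T s) s \<le> ?g s"
    using fubini_upd(1)[OF fin j H(1)] by eventually_elim (rule slicewise)
  have nn: "AE s in lborel. 0 \<le> ?g s"
    using AE_s
  proof eventually_elim
    case (elim s)
    have "0 \<le> ?r (T s) s" using \<theta> by simp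
    with elim show ?case by linarith
  qed
  note fG = fubini_upd(2,3)[OF fin j iG]
  show "0 \<le> (\<integral>x. H x \<partial>LM (insert j I)) + (\<integral>x. T (x j) * D j x \<partial>LM (insert j I))"
    unfolding eqG[symmetric] fG(2) by (rule integral_nonneg_AE[OF nn])
  have "(\<integral>\<^sup>+s. ennreal (?r (T s) s) \<partial>lborel) \<le> (\<integral>\<^sup>+s. ennreal (?g s) \<partial>lborel)"
  proof (rule nn_integral_mono_AE)
    show "AE s in lborel. ennreal (?r (T s) s) \<le> ennreal (?g s)"
      using AE_s by eventually_elim (rule ennreal_leI)
  qed
  also have "\<dots> = ennreal (\<integral>s. ?g s \<partial>lborel)" by (rule nn_integral_eq_integral[OF fG(1) nn])
  finally show "(\<integral>\<^sup>+s. ennreal (?r (T s) s) \<partial>lborel)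
      \<le> ennreal ((\<integral>x. H x \<partial>LM (insert j I)) + (\<integral>x. T (x j) * D j x \<partial>LM (insert j I)))"
    unfolding eqG[symmetric] fG(2) .
qed

end

text \<open>\<open>amgm_powr\<close> at \<open>r = B / m\<close>, multiplied by \<open>B\<close>, in
  the shape in which the slice volumes \<open>B\<close> and \<open>m\<close> occur.\<close>

lemma amgm_slice:
  fixes m B c :: real
  assumes "m > 0" "B > 0" "c > 0" "n \<ge> (1::nat)"
  shows "(real n + 1) * c powr (1 / (real n + 1)) * B \<le> B * (B * c / m) + real n * m powr (1 / real n) * B powr (1 - 1 / real n)"
    and "c = 1 \<Longrightarrow> B \<noteq> m \<Longrightarrow> (real n + 1) * B < B * (B / m) + real n * m powr (1 / real n) * B powr (1 - 1 / real n)"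
proof -
  have r: "B / m > 0" using assms by simp
  have "(B / m) powr (- 1 / real n) * B = m powr (1 / real n) * B powr (1 - 1 / real n)"
  proof -
    have "B powr (- 1 / real n) * B = B powr (1 - 1 / real n)"
      using assms by (simp add: powr_diff powr_minus divide_inverse)
    moreover have "(B / m) powr (- 1 / real n) = m powr (1 / real n) * B powr (- 1 / real n)"
    proof -
      have "(B / m) powr (- 1 / real n) = B powr (- 1 / real n) / m powr (- 1 / real n)"
        using assms by (simp add: powr_divide)
      also have "m powr (- 1 / real n) = inverse (m powr (1 / real n))"
        using powr_minus[of m "1 / real n"] by simp
      finally show ?thesis by (simp add: divide_inverse)
    qed
    ultimately show ?thesis by simp
  qed
  then have e: "B * (B / m * c + real n * (B / m) powr (- 1 / real n))
      = B * (B * c / m) + real n * m powr (1 / real n) * B powr (1 - 1 / real n)"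
    by (simp add: distrib_left mult.commute mult.left_commute)
  show "(real n + 1) * c powr (1 / (real n + 1)) * B \<le> B * (B * c / m) + real n * m powr (1 / real n) * B powr (1 - 1 / real n)"
    using mult_left_mono[OF amgm_powr(1)[OF r assms(3,4)], of B] assms(2) unfolding e by (simp add: mult.commute)
  assume "c = 1" "B \<noteq> m"
  then have "B / m \<noteq> 1" using assms by simp
  then have "real n + 1 < B / m + real n * (B / m) powr (- 1 / real n)"
    by (rule amgm_powr(2)[OF r assms(3,4) \<open>c = 1\<close>])
  then have "(real n + 1) * B < B * (B / m * c + real n * (B / m) powr (- 1 / real n))"
    using assms(2) \<open>c = 1\<close> by simp
  then show "(real n + 1) * B < B * (B / m) + real n * m powr (1 / real n) * B powr (1 - 1 / real n)"
    using \<open>c = 1\<close> unfolding e by simp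
qed

context
  fixes I :: "'i set" and j :: 'i
  assumes fin: "finite I" and j: "j \<notin> I"
begin

lemma slice_measurable:
  assumes A: "A \<in> sets (LM (insert j I))"
  shows "(\<lambda>s. emeasure (LM I) (slice I j s A)) \<in> borel_measurable borel"
    and "(\<lambda>s. measure (LM I) (slice I j s A)) \<in> borel_measurable borel"
    and "(\<integral>\<^sup>+s. emeasure (LM I) (slice I j s A) \<partial>lborel) = emeasure (LM (insert j I)) A"
    and "emeasure (LM (insert j I)) A < \<infinity> \<Longrightarrow> AE s in lborel. emeasure (LM I) (slice I j s A) < \<infinity>"
    and "emeasure (LM (insert j I)) A < \<infinity> \<Longrightarrow>
          (\<integral>\<^sup>+s. ennreal (measure (LM I) (slice I j s A)) \<partial>lborel) = emeasure (LM (insert j I)) A"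
proof -
  interpret sigma_finite_measure "LM I" by (rule sigma_finite_LM[OF fin])
  let ?A = "(\<lambda>(s, x). x(j := s)) -` A \<inter> space (lborel \<Otimes>\<^sub>M LM I)"
  have sA: "?A \<in> sets (lborel \<Otimes>\<^sub>M LM I)" by (rule measurable_sets[OF measurable_upd_pair A])
  have eq: "Pair s -` ?A = slice I j s A" for s
    by (auto simp: slice_def space_pair_measure)
  show m: "(\<lambda>s. emeasure (LM I) (slice I j s A)) \<in> borel_measurable borel"
    using measurable_emeasure_Pair[OF sA] unfolding eq by simp
  show "(\<lambda>s. measure (LM I) (slice I j s A)) \<in> borel_measurable borel"
    unfolding measure_def using m by simp
  have "emeasure (LM (insert j I)) A = (\<integral>\<^sup>+x. indicator A x \<partial>LM (insert j I))" using A by simp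
  also have "\<dots> = (\<integral>\<^sup>+s. \<integral>\<^sup>+x. indicator A (x(j := s)) \<partial>LM I \<partial>lborel)"
    using A by (intro nn_fubini_upd(1)[OF fin j]) simp
  also have "\<dots> = (\<integral>\<^sup>+s. emeasure (LM I) (slice I j s A) \<partial>lborel)"
  proof (rule nn_integral_cong)
    fix s :: real
    have "(\<integral>\<^sup>+x. indicator A (x(j := s)) \<partial>LM I) = (\<integral>\<^sup>+x. indicator (slice I j s A) x \<partial>LM I)"
      by (rule nn_integral_cong) (auto simp: slice_def indicator_def)
    then show "(\<integral>\<^sup>+x. indicator A (x(j := s)) \<partial>LM I) = emeasure (LM I) (slice I j s A)"
      using sets_slice[OF A, of s] by simp
  qed
  finally show i: "(\<integral>\<^sup>+s. emeasure (LM I) (slice I j s A) \<partial>lborel) = emeasure (LM (insert j I)) A" ..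
  assume f: "emeasure (LM (insert j I)) A < \<infinity>"
  have "AE s in lborel. emeasure (LM I) (slice I j s A) \<noteq> \<infinity>"
    by (rule nn_integral_PInf_AE) (use m i f in auto)
  then show a: "AE s in lborel. emeasure (LM I) (slice I j s A) < \<infinity>"
    by (auto simp: less_top)
  have "(\<integral>\<^sup>+s. ennreal (measure (LM I) (slice I j s A)) \<partial>lborel) = (\<integral>\<^sup>+s. emeasure (LM I) (slice I j s A) \<partial>lborel)"
  proof (rule nn_integral_cong_AE)
    show "AE s in lborel. ennreal (measure (LM I) (slice I j s A)) = emeasure (LM I) (slice I j s A)"
      using a by eventually_elim (simp add: emeasure_eq_ennreal_measure)
  qed
  then show "(\<integral>\<^sup>+s. ennreal (measure (LM I) (slice I j s A)) \<partial>lborel) = emeasure (LM (insert j I)) A"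
    by (simp only: i)
qed

lemma projection_range:
  assumes K: "K \<noteq> {}" "convex_fun (insert j I) K" "bounded_fun (insert j I) K"
  shows "{Inf ((\<lambda>k. k j) ` K)..Sup ((\<lambda>k. k j) ` K)} \<subseteq> closure ((\<lambda>k. k j) ` K)"
    and "k \<in> K \<Longrightarrow> k j \<in> {Inf ((\<lambda>k. k j) ` K)..Sup ((\<lambda>k. k j) ` K)}"
proof -
  let ?P = "(\<lambda>k. k j) ` K"
  obtain C where C: "\<And>k. k \<in> K \<Longrightarrow> \<bar>k j\<bar> \<le> C" using K(3) unfolding bounded_fun_def by auto
  have ne: "?P \<noteq> {}" using K(1) by simp
  have bdd: "bdd_above ?P" "bdd_below ?P"
  proof -
    have ub: "k j \<le> C" and lb: "- C \<le> k j" if "k \<in> K" for k using C[OF that] by linarith+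
    show "bdd_above ?P" by (rule bdd_aboveI2[OF ub])
    show "bdd_below ?P" by (rule bdd_belowI2[OF lb])
  qed
  have "convex ?P"
  proof (rule convexI)
    fix x y s t :: real assume "x \<in> ?P" "y \<in> ?P" and st: "0 \<le> s" "0 \<le> t" "s + t = 1"
    then obtain f g where fg: "f \<in> K" "g \<in> K" "x = f j" "y = g j" by auto
    have "(\<lambda>i\<in>insert j I. (1 - t) * f i + t * g i) \<in> K"
    proof -
      have "t \<in> {0..1}" using st by simp
      then show ?thesis using K(2) fg(1,2) unfolding convex_fun_def by blast
    qed
    then have "(\<lambda>i\<in>insert j I. (1 - t) * f i + t * g i) j \<in> ?P" by blast
    moreover have "1 - t = s" using st by simp
    ultimately show "s *\<^sub>R x + t *\<^sub>R y \<in> ?P" using fg by simp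
  qed
  then have cc: "convex (closure ?P)" by (rule convex_closure)
  have "closed_segment (Inf ?P) (Sup ?P) \<subseteq> closure ?P"
    by (rule closed_segment_subset[OF closure_contains_Inf[OF ne bdd(2)] closure_contains_Sup[OF ne bdd(1)] cc])
  moreover have "Inf ?P \<le> Sup ?P" by (rule cInf_le_cSup[OF ne bdd])
  ultimately show "{Inf ?P..Sup ?P} \<subseteq> closure ?P" by (simp add: closed_segment_eq_real_ivl)
  show "k j \<in> {Inf ?P..Sup ?P}" if "k \<in> K"
    using cInf_lower[OF imageI[OF that] bdd(2)] cSup_upper[OF imageI[OF that] bdd(1)] by simp
qed

end

lemma bounded_fun_emeasure:
  assumes "finite J" "K \<in> sets (LM J)" "bounded_fun J K"
  shows "emeasure (LM J) K < \<infinity>"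
proof -
  obtain C where C: "\<And>k i. k \<in> K \<Longrightarrow> i \<in> J \<Longrightarrow> \<bar>k i\<bar> \<le> C" using assms(3) unfolding bounded_fun_def by blast
  have "K \<subseteq> Pi\<^sub>E J (\<lambda>_. {-C..C})"
  proof
    fix k assume k: "k \<in> K"
    then have "k \<in> space (LM J)" using sets.sets_into_space[OF assms(2)] by blast
    then have "k \<in> extensional J" by (simp add: space_PiM PiE_iff)
    moreover have "k i \<in> {-C..C}" if "i \<in> J" for i using C[OF k that] by (simp add: abs_le_iff minus_le_iff)
    ultimately show "k \<in> Pi\<^sub>E J (\<lambda>_. {-C..C})" by (simp add: PiE_iff)
  qed
  then have "emeasure (LM J) K \<le> emeasure (LM J) (Pi\<^sub>E J (\<lambda>_. {-C..C}))"
    by (rule emeasure_mono) (use assms(1) in \<open>simp add: sets_PiM_I_finite\<close>)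
  also have "\<dots> = (\<Prod>i\<in>J. emeasure lborel {-C..C})"
    using assms(1) by (simp add: LB.emeasure_PiM)
  also have "\<dots> < \<infinity>" using assms(1) by (simp add: emeasure_lborel_Icc_eq power_less_top_ennreal)
  finally show ?thesis .
qed

lemma sobolev_empty: "sobolev {}"
  unfolding sobolev_def
proof (intro allI impI)
  fix u D and K :: "('a \<Rightarrow> real) set" and H and \<theta> :: real
  assume "K \<noteq> {}" and H: "\<forall>x\<in>space (LM {}). \<forall>k\<in>K. - (\<Sum>i\<in>{}. k i * D i x) \<le> H x"
  then obtain k where "k \<in> K" by blast
  then have "0 \<le> H x" if "x \<in> space (LM {})" for x
    using bspec[OF bspec[OF H that]] by simp
  then have "0 \<le> (\<integral>x. H x \<partial>LM {})" by (rule Bochner_Integration.integral_nonneg)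
  then show "\<theta> * card {} * measure (LM {}) K powr (1 / card {}) *
       measure (LM {}) {x\<in>space (LM {}). \<theta> \<le> u x} powr (1 - 1 / card {}) \<le> (\<integral>x. H x \<partial>LM {})" by simp
qed

text \<open>In the first induction step the slices live over the empty index set, where
  \<open>1 / n\<close> is \<open>1 / 0 = 0\<close>. All slice volumes being 0 or 1 makes the
  inequality of means hold there by inspection.\<close>

lemma measure_LM_empty: "measure (LM {}) A = 0 \<or> measure (LM {}) A = 1"
proof (cases "A \<in> sets (LM {})")
  case True
  then have "A \<subseteq> {\<lambda>_. undefined}" using sets.sets_into_space[OF True] by (simp add: PiM_empty)
  then have "A = {} \<or> A = {\<lambda>_. undefined}" by blast
  then show ?thesis by (elim disjE) (simp_all add: PiM_empty measure_count_space)
qed (simp add: measure_notin_sets)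

text \<open>The integral of \<open>T (x j) * D j x\<close> enters \<open>slice_bound\<close> with a
  plus sign and \<open>transport_bound\<close> with a minus sign, so it cancels when the two are
  added. What is left against the integral of \<open>H\<close> is the pointwise sum to which the
  inequality of means applies.\<close>

lemma sobolev_insert:
  assumes fin: "finite I" and j: "j \<notin> I" and sob: "sobolev I"
  shows "sobolev (insert j I)"
  unfolding sobolev_def
proof (intro allI impI)
  fix u D and K :: "('a \<Rightarrow> real) set" and H and \<theta> :: real
  let ?J = "insert j I"
  assume reg: "regular ?J u D" and K: "K \<in> sets (LM ?J)" "K \<noteq> {}" "convex_fun ?J K" "bounded_fun ?J K"
    and iH: "integrable (LM ?J) H"
    and H: "\<forall>x\<in>space (LM ?J). \<forall>k\<in>K. - (\<Sum>i\<in>?J. k i * D i x) \<le> H x" and \<theta>: "\<theta> > 0"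
  let ?n = "real (card I)"
  have card: "real (card ?J) = ?n + 1" using fin j by simp
  have n0: "0 \<le> ?n" by simp
  let ?U = "{x\<in>space (LM ?J). \<theta> \<le> u x}"
  define \<kappa> where "\<kappa> = measure (LM ?J) K"
  define b where "b = measure (LM ?J) ?U"
  have H': "- (\<Sum>i\<in>?J. k i * D i x) \<le> H x" if "x \<in> space (LM ?J)" "k \<in> K" for x k
    using H that by blast
  have sb1: "0 \<le> (\<integral>x. H x \<partial>LM ?J) + (\<integral>x. T (x j) * D j x \<partial>LM ?J)"
    and sb2: "(\<integral>\<^sup>+s. ennreal (\<theta> * card I * measure (LM I) (slice I j (T s) K) powr (1 / card I) *
          measure (LM I) {x\<in>space (LM I). \<theta> \<le> u (x(j := s))} powr (1 - 1 / card I)) \<partial>lborel)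
      \<le> ennreal ((\<integral>x. H x \<partial>LM ?J) + (\<integral>x. T (x j) * D j x \<partial>LM ?J))"
    if T: "T \<in> borel_measurable borel" "\<And>s. T s \<in> closure ((\<lambda>k. k j) ` K)" for T
    by (rule slice_bound[OF fin j reg sob K iH]; fact H' \<theta> T)+
  have U_sets: "?U \<in> sets (LM ?J)"
    using reg unfolding regular_def by (intro borel_measurable_le) auto
  have iu: "integrable (LM ?J) u" by (rule regular_integrable(1)[OF _ reg]) (simp add: fin)
  have u_nonneg: "0 \<le> u x" if "x \<in> space (LM ?J)" for x using reg that unfolding regular_def by blast
  have U_fin: "emeasure (LM ?J) ?U < \<infinity>"
  proof -
    have "integrable (LM ?J) (indicator ?U :: _ \<Rightarrow> real)"
    proof (rule Bochner_Integration.integrable_bound)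
      show "integrable (LM ?J) (\<lambda>x. u x / \<theta>)" using iu by simp
      show "AE x in LM ?J. norm (indicator ?U x :: real) \<le> norm (u x / \<theta>)"
        using \<theta> u_nonneg by (intro AE_I2) (auto simp: indicator_def)
    qed (use U_sets in simp)
    moreover have "?U \<inter> space (LM ?J) = ?U" by blast
    ultimately show ?thesis using integrable_indicator_iff[of "LM ?J" ?U] by simp
  qed
  have K_fin: "emeasure (LM ?J) K < \<infinity>"
    by (rule bounded_fun_emeasure[OF _ K(1,4)]) (simp add: fin)
  \<comment> \<open>A constant map in place of the transport: its term is a multiple of the integral
    of a derivative and vanishes.\<close>
  have nonneg: "0 \<le> (\<integral>x. H x \<partial>LM ?J)"
  proof -
    obtain k where k: "k \<in> K" using K(2) by blast
    then have "k j \<in> closure ((\<lambda>k. k j) ` K)" by (intro subsetD[OF closure_subset] imageI)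
    then have "0 \<le> (\<integral>x. H x \<partial>LM ?J) + (\<integral>x. k j * D j x \<partial>LM ?J)"
      using sb1[of "\<lambda>_. k j"] by simp
    then show ?thesis
      using integral_partial_zero[OF fin j reg] by simp
  qed
  have "\<theta> * (?n + 1) * \<kappa> powr (1 / (?n + 1)) * b powr (1 - 1 / (?n + 1)) \<le> (\<integral>x. H x \<partial>LM ?J)"
  proof (cases "\<kappa> = 0 \<or> b = 0")
    case True
    then show ?thesis using nonneg by auto
  next
    case False
    then have pos: "\<kappa> > 0" "b > 0" by (auto simp: \<kappa>_def b_def zero_less_measure_iff less_le)
    define m where "m t = measure (LM I) (slice I j t K)" for t
    define B where "B s = measure (LM I) (slice I j s ?U)" for s
    have B_eq: "B s = measure (LM I) {x\<in>space (LM I). \<theta> \<le> u (x(j := s))}" for s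
    proof -
      have "slice I j s ?U = {x\<in>space (LM I). \<theta> \<le> u (x(j := s))}"
        using upd_space[of _ I j s] by (auto simp: slice_def)
      then show ?thesis by (simp add: B_def)
    qed
    have m_meas[measurable]: "m \<in> borel_measurable borel"
      unfolding m_def by (rule slice_measurable(2)[OF fin j K(1)])
    have B_meas[measurable]: "B \<in> borel_measurable borel"
      unfolding B_def by (rule slice_measurable(2)[OF fin j U_sets])
    have m_nonneg: "0 \<le> m t" and B_nonneg: "0 \<le> B t" for t by (simp_all add: m_def B_def)
    have m_int: "(\<integral>\<^sup>+t. m t \<partial>lborel) = ennreal \<kappa>"
      unfolding m_def \<kappa>_def slice_measurable(5)[OF fin j K(1) K_fin]
      by (rule emeasure_eq_ennreal_measure) (use K_fin in simp)
    have B_int: "(\<integral>\<^sup>+t. B t \<partial>lborel) = ennreal b"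
      unfolding B_def b_def slice_measurable(5)[OF fin j U_sets U_fin]
      by (rule emeasure_eq_ennreal_measure) (use U_fin in simp)
    define p where "p s = B s / b" for s
    define q where "q t = m t / \<kappa>" for t
    define lo where "lo = Inf ((\<lambda>k. k j) ` K)"
    define hi where "hi = Sup ((\<lambda>k. k j) ` K)"
    have dt: "density_transport p q lo hi"
    proof
      show "p \<in> borel_measurable borel" "q \<in> borel_measurable borel" unfolding p_def q_def by simp_all
      show "0 \<le> p s" "0 \<le> q s" for s using B_nonneg m_nonneg pos by (simp_all add: p_def q_def)
      have "(\<integral>\<^sup>+s. ennreal (p s) \<partial>lborel) = (\<integral>\<^sup>+s. ennreal (B s) / ennreal b \<partial>lborel)"
        using pos B_nonneg by (simp add: p_def divide_ennreal)
      also have "\<dots> = ennreal b / ennreal b" using B_int by (simp add: nn_integral_divide)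
      finally show "(\<integral>\<^sup>+s. ennreal (p s) \<partial>lborel) = 1" using pos by (simp add: divide_ennreal)
      have "(\<integral>\<^sup>+s. ennreal (q s) \<partial>lborel) = (\<integral>\<^sup>+s. ennreal (m s) / ennreal \<kappa> \<partial>lborel)"
        using pos m_nonneg by (simp add: q_def divide_ennreal)
      also have "\<dots> = ennreal \<kappa> / ennreal \<kappa>" using m_int by (simp add: nn_integral_divide)
      finally show "(\<integral>\<^sup>+s. ennreal (q s) \<partial>lborel) = 1" using pos by (simp add: divide_ennreal)
      show "q t = 0" if "t \<notin> {lo..hi}" for t
      proof -
        have "slice I j t K = {}"
        proof (rule ccontr)
          assume "slice I j t K \<noteq> {}"
          then obtain x where "x(j := t) \<in> K" unfolding slice_def by blast
          then have "(x(j := t)) j \<in> {lo..hi}"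
            unfolding lo_def hi_def by (rule projection_range(2)[OF fin j K(2,3,4)])
          with that show False by simp
        qed
        then show ?thesis by (simp add: q_def m_def)
      qed
    qed
    interpret density_transport p q lo hi by (rule dt)
    have Tcl: "T s \<in> closure ((\<lambda>k. k j) ` K)" for s
      using projection_range(1)[OF fin j K(2,3,4)] T_range[of s] by (auto simp: lo_def hi_def)
    let ?M = "\<lambda>s. \<integral>x. u (x(j := s)) \<partial>LM I"
    let ?TD = "\<integral>x. T (x j) * D j x \<partial>LM ?J"
    let ?f = "\<lambda>s. \<theta> * ?n * m (T s) powr (1 / ?n) * B s powr (1 - 1 / ?n)"
    let ?g = "\<lambda>s. ?M s * p s / q (T s)"
    have fb: "(\<integral>\<^sup>+s. ennreal (?f s) \<partial>lborel) \<le> ennreal ((\<integral>x. H x \<partial>LM ?J) + ?TD)"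
      using sb2[OF T_meas Tcl] by (simp add: m_def B_eq)
    have gb: "(\<integral>\<^sup>+s. ennreal (?g s) \<partial>lborel) \<le> ennreal (- ?TD)" "0 \<le> - ?TD"
      using transport_bound[OF fin j reg dt] by auto
    have hb: "0 \<le> (\<integral>x. H x \<partial>LM ?J) + ?TD" by (rule sb1[OF T_meas Tcl])
    \<comment> \<open>Chebyshev's inequality on the slice: it replaces the marginal of
      \<open>u\<close> by \<theta> times the marginal of the superlevel set, which is the source
      density \<open>p\<close> up to normalisation.\<close>
    have M_ge: "\<theta> * B s \<le> ?M s" and M_nonneg: "0 \<le> ?M s" for s
    proof -
      note rs = regular_slice[OF reg j, of s]
      have us: "0 \<le> u (x(j := s))" if "x \<in> space (LM I)" for x using rs that unfolding regular_def by blast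
      have ius: "integrable (LM I) (\<lambda>x. u (x(j := s)))" by (rule regular_integrable(1)[OF fin rs])
      have "\<theta> * B s = (\<integral>x. \<theta> * indicator (slice I j s ?U) x \<partial>LM I)"
        using sets_slice[OF U_sets, of s] sets.sets_into_space[OF sets_slice[OF U_sets, of s]]
        by (simp add: B_def Int_absorb2)
      also have "\<dots> \<le> ?M s"
        by (rule integral_mono'[OF ius]) (use us \<theta> in \<open>auto simp: slice_def indicator_def\<close>)
      finally show "\<theta> * B s \<le> ?M s" .
      show "0 \<le> ?M s" using us by (rule Bochner_Integration.integral_nonneg)
    qed
    \<comment> \<open>The ratio of the two volumes, which is the formal Jacobian of a transport
      between them. With it \<open>p s / q (T s)\<close> equals
      \<open>B s * ?c / m (T s)\<close>.\<close>
    let ?c = "\<kappa> / b"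
    have pw: "AE s in lborel. ennreal (\<theta> * (?n + 1) * ?c powr (1 / (?n + 1)) * B s) \<le> ennreal (?f s) + ennreal (?g s)"
      using AE_q_T_pos
    proof eventually_elim
      case (elim s)
      have nn: "0 \<le> ?f s" "0 \<le> ?g s"
        using \<theta> M_nonneg[of s] p_nonneg[of s] q_nonneg[of "T s"] by simp_all
      show ?case
      proof (cases "B s = 0")
        case False
        then have Bp: "B s > 0" using B_nonneg[of s] by simp
        then have "q (T s) > 0" using elim pos by (simp add: p_def)
        then have mp: "m (T s) > 0" using pos by (simp add: q_def zero_less_divide_iff)
        have "\<theta> * (B s * (B s * ?c / m (T s))) = \<theta> * B s * p s / q (T s)"
          using pos mp by (simp add: p_def q_def field_simps)
        also have "\<dots> \<le> ?g s"
          using M_ge[of s] p_nonneg[of s] q_nonneg[of "T s"] by (intro divide_right_mono mult_right_mono) auto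
        finally have g: "\<theta> * (B s * (B s * ?c / m (T s))) \<le> ?g s" .
        have "(?n + 1) * ?c powr (1 / (?n + 1)) * B s \<le> B s * (B s * ?c / m (T s)) + ?n * m (T s) powr (1 / ?n) * B s powr (1 - 1 / ?n)"
        \<comment> \<open>\<open>amgm_slice\<close> needs at least one remaining direction. With
          none, both slice volumes equal 1 and the two sides coincide.\<close>
        proof (cases "card I = 0")
          case True
          then have "I = {}" using fin by simp
          then have "B s = 0 \<or> B s = 1" "m (T s) = 0 \<or> m (T s) = 1"
            unfolding B_def m_def by (simp_all only: measure_LM_empty)
          then have "B s = 1" "m (T s) = 1" using Bp mp by linarith+
          then show ?thesis using True pos by simp
        next
          case False
          then show ?thesis using Bp mp pos by (intro amgm_slice(1)) auto
        qed
        from mult_left_mono[OF this less_imp_le[OF \<theta>]]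
        have "\<theta> * ((?n + 1) * ?c powr (1 / (?n + 1)) * B s) \<le> \<theta> * (B s * (B s * ?c / m (T s))) +
          \<theta> * (?n * m (T s) powr (1 / ?n) * B s powr (1 - 1 / ?n))"
          unfolding distrib_left[of \<theta> "B s * (B s * ?c / m (T s))"] .
        then have "\<theta> * (?n + 1) * ?c powr (1 / (?n + 1)) * B s \<le> \<theta> * (B s * (B s * ?c / m (T s))) + ?f s"
          by (simp only: mult.assoc)
        then have "\<theta> * (?n + 1) * ?c powr (1 / (?n + 1)) * B s \<le> ?f s + ?g s" using g by linarith
        then show ?thesis unfolding ennreal_plus[OF nn, symmetric] by (rule ennreal_leI)
      qed simp
    qed
    let ?A = "\<theta> * (?n + 1) * ?c powr (1 / (?n + 1))"
    have A0: "0 \<le> ?A" using \<theta> by simp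
    have "ennreal (?A * b) = ennreal ?A * (\<integral>\<^sup>+s. B s \<partial>lborel)"
      using A0 by (simp only: B_int ennreal_mult')
    also have "\<dots> = (\<integral>\<^sup>+s. ennreal (?A * B s) \<partial>lborel)"
      using A0 by (simp add: nn_integral_cmult ennreal_mult')
    also have "\<dots> \<le> (\<integral>\<^sup>+s. ennreal (?f s) + ennreal (?g s) \<partial>lborel)"
      by (rule nn_integral_mono_AE[OF pw])
    also have "\<dots> = (\<integral>\<^sup>+s. ennreal (?f s) \<partial>lborel) + (\<integral>\<^sup>+s. ennreal (?g s) \<partial>lborel)"
    proof (rule nn_integral_add)
      have "(\<lambda>s. m (T s)) \<in> borel_measurable lborel" using measurable_compose[OF T_meas m_meas] by simp
      then show "(\<lambda>s. ennreal (?f s)) \<in> borel_measurable lborel"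
        by (intro measurable_compose[OF _ measurable_ennreal] borel_measurable_times powr_real_measurable)
          simp_all
      have "(\<lambda>s. ?M s) \<in> borel_measurable lborel"
        using fubini_upd(2)[OF fin j iu] by simp
      moreover have "(\<lambda>s. q (T s)) \<in> borel_measurable lborel" using measurable_compose[OF T_meas q_meas] by simp
      ultimately show "(\<lambda>s. ennreal (?g s)) \<in> borel_measurable lborel"
        by (intro measurable_compose[OF _ measurable_ennreal] borel_measurable_times borel_measurable_divide)
          simp_all
    qed
    also have "\<dots> \<le> ennreal ((\<integral>x. H x \<partial>LM ?J) + ?TD) + ennreal (- ?TD)"
      by (rule add_mono[OF fb gb(1)])
    also have "\<dots> = ennreal (\<integral>x. H x \<partial>LM ?J)"
      using hb gb(2) by (simp add: ennreal_plus[symmetric] del: ennreal_plus)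
    finally have "?A * b \<le> (\<integral>x. H x \<partial>LM ?J)" using nonneg by (simp add: ennreal_le_iff)
    moreover have "?c powr (1 / (?n + 1)) * b = \<kappa> powr (1 / (?n + 1)) * b powr (1 - 1 / (?n + 1))"
      using pos by (simp add: powr_divide powr_diff)
    ultimately show ?thesis by (simp add: mult.assoc)
  qed
  then show "\<theta> * card ?J * measure (LM ?J) K powr (1 / card ?J) * measure (LM ?J) ?U powr (1 - 1 / card ?J)
    \<le> (\<integral>x. H x \<partial>LM ?J)"
    unfolding card \<kappa>_def b_def .
qed

theorem sobolev_finite: "finite I \<Longrightarrow> sobolev I"
  by (induction I rule: finite_induct) (auto intro: sobolev_empty sobolev_insert)

section \<open>The equality case\<close>

text \<open>\<open>card I + 1\<close> is the dimension, so \<open>(card I + 1) * V\<close> is the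
  sharp value for a set with the volume of \<open>K\<close>, and \<eta> is the vanishing excess.
  Convergence is demanded slice by slice, which a subsequence of an L1 convergent sequence provides.
  The last assumption says that the marginal of \<open>K\<close> has no zero between the ends of its
  range.\<close>

locale slice_comparison =
  fixes I :: "'i set" and j :: 'i and K E :: "('i \<Rightarrow> real) set" and V :: real
    and u :: "nat \<Rightarrow> ('i \<Rightarrow> real) \<Rightarrow> real" and D :: "nat \<Rightarrow> 'i \<Rightarrow> ('i \<Rightarrow> real) \<Rightarrow> real"
    and H :: "nat \<Rightarrow> ('i \<Rightarrow> real) \<Rightarrow> real" and \<eta> :: "nat \<Rightarrow> real"
  assumes fin: "finite I" and j: "j \<notin> I" and card_I: "card I \<ge> 1"
    and K: "K \<in> sets (LM (insert j I))" "K \<noteq> {}" "convex_fun (insert j I) K" "bounded_fun (insert j I) K"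
    and E: "E \<in> sets (LM (insert j I))" "emeasure (LM (insert j I)) E = ennreal V"
    and K_V: "emeasure (LM (insert j I)) K = ennreal V" and V: "V > 0"
    and reg: "\<And>k. regular (insert j I) (u k) (D k)"
    and lim: "AE s in lborel.
      (\<lambda>k. \<integral>x. \<bar>u k (x(j := s)) - indicator (slice I j s E) x\<bar> \<partial>LM I) \<longlonglongrightarrow> 0"
    and iH: "\<And>k. integrable (LM (insert j I)) (H k)"
    and H: "\<And>k x y. x \<in> space (LM (insert j I)) \<Longrightarrow> y \<in> K \<Longrightarrow> - (\<Sum>i\<in>insert j I. y i * D k i x) \<le> H k x"
    and H_le: "\<And>k. (\<integral>x. H k x \<partial>LM (insert j I)) \<le> (real (card I) + 1) * V + \<eta> k"
    and \<eta>: "\<eta> \<longlonglongrightarrow> 0"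
    and interior_slices: "\<And>t. Inf ((\<lambda>k. k j) ` K) < t \<Longrightarrow> t < Sup ((\<lambda>k. k j) ` K) \<Longrightarrow> 0 < measure (LM I) (slice I j t K)"
begin

abbreviation "J \<equiv> insert j I"
abbreviation "n \<equiv> real (card I)"

definition "lo = Inf ((\<lambda>k. k j) ` K)"
definition "hi = Sup ((\<lambda>k. k j) ` K)"
definition "mK t = measure (LM I) (slice I j t K)"
definition "mE s = measure (LM I) (slice I j s E)"
definition "M k s = (\<integral>x. u k (x(j := s)) \<partial>LM I)"
definition "N k s = (\<integral>x. \<bar>u k (x(j := s)) - indicator (slice I j s E) x\<bar> \<partial>LM I)"

lemma n_pos: "n \<ge> 1" using card_I by simp

lemma mK_meas[measurable]: "mK \<in> borel_measurable borel"
  unfolding mK_def by (rule slice_measurable(2)[OF fin j K(1)])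

lemma mE_meas[measurable]: "mE \<in> borel_measurable borel"
  unfolding mE_def by (rule slice_measurable(2)[OF fin j E(1)])

lemma mK_nonneg: "0 \<le> mK t" and mE_nonneg: "0 \<le> mE t" by (simp_all add: mK_def mE_def)

lemma mK_mass: "(\<integral>\<^sup>+t. mK t \<partial>lborel) = ennreal V"
  unfolding mK_def using slice_measurable(5)[OF fin j K(1)] K_V by simp

lemma mE_mass: "(\<integral>\<^sup>+t. mE t \<partial>lborel) = ennreal V"
  unfolding mE_def using slice_measurable(5)[OF fin j E(1)] E(2) by simp

lemma iu_slice: "integrable (LM I) (\<lambda>x. u k (x(j := s)))"
  by (rule regular_integrable(1)[OF fin regular_slice[OF reg j]])

lemma u_nonneg: "x \<in> space (LM I) \<Longrightarrow> 0 \<le> u k (x(j := s))"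
  using regular_slice[OF reg j, of k s] unfolding regular_def by blast

lemma M_meas[measurable]: "M k \<in> borel_measurable borel"
proof -
  have "integrable (LM J) (u k)" by (rule regular_integrable(1)[OF _ reg]) (simp add: fin)
  from fubini_upd(2)[OF fin j this] show ?thesis unfolding M_def by simp
qed

lemma M_nonneg: "0 \<le> M k s"
  unfolding M_def by (rule Bochner_Integration.integral_nonneg) (rule u_nonneg)

lemma i_ind: "emeasure (LM I) (slice I j s E) < \<infinity> \<Longrightarrow> integrable (LM I) (indicator (slice I j s E) :: _ \<Rightarrow> real)"
  using sets_slice[OF E(1), of s] by simp

lemma mE_eq: "mE s = (\<integral>x. indicator (slice I j s E) x \<partial>LM I)"
  using sets.sets_into_space[OF sets_slice[OF E(1), of s]] by (simp add: mE_def Int_absorb2)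

lemma M_close:
  assumes f: "emeasure (LM I) (slice I j s E) < \<infinity>"
  shows "\<bar>M k s - mE s\<bar> \<le> N k s"
proof -
  have "M k s - mE s = (\<integral>x. u k (x(j := s)) - indicator (slice I j s E) x \<partial>LM I)"
    unfolding M_def mE_eq by (rule Bochner_Integration.integral_diff[OF iu_slice i_ind[OF f], symmetric])
  also have "\<bar>\<dots>\<bar> \<le> N k s" unfolding N_def by (rule integral_abs_bound)
  finally show ?thesis .
qed

definition "B \<theta> k s = measure (LM I) {x\<in>space (LM I). \<theta> \<le> u k (x(j := s))}"

text \<open>On the part of the slice of \<open>E\<close> that the superlevel set misses,
  \<open>u\<close> differs from 1 by more than \<open>1 - \<theta>\<close>; Chebyshev's inequality
  bounds the volume of that part.\<close>

lemma B_lower: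
  assumes f: "emeasure (LM I) (slice I j s E) < \<infinity>" and \<theta>: "0 < \<theta>" "\<theta> < 1"
  shows "mE s - N k s / (1 - \<theta>) \<le> B \<theta> k s"
proof -
  let ?S = "slice I j s E" and ?U = "{x\<in>space (LM I). \<theta> \<le> u k (x(j := s))}"
  have us: "(\<lambda>x. u k (x(j := s))) \<in> borel_measurable (LM I)" using iu_slice by simp
  have U: "?U \<in> sets (LM I)" using us by (intro borel_measurable_le) auto
  have iU: "integrable (LM I) (indicator ?U :: _ \<Rightarrow> real)"
  proof (rule Bochner_Integration.integrable_bound)
    show "integrable (LM I) (\<lambda>x. u k (x(j := s)) / \<theta>)" using iu_slice by simp
    show "AE x in LM I. norm (indicator ?U x :: real) \<le> norm (u k (x(j := s)) / \<theta>)"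
    proof (rule AE_I2)
      fix x assume "x \<in> space (LM I)"
      then show "norm (indicator ?U x :: real) \<le> norm (u k (x(j := s)) / \<theta>)"
        using \<theta> u_nonneg[of x k s] by (cases "x \<in> ?U") (simp_all add: field_simps)
    qed
  qed (use U in simp)
  have "mE s - B \<theta> k s = (\<integral>x. indicator ?S x - indicator ?U x \<partial>LM I)"
  proof -
    have "B \<theta> k s = (\<integral>x. indicator ?U x \<partial>LM I)" by (simp add: B_def Int_def conj_commute)
    then show ?thesis unfolding mE_eq using Bochner_Integration.integral_diff[OF i_ind[OF f] iU] by simp
  qed
  also have "\<dots> \<le> (\<integral>x. \<bar>u k (x(j := s)) - indicator ?S x\<bar> / (1 - \<theta>) \<partial>LM I)"
  proof (rule integral_mono)
    show "integrable (LM I) (\<lambda>x. indicator ?S x - indicator ?U x :: real)" using i_ind[OF f] iU by simp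
    show "integrable (LM I) (\<lambda>x. \<bar>u k (x(j := s)) - indicator ?S x\<bar> / (1 - \<theta>))"
      using iu_slice i_ind[OF f] by simp
    show "indicator ?S x - indicator ?U x \<le> \<bar>u k (x(j := s)) - indicator ?S x\<bar> / (1 - \<theta>)"
      if "x \<in> space (LM I)" for x
    proof (cases "x \<in> ?S \<and> x \<notin> ?U")
      case True
      then have "u k (x(j := s)) < \<theta>" using that by auto
      then have "1 - \<theta> \<le> \<bar>u k (x(j := s)) - 1\<bar>" using \<theta> by auto
      then show ?thesis using True \<theta> by (simp add: field_simps)
    next
      case False
      then have "indicator ?S x - indicator ?U x \<le> (0::real)" by (auto simp: indicator_def)
      also have "0 \<le> \<bar>u k (x(j := s)) - indicator ?S x\<bar> / (1 - \<theta>)" using \<theta> by simp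
      finally show ?thesis .
    qed
  qed
  also have "\<dots> = N k s / (1 - \<theta>)" by (simp add: N_def)
  finally show ?thesis by simp
qed

lemma AE_good: "AE s in lborel. emeasure (LM I) (slice I j s E) < \<infinity> \<and> (\<lambda>k. N k s) \<longlonglongrightarrow> 0 \<and> (\<lambda>k. M k s) \<longlonglongrightarrow> mE s"
proof -
  have "AE s in lborel. emeasure (LM I) (slice I j s E) < \<infinity>"
    by (rule slice_measurable(4)[OF fin j E(1)]) (simp add: E(2))
  then show ?thesis using lim
  proof eventually_elim
    case (elim s)
    then have N0: "(\<lambda>k. N k s) \<longlonglongrightarrow> 0" by (simp add: N_def)
    have "(\<lambda>k. M k s - mE s) \<longlonglongrightarrow> 0"
      by (rule Lim_null_comparison[OF _ N0]) (use M_close[OF elim(1)] in simp)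
    then show ?case using N0 elim(1) by (simp add: LIM_zero_iff)
  qed
qed

lemma Tcl: "t \<in> {lo..hi} \<Longrightarrow> t \<in> closure ((\<lambda>k. k j) ` K)"
  using projection_range(1)[OF fin j K(2,3,4)] by (auto simp: lo_def hi_def)

text \<open>The passage to the limit \<open>u k \<rightarrow> indicator E\<close> only needs Fatou's lemma.\<close>

lemma limit_inequality:
  assumes T: "T \<in> borel_measurable borel" "\<And>s. T s \<in> {lo..hi}"
    and w: "w \<in> borel_measurable borel" "\<And>s. 0 \<le> w s"
    and err: "err \<longlonglongrightarrow> 0" "\<And>k. 0 \<le> err k - (\<integral>x. T (x j) * D k j x \<partial>LM J)"
      "\<And>k. (\<integral>\<^sup>+s. ennreal (M k s * w s) \<partial>lborel) \<le> ennreal (err k - (\<integral>x. T (x j) * D k j x \<partial>LM J))"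
  shows "(\<integral>\<^sup>+s. ennreal (mE s * w s + n * mK (T s) powr (1 / n) * mE s powr (1 - 1 / n)) \<partial>lborel)
    \<le> ennreal ((n + 1) * V)"
proof -
  \<comment> \<open>\<open>T\<close>, \<open>w\<close> and \<open>err\<close> are left general
    because the inequality is used twice: with the transport of the whole marginal, where
    \<open>err\<close> is 0, and with two transports glued at a gap, where \<open>w\<close> is a sum
    of two weights and \<open>err\<close> absorbs the jump.\<close>
  let ?TD = "\<lambda>k. \<integral>x. T (x j) * D k j x \<partial>LM J"
  let ?y = "\<lambda>s. n * mK (T s) powr (1 / n) * mE s powr (1 - 1 / n)"
  have mKT[measurable]: "(\<lambda>s. mK (T s)) \<in> borel_measurable borel"
    using measurable_compose[OF T(1) mK_meas] .
  have y_meas: "?y \<in> borel_measurable borel"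
    by (intro borel_measurable_times powr_real_measurable) simp_all
  have x_meas: "(\<lambda>s. mE s * w s) \<in> borel_measurable borel" using w(1) by (intro borel_measurable_times) simp_all
  \<comment> \<open>The threshold stays below 1 while \<open>k\<close> grows, since L1 convergence
    to an indicator controls \<open>{u \<ge> \<theta>}\<close> from below only for
    \<open>\<theta> < 1\<close>. It tends to 1 at the very end.\<close>
  have \<theta>_bound: "(\<integral>\<^sup>+s. ennreal (mE s * w s + \<theta> * ?y s) \<partial>lborel) \<le> ennreal ((n + 1) * V)"
    if \<theta>: "0 < \<theta>" "\<theta> < 1" for \<theta>
  proof -
    define f where "f k s = \<theta> * n * mK (T s) powr (1 / n) * B \<theta> k s powr (1 - 1 / n)" for k s
    have f_nonneg: "0 \<le> f k s" for k s using \<theta> by (simp add: f_def)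
    have B_meas: "B \<theta> k \<in> borel_measurable borel" for k
    proof -
      have U: "{x\<in>space (LM J). \<theta> \<le> u k x} \<in> sets (LM J)"
        using reg[of k] unfolding regular_def by (intro borel_measurable_le) auto
      have "B \<theta> k = (\<lambda>s. measure (LM I) (slice I j s {x\<in>space (LM J). \<theta> \<le> u k x}))"
        using upd_space[of _ I j] by (intro ext) (auto simp: B_def slice_def intro!: arg_cong[where f="measure (LM I)"])
      then show ?thesis using slice_measurable(2)[OF fin j U] by simp
    qed
    have f_meas: "f k \<in> borel_measurable borel" for k
      unfolding f_def using B_meas by (intro borel_measurable_times powr_real_measurable) simp_all
    have Mw_meas: "(\<lambda>s. M k s * w s) \<in> borel_measurable borel" for k using w(1) by (intro borel_measurable_times) simp_all
    have sb: "0 \<le> (\<integral>x. H k x \<partial>LM J) + ?TD k"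
      "(\<integral>\<^sup>+s. ennreal (f k s) \<partial>lborel) \<le> ennreal ((\<integral>x. H k x \<partial>LM J) + ?TD k)" for k
    proof -
      have sob: "sobolev I" by (rule sobolev_finite[OF fin])
      note T' = T(1) Tcl[OF T(2)]
      show "0 \<le> (\<integral>x. H k x \<partial>LM J) + ?TD k"
        by (rule slice_bound(1)[OF fin j reg sob K iH]; fact H \<theta> T')
      show "(\<integral>\<^sup>+s. ennreal (f k s) \<partial>lborel) \<le> ennreal ((\<integral>x. H k x \<partial>LM J) + ?TD k)"
        unfolding f_def mK_def B_def by (rule slice_bound(2)[OF fin j reg sob K iH]; fact H \<theta> T')
    qed
    let ?F = "\<lambda>k s. ennreal (M k s * w s) + ennreal (f k s)"
    have F_meas: "?F k \<in> borel_measurable lborel" for k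
      using Mw_meas[of k] f_meas[of k] by simp
    have F_le: "(\<integral>\<^sup>+s. ?F k s \<partial>lborel) \<le> ennreal ((n + 1) * V + \<eta> k + err k)" for k
    proof -
      have "(\<integral>\<^sup>+s. ?F k s \<partial>lborel) = (\<integral>\<^sup>+s. ennreal (M k s * w s) \<partial>lborel) + (\<integral>\<^sup>+s. ennreal (f k s) \<partial>lborel)"
        using Mw_meas[of k] f_meas[of k] by (intro nn_integral_add) simp_all
      also have "\<dots> \<le> ennreal (err k - ?TD k) + ennreal ((\<integral>x. H k x \<partial>LM J) + ?TD k)"
        by (rule add_mono[OF err(3) sb(2)])
      also have "\<dots> = ennreal ((err k - ?TD k) + ((\<integral>x. H k x \<partial>LM J) + ?TD k))"
        by (rule ennreal_plus[OF err(2) sb(1), symmetric])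
      also have "\<dots> \<le> ennreal ((n + 1) * V + \<eta> k + err k)"
        by (rule ennreal_leI) (use H_le[of k] in linarith)
      finally show ?thesis .
    qed
    have pw: "AE s in lborel. ennreal (mE s * w s + \<theta> * ?y s) \<le> liminf (\<lambda>k. ?F k s)"
      using AE_good
    proof eventually_elim
      case (elim s)
      \<comment> \<open>The lower bound from \<open>B_lower\<close>, clipped at 0 so that
        \<open>powr\<close> is monotone on it; it still tends to \<open>mE s\<close>.\<close>
      define b where "b k = max 0 (min (mE s) (mE s - N k s / (1 - \<theta>)))" for k
      have b_lim: "b \<longlonglongrightarrow> max 0 (min (mE s) (mE s - 0 / (1 - \<theta>)))"
        unfolding b_def using elim \<theta> by (intro tendsto_intros) auto
      then have b_lim: "b \<longlonglongrightarrow> mE s" using mE_nonneg[of s] by simp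
      have b_le: "b k \<le> B \<theta> k s" for k
        using B_lower[of s \<theta> k] elim \<theta> measure_nonneg[of "LM I"] by (auto simp: b_def B_def)
      define g where "g k = M k s * w s + \<theta> * n * mK (T s) powr (1 / n) * b k powr (1 - 1 / n)" for k
      have p0: "0 \<le> 1 - 1 / n" using n_pos by (simp add: field_simps)
      have g_le: "ennreal (g k) \<le> ?F k s" for k
      proof -
        have "b k powr (1 - 1 / n) \<le> B \<theta> k s powr (1 - 1 / n)"
          using b_le[of k] p0 by (intro powr_mono2) (auto simp: b_def)
        then have "\<theta> * n * mK (T s) powr (1 / n) * b k powr (1 - 1 / n) \<le> f k s"
          unfolding f_def using \<theta> by (intro mult_left_mono) simp_all
        then have "ennreal (g k) \<le> ennreal (M k s * w s + f k s)" unfolding g_def by (intro ennreal_leI) simp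
        then show ?thesis using M_nonneg[of k s] w(2)[of s] f_nonneg[of k s] by simp
      qed
      \<comment> \<open>Continuity of \<open>powr\<close> needs a nonzero base. For
        \<open>mE s = 0\<close> the left-hand side of the claim is simply 0, also when
        \<open>n = 1\<close>, because \<open>0 powr 0 = 0\<close>.\<close>
      have g_lim: "g \<longlonglongrightarrow> mE s * w s + \<theta> * ?y s" if "mE s \<noteq> 0"
      proof -
        have bp: "(\<lambda>k. b k powr (1 - 1 / n)) \<longlonglongrightarrow> mE s powr (1 - 1 / n)"
          by (rule tendsto_powr[OF b_lim tendsto_const that])
        have M_lim: "(\<lambda>k. M k s) \<longlonglongrightarrow> mE s" using elim by simp
        have "g \<longlonglongrightarrow> mE s * w s + \<theta> * n * mK (T s) powr (1 / n) * mE s powr (1 - 1 / n)"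
          unfolding g_def by (intro tendsto_add tendsto_mult[OF M_lim] tendsto_mult[OF _ bp] tendsto_const)
        then show ?thesis by (simp only: mult.assoc)
      qed
      show ?case
      proof (cases "mE s = 0")
        case False
        have "ennreal (mE s * w s + \<theta> * ?y s) = liminf (\<lambda>k. ennreal (g k))"
          using tendsto_ennrealI[OF g_lim[OF False]] by (intro lim_imp_Liminf[symmetric]) simp_all
        also have "\<dots> \<le> liminf (\<lambda>k. ?F k s)" by (intro Liminf_mono always_eventually allI g_le)
        finally show ?thesis .
      qed simp
    qed
    have "(\<integral>\<^sup>+s. ennreal (mE s * w s + \<theta> * ?y s) \<partial>lborel) \<le> (\<integral>\<^sup>+s. liminf (\<lambda>k. ?F k s) \<partial>lborel)"
      by (rule nn_integral_mono_AE[OF pw])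
    also have "\<dots> \<le> liminf (\<lambda>k. \<integral>\<^sup>+s. ?F k s \<partial>lborel)"
      by (rule nn_integral_liminf[OF F_meas])
    also have "\<dots> \<le> liminf (\<lambda>k. ennreal ((n + 1) * V + \<eta> k + err k))"
      by (intro Liminf_mono always_eventually allI F_le)
    also have "\<dots> = ennreal ((n + 1) * V + 0 + 0)"
      by (intro lim_imp_Liminf tendsto_ennrealI tendsto_add tendsto_const \<eta> err(1)) simp
    finally show ?thesis by simp
  qed
  let ?X = "\<integral>\<^sup>+s. ennreal (mE s * w s) \<partial>lborel" and ?Y = "\<integral>\<^sup>+s. ennreal (?y s) \<partial>lborel"
  have xn: "0 \<le> mE s * w s" and yn: "0 \<le> ?y s" for s using mE_nonneg[of s] w(2)[of s] by simp_all
  have split: "(\<integral>\<^sup>+s. ennreal (mE s * w s + \<theta> * ?y s) \<partial>lborel) = ?X + ennreal \<theta> * ?Y" if "0 < \<theta>" for \<theta>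
  proof -
    have "(\<integral>\<^sup>+s. ennreal (mE s * w s + \<theta> * ?y s) \<partial>lborel) = (\<integral>\<^sup>+s. ennreal (mE s * w s) + ennreal \<theta> * ennreal (?y s) \<partial>lborel)"
      using that xn yn by (intro nn_integral_cong) (simp add: ennreal_mult')
    also have "\<dots> = ?X + (\<integral>\<^sup>+s. ennreal \<theta> * ennreal (?y s) \<partial>lborel)"
      using x_meas y_meas by (intro nn_integral_add) simp_all
    also have "(\<integral>\<^sup>+s. ennreal \<theta> * ennreal (?y s) \<partial>lborel) = ennreal \<theta> * ?Y"
      using y_meas by (intro nn_integral_cmult) simp
    finally show ?thesis .
  qed
  \<comment> \<open>Separated into two integrals, the bound depends on \<theta> only through a
    factor, so \<theta> can tend to 1 without any interchange of limits. The offset 2 keeps every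
    term strictly between 0 and 1.\<close>
  have lim1: "(\<lambda>k. ?X + ennreal (1 - 1 / (real k + 2)) * ?Y) \<longlonglongrightarrow> ?X + ennreal 1 * ?Y"
  proof (intro tendsto_add tendsto_const tendsto_mult_ennreal tendsto_ennrealI)
    show "(\<lambda>k. 1 - 1 / (real k + 2)) \<longlonglongrightarrow> 1"
      using tendsto_diff[OF tendsto_const[of 1] LIMSEQ_ignore_initial_segment[OF lim_1_over_n[where 'a=real], of 2]]
      by (simp add: add.commute)
  qed simp_all
  have "?X + ennreal (1 - 1 / (real k + 2)) * ?Y \<le> ennreal ((n + 1) * V)" for k
  proof -
    have t: "0 < 1 - 1 / (real k + 2)" "1 - 1 / (real k + 2) < 1" by (simp_all add: field_simps)
    from \<theta>_bound[OF t] show ?thesis unfolding split[OF t(1)] .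
  qed
  then have "?X + ennreal 1 * ?Y \<le> ennreal ((n + 1) * V)"
    by (intro LIMSEQ_le_const2[OF lim1]) blast
  then show ?thesis using split[of 1] by simp
qed

section \<open>Rigidity of the transport between the normalised marginals\<close>

definition "q t = mK t / V"
definition "p s = mE s / V"

lemma q_meas[measurable]: "q \<in> borel_measurable borel" unfolding q_def by simp
lemma p_meas[measurable]: "p \<in> borel_measurable borel" unfolding p_def by simp

lemma q_nonneg: "0 \<le> q t" and p_nonneg: "0 \<le> p t"
  using mK_nonneg[of t] mE_nonneg[of t] V by (simp_all add: q_def p_def)

lemma q_mass: "(\<integral>\<^sup>+t. q t \<partial>lborel) = 1"
proof -
  have "(\<integral>\<^sup>+t. q t \<partial>lborel) = (\<integral>\<^sup>+t. ennreal (mK t) / ennreal V \<partial>lborel)"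
    using V mK_nonneg by (simp add: q_def divide_ennreal)
  also have "\<dots> = ennreal V / ennreal V" using mK_mass by (simp add: nn_integral_divide)
  finally show ?thesis using V by (simp add: divide_ennreal)
qed

lemma p_mass: "(\<integral>\<^sup>+t. p t \<partial>lborel) = 1"
proof -
  have "(\<integral>\<^sup>+t. p t \<partial>lborel) = (\<integral>\<^sup>+t. ennreal (mE t) / ennreal V \<partial>lborel)"
    using V mE_nonneg by (simp add: p_def divide_ennreal)
  also have "\<dots> = ennreal V / ennreal V" using mE_mass by (simp add: nn_integral_divide)
  finally show ?thesis using V by (simp add: divide_ennreal)
qed

lemma q_supp: "t \<notin> {lo..hi} \<Longrightarrow> q t = 0"
proof -
  assume t: "t \<notin> {lo..hi}"
  have "slice I j t K = {}"
  proof (rule ccontr)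
    assume "slice I j t K \<noteq> {}"
    then obtain x where "x(j := t) \<in> K" unfolding slice_def by blast
    then have "(x(j := t)) j \<in> {lo..hi}"
      unfolding lo_def hi_def by (rule projection_range(2)[OF fin j K(2,3,4)])
    with t show False by simp
  qed
  then show ?thesis by (simp add: q_def mK_def)
qed

lemma q_pos: "lo < t \<Longrightarrow> t < hi \<Longrightarrow> 0 < q t"
  using interior_slices[of t] V by (simp add: lo_def hi_def q_def mK_def)

lemma transport_to_q:
  assumes "r \<in> borel_measurable borel" "\<And>s. 0 \<le> r s" "(\<integral>\<^sup>+s. ennreal (r s) \<partial>lborel) = 1"
  shows "density_transport r q lo hi"
  by unfold_locales (use assms q_meas q_nonneg q_mass q_supp in simp_all)

sublocale tr: density_transport p q lo hi
  by (rule transport_to_q) (simp_all add: p_nonneg p_mass)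

lemma transport_err:
  assumes dt: "density_transport r q lo hi"
  shows "0 \<le> - (\<integral>x. density_transport.T r q lo hi (x j) * D k j x \<partial>LM J)"
    "(\<integral>\<^sup>+s. ennreal (M k s * (r s / q (density_transport.T r q lo hi s))) \<partial>lborel)
       \<le> ennreal (- (\<integral>x. density_transport.T r q lo hi (x j) * D k j x \<partial>LM J))"
  using transport_bound[OF fin j reg dt, of k] by (simp_all add: M_def)

text \<open>In the limit the integrals of the two sides of the inequality of means agree, so that
  inequality is an equality almost everywhere; its strict form then leaves only equal slice volumes.
  Equivalently \<open>q (T s) = p s\<close>, which says that \<open>T\<close> has slope 1 where
  there is mass.\<close>

lemma AE_slices_eq: "AE s in lborel. mE s > 0 \<longrightarrow> mK (tr.T s) = mE s"
proof -
  define w where "w s = p s / q (tr.T s)" for s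
  have w: "w \<in> borel_measurable borel" "0 \<le> w s" for s
    unfolding w_def using measurable_compose[OF tr.T_meas q_meas] p_nonneg[of s] q_nonneg[of "tr.T s"]
    by (auto intro: borel_measurable_divide)
  let ?a = "\<lambda>s. mE s * w s + n * mK (tr.T s) powr (1 / n) * mE s powr (1 - 1 / n)"
  have a_meas: "?a \<in> borel_measurable borel"
    using w(1) measurable_compose[OF tr.T_meas mK_meas]
    by (intro borel_measurable_add borel_measurable_times powr_real_measurable) simp_all
  have le: "(\<integral>\<^sup>+s. ennreal (?a s) \<partial>lborel) \<le> ennreal ((n + 1) * V)"
  proof (rule limit_inequality[where err="\<lambda>_. 0"])
    show "tr.T s \<in> {lo..hi}" for s using tr.T_range by simp
  qed (use w transport_err[OF tr.density_transport_axioms] in \<open>simp_all add: w_def\<close>)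
  have pw: "AE s in lborel. (mE s > 0 \<longrightarrow> mK (tr.T s) > 0) \<and> (n + 1) * mE s \<le> ?a s"
    using tr.AE_q_T_pos
  proof eventually_elim
    case (elim s)
    show ?case
    proof (cases "mE s = 0")
      case False
      then have m: "mE s > 0" using mE_nonneg[of s] by simp
      then have k: "mK (tr.T s) > 0" using elim V by (simp add: p_def q_def zero_less_divide_iff)
      then have "w s = mE s / mK (tr.T s)" using V by (simp add: w_def p_def q_def)
      then show ?thesis using amgm_slice(1)[OF k m, of 1 "card I"] k card_I by simp
    qed (use w(2)[of s] in simp)
  qed
  have nn: "(\<integral>\<^sup>+s. ennreal ((n + 1) * mE s) \<partial>lborel) = ennreal ((n + 1) * V)"
  proof -
    have "(\<integral>\<^sup>+s. ennreal ((n + 1) * mE s) \<partial>lborel) = ennreal (n + 1) * (\<integral>\<^sup>+s. mE s \<partial>lborel)"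
      using mE_nonneg by (subst nn_integral_cmult[symmetric]) (simp_all add: ennreal_mult')
    then show ?thesis using V by (simp add: mE_mass ennreal_mult')
  qed
  have "AE s in lborel. ennreal (?a s) = ennreal ((n + 1) * mE s)"
  proof -
    have d: "(\<integral>\<^sup>+s. ennreal (?a s) - ennreal ((n + 1) * mE s) \<partial>lborel)
        = (\<integral>\<^sup>+s. ennreal (?a s) \<partial>lborel) - (\<integral>\<^sup>+s. ennreal ((n + 1) * mE s) \<partial>lborel)"
    proof (rule nn_integral_diff)
      show "(\<integral>\<^sup>+s. ennreal ((n + 1) * mE s) \<partial>lborel) \<noteq> \<infinity>" unfolding nn by simp
      show "AE s in lborel. ennreal ((n + 1) * mE s) \<le> ennreal (?a s)"
        using pw by eventually_elim (simp add: ennreal_leI)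
    qed (use a_meas in simp_all)
    have "(\<integral>\<^sup>+s. ennreal (?a s) - ennreal ((n + 1) * mE s) \<partial>lborel) = 0"
      unfolding d nn by (rule diff_eq_0_ennreal[OF order.strict_trans1[OF le ennreal_less_top] le])
    then have "AE s in lborel. ennreal (?a s) - ennreal ((n + 1) * mE s) = 0"
      using a_meas by (subst (asm) nn_integral_0_iff_AE) simp_all
    then show ?thesis using pw
    proof eventually_elim
      case (elim s)
      then have "ennreal (?a s) \<le> ennreal ((n + 1) * mE s)" by (simp add: diff_eq_0_iff_ennreal)
      moreover have "ennreal ((n + 1) * mE s) \<le> ennreal (?a s)" using elim by (intro ennreal_leI) simp
      ultimately show ?case by (rule antisym)
    qed
  qed
  then show ?thesis using pw
  proof eventually_elim
    case (elim s)
    show ?case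
    proof (intro impI, rule ccontr)
      assume m: "mE s > 0" and ne: "mK (tr.T s) \<noteq> mE s"
      have k: "mK (tr.T s) > 0" using elim m by simp
      have "w s = mE s / mK (tr.T s)" using V by (simp add: w_def p_def q_def)
      moreover have "(n + 1) * mE s < mE s * (mE s / mK (tr.T s)) + n * mK (tr.T s) powr (1 / n) * mE s powr (1 - 1 / n)"
        by (rule amgm_slice(2)[OF k m zero_less_one card_I refl]) (use ne in simp)
      ultimately have "(n + 1) * mE s < ?a s" by simp
      moreover have "0 \<le> (n + 1) * mE s" using mE_nonneg[of s] by simp
      moreover have "0 \<le> ?a s" using elim \<open>0 \<le> (n + 1) * mE s\<close> by linarith
      ultimately show False using elim(1) by (simp only: ennreal_inj)
    qed
  qed
qed

text \<open>If a hyperplane that splits \<open>E\<close> met \<open>E\<close> in a null set, both parts could be transported to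
  the whole of \<open>K\<close>, and strict concavity of the isoperimetric profile would contradict
  the limit inequality.\<close>

lemma no_gap:
  assumes s0: "(\<lambda>k. M k s0) \<longlonglongrightarrow> 0"
  shows "tr.F s0 = 0 \<or> tr.F s0 = 1"
proof (rule ccontr)
  assume "\<not> ?thesis"
  then have F: "0 < tr.F s0" "tr.F s0 < 1" using tr.F_range[of s0] by auto
  define f where "f = tr.F s0"
  have f: "0 < f" "f < 1" using F by (auto simp: f_def)
  \<comment> \<open>The two parts of \<open>p\<close> to the left and right of \<open>s0\<close>,
    renormalised to probability densities; \<open>f\<close> is the share of mass on the
    left.\<close>
  define r1 where "r1 s = p s * indicator {..s0} s / f" for s
  define r2 where "r2 s = p s * indicator {s0<..} s / (1 - f)" for s
  have r_meas: "r1 \<in> borel_measurable borel" "r2 \<in> borel_measurable borel"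
    unfolding r1_def r2_def by (intro borel_measurable_divide borel_measurable_times; simp)+
  have r_nonneg: "0 \<le> r1 s" "0 \<le> r2 s" for s
    using p_nonneg[of s] f by (simp_all add: r1_def r2_def)
  have P1: "(\<integral>\<^sup>+s. ennreal (p s * indicator {..s0} s) \<partial>lborel) = ennreal f"
    using tr.emeasure_P[of "{..s0}"] by (simp add: f_def cdf_def tr.P.emeasure_eq_measure)
  have P2: "(\<integral>\<^sup>+s. ennreal (p s * indicator {s0<..} s) \<partial>lborel) = ennreal (1 - f)"
  proof -
    have "measure tr.P {s0<..} = 1 - f"
    proof -
      have "{s0<..} = space tr.P - {..s0}" by auto
      then show ?thesis using tr.P.prob_compl[of "{..s0}"] by (simp add: f_def cdf_def)
    qed
    then show ?thesis using tr.emeasure_P[of "{s0<..}"] by (simp add: tr.P.emeasure_eq_measure)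
  qed
  have r1_mass: "(\<integral>\<^sup>+s. ennreal (r1 s) \<partial>lborel) = 1"
  proof -
    have "(\<integral>\<^sup>+s. ennreal (r1 s) \<partial>lborel) = (\<integral>\<^sup>+s. ennreal (p s * indicator {..s0} s) / ennreal f \<partial>lborel)"
      using f p_nonneg by (intro nn_integral_cong) (simp add: r1_def divide_ennreal)
    also have "\<dots> = ennreal f / ennreal f" unfolding P1[symmetric] by (rule nn_integral_divide) simp
    finally show ?thesis using f by (simp add: divide_ennreal)
  qed
  have r2_mass: "(\<integral>\<^sup>+s. ennreal (r2 s) \<partial>lborel) = 1"
  proof -
    have "(\<integral>\<^sup>+s. ennreal (r2 s) \<partial>lborel) = (\<integral>\<^sup>+s. ennreal (p s * indicator {s0<..} s) / ennreal (1 - f) \<partial>lborel)"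
      using f p_nonneg by (intro nn_integral_cong) (simp add: r2_def divide_ennreal)
    also have "\<dots> = ennreal (1 - f) / ennreal (1 - f)" unfolding P2[symmetric] by (rule nn_integral_divide) simp
    finally show ?thesis using f by (simp add: divide_ennreal)
  qed
  interpret t1: density_transport r1 q lo hi by (rule transport_to_q[OF r_meas(1) r_nonneg(1) r1_mass])
  interpret t2: density_transport r2 q lo hi by (rule transport_to_q[OF r_meas(2) r_nonneg(2) r2_mass])
  have F1: "t1.F s = 1" if "s0 \<le> s" for s
  proof -
    have "emeasure t1.P {..s} = (\<integral>\<^sup>+x. ennreal (r1 x) \<partial>lborel)"
      unfolding t1.emeasure_P[OF borel_closed[OF closed_atMost]]
      by (rule nn_integral_cong) (use that in \<open>auto simp: r1_def indicator_def\<close>)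
    then show ?thesis by (simp add: r1_mass cdf_def measure_def)
  qed
  have F2: "t2.F s = 0" if "s \<le> s0" for s
  proof -
    have "emeasure t2.P {..s} = (\<integral>\<^sup>+(x::real). 0 \<partial>lborel)"
      unfolding t2.emeasure_P[OF borel_closed[OF closed_atMost]]
      by (rule nn_integral_cong) (use that in \<open>auto simp: r2_def indicator_def\<close>)
    then show ?thesis by (simp add: cdf_def measure_def)
  qed
  define h where "h = t1.T s0"
  have T1: "t1.T s = h" if "s0 \<le> s" for s unfolding h_def by (rule t1.T_cong) (simp add: F1 that)
  have T2: "t2.T s = lo" if "s \<le> s0" for s by (rule t2.T_eq_a[OF F2[OF that]])
  \<comment> \<open>Each part is sent onto the whole range of \<open>K\<close>, so the glued map
    falls back from \<open>h\<close> to \<open>lo\<close> at \<open>s0\<close>. \<open>T0_eq\<close>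
    writes it as the sum of the two monotone maps, corrected by a constant and by a step function
    carrying that fall.\<close>
  define T0 where "T0 s = (if s \<le> s0 then t1.T s else t2.T s)" for s
  have T0_eq: "T0 s = t1.T s + t2.T s - lo - (h - lo) * indicator {s0<..} s" for s
    using T1[of s] T2[of s] by (auto simp: T0_def indicator_def)
  have T0_meas: "T0 \<in> borel_measurable borel"
    unfolding T0_def by (rule measurable_If) (simp_all add: t1.T_meas t2.T_meas)
  have T0_range: "T0 s \<in> {lo..hi}" for s using t1.T_range[of s] t2.T_range[of s] by (simp add: T0_def)
  define w1 where "w1 s = r1 s / q (t1.T s)" for s
  define w2 where "w2 s = r2 s / q (t2.T s)" for s
  have w_meas: "w1 \<in> borel_measurable borel" "w2 \<in> borel_measurable borel"
    unfolding w1_def w2_def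
    using measurable_compose[OF t1.T_meas q_meas] measurable_compose[OF t2.T_meas q_meas] r_meas
    by (auto intro: borel_measurable_divide)
  have w_nonneg: "0 \<le> w1 s" "0 \<le> w2 s" for s
    using r_nonneg q_nonneg by (simp_all add: w1_def w2_def)
  \<comment> \<open>By \<open>integral_partial_halfspace\<close> the step function contributes its
    height times the slice integral \<open>M k s0\<close>, which tends to 0 by assumption.\<close>
  define err where "err k = (h - lo) * M k s0" for k
  have err_lim: "err \<longlonglongrightarrow> 0" unfolding err_def using tendsto_mult_right_zero[OF s0] by simp
  have TD: "err k - (\<integral>x. T0 (x j) * D k j x \<partial>LM J)
      = - (\<integral>x. t1.T (x j) * D k j x \<partial>LM J) + - (\<integral>x. t2.T (x j) * D k j x \<partial>LM J)" for k
  proof -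
    have b: "\<bar>t\<bar> \<le> \<bar>lo\<bar> + \<bar>hi\<bar>" if "t \<in> {lo..hi}" for t using that by auto
    have i1: "integrable (LM J) (\<lambda>x. t1.T (x j) * D k j x)"
      by (rule bounded_times_partial_integrable[OF fin j reg t1.T_meas b]) (use t1.T_range in simp)
    have i2: "integrable (LM J) (\<lambda>x. t2.T (x j) * D k j x)"
      by (rule bounded_times_partial_integrable[OF fin j reg t2.T_meas b]) (use t2.T_range in simp)
    have i3: "integrable (LM J) (\<lambda>x. indicator {s0<..} (x j) * D k j x)"
      by (rule bounded_times_partial_integrable[OF fin j reg, where c=1]) (auto simp: indicator_def)
    have i4: "integrable (LM J) (D k j)" using regular_integrable(2)[OF _ reg] fin by simp
    have "(\<integral>x. T0 (x j) * D k j x \<partial>LM J) =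
       (\<integral>x. t1.T (x j) * D k j x + t2.T (x j) * D k j x - lo * D k j x - (h - lo) * (indicator {s0<..} (x j) * D k j x) \<partial>LM J)"
      by (intro Bochner_Integration.integral_cong refl) (simp add: T0_eq algebra_simps)
    also have "\<dots> = (\<integral>x. t1.T (x j) * D k j x \<partial>LM J) + (\<integral>x. t2.T (x j) * D k j x \<partial>LM J)
       - lo * (\<integral>x. D k j x \<partial>LM J) - (h - lo) * (\<integral>x. indicator {s0<..} (x j) * D k j x \<partial>LM J)"
      using i1 i2 i3 i4 by simp
    also have "\<dots> = (\<integral>x. t1.T (x j) * D k j x \<partial>LM J) + (\<integral>x. t2.T (x j) * D k j x \<partial>LM J) + (h - lo) * M k s0"
      unfolding integral_partial_zero[OF fin j reg] integral_partial_halfspace[OF fin j reg] M_def by simp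
    finally show ?thesis by (simp add: err_def)
  qed
  note te1 = transport_err[OF t1.density_transport_axioms, folded w1_def]
  note te2 = transport_err[OF t2.density_transport_axioms, folded w2_def]
  have le: "(\<integral>\<^sup>+s. ennreal (mE s * (w1 s + w2 s) + n * mK (T0 s) powr (1 / n) * mE s powr (1 - 1 / n)) \<partial>lborel)
    \<le> ennreal ((n + 1) * V)"
  proof (rule limit_inequality[OF T0_meas T0_range _ _ err_lim])
    show "(\<lambda>s. w1 s + w2 s) \<in> borel_measurable borel" using w_meas by simp
    show "0 \<le> w1 s + w2 s" for s using w_nonneg[of s] by simp
    show "0 \<le> err k - (\<integral>x. T0 (x j) * D k j x \<partial>LM J)" for k
      unfolding TD by (rule add_nonneg_nonneg[OF te1(1) te2(1)])
    show "(\<integral>\<^sup>+s. ennreal (M k s * (w1 s + w2 s)) \<partial>lborel) \<le> ennreal (err k - (\<integral>x. T0 (x j) * D k j x \<partial>LM J))" for k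
    proof -
      have "(\<integral>\<^sup>+s. ennreal (M k s * (w1 s + w2 s)) \<partial>lborel) = (\<integral>\<^sup>+s. ennreal (M k s * w1 s) + ennreal (M k s * w2 s) \<partial>lborel)"
        using M_nonneg w_nonneg by (intro nn_integral_cong) (simp add: distrib_left)
      also have "\<dots> = (\<integral>\<^sup>+s. ennreal (M k s * w1 s) \<partial>lborel) + (\<integral>\<^sup>+s. ennreal (M k s * w2 s) \<partial>lborel)"
        using w_meas by (intro nn_integral_add) (simp_all add: borel_measurable_times)
      also have "\<dots> \<le> ennreal (- (\<integral>x. t1.T (x j) * D k j x \<partial>LM J)) + ennreal (- (\<integral>x. t2.T (x j) * D k j x \<partial>LM J))"
        by (rule add_mono[OF te1(2) te2(2)])
      also have "\<dots> = ennreal (err k - (\<integral>x. T0 (x j) * D k j x \<partial>LM J))"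
        unfolding TD by (rule ennreal_plus[OF te1(1) te2(1), symmetric])
      finally show ?thesis .
    qed
  qed
  \<comment> \<open>The left part has volume \<open>f * V\<close> but is mapped onto a body of
    volume \<open>V\<close>, so the ratio \<open>c\<close> in the inequality of means is
    \<open>1 / f\<close>; on the right it is \<open>1 / (1 - f)\<close>. Both exceed 1, and
    \<open>g\<close> is the smaller of the two gains.\<close>
  define g where "g = min ((1 / f) powr (1 / (n + 1))) ((1 / (1 - f)) powr (1 / (n + 1)))"
  have g1: "1 < g"
    unfolding g_def using f n_pos by (simp add: gr_one_powr)
  have "AE s in lborel. ennreal ((n + 1) * g * mE s)
      \<le> ennreal (mE s * (w1 s + w2 s) + n * mK (T0 s) powr (1 / n) * mE s powr (1 - 1 / n))"
    using t1.AE_q_T_pos t2.AE_q_T_pos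
  proof eventually_elim
    case (elim s)
    show ?case
    proof (rule ennreal_leI, cases "mE s = 0")
      case False
      then have m: "mE s > 0" using mE_nonneg[of s] by simp
      show "(n + 1) * g * mE s \<le> mE s * (w1 s + w2 s) + n * mK (T0 s) powr (1 / n) * mE s powr (1 - 1 / n)"
      proof (cases "s \<le> s0")
        case True
        then have "r1 s > 0" using m V f by (simp add: r1_def p_def)
        then have k: "mK (t1.T s) > 0" using elim(1) V by (simp add: q_def zero_less_divide_iff)
        have "w1 s = mE s * (1 / f) / mK (t1.T s)" using V True by (simp add: w1_def r1_def p_def q_def)
        moreover have "w2 s = 0" using True by (simp add: w2_def r2_def)
        moreover have gm: "(n + 1) * g * mE s \<le> (n + 1) * (1 / f) powr (1 / (n + 1)) * mE s"
          using m by (intro mult_right_mono mult_left_mono) (simp_all add: g_def)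
        moreover have "(n + 1) * (1 / f) powr (1 / (n + 1)) * mE s \<le> mE s * (mE s * (1 / f) / mK (t1.T s)) +
            n * mK (t1.T s) powr (1 / n) * mE s powr (1 - 1 / n)"
          by (rule amgm_slice(1)[OF k m _ card_I]) (use f in simp)
        note order.trans[OF gm this]
        ultimately show ?thesis using True
          by (simp add: T0_def)
      next
        case False
        then have "r2 s > 0" using m V f by (simp add: r2_def p_def)
        then have k: "mK (t2.T s) > 0" using elim(2) V by (simp add: q_def zero_less_divide_iff)
        have "w2 s = mE s * (1 / (1 - f)) / mK (t2.T s)" using V False by (simp add: w2_def r2_def p_def q_def)
        moreover have "w1 s = 0" using False by (simp add: w1_def r1_def)
        moreover have gm: "(n + 1) * g * mE s \<le> (n + 1) * (1 / (1 - f)) powr (1 / (n + 1)) * mE s"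
          using m by (intro mult_right_mono mult_left_mono) (simp_all add: g_def)
        moreover have "(n + 1) * (1 / (1 - f)) powr (1 / (n + 1)) * mE s \<le> mE s * (mE s * (1 / (1 - f)) / mK (t2.T s)) +
            n * mK (t2.T s) powr (1 / n) * mE s powr (1 - 1 / n)"
          by (rule amgm_slice(1)[OF k m _ card_I]) (use f in simp)
        note order.trans[OF gm this]
        ultimately show ?thesis using False
          by (simp add: T0_def)
      qed
    qed simp
  qed
  then have "(\<integral>\<^sup>+s. ennreal ((n + 1) * g * mE s) \<partial>lborel) \<le> ennreal ((n + 1) * V)"
    using le by (rule order.trans[OF nn_integral_mono_AE])
  moreover have "(\<integral>\<^sup>+s. ennreal ((n + 1) * g * mE s) \<partial>lborel) = ennreal ((n + 1) * g * V)"
  proof -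
    have "(\<integral>\<^sup>+s. ennreal ((n + 1) * g * mE s) \<partial>lborel) = ennreal ((n + 1) * g) * (\<integral>\<^sup>+s. mE s \<partial>lborel)"
      using g1 by (subst nn_integral_cmult[symmetric]) (simp_all add: ennreal_mult')
    then show ?thesis using g1 by (simp only: mE_mass) (simp add: ennreal_mult')
  qed
  ultimately have "(n + 1) * g * V \<le> (n + 1) * V" using V by (simp add: ennreal_le_iff)
  then show False using g1 V n_pos by simp
qed

text \<open>Where the slice of \<open>E\<close> is null the slice integrals of the approximants tend
  to 0, and \<open>no_gap\<close> then puts the point outside the range in which \<open>F\<close> is
  strictly between 0 and 1.\<close>

lemma AE_p_pos: "AE s in lborel. 0 < tr.F s \<and> tr.F s < 1 \<longrightarrow> p s > 0"
  using AE_good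
proof eventually_elim
  case (elim s)
  show ?case
  proof (intro impI, rule ccontr)
    assume F: "0 < tr.F s \<and> tr.F s < 1" and "\<not> 0 < p s"
    then have "mE s = 0" using V p_nonneg[of s] by (simp add: p_def)
    with elim have "(\<lambda>k. M k s) \<longlonglongrightarrow> 0" by simp
    from no_gap[OF this] F show False by simp
  qed
qed

text \<open>On a flat piece the density would integrate to 0 although \<open>AE_p_pos\<close> makes
  it positive almost everywhere there.\<close>

lemma F_strict:
  assumes "r < s" "0 < tr.F r" "tr.F r < 1"
  shows "tr.F r < tr.F s"
proof (rule ccontr)
  assume "\<not> tr.F r < tr.F s"
  then have eq: "tr.F x = tr.F r" if "x \<in> {r<..s}" for x
    using tr.F_mono[of r x] tr.F_mono[of x s] that by simp
  then have "measure tr.P {r<..s} = 0" using tr.P.cdf_diff_eq[OF assms(1)] eq[of s] assms(1) by simp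
  then have "(\<integral>\<^sup>+x. ennreal (p x * indicator {r<..s} x) \<partial>lborel) = 0"
    using tr.emeasure_P[of "{r<..s}"] by (simp add: tr.P.emeasure_eq_measure)
  then have "AE x in lborel. ennreal (p x * indicator {r<..s} x) = 0"
    by (subst (asm) nn_integral_0_iff_AE) simp_all
  then have "AE x in lborel. x \<notin> {r<..s}"
    using AE_p_pos
  proof eventually_elim
    case (elim x)
    show ?case
    proof
      assume x: "x \<in> {r<..s}"
      then have "p x > 0" using elim(2) eq[OF x] assms by simp
      then show False using elim(1) x by simp
    qed
  qed
  then have "{r<..s} \<in> null_sets lborel" by (subst AE_iff_null_sets) simp_all
  then have "emeasure lborel {r<..s} = 0" by auto
  then show False using assms(1) by simp
qed

text \<open>The change of variables is applied to the function \<open>1 / q\<close> on the interval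
  between \<open>T r\<close> and \<open>T s\<close>. On the target side this yields the length of
  that interval; on the source side \<open>q (T x) = p x\<close> turns the integrand into the
  indicator of \<open>{r<..s}\<close>.\<close>

lemma T_increment:
  assumes rs: "r < s" "0 < tr.F r" "tr.F s < 1"
  shows "tr.T s - tr.T r = s - r"
proof -
  have Fr: "tr.F r < 1" using tr.F_mono[of r s] rs by simp
  have Tle: "tr.T x \<le> tr.T y \<longleftrightarrow> tr.F x \<le> tr.F y" for x y
    using tr.T_le_iff[of "tr.T y" x] tr.T_range[of y] by (simp add: tr.G_T)
  have set: "tr.T r < tr.T x \<and> tr.T x \<le> tr.T s \<longleftrightarrow> x \<in> {r<..s}" for x
  proof
    assume a: "tr.T r < tr.T x \<and> tr.T x \<le> tr.T s"
    then have F: "tr.F r < tr.F x" "tr.F x \<le> tr.F s" using Tle[of x r] Tle[of x s] by auto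
    have "r < x" using F tr.F_mono[of x r] by (cases "r < x") auto
    moreover have "x \<le> s" using F_strict[of s x] F rs by (cases "x \<le> s") auto
    ultimately show "x \<in> {r<..s}" by simp
  next
    assume x: "x \<in> {r<..s}"
    then have "tr.F r < tr.F x" using F_strict[of r x] rs Fr by simp
    moreover have "tr.F x \<le> tr.F s" using x by (intro tr.F_mono) simp
    ultimately show "tr.T r < tr.T x \<and> tr.T x \<le> tr.T s" using Tle[of x r] Tle[of x s] by auto
  qed
  define g where "g t = ennreal (indicator {tr.T r<..tr.T s} t / q t)" for t
  have g_meas: "g \<in> borel_measurable borel" unfolding g_def
    by (intro measurable_compose[OF _ measurable_ennreal] borel_measurable_divide) simp_all
  have "(\<integral>\<^sup>+x. ennreal (p x) * g (tr.T x) \<partial>lborel) = (\<integral>\<^sup>+x. indicator {r<..s} x \<partial>lborel)"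
  proof (rule nn_integral_cong_AE)
    show "AE x in lborel. ennreal (p x) * g (tr.T x) = indicator {r<..s} x"
      using AE_p_pos AE_slices_eq
    proof eventually_elim
      case (elim x)
      show ?case
      proof (cases "x \<in> {r<..s}")
        case True
        then have "0 < tr.F x" "tr.F x < 1"
          using tr.F_mono[of r x] tr.F_mono[of x s] rs by auto
        then have p: "p x > 0" using elim(1) by simp
        then have "q (tr.T x) = p x" using elim(2) V by (simp add: p_def q_def zero_less_divide_iff)
        then have "g (tr.T x) = ennreal (1 / p x)" using True set[of x] by (simp add: g_def)
        then show ?thesis using True p by (simp add: ennreal_mult'[symmetric])
      next
        case False
        then have "tr.T x \<notin> {tr.T r<..tr.T s}" using set[of x] by simp
        then show ?thesis using False by (simp add: g_def)
      qed
    qed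
  qed
  also have "\<dots> = ennreal (s - r)" using rs by simp
  finally have l: "(\<integral>\<^sup>+x. ennreal (p x) * g (tr.T x) \<partial>lborel) = ennreal (s - r)" .
  have "(\<integral>\<^sup>+t. ennreal (q t) * g t \<partial>lborel) = (\<integral>\<^sup>+t. indicator {tr.T r<..tr.T s} t \<partial>lborel)"
  proof (rule nn_integral_cong_AE)
    show "AE t in lborel. ennreal (q t) * g t = indicator {tr.T r<..tr.T s} t"
      \<comment> \<open>\<open>q\<close> is positive on the open interval only. The point
        \<open>hi\<close> may lie in the half-open target interval, while \<open>lo\<close> never
        does because \<open>lo \<le> tr.T r\<close>.\<close>
      using AE_lborel_singleton[of hi]
    proof eventually_elim
      case (elim t)
      show ?case
      proof (cases "t \<in> {tr.T r<..tr.T s}")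
        case True
        then have "q t > 0" using tr.T_range[of r] tr.T_range[of s] elim by (intro q_pos) auto
        then show ?thesis using True by (simp add: g_def ennreal_mult'[symmetric])
      qed (simp add: g_def)
    qed
  qed
  also have "\<dots> = ennreal (tr.T s - tr.T r)" using tr.T_mono[of r s] rs by simp
  finally have "ennreal (s - r) = ennreal (tr.T s - tr.T r)"
    using tr.nn_integral_T[OF g_meas] l by simp
  then show ?thesis using rs tr.T_mono[of r s] by (simp add: ennreal_inj)
qed

text \<open>Stated against arbitrary Borel functions, the equality of marginals up to a shift can
  later be tested both on indicators of half-lines and on affine functions.\<close>

theorem translation:
  obtains c where "\<And>g. g \<in> borel_measurable borel \<Longrightarrow>
    (\<integral>\<^sup>+s. ennreal (mE s) * g (s + c) \<partial>lborel) = (\<integral>\<^sup>+t. ennreal (mK t) * g t \<partial>lborel)"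
proof -
  \<comment> \<open>A median serves as base point; it lies where \<open>T_increment\<close> is
    available, and the increments to either side then fix the shift.\<close>
  have "\<exists>r. tr.F r = 1 / 2"
  proof -
    obtain y where y: "tr.F y < 1 / 2"
      using order_tendstoD(2)[OF tr.P.cdf_lim_at_bot, of "1/2"] eventually_happens'[OF trivial_limit_at_bot_linorder] by auto
    obtain z where z: "tr.F z > 1 / 2"
      using order_tendstoD(1)[OF tr.P.cdf_lim_at_top_prob, of "1/2"] eventually_happens'[OF trivial_limit_at_top_linorder] by auto
    have "y \<le> z" using y z tr.F_mono[of z y] by linarith
    then show ?thesis using IVT'[of tr.F y "1/2" z] y z tr.continuous_F by (meson less_imp_le)
  qed
  then obtain r where r: "tr.F r = 1 / 2" by blast
  define c where "c = tr.T r - r"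
  have Tc: "tr.T s = s + c" if "0 < tr.F s" "tr.F s < 1" for s
  proof -
    consider "s = r" | "r < s" | "s < r" by linarith
    then show ?thesis
      using T_increment[of r s] T_increment[of s r] that r by cases (auto simp: c_def)
  qed
  \<comment> \<open>The exceptional values carry no mass: \<open>F = 0\<close> has probability 0 by
    \<open>prob_F_le\<close>, and at a point from which \<open>F\<close> still increases its value
    is below 1.\<close>
  have "AE s in tr.P. tr.T s = s + c"
  proof -
    have m: "{s. tr.F s \<le> 0} \<in> sets tr.P"
      using closed_Collect_le[OF tr.continuous_F continuous_on_const] by simp
    have "emeasure tr.P {s. tr.F s \<le> 0} = 0"
      using tr.prob_F_le[of 0] by (simp add: tr.P.emeasure_eq_measure)
    with m have "{s. tr.F s \<le> 0} \<in> null_sets tr.P" by auto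
    then have "AE s in tr.P. \<not> tr.F s \<le> 0" by (rule AE_I') simp
    then show ?thesis using tr.AE_F_strict
    proof eventually_elim
      case (elim s)
      have "tr.F s < tr.F (s + 1)" using elim by simp
      then have "tr.F s < 1" using tr.F_range(2)[of "s + 1"] by simp
      then show ?case using elim by (intro Tc) auto
    qed
  qed
  then have AE: "AE s in lborel. p s > 0 \<longrightarrow> tr.T s = s + c"
    unfolding tr.P_def by (subst (asm) AE_density) auto
  show thesis
  proof (rule that)
    fix g :: "real \<Rightarrow> ennreal" assume g: "g \<in> borel_measurable borel"
    have a: "(\<integral>\<^sup>+s. ennreal (p s) * g (s + c) \<partial>lborel) = (\<integral>\<^sup>+t. ennreal (q t) * g t \<partial>lborel)"
    proof -
      have "(\<integral>\<^sup>+s. ennreal (p s) * g (s + c) \<partial>lborel) = (\<integral>\<^sup>+s. ennreal (p s) * g (tr.T s) \<partial>lborel)"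
      proof (rule nn_integral_cong_AE)
        show "AE s in lborel. ennreal (p s) * g (s + c) = ennreal (p s) * g (tr.T s)"
          using AE by eventually_elim (metis ennreal_0 less_eq_real_def mult_zero_left p_nonneg)
      qed
      then show ?thesis using tr.nn_integral_T[OF g] by simp
    qed
    have gc: "(\<lambda>s. g (s + c)) \<in> borel_measurable borel" using g by measurable
    have "(\<integral>\<^sup>+s. ennreal (mE s) * g (s + c) \<partial>lborel) = ennreal V * (\<integral>\<^sup>+s. ennreal (p s) * g (s + c) \<partial>lborel)"
    proof (subst nn_integral_cmult[symmetric])
      show "(\<lambda>s. ennreal (p s) * g (s + c)) \<in> borel_measurable lborel" using gc by simp
      have "ennreal (mE s) = ennreal V * ennreal (p s)" for s
        using V p_nonneg[of s] by (simp add: ennreal_mult'[symmetric] p_def)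
      then show "(\<integral>\<^sup>+s. ennreal (mE s) * g (s + c) \<partial>lborel) = (\<integral>\<^sup>+s. ennreal V * (ennreal (p s) * g (s + c)) \<partial>lborel)"
        by (simp add: mult.assoc)
    qed
    also have "\<dots> = ennreal V * (\<integral>\<^sup>+t. ennreal (q t) * g t \<partial>lborel)" by (simp only: a)
    also have "\<dots> = (\<integral>\<^sup>+t. ennreal (mK t) * g t \<partial>lborel)"
    proof (subst nn_integral_cmult[symmetric])
      show "(\<lambda>t. ennreal (q t) * g t) \<in> borel_measurable lborel" using g by simp
      have "ennreal (mK s) = ennreal V * ennreal (q s)" for s
        using V q_nonneg[of s] by (simp add: ennreal_mult'[symmetric] q_def)
      then show "(\<integral>\<^sup>+t. ennreal V * (ennreal (q t) * g t) \<partial>lborel) = (\<integral>\<^sup>+t. ennreal (mK t) * g t \<partial>lborel)"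
        by (simp add: mult.assoc)
    qed
    finally show "(\<integral>\<^sup>+s. ennreal (mE s) * g (s + c) \<partial>lborel) = (\<integral>\<^sup>+t. ennreal (mK t) * g t \<partial>lborel)" .
  qed
qed

end

section \<open>Translation in every direction\<close>

text \<open>The functional \<open>e\<close> is normalised so that its \<open>j\<close>-th component
  is \<sigma>, one of 1 and -1. Replacing coordinate \<open>j\<close> by the value of
  \<open>e\<close> then has determinant of modulus 1 and leaves the other coordinates
  unchanged.\<close>

locale shear_coordinates =
  fixes e j :: "'a::euclidean_space" and \<sigma> :: real
  assumes j: "j \<in> Basis" and \<sigma>: "e \<bullet> j = \<sigma>" "\<sigma> * \<sigma> = 1"
begin

definition "I = Basis - {j}"

text \<open>The basis dual to the functionals \<open>e\<close> (at index \<open>j\<close>) and the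
  remaining coordinates, so that the \<open>j\<close>-th argument of \<Phi> is recovered as the
  value of \<open>e\<close>.\<close>

definition shear_axis :: "'a \<Rightarrow> 'a" where "shear_axis b = (if b = j then \<sigma> *\<^sub>R j else b - (\<sigma> * (e \<bullet> b)) *\<^sub>R j)"

definition "\<Phi> f = (\<Sum>b\<in>Basis. f b *\<^sub>R shear_axis b)" for f :: "'a \<Rightarrow> real"

lemma Basis_eq: "insert j I = Basis" using j by (auto simp: I_def)
lemma fin: "finite I" and j_notin: "j \<notin> I" by (simp_all add: I_def)
lemma card_I: "card I = DIM('a) - 1" using j by (simp add: I_def)

lemma \<Phi>_upd: "b \<in> Basis \<Longrightarrow> \<Phi> (f(b := t)) = \<Phi> f + (t - f b) *\<^sub>R shear_axis b"
  by (simp add: \<Phi>_def sum.remove[of Basis b] algebra_simps)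

lemma \<Phi>_measurable[measurable]: "\<Phi> \<in> borel_measurable (LM Basis)"
  unfolding \<Phi>_def
proof (intro borel_measurable_sum borel_measurable_scaleR)
  fix b :: 'a assume "b \<in> Basis"
  then show "(\<lambda>f. f b) \<in> borel_measurable (LM Basis)"
    using measurable_component_singleton[of b Basis "\<lambda>_. lborel :: real measure"] by simp
qed simp

lemma inner_e_axis: "b \<in> Basis \<Longrightarrow> e \<bullet> shear_axis b = (if b = j then 1 else 0)"
  using \<sigma> by (simp add: shear_axis_def inner_diff_right mult.assoc[symmetric] mult.commute[of \<sigma> "e \<bullet> b"])

lemma inner_e_\<Phi>: "e \<bullet> \<Phi> f = f j"
proof -
  have "e \<bullet> \<Phi> f = (\<Sum>b\<in>Basis. f b * (if b = j then 1 else 0))"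
    by (simp add: \<Phi>_def inner_sum_right inner_e_axis)
  also have "\<dots> = f j" using j by (simp add: if_distrib sum.delta cong: if_cong)
  finally show ?thesis .
qed

lemma inner_Basis_\<Phi>: assumes "b \<in> I" shows "\<Phi> f \<bullet> b = f b"
proof -
  have b: "b \<in> Basis" "b \<noteq> j" using assms by (auto simp: I_def)
  have "shear_axis c \<bullet> b = (if c = b then 1 else 0)" if "c \<in> Basis" for c
    using b j that by (simp add: shear_axis_def inner_diff_left inner_Basis)
  then have "\<Phi> f \<bullet> b = (\<Sum>c\<in>Basis. f c * (if c = b then 1 else 0))"
    by (simp add: \<Phi>_def inner_sum_left)
  also have "\<dots> = f b" using b by (simp add: if_distrib sum.delta cong: if_cong)
  finally show ?thesis .
qed

definition "\<Psi> x = (\<lambda>b\<in>Basis. if b = j then e \<bullet> x else x \<bullet> b)"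

lemma \<Psi>_space: "\<Psi> x \<in> space (LM Basis)" by (simp add: \<Psi>_def space_PiM)

lemma \<Phi>_\<Psi>: "\<Phi> (\<Psi> x) = x"
proof -
  let ?y = "\<Phi> (\<Psi> x)"
  have I: "?y \<bullet> b = x \<bullet> b" if "b \<in> I" for b using inner_Basis_\<Phi>[OF that, of "\<Psi> x"] that by (auto simp: \<Psi>_def I_def)
  have e: "e \<bullet> ?y = e \<bullet> x" using inner_e_\<Phi>[of "\<Psi> x"] j by (simp add: \<Psi>_def)
  have ex: "e \<bullet> z = \<sigma> * (z \<bullet> j) + (\<Sum>b\<in>I. (e \<bullet> b) * (z \<bullet> b))" for z
  proof -
    have "e \<bullet> z = (\<Sum>b\<in>insert j I. (e \<bullet> b) * (z \<bullet> b))" by (simp only: Basis_eq euclidean_inner[of e z])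
    then show ?thesis using fin j_notin \<sigma>(1) by simp
  qed
  have "\<sigma> * (?y \<bullet> j) = \<sigma> * (x \<bullet> j)" using e I unfolding ex[of ?y] ex[of x] by simp
  moreover have "\<sigma> \<noteq> 0" using \<sigma>(2) by auto
  ultimately have "?y \<bullet> j = x \<bullet> j" by simp
  then have "?y \<bullet> b = x \<bullet> b" if "b \<in> Basis" for b using I[of b] that by (cases "b = j") (auto simp: I_def)
  then show ?thesis by (rule euclidean_eqI)
qed

text \<open>With the coordinates in \<open>I\<close> frozen, \<Phi> differs from the standard
  representation only in its \<open>j\<close>-th coordinate, which is multiplied by \<sigma> and
  translated. Fubini reduces volume preservation to the affine substitution on the line.\<close>

lemma distr_\<Phi>: "distr (LM Basis) borel \<Phi> = (lborel :: 'a measure)"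
proof (rule measure_eqI)
  fix A assume "A \<in> sets (distr (LM Basis) borel \<Phi>)"
  then have A[measurable]: "A \<in> sets borel" by simp
  let ?\<Phi>0 = "\<lambda>f. \<Sum>b\<in>Basis. f b *\<^sub>R b :: 'a"
  have \<Phi>0[measurable]: "?\<Phi>0 \<in> borel_measurable (LM Basis)"
  proof (intro borel_measurable_sum borel_measurable_scaleR)
    fix b :: 'a assume "b \<in> Basis"
    then show "(\<lambda>f. f b) \<in> borel_measurable (LM Basis)"
      using measurable_component_singleton[of b Basis "\<lambda>_. lborel :: real measure"] by simp
  qed simp
  have ind: "(\<lambda>f. indicator A (\<Phi> f) :: ennreal) \<in> borel_measurable (LM (insert j I))"
    "(\<lambda>f. indicator A (?\<Phi>0 f) :: ennreal) \<in> borel_measurable (LM (insert j I))"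
    unfolding Basis_eq by measurable
  have "emeasure (distr (LM Basis) borel \<Phi>) A = (\<integral>\<^sup>+f. indicator A (\<Phi> f) \<partial>LM Basis)"
  proof -
    have "(\<integral>\<^sup>+x. indicator A x \<partial>distr (LM Basis) borel \<Phi>) = (\<integral>\<^sup>+f. indicator A (\<Phi> f) \<partial>LM Basis)"
      by (rule nn_integral_distr) simp_all
    then show ?thesis by simp
  qed
  also have "\<dots> = (\<integral>\<^sup>+x. \<integral>\<^sup>+s. indicator A (\<Phi> (x(j := s))) \<partial>lborel \<partial>LM I)"
    using nn_fubini_upd(2)[OF fin j_notin ind(1)] by (simp only: Basis_eq)
  also have "\<dots> = (\<integral>\<^sup>+x. \<integral>\<^sup>+s. indicator A (?\<Phi>0 (x(j := s))) \<partial>lborel \<partial>LM I)"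
  proof (rule nn_integral_cong)
    fix x :: "'a \<Rightarrow> real" assume x: "x \<in> space (LM I)"
    define l where "l = (\<Sum>b\<in>I. x b * (e \<bullet> b))"
    have eq: "\<Phi> (x(j := s)) = ?\<Phi>0 (x(j := - (\<sigma> * l) + \<sigma> * s))" for s
    proof -
      have "\<Phi> (x(j := s)) = s *\<^sub>R shear_axis j + (\<Sum>b\<in>I. x b *\<^sub>R shear_axis b)"
        unfolding \<Phi>_def Basis_eq[symmetric] using fin j_notin by (simp add: sum.insert) (rule sum.cong, auto)
      also have "(\<Sum>b\<in>I. x b *\<^sub>R shear_axis b) = (\<Sum>b\<in>I. x b *\<^sub>R b - (\<sigma> * (x b * (e \<bullet> b))) *\<^sub>R j)"
        by (rule sum.cong) (auto simp: shear_axis_def I_def algebra_simps)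
      also have "\<dots> = (\<Sum>b\<in>I. x b *\<^sub>R b) - (\<sigma> * l) *\<^sub>R j"
        by (simp add: sum_subtractf l_def sum_distrib_left scaleR_left.sum)
      also have "s *\<^sub>R shear_axis j + ((\<Sum>b\<in>I. x b *\<^sub>R b) - (\<sigma> * l) *\<^sub>R j) = (- (\<sigma> * l) + \<sigma> * s) *\<^sub>R j + (\<Sum>b\<in>I. x b *\<^sub>R b)"
        by (simp add: shear_axis_def algebra_simps)
      also have "\<dots> = ?\<Phi>0 (x(j := - (\<sigma> * l) + \<sigma> * s))"
        unfolding Basis_eq[symmetric] using fin j_notin by (simp add: sum.insert) (rule sum.cong, auto)
      finally show ?thesis .
    qed
    have m: "(\<lambda>s. indicator A (?\<Phi>0 (x(j := s))) :: ennreal) \<in> borel_measurable borel"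
      using measurable_compose[OF measurable_upd_left[OF x j_notin] ind(2)] .
    have "\<bar>\<sigma>\<bar> = 1" using \<sigma>(2) by (metis abs_mult_self_eq abs_one mult_cancel_left1 square_eq_1_iff abs_minus_cancel)
    then have a: "\<sigma> \<noteq> 0" "ennreal \<bar>\<sigma>\<bar> = 1" by auto
    have "(\<integral>\<^sup>+s. indicator A (?\<Phi>0 (x(j := s))) \<partial>lborel)
      = ennreal \<bar>\<sigma>\<bar> * (\<integral>\<^sup>+s. indicator A (?\<Phi>0 (x(j := - (\<sigma> * l) + \<sigma> * s))) \<partial>lborel)"
      by (rule nn_integral_real_affine[OF m a(1)])
    then show "(\<integral>\<^sup>+s. indicator A (\<Phi> (x(j := s))) \<partial>lborel) = (\<integral>\<^sup>+s. indicator A (?\<Phi>0 (x(j := s))) \<partial>lborel)"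
      unfolding eq a(2) by simp
  qed
  also have "\<dots> = (\<integral>\<^sup>+f. indicator A (?\<Phi>0 f) \<partial>LM Basis)"
    using nn_fubini_upd(2)[OF fin j_notin ind(2)] by (simp only: Basis_eq)
  also have "\<dots> = emeasure lborel A"
  proof -
    have "(\<integral>\<^sup>+x. indicator A x \<partial>distr (LM Basis) borel ?\<Phi>0) = (\<integral>\<^sup>+f. indicator A (?\<Phi>0 f) \<partial>LM Basis)"
      by (rule nn_integral_distr) simp_all
    then show ?thesis unfolding lborel_eq[symmetric] by simp
  qed
  finally show "emeasure (distr (LM Basis) borel \<Phi>) A = emeasure lborel A" .
qed simp

lemma nn_integral_\<Phi>:
  "f \<in> borel_measurable borel \<Longrightarrow> (\<integral>\<^sup>+x. f x \<partial>lborel) = (\<integral>\<^sup>+y. f (\<Phi> y) \<partial>LM Basis)"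
  by (subst distr_\<Phi>[symmetric], rule nn_integral_distr) simp_all

lemma integral_\<Phi>:
  fixes f :: "'a \<Rightarrow> real"
  shows "f \<in> borel_measurable borel \<Longrightarrow> (\<integral>x. f x \<partial>lborel) = (\<integral>y. f (\<Phi> y) \<partial>LM Basis)"
  by (subst distr_\<Phi>[symmetric], rule integral_distr) simp_all

lemma integrable_\<Phi>:
  fixes f :: "'a \<Rightarrow> real"
  shows "integrable lborel f \<Longrightarrow> integrable (LM Basis) (\<lambda>y. f (\<Phi> y))"
  by (rule integrable_distr[OF \<Phi>_measurable]) (simp add: distr_\<Phi>)

definition "pull A = {f\<in>space (LM Basis). \<Phi> f \<in> A}"

lemma pull_sets: "A \<in> sets borel \<Longrightarrow> pull A \<in> sets (LM Basis)"
  using measurable_sets[OF \<Phi>_measurable, of A] by (simp add: pull_def vimage_def Int_def conj_commute)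

lemma emeasure_pull: "A \<in> sets borel \<Longrightarrow> emeasure (LM Basis) (pull A) = emeasure lborel A"
  by (subst distr_\<Phi>[symmetric], subst emeasure_distr) (simp_all add: pull_def vimage_def Int_def conj_commute)

lemma coordinate_bound:
  assumes "b \<in> Basis" shows "\<bar>f b\<bar> \<le> (1 + norm e) * norm (\<Phi> f)"
proof -
  have n: "norm (\<Phi> f) \<le> (1 + norm e) * norm (\<Phi> f)" "norm e * norm (\<Phi> f) \<le> (1 + norm e) * norm (\<Phi> f)"
    by (simp_all add: algebra_simps)
  show ?thesis
  proof (cases "b = j")
    case True
    then have "\<bar>f b\<bar> \<le> norm e * norm (\<Phi> f)"
      using Cauchy_Schwarz_ineq2[of e "\<Phi> f"] by (simp add: inner_e_\<Phi>)
    with n show ?thesis by linarith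
  next
    case False
    then have "b \<in> I" using assms by (simp add: I_def)
    then have "\<bar>f b\<bar> \<le> norm (\<Phi> f)"
      using Basis_le_norm[OF assms, of "\<Phi> f"] by (simp add: inner_Basis_\<Phi>)
    with n show ?thesis by linarith
  qed
qed

lemma convex_pull: "convex W \<Longrightarrow> convex_fun Basis (pull W)"
  unfolding convex_fun_def
proof (intro ballI)
  fix f g t assume W: "convex W" and fg: "f \<in> pull W" "g \<in> pull W" and t: "t \<in> {0..1::real}"
  have "\<Phi> (\<lambda>i\<in>Basis. (1 - t) * f i + t * g i) = (1 - t) *\<^sub>R \<Phi> f + t *\<^sub>R \<Phi> g"
    by (simp add: \<Phi>_def sum.distrib[symmetric] scaleR_sum_right algebra_simps)
  moreover have "(1 - t) *\<^sub>R \<Phi> f + t *\<^sub>R \<Phi> g \<in> W"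
    using W fg t by (intro convexD) (auto simp: pull_def)
  ultimately show "(\<lambda>i\<in>Basis. (1 - t) * f i + t * g i) \<in> pull W"
    by (simp add: pull_def space_PiM)
qed

lemma bounded_pull: assumes "bounded W" shows "bounded_fun Basis (pull W)"
proof -
  obtain C where C: "\<And>x. x \<in> W \<Longrightarrow> norm x \<le> C" using assms by (auto simp: bounded_iff)
  have "\<bar>f b\<bar> \<le> (1 + norm e) * C" if "f \<in> pull W" "b \<in> Basis" for f b
    using order.trans[OF coordinate_bound[OF that(2), of f] mult_left_mono[OF C, of "\<Phi> f" "1 + norm e"]] that
    by (simp add: pull_def)
  then show ?thesis unfolding bounded_fun_def by blast
qed

lemma regular_pull:
  fixes u :: "'a \<Rightarrow> real"
  assumes der: "\<And>x. (u has_derivative Du x) (at x)"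
    and meas: "\<And>b. (\<lambda>x. Du x b) \<in> borel_measurable borel"
    and bnd: "\<And>x. 0 \<le> u x" "\<And>x. u x \<le> 1" "\<And>x b. \<bar>Du x b\<bar> \<le> C * norm b"
    and supp: "\<And>x. norm x > R \<Longrightarrow> u x = 0" "\<And>x b. norm x > R \<Longrightarrow> Du x b = 0"
  shows "regular Basis (\<lambda>f. u (\<Phi> f)) (\<lambda>b f. Du (\<Phi> f) (shear_axis b))"
proof -
  have u_meas: "u \<in> borel_measurable borel"
    by (intro borel_measurable_continuous_onI continuous_at_imp_continuous_on ballI)
      (use der has_derivative_continuous in blast)
  let ?A = "\<Sum>b\<in>Basis. norm (shear_axis b)"
  have C: "0 \<le> C" using bnd(3)[of 0 j] j by (simp add: order.trans[OF abs_ge_zero])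
  have "0 \<le> u (\<Phi> x) \<and> u (\<Phi> x) \<le> max 1 (C * ?A) \<and>
        (\<forall>b\<in>Basis. \<bar>Du (\<Phi> x) (shear_axis b)\<bar> \<le> max 1 (C * ?A) \<and>
          ((\<lambda>s. u (\<Phi> (x(b := s)))) has_real_derivative Du (\<Phi> x) (shear_axis b)) (at (x b))) \<and>
        ((\<exists>b\<in>Basis. \<bar>x b\<bar> > (1 + norm e) * \<bar>R\<bar>) \<longrightarrow> u (\<Phi> x) = 0 \<and> (\<forall>b\<in>Basis. Du (\<Phi> x) (shear_axis b) = 0))" for x
  proof (intro conjI ballI impI)
    show "0 \<le> u (\<Phi> x)" by (rule bnd)
    show "u (\<Phi> x) \<le> max 1 (C * ?A)" using bnd(2)[of "\<Phi> x"] by simp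
    fix b :: 'a assume b: "b \<in> Basis"
    have "norm (shear_axis b) \<le> ?A" using b by (intro member_le_sum) auto
    then have "C * norm (shear_axis b) \<le> C * ?A" using C by (rule mult_left_mono)
    then show "\<bar>Du (\<Phi> x) (shear_axis b)\<bar> \<le> max 1 (C * ?A)" using bnd(3)[of "\<Phi> x" "shear_axis b"] by simp
    have l: "((\<lambda>s. \<Phi> x + (s - x b) *\<^sub>R shear_axis b) has_vector_derivative shear_axis b) (at (x b))"
      by (auto intro!: derivative_eq_intros)
    have d: "(u has_derivative Du (\<Phi> x)) (at (\<Phi> x + (x b - x b) *\<^sub>R shear_axis b) within range (\<lambda>s. \<Phi> x + (s - x b) *\<^sub>R shear_axis b))"
      using has_derivative_at_withinI[OF der[of "\<Phi> x"]] by simp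
    from vector_derivative_diff_chain_within[OF l d]
    show "((\<lambda>s. u (\<Phi> (x(b := s)))) has_real_derivative Du (\<Phi> x) (shear_axis b)) (at (x b))"
      by (simp add: has_real_derivative_iff_has_vector_derivative \<Phi>_upd[OF b] comp_def)
  next
    assume "\<exists>b\<in>Basis. \<bar>x b\<bar> > (1 + norm e) * \<bar>R\<bar>"
    then obtain b where "b \<in> Basis" "\<bar>x b\<bar> > (1 + norm e) * \<bar>R\<bar>" by blast
    then have "(1 + norm e) * \<bar>R\<bar> < (1 + norm e) * norm (\<Phi> x)" using coordinate_bound[of b x] by linarith
    moreover have "0 < 1 + norm e" by (simp add: add_pos_nonneg)
    ultimately have "norm (\<Phi> x) > R" by simp
    then show "u (\<Phi> x) = 0" "\<And>b. b \<in> Basis \<Longrightarrow> Du (\<Phi> x) (shear_axis b) = 0" using supp by auto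
  qed
  moreover have "(\<lambda>f. u (\<Phi> f)) \<in> borel_measurable (LM Basis)"
    by (rule measurable_compose[OF \<Phi>_measurable u_meas])
  moreover have "(\<lambda>f. Du (\<Phi> f) (shear_axis b)) \<in> borel_measurable (LM Basis)" for b
    by (rule measurable_compose[OF \<Phi>_measurable meas])
  ultimately show ?thesis unfolding regular_def by blast
qed

text \<open>The segment from an interior point of \<open>W\<close> to a point of \<open>W\<close> at
  or beyond the level \<open>t\<close> crosses that level inside the interior, and a small box
  around the crossing point has positive volume in the slice.\<close>

lemma interior_slice_pos:
  assumes W: "compact W" "convex W" "interior W \<noteq> {}"
    and t: "Inf ((\<lambda>k. k j) ` pull W) < t" "t < Sup ((\<lambda>k. k j) ` pull W)"
  shows "0 < measure (LM I) (slice I j t (pull W))"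
proof -
  have Ws: "W \<in> sets borel" using W(1) by (simp add: borel_compact)
  obtain w0 where w0: "w0 \<in> interior W" using W(3) by blast
  have "\<Psi> w0 \<in> pull W" using w0 interior_subset by (auto simp: pull_def \<Psi>_space \<Phi>_\<Psi>)
  then have ne: "(\<lambda>k. k j) ` pull W \<noteq> {}" by blast
  obtain f1 where f1: "f1 \<in> pull W" "f1 j < t" using cInf_lessD[OF ne t(1)] by blast
  obtain f2 where f2: "f2 \<in> pull W" "t < f2 j" using less_cSupE[OF t(2) ne] by blast
  have w1: "\<Phi> f1 \<in> W" "e \<bullet> \<Phi> f1 < t" and w2: "\<Phi> f2 \<in> W" "t < e \<bullet> \<Phi> f2"
    using f1 f2 by (auto simp: pull_def inner_e_\<Phi>)
  have seg: "\<exists>w\<in>interior W. e \<bullet> w = t" if x: "x \<in> W" and l: "(t - e \<bullet> w0) / (e \<bullet> x - e \<bullet> w0) \<in> {0..<1}" and ne: "e \<bullet> x \<noteq> e \<bullet> w0" for x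
  proof -
    \<comment> \<open>The parameter at which the segment from \<open>x\<close> to \<open>w0\<close>
      has \<open>e\<close>-value \<open>t\<close>; it is positive, as required for the point to be
      interior.\<close>
    define \<mu> where "\<mu> = 1 - (t - e \<bullet> w0) / (e \<bullet> x - e \<bullet> w0)"
    have "x - \<mu> *\<^sub>R (x - w0) \<in> interior W"
      by (rule mem_interior_convex_shrink[OF W(2) w0 x]) (use l in \<open>auto simp: \<mu>_def\<close>)
    moreover have "e \<bullet> (x - \<mu> *\<^sub>R (x - w0)) = t"
    proof -
      have "e \<bullet> (x - \<mu> *\<^sub>R (x - w0)) = e \<bullet> x - \<mu> * (e \<bullet> x - e \<bullet> w0)" by (simp add: inner_diff_right)
      moreover have "\<mu> * (e \<bullet> x - e \<bullet> w0) = (e \<bullet> x - e \<bullet> w0) - (t - e \<bullet> w0)"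
      proof -
        have "(1 - a / d) * d = d - a" if "d \<noteq> 0" for a d :: real using that by (simp add: left_diff_distrib)
        then show ?thesis unfolding \<mu>_def using ne by (metis right_minus_eq)
      qed
      ultimately show ?thesis by simp
    qed
    ultimately show ?thesis by blast
  qed
  obtain w where w: "w \<in> interior W" "e \<bullet> w = t"
  proof -
    consider "e \<bullet> w0 = t" | "e \<bullet> w0 < t" | "e \<bullet> w0 > t" by linarith
    then have "\<exists>w\<in>interior W. e \<bullet> w = t"
    proof cases
      case 1 then show ?thesis using w0 by blast
    next
      case 2 then show ?thesis using w2 by (intro seg[OF w2(1)]) (auto simp: field_simps)
    next
      case 3 then show ?thesis using w1 by (intro seg[OF w1(1)]) (auto simp: field_simps)
    qed
    then show ?thesis using that by blast
  qed
  obtain \<rho> where \<rho>: "\<rho> > 0" "ball w \<rho> \<subseteq> W" using w(1) by (auto simp: mem_interior)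
  let ?S = "\<Sum>b\<in>I. norm (shear_axis b)"
  \<comment> \<open>A box of half-side \<delta> moves the point by at most \<delta> times the sum of
    the axis lengths, which is less than \<rho>; the summand 1 keeps this strict and the denominator
    positive.\<close>
  define \<delta> where "\<delta> = \<rho> / (?S + 1)"
  have S: "0 \<le> ?S" by (simp add: sum_nonneg)
  have \<delta>: "\<delta> > 0" using \<rho> S by (simp add: \<delta>_def)
  let ?Q = "Pi\<^sub>E I (\<lambda>b. {w \<bullet> b - \<delta>..w \<bullet> b + \<delta>})"
  have Q: "?Q \<in> sets (LM I)" using fin by (intro sets_PiM_I_finite) auto
  have sub: "?Q \<subseteq> slice I j t (pull W)"
  proof
    fix x assume x: "x \<in> ?Q"
    then have xs: "x \<in> space (LM I)" by (auto simp: space_PiM PiE_iff)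
    have "\<Phi> (x(j := t)) - w = \<Phi> (x(j := t)) - \<Phi> (\<Psi> w)" by (simp add: \<Phi>_\<Psi>)
    also have "\<dots> = (\<Sum>b\<in>insert j I. ((x(j := t)) b - \<Psi> w b) *\<^sub>R shear_axis b)"
      unfolding \<Phi>_def Basis_eq by (simp add: sum_subtractf scaleR_diff_left)
    also have "\<dots> = (\<Sum>b\<in>I. (x b - w \<bullet> b) *\<^sub>R shear_axis b)"
    proof -
      have "\<Psi> w j = t" using j w(2) by (simp add: \<Psi>_def)
      moreover have "(\<Sum>b\<in>I. ((x(j := t)) b - \<Psi> w b) *\<^sub>R shear_axis b) = (\<Sum>b\<in>I. (x b - w \<bullet> b) *\<^sub>R shear_axis b)"
        by (rule sum.cong) (auto simp: I_def \<Psi>_def)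
      ultimately show ?thesis unfolding sum.insert[OF fin j_notin] by simp
    qed
    also have "norm \<dots> \<le> (\<Sum>b\<in>I. \<delta> * norm (shear_axis b))"
    proof (rule sum_norm_le)
      fix b assume b: "b \<in> I"
      then have "x b \<in> {w \<bullet> b - \<delta>..w \<bullet> b + \<delta>}" using x by (rule PiE_mem[rotated])
      then have "\<bar>x b - w \<bullet> b\<bar> \<le> \<delta>" by auto
      then show "norm ((x b - w \<bullet> b) *\<^sub>R shear_axis b) \<le> \<delta> * norm (shear_axis b)" by (simp add: mult_right_mono)
    qed
    also have "\<dots> = \<delta> * ?S" by (simp add: sum_distrib_left)
    also have "\<dots> < \<rho>" using \<rho> S by (simp add: \<delta>_def field_simps)
    finally have "\<Phi> (x(j := t)) \<in> W" using \<rho>(2) by (auto simp: dist_norm norm_minus_commute)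
    moreover have "x(j := t) \<in> space (LM Basis)" using upd_space[OF xs, of j t] by (simp only: Basis_eq)
    ultimately show "x \<in> slice I j t (pull W)" using xs by (simp add: slice_def pull_def)
  qed
  have ps: "pull W \<in> sets (LM (insert j I))" using pull_sets[OF Ws] by (simp only: Basis_eq)
  have pb: "bounded_fun (insert j I) (pull W)" using bounded_pull[OF compact_imp_bounded[OF W(1)]] by (simp only: Basis_eq)
  have fin_s: "emeasure (LM I) (slice I j t (pull W)) < \<infinity>"
    by (rule bounded_fun_emeasure[OF fin sets_slice[OF ps] bounded_slice[OF pb j_notin]])
  have "emeasure (LM I) ?Q = (\<Prod>b\<in>I. ennreal (2 * \<delta>))"
    using fin \<delta> by (simp add: LB.emeasure_PiM)
  also have "\<dots> = ennreal ((2 * \<delta>) ^ card I)" using \<delta> by (simp add: ennreal_power)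
  also have "\<dots> > 0" using \<delta> by simp
  finally have "0 < emeasure (LM I) (slice I j t (pull W))"
    using emeasure_mono[OF sub sets_slice[OF ps]] by (rule less_le_trans)
  then show ?thesis using fin_s by (simp add: emeasure_eq_ennreal_measure)
qed

end

section \<open>From approximants of the indicator to translations of marginals\<close>

text \<open>Everything the transport argument is told about the perimeter of \<open>E\<close>:
  \<open>A\<close> bounds the total variation measured by \<open>W\<close>, up to \<eta>. It is free
  of coordinates, so the same property serves every shear. The constants \<open>C\<close> and
  \<open>R\<close> may depend on \<eta> without control.\<close>

definition approximable :: "'a::euclidean_space set \<Rightarrow> 'a set \<Rightarrow> real \<Rightarrow> bool" where
  "approximable W E A \<longleftrightarrow> (\<forall>\<eta>>0. \<exists>u Du H C R.
     (\<forall>x. (u has_derivative Du x) (at x)) \<and> (\<forall>b. (\<lambda>x. Du x b) \<in> borel_measurable borel) \<and>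
     (\<forall>x. 0 \<le> u x \<and> u x \<le> 1) \<and> (\<forall>x b. \<bar>Du x b\<bar> \<le> C * norm b) \<and>
     (\<forall>x. norm x > R \<longrightarrow> u x = 0 \<and> (\<forall>b. Du x b = 0)) \<and>
     (\<integral>x. \<bar>u x - indicator E x\<bar> \<partial>lborel) \<le> \<eta> \<and>
     integrable lborel H \<and> (\<forall>x. \<forall>k\<in>W. - Du x k \<le> H x) \<and> (\<integral>x. H x \<partial>lborel) \<le> A + \<eta>)"

context shear_coordinates
begin

lemma linear_combination:
  fixes L :: "'a \<Rightarrow> real"
  assumes "linear L"
  shows "L (\<Phi> f) = (\<Sum>b\<in>Basis. f b * L (shear_axis b))"
  by (simp add: \<Phi>_def linear_sum[OF assms] linear_scale[OF assms])

lemma transfer_slices: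
  assumes A: "A \<in> sets borel" "emeasure lborel A < \<infinity>" and g: "g \<in> borel_measurable borel"
  shows "(\<integral>\<^sup>+x. indicator A x * g (e \<bullet> x + c) \<partial>lborel)
    = (\<integral>\<^sup>+s. ennreal (measure (LM I) (slice I j s (pull A))) * g (s + c) \<partial>lborel)"
proof -
  have pA: "pull A \<in> sets (LM (insert j I))" using pull_sets[OF A(1)] by (simp only: Basis_eq)
  have pf: "emeasure (LM (insert j I)) (pull A) < \<infinity>" using emeasure_pull[OF A(1)] A(2) by (simp only: Basis_eq)
  have gm: "(\<lambda>x. indicator A x * g (e \<bullet> x + c)) \<in> borel_measurable borel"
    using A(1) g by measurable
  have gc: "(\<lambda>s. g (s + c)) \<in> borel_measurable borel" using g by measurable
  have cm: "(\<lambda>f. f j) \<in> measurable (LM (insert j I)) borel"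
    using measurable_component_singleton[of j "insert j I" "\<lambda>_. lborel :: real measure"] by simp
  have m: "(\<lambda>f. indicator (pull A) f * g (f j + c)) \<in> borel_measurable (LM (insert j I))"
    using pA measurable_compose[OF cm gc] by (intro borel_measurable_times_ennreal) auto
  have "(\<integral>\<^sup>+x. indicator A x * g (e \<bullet> x + c) \<partial>lborel) = (\<integral>\<^sup>+f. indicator A (\<Phi> f) * g (f j + c) \<partial>LM Basis)"
    using nn_integral_\<Phi>[OF gm] by (simp add: inner_e_\<Phi>)
  also have "\<dots> = (\<integral>\<^sup>+f. indicator (pull A) f * g (f j + c) \<partial>LM (insert j I))"
    unfolding Basis_eq by (rule nn_integral_cong) (auto simp: pull_def indicator_def)
  also have "\<dots> = (\<integral>\<^sup>+s. \<integral>\<^sup>+x. indicator (pull A) (x(j := s)) * g (s + c) \<partial>LM I \<partial>lborel)"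
    using nn_fubini_upd(1)[OF fin j_notin m] by simp
  also have "\<dots> = (\<integral>\<^sup>+s. ennreal (measure (LM I) (slice I j s (pull A))) * g (s + c) \<partial>lborel)"
  proof (rule nn_integral_cong_AE)
    show "AE s in lborel. (\<integral>\<^sup>+x. indicator (pull A) (x(j := s)) * g (s + c) \<partial>LM I)
       = ennreal (measure (LM I) (slice I j s (pull A))) * g (s + c)"
      using slice_measurable(4)[OF fin j_notin pA pf]
    proof eventually_elim
      case (elim s)
      have "(\<integral>\<^sup>+x. indicator (pull A) (x(j := s)) * g (s + c) \<partial>LM I)
         = (\<integral>\<^sup>+x. g (s + c) * indicator (slice I j s (pull A)) x \<partial>LM I)"
        by (rule nn_integral_cong) (auto simp: slice_def indicator_def)
      also have "\<dots> = g (s + c) * emeasure (LM I) (slice I j s (pull A))"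
        by (rule nn_integral_cmult_indicator[OF sets_slice[OF pA]])
      also have "emeasure (LM I) (slice I j s (pull A)) = ennreal (measure (LM I) (slice I j s (pull A)))"
        by (rule emeasure_eq_ennreal_measure) (use elim in simp)
      finally show ?case by (simp only: mult.commute)
    qed
  qed
  finally show ?thesis .
qed

text \<open>The approximants are read in shear coordinates, where the derivative along a vector of
  the body becomes the combination of partial derivatives that \<open>slice_comparison\<close>
  expects; its translation of marginals is then transferred back through the slices.\<close>

theorem direction_translation:
  fixes W E :: "'a set" and V :: real
  assumes dim: "2 \<le> DIM('a)" and W: "compact W" "convex W" "interior W \<noteq> {}"
    and E: "E \<in> sets borel" "emeasure lborel E = ennreal V" and WV: "emeasure lborel W = ennreal V" and V: "V > 0"
    and app: "approximable W E (DIM('a) * V)"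
  obtains c where "\<And>g. g \<in> borel_measurable borel \<Longrightarrow>
    (\<integral>\<^sup>+x. indicator E x * g (e \<bullet> x + c) \<partial>lborel) = (\<integral>\<^sup>+x. indicator W x * g (e \<bullet> x) \<partial>lborel)"
proof -
  have Ws: "W \<in> sets borel" using W(1) by (simp add: borel_compact)
  let ?\<eta> = "\<lambda>k::nat. 1 / (real k + 1)"
  have "\<forall>k. \<exists>u Du H C R.
     (\<forall>x. (u has_derivative Du x) (at x)) \<and> (\<forall>b. (\<lambda>x. Du x b) \<in> borel_measurable borel) \<and>
     (\<forall>x. 0 \<le> u x \<and> u x \<le> 1) \<and> (\<forall>x b. \<bar>Du x b\<bar> \<le> C * norm b) \<and>
     (\<forall>x. norm x > R \<longrightarrow> u x = 0 \<and> (\<forall>b. Du x b = 0)) \<and>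
     (\<integral>x. \<bar>u x - indicator E x\<bar> \<partial>lborel) \<le> ?\<eta> k \<and>
     integrable lborel H \<and> (\<forall>x. \<forall>k\<in>W. - Du x k \<le> H x) \<and> (\<integral>x. H x \<partial>lborel) \<le> DIM('a) * V + ?\<eta> k"
    using app unfolding approximable_def by simp
  from choice[OF this] obtain u where "\<forall>k. \<exists>Du H C R.
     (\<forall>x. (u k has_derivative Du x) (at x)) \<and> (\<forall>b. (\<lambda>x. Du x b) \<in> borel_measurable borel) \<and>
     (\<forall>x. 0 \<le> u k x \<and> u k x \<le> 1) \<and> (\<forall>x b. \<bar>Du x b\<bar> \<le> C * norm b) \<and>
     (\<forall>x. norm x > R \<longrightarrow> u k x = 0 \<and> (\<forall>b. Du x b = 0)) \<and>
     (\<integral>x. \<bar>u k x - indicator E x\<bar> \<partial>lborel) \<le> ?\<eta> k \<and>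
     integrable lborel H \<and> (\<forall>x. \<forall>k\<in>W. - Du x k \<le> H x) \<and> (\<integral>x. H x \<partial>lborel) \<le> DIM('a) * V + ?\<eta> k" ..
  from choice[OF this] obtain Du where "\<forall>k. \<exists>H C R.
     (\<forall>x. (u k has_derivative Du k x) (at x)) \<and> (\<forall>b. (\<lambda>x. Du k x b) \<in> borel_measurable borel) \<and>
     (\<forall>x. 0 \<le> u k x \<and> u k x \<le> 1) \<and> (\<forall>x b. \<bar>Du k x b\<bar> \<le> C * norm b) \<and>
     (\<forall>x. norm x > R \<longrightarrow> u k x = 0 \<and> (\<forall>b. Du k x b = 0)) \<and>
     (\<integral>x. \<bar>u k x - indicator E x\<bar> \<partial>lborel) \<le> ?\<eta> k \<and>
     integrable lborel H \<and> (\<forall>x. \<forall>k'\<in>W. - Du k x k' \<le> H x) \<and> (\<integral>x. H x \<partial>lborel) \<le> DIM('a) * V + ?\<eta> k" ..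
  from choice[OF this] obtain H where uH: "\<And>k. \<exists>C R.
     (\<forall>x. (u k has_derivative Du k x) (at x)) \<and> (\<forall>b. (\<lambda>x. Du k x b) \<in> borel_measurable borel) \<and>
     (\<forall>x. 0 \<le> u k x \<and> u k x \<le> 1) \<and> (\<forall>x b. \<bar>Du k x b\<bar> \<le> C * norm b) \<and>
     (\<forall>x. norm x > R \<longrightarrow> u k x = 0 \<and> (\<forall>b. Du k x b = 0)) \<and>
     (\<integral>x. \<bar>u k x - indicator E x\<bar> \<partial>lborel) \<le> ?\<eta> k \<and>
     integrable lborel (H k) \<and> (\<forall>x. \<forall>k'\<in>W. - Du k x k' \<le> H k x) \<and> (\<integral>x. H k x \<partial>lborel) \<le> DIM('a) * V + ?\<eta> k" by blast
  have der: "(u k has_derivative Du k x) (at x)" for k x using uH[of k] by blast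
  have L1: "(\<integral>x. \<bar>u k x - indicator E x\<bar> \<partial>lborel) \<le> ?\<eta> k" for k using uH[of k] by blast
  have iH: "integrable lborel (H k)" for k using uH[of k] by blast
  have H: "- Du k x y \<le> H k x" if "y \<in> W" for k x y using uH[of k] that by blast
  have H_le: "(\<integral>x. H k x \<partial>lborel) \<le> DIM('a) * V + ?\<eta> k" for k using uH[of k] by blast
  define v where "v k f = u k (\<Phi> f)" for k f
  define D where "D k b f = Du k (\<Phi> f) (shear_axis b)" for k b f
  have reg: "regular (insert j I) (v k) (D k)" for k
  proof -
    obtain C R where "\<And>b. (\<lambda>x. Du k x b) \<in> borel_measurable borel" "\<And>x. 0 \<le> u k x" "\<And>x. u k x \<le> 1"
      "\<And>x b. \<bar>Du k x b\<bar> \<le> C * norm b" "\<And>x. norm x > R \<Longrightarrow> u k x = 0" "\<And>x b. norm x > R \<Longrightarrow> Du k x b = 0"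
      using uH[of k] by blast
    from regular_pull[OF der this] show ?thesis by (simp add: Basis_eq v_def[abs_def] D_def[abs_def])
  qed
  have pE: "pull E \<in> sets (LM (insert j I))" using pull_sets[OF E(1)] by (simp only: Basis_eq)
  have pE_fin: "emeasure (LM (insert j I)) (pull E) = ennreal V" using emeasure_pull[OF E(1)] E(2) by (simp only: Basis_eq)
  have iE: "integrable (LM (insert j I)) (indicator (pull E) :: _ \<Rightarrow> real)"
    using pE pE_fin by simp
  have iv: "integrable (LM (insert j I)) (v k)" for k by (rule regular_integrable(1)[OF _ reg]) (simp add: fin)
  let ?d = "\<lambda>k f. \<bar>v k f - indicator (pull E) f\<bar>"
  have id: "integrable (LM (insert j I)) (?d k)" for k using iv iE by simp
  let ?N = "\<lambda>k s. \<integral>x. ?d k (x(j := s)) \<partial>LM I"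
  have iN: "integrable lborel (?N k)" for k by (rule fubini_upd(2)[OF fin j_notin id])
  have N_nonneg: "0 \<le> ?N k s" for k s by (rule Bochner_Integration.integral_nonneg) simp
  have N_le: "(\<integral>s. norm (?N k s) \<partial>lborel) \<le> ?\<eta> k" for k
  proof -
    have um: "u k \<in> borel_measurable borel"
      by (intro borel_measurable_continuous_onI continuous_at_imp_continuous_on ballI)
        (use der has_derivative_continuous in blast)
    have "(\<integral>s. norm (?N k s) \<partial>lborel) = (\<integral>s. ?N k s \<partial>lborel)" using N_nonneg by simp
    also have "\<dots> = (\<integral>f. ?d k f \<partial>LM (insert j I))" by (rule fubini_upd(3)[OF fin j_notin id, symmetric])
    also have "\<dots> = (\<integral>f. \<bar>u k (\<Phi> f) - indicator E (\<Phi> f)\<bar> \<partial>LM Basis)"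
      unfolding Basis_eq by (rule Bochner_Integration.integral_cong) (auto simp: v_def pull_def indicator_def)
    also have "\<dots> = (\<integral>x. \<bar>u k x - indicator E x\<bar> \<partial>lborel)"
      by (rule integral_\<Phi>[symmetric]) (use um E(1) in simp)
    also have "\<dots> \<le> ?\<eta> k" by (rule L1)
    finally show ?thesis .
  qed
  have \<eta>_lim: "?\<eta> \<longlonglongrightarrow> 0"
    using LIMSEQ_ignore_initial_segment[OF lim_1_over_n[where 'a=real], of 1] by (simp add: add.commute)
  have "(\<lambda>k. \<integral>s. norm (?N k s) \<partial>lborel) \<longlonglongrightarrow> 0"
    by (rule tendsto_sandwich[OF _ _ tendsto_const \<eta>_lim]) (use N_le in \<open>auto intro!: always_eventually\<close>)
  \<comment> \<open>Fubini makes the slice errors converge to 0 in L1 over the heights; almost every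
    height then works along a subsequence \<open>r\<close>.\<close>
  from tendsto_L1_AE_subseq[OF iN this] obtain r where r: "strict_mono r" "AE s in lborel. (\<lambda>k. ?N (r k) s) \<longlonglongrightarrow> 0"
    by blast
  have pW: "pull W \<in> sets (LM (insert j I))" using pull_sets[OF Ws] by (simp only: Basis_eq)
  have "slice_comparison I j (pull W) (pull E) V (\<lambda>k. v (r k)) (\<lambda>k. D (r k)) (\<lambda>k f. H (r k) (\<Phi> f)) (\<lambda>k. ?\<eta> (r k))"
  proof
    show "finite I" "j \<notin> I" by (fact fin j_notin)+
    show "1 \<le> card I" using dim by (simp add: card_I)
    show "pull W \<in> sets (LM (insert j I))" by (rule pW)
    obtain w where "w \<in> W" using W(3) interior_subset by blast
    then have "\<Psi> w \<in> pull W" by (simp add: pull_def \<Psi>_space \<Phi>_\<Psi>)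
    then show "pull W \<noteq> {}" by blast
    show "convex_fun (insert j I) (pull W)" using convex_pull[OF W(2)] by (simp only: Basis_eq)
    show "bounded_fun (insert j I) (pull W)" using bounded_pull[OF compact_imp_bounded[OF W(1)]] by (simp only: Basis_eq)
    show "pull E \<in> sets (LM (insert j I))" "emeasure (LM (insert j I)) (pull E) = ennreal V" by (fact pE pE_fin)+
    show "emeasure (LM (insert j I)) (pull W) = ennreal V" using emeasure_pull[OF Ws] WV by (simp only: Basis_eq)
    show "V > 0" by (rule V)
    show "regular (insert j I) (v (r k)) (D (r k))" for k by (rule reg)
    have "?N k s = (\<integral>x. \<bar>v k (x(j := s)) - indicator (slice I j s (pull E)) x\<bar> \<partial>LM I)" for k s
      by (rule Bochner_Integration.integral_cong) (auto simp: slice_def indicator_def)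
    then show "AE s in lborel. (\<lambda>k. \<integral>x. \<bar>v (r k) (x(j := s)) - indicator (slice I j s (pull E)) x\<bar> \<partial>LM I) \<longlonglongrightarrow> 0"
      using r(2) by simp
    show "integrable (LM (insert j I)) (\<lambda>f. H (r k) (\<Phi> f))" for k
      using integrable_\<Phi>[OF iH] by (simp only: Basis_eq)
    show "- (\<Sum>i\<in>insert j I. y i * D (r k) i x) \<le> H (r k) (\<Phi> x)" if "y \<in> pull W" for k x y
    proof -
      have "(\<Sum>i\<in>insert j I. y i * D (r k) i x) = Du (r k) (\<Phi> x) (\<Phi> y)"
        unfolding Basis_eq D_def by (rule linear_combination[symmetric]) (rule has_derivative_linear[OF der])
      then show ?thesis using H[of "\<Phi> y" "r k" "\<Phi> x"] that by (simp add: pull_def)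
    qed
    show "(\<integral>f. H (r k) (\<Phi> f) \<partial>LM (insert j I)) \<le> (real (card I) + 1) * V + ?\<eta> (r k)" for k
    proof -
      have "(\<integral>f. H (r k) (\<Phi> f) \<partial>LM (insert j I)) = (\<integral>x. H (r k) x \<partial>lborel)"
        unfolding Basis_eq using iH by (intro integral_\<Phi>[symmetric]) simp
      moreover have "real (card I) + 1 = DIM('a)" using dim by (simp add: card_I)
      ultimately show ?thesis using H_le[of "r k"] by simp
    qed
    show "(\<lambda>k. ?\<eta> (r k)) \<longlonglongrightarrow> 0"
      using LIMSEQ_subseq_LIMSEQ[OF \<eta>_lim r(1)] by (simp add: comp_def)
    show "0 < measure (LM I) (slice I j t (pull W))"
      if "Inf ((\<lambda>k. k j) ` pull W) < t" "t < Sup ((\<lambda>k. k j) ` pull W)" for t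
      by (rule interior_slice_pos[OF W that])
  qed
  then interpret sc: slice_comparison I j "pull W" "pull E" V "\<lambda>k. v (r k)" "\<lambda>k. D (r k)" "\<lambda>k f. H (r k) (\<Phi> f)" "\<lambda>k. ?\<eta> (r k)" .
  from sc.translation obtain c where c: "\<And>g. g \<in> borel_measurable borel \<Longrightarrow>
    (\<integral>\<^sup>+s. ennreal (sc.mE s) * g (s + c) \<partial>lborel) = (\<integral>\<^sup>+t. ennreal (sc.mK t) * g t \<partial>lborel)" by blast
  show thesis
  proof (rule that)
    fix g :: "real \<Rightarrow> ennreal" assume g: "g \<in> borel_measurable borel"
    have "(\<integral>\<^sup>+x. indicator E x * g (e \<bullet> x + c) \<partial>lborel) = (\<integral>\<^sup>+s. ennreal (sc.mE s) * g (s + c) \<partial>lborel)"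
      unfolding sc.mE_def by (rule transfer_slices[OF E(1) _ g]) (simp add: E(2))
    also have "\<dots> = (\<integral>\<^sup>+t. ennreal (sc.mK t) * g t \<partial>lborel)" by (rule c[OF g])
    also have "\<dots> = (\<integral>\<^sup>+x. indicator W x * g (e \<bullet> x) \<partial>lborel)"
      using transfer_slices[OF Ws _ g, of 0] WV by (simp add: sc.mK_def)
    finally show "(\<integral>\<^sup>+x. indicator E x * g (e \<bullet> x + c) \<partial>lborel) = (\<integral>\<^sup>+x. indicator W x * g (e \<bullet> x) \<partial>lborel)" .
  qed
qed

end

lemma abs_le_imp_mem_interval: "\<bar>t\<bar> \<le> r \<Longrightarrow> t \<in> {- r..r}" for t r :: real
  by auto

text \<open>Division by the modulus of a nonzero component brings \<open>e\<close> into the normal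
  form of \<open>shear_coordinates\<close>; the factor \<open>a\<close> is put into the test
  function and into the shift.\<close>

lemma linear_functional_translation:
  fixes W E :: "'a::euclidean_space set" and V :: real
  assumes dim: "2 \<le> DIM('a)" and W: "compact W" "convex W" "interior W \<noteq> {}"
    and E: "E \<in> sets borel" "emeasure lborel E = ennreal V" and WV: "emeasure lborel W = ennreal V" and V: "V > 0"
    and app: "approximable W E (DIM('a) * V)" and e: "e \<noteq> 0"
  obtains c where "\<And>g. g \<in> borel_measurable borel \<Longrightarrow>
    (\<integral>\<^sup>+x. indicator E x * g (e \<bullet> x + c) \<partial>lborel) = (\<integral>\<^sup>+x. indicator W x * g (e \<bullet> x) \<partial>lborel)"
proof -
  obtain j where j: "j \<in> Basis" "e \<bullet> j \<noteq> 0" using e euclidean_all_zero_iff by blast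
  define a where "a = \<bar>e \<bullet> j\<bar>"
  have a: "a > 0" using j by (simp add: a_def)
  define e' where "e' = (1 / a) *\<^sub>R e"
  have ee: "e = a *\<^sub>R e'" using a by (simp add: e'_def)
  have "shear_coordinates e' j (e' \<bullet> j)"
  proof
    show "(e' \<bullet> j) * (e' \<bullet> j) = 1" using j(2) by (simp add: e'_def a_def abs_if)
  qed (use j in simp_all)
  from shear_coordinates.direction_translation[OF this dim W E WV V app]
  obtain c where c: "\<And>g. g \<in> borel_measurable borel \<Longrightarrow>
    (\<integral>\<^sup>+x. indicator E x * g (e' \<bullet> x + c) \<partial>lborel) = (\<integral>\<^sup>+x. indicator W x * g (e' \<bullet> x) \<partial>lborel)" by blast
  show thesis
  proof (rule that)
    fix g :: "real \<Rightarrow> ennreal" assume g: "g \<in> borel_measurable borel"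
    then have "(\<lambda>t. g (a * t)) \<in> borel_measurable borel" by measurable
    from c[OF this] show "(\<integral>\<^sup>+x. indicator E x * g (e \<bullet> x + a * c) \<partial>lborel) = (\<integral>\<^sup>+x. indicator W x * g (e \<bullet> x) \<partial>lborel)"
      by (simp add: ee distrib_left)
  qed
qed

section \<open>Recovering the set from its marginals\<close>

text \<open>The complement of \<open>W\<close> is a union of uncountably many open half-spaces, each
  avoided almost everywhere. The Lindelof property selects countably many with the same union, so
  that the exceptional null sets can be collected.\<close>

lemma AE_in_closed_convexI:
  fixes W :: "'a::euclidean_space set"
  assumes W: "closed W" "convex W" "W \<noteq> {}" and X: "X \<in> borel_measurable M"
    and half: "\<And>e \<beta>. e \<noteq> 0 \<Longrightarrow> W \<subseteq> {x. e \<bullet> x \<le> \<beta>} \<Longrightarrow> AE x in M. e \<bullet> X x \<le> \<beta>"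
  shows "AE x in M. X x \<in> W"
proof -
  define \<H> where "\<H> = {{x. \<beta> < e \<bullet> x} | e \<beta>. e \<noteq> 0 \<and> W \<subseteq> {x. e \<bullet> x \<le> \<beta>}}"
  have op: "open S" if "S \<in> \<H>" for S
    using that by (auto simp: \<H>_def intro!: open_halfspace_gt)
  obtain \<H>' where H': "\<H>' \<subseteq> \<H>" "countable \<H>'" "\<Union>\<H>' = \<Union>\<H>" using Lindelof[of \<H>] op by blast
  have cover: "y \<in> \<Union>\<H>" if yW: "y \<notin> W" for y
  proof -
    obtain e \<beta> where eb: "e \<bullet> y < \<beta>" "\<And>x. x \<in> W \<Longrightarrow> \<beta> < e \<bullet> x"
      using separating_hyperplane_closed_point[OF W(2,1) yW] by blast
    obtain w where "w \<in> W" using W(3) by blast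
    with eb have "e \<noteq> 0" by fastforce
    then have "{x. - \<beta> < (- e) \<bullet> x} \<in> \<H>" using eb(2) unfolding \<H>_def
      by (intro CollectI exI[of _ "- e"] exI[of _ "- \<beta>"]) (auto simp: less_imp_le)
    moreover have "y \<in> {x. - \<beta> < (- e) \<bullet> x}" using eb(1) by simp
    ultimately show ?thesis by blast
  qed
  have "AE x in M. \<forall>S\<in>\<H>'. X x \<notin> S"
  proof (subst AE_ball_countable[OF H'(2)], rule ballI)
    fix S assume "S \<in> \<H>'"
    then obtain e \<beta> where "S = {x. \<beta> < e \<bullet> x}" "e \<noteq> 0" "W \<subseteq> {x. e \<bullet> x \<le> \<beta>}"
      using H'(1) by (auto simp: \<H>_def)
    then show "AE x in M. X x \<notin> S" using half[of e \<beta>] by (auto simp: not_less)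
  qed
  then show ?thesis
  proof eventually_elim
    case (elim x)
    show ?case
    proof (rule ccontr)
      assume "X x \<notin> W"
      from cover[OF this] have "X x \<in> \<Union>\<H>'" using H'(3) by simp
      with elim show False by blast
    qed
  qed
qed

theorem rigidity:
  fixes W E :: "'a::euclidean_space set" and V :: real
  assumes dim: "2 \<le> DIM('a)" and W: "compact W" "convex W" "interior W \<noteq> {}"
    and E: "E \<in> sets borel" "emeasure lborel E = ennreal V" and WV: "emeasure lborel W = ennreal V" and V: "V > 0"
    and app: "approximable W E (DIM('a) * V)"
  obtains p where "AE x in lborel. x \<in> E \<longleftrightarrow> x - p \<in> W"
proof -
  have Ws: "W \<in> sets borel" using W(1) by (simp add: borel_compact)
  obtain R where R: "\<And>x. x \<in> W \<Longrightarrow> norm x \<le> R" using compact_imp_bounded[OF W(1)] by (auto simp: bounded_iff)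
  have "\<forall>e. \<exists>c. e \<noteq> 0 \<longrightarrow> (\<forall>g\<in>borel_measurable borel.
    (\<integral>\<^sup>+x. indicator E x * g (e \<bullet> x + c) \<partial>lborel) = (\<integral>\<^sup>+x. indicator W x * g (e \<bullet> x) \<partial>lborel))"
    using linear_functional_translation[OF dim W E WV V app] by metis
  from choice[OF this] obtain c where "\<forall>e. e \<noteq> 0 \<longrightarrow> (\<forall>g\<in>borel_measurable borel.
    (\<integral>\<^sup>+x. indicator E x * g (e \<bullet> x + c e) \<partial>lborel) = (\<integral>\<^sup>+x. indicator W x * g (e \<bullet> x) \<partial>lborel))" ..
  then have c: "(\<integral>\<^sup>+x. indicator E x * g (e \<bullet> x + c e) \<partial>lborel) = (\<integral>\<^sup>+x. indicator W x * g (e \<bullet> x) \<partial>lborel)"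
    if "e \<noteq> 0" "g \<in> borel_measurable borel" for e and g :: "real \<Rightarrow> ennreal" using that by blast
  \<comment> \<open>The shifted marginal of \<open>E\<close> lives where that of \<open>W\<close>
    does; this is the translation tested on the indicator of the complement of
    \<open>A\<close>.\<close>
  have range: "AE x in lborel. x \<in> E \<longrightarrow> e \<bullet> x + c e \<in> A"
    if e: "e \<noteq> 0" and A: "A \<in> sets borel" "\<And>x. x \<in> W \<Longrightarrow> e \<bullet> x \<in> A" for e A
  proof -
    have g: "(\<lambda>t. indicator (- A) t :: ennreal) \<in> borel_measurable borel" using A(1) by simp
    have m: "(\<lambda>x. indicator E x * indicator (- A) (e \<bullet> x + c e) :: ennreal) \<in> borel_measurable lborel"
      using E(1) A(1) by measurable
    have "(\<integral>\<^sup>+x. indicator E x * indicator (- A) (e \<bullet> x + c e) \<partial>lborel) = (\<integral>\<^sup>+x. indicator W x * indicator (- A) (e \<bullet> x) \<partial>lborel)"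
      by (rule c[OF e g])
    also have "\<dots> = (\<integral>\<^sup>+(x::'a). 0 \<partial>lborel)"
      by (rule nn_integral_cong) (use A(2) in \<open>auto simp: indicator_def\<close>)
    finally have "AE x in lborel. indicator E x * indicator (- A) (e \<bullet> x + c e) = (0::ennreal)"
      using m by (simp add: nn_integral_0_iff_AE)
    then show ?thesis by eventually_elim (auto simp: indicator_def split: if_splits)
  qed
  \<comment> \<open>The barycentre of \<open>E\<close> exists only once \<open>E\<close> is
    essentially bounded. The shifts along the finitely many basis vectors already bound it.\<close>
  have "\<exists>C. AE x in lborel. x \<in> E \<longrightarrow> norm x \<le> C"
  proof -
    have "AE x in lborel. \<forall>b\<in>Basis. x \<in> E \<longrightarrow> b \<bullet> x + c b \<in> {-R..R}"
    proof (subst AE_ball_countable)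
      show "\<forall>b\<in>(Basis::'a set). AE x in lborel. x \<in> E \<longrightarrow> b \<bullet> x + c b \<in> {-R..R}"
      proof
        fix b :: 'a assume b: "b \<in> Basis"
        have "\<bar>b \<bullet> x\<bar> \<le> R" if "x \<in> W" for x
          using order.trans[OF Basis_le_norm[OF b, of x] R[OF that]] by (simp add: inner_commute)
        then show "AE x in lborel. x \<in> E \<longrightarrow> b \<bullet> x + c b \<in> {-R..R}"
          using b by (intro range abs_le_imp_mem_interval) auto
      qed
    qed (simp add: countable_finite)
    then have "AE x in lborel. x \<in> E \<longrightarrow> norm x \<le> (\<Sum>b\<in>Basis. R + \<bar>c b\<bar>)"
    proof eventually_elim
      case (elim x)
      show ?case
      proof
        assume x: "x \<in> E"
        have "norm x \<le> (\<Sum>b\<in>Basis. \<bar>x \<bullet> b\<bar>)" by (rule norm_le_l1)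
        also have "\<dots> \<le> (\<Sum>b\<in>Basis. R + \<bar>c b\<bar>)"
        proof (rule sum_mono)
          fix b :: 'a assume "b \<in> Basis"
          then have "b \<bullet> x + c b \<in> {-R..R}" using elim x by blast
          then show "\<bar>x \<bullet> b\<bar> \<le> R + \<bar>c b\<bar>" by (auto simp: inner_commute)
        qed
        finally show "norm x \<le> (\<Sum>b\<in>Basis. R + \<bar>c b\<bar>)" .
      qed
    qed
    then show ?thesis by blast
  qed
  then obtain C where C: "AE x in lborel. x \<in> E \<longrightarrow> norm x \<le> C" by blast
  have iI: "integrable lborel (indicator A :: 'a \<Rightarrow> real)" if "A \<in> sets borel" "emeasure lborel A = ennreal V" for A
    using that by simp
  have iv: "integrable lborel (\<lambda>x. indicator A x *\<^sub>R x)"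
    if "A \<in> sets borel" "emeasure lborel A = ennreal V" "AE x in lborel. x \<in> A \<longrightarrow> norm x \<le> D" for A :: "'a set" and D
  proof (rule Bochner_Integration.integrable_bound)
    show "integrable lborel (\<lambda>x. D * indicator A x)" using iI[OF that(1,2)] by simp
    show "AE x in lborel. norm (indicator A x *\<^sub>R x) \<le> norm (D * indicator A x)"
      using that(3) by eventually_elim (auto simp: indicator_def)
  qed (use that(1) in simp)
  have ivE: "integrable lborel (\<lambda>x. indicator E x *\<^sub>R x)" by (rule iv[OF E C])
  have ivW: "integrable lborel (\<lambda>x. indicator W x *\<^sub>R x)" by (rule iv[OF Ws WV]) (use R in auto)
  \<comment> \<open>The difference of the two barycentres, each being a first moment divided by the
    common volume \<open>V\<close>.\<close>
  define p where "p = (1 / V) *\<^sub>R ((\<integral>x. indicator E x *\<^sub>R x \<partial>lborel) - (\<integral>x. indicator W x *\<^sub>R x \<partial>lborel))"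
  have cp: "c e = - (e \<bullet> p)" if e: "e \<noteq> 0" for e
  proof -
    \<comment> \<open>The translation property is stated for nonnegative integrals. Adding
      \<open>L\<close>, a bound for \<open>e\<close> on \<open>W\<close>, makes the affine test
      function nonnegative on both sets before first moments are compared.\<close>
    define L where "L = norm e * R"
    have L: "\<bar>e \<bullet> x\<bar> \<le> L" if "x \<in> W" for x
      unfolding L_def using Cauchy_Schwarz_ineq2[of e x] R[OF that] by (meson mult_left_mono norm_ge_zero order.trans)
    have AE_E: "AE x in lborel. x \<in> E \<longrightarrow> e \<bullet> x + c e \<in> {-L..L}"
      by (rule range[OF e]) (simp, rule abs_le_imp_mem_interval, erule L)
    have inner: "e \<bullet> (\<integral>x. indicator A x *\<^sub>R x \<partial>lborel) = (\<integral>x. indicator A x * (e \<bullet> x) \<partial>lborel)"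
      "integrable lborel (\<lambda>x. indicator A x * (e \<bullet> x))"
      if "integrable lborel (\<lambda>x. indicator A x *\<^sub>R x)" for A
      using integral_inner_right[of e lborel "\<lambda>x. indicator A x *\<^sub>R x"] that
        integrable_inner_right[of e lborel "\<lambda>x. indicator A x *\<^sub>R x"] by simp_all
    have meas_A: "(\<integral>x. indicator A x \<partial>lborel) = V" if "A \<in> sets borel" "emeasure lborel A = ennreal V" for A :: "'a set"
      using that V by (simp add: measure_def)
    have bochner: "(\<integral>\<^sup>+x. indicator A x * ennreal (e \<bullet> x + d + L) \<partial>lborel)
        = ennreal (e \<bullet> (\<integral>x. indicator A x *\<^sub>R x \<partial>lborel) + (d + L) * V)"
      "0 \<le> e \<bullet> (\<integral>x. indicator A x *\<^sub>R x \<partial>lborel) + (d + L) * V"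
      if A: "A \<in> sets borel" "emeasure lborel A = ennreal V" and i: "integrable lborel (\<lambda>x. indicator A x *\<^sub>R x)"
        and nn: "AE x in lborel. x \<in> A \<longrightarrow> 0 \<le> e \<bullet> x + d + L" for A d
    proof -
      let ?f = "\<lambda>x. indicator A x * (e \<bullet> x) + (d + L) * indicator A x"
      have f: "integrable lborel ?f" using inner(2)[OF i] iI[OF A] by simp
      have f0: "AE x in lborel. 0 \<le> ?f x" using nn by eventually_elim (auto simp: indicator_def add.assoc)
      have fe: "(\<integral>x. ?f x \<partial>lborel) = e \<bullet> (\<integral>x. indicator A x *\<^sub>R x \<partial>lborel) + (d + L) * V"
        using inner[OF i] iI[OF A] meas_A[OF A] by simp
      have "(\<integral>\<^sup>+x. indicator A x * ennreal (e \<bullet> x + d + L) \<partial>lborel) = (\<integral>\<^sup>+x. ennreal (?f x) \<partial>lborel)"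
        by (rule nn_integral_cong) (auto simp: indicator_def add.assoc)
      also have "\<dots> = ennreal (\<integral>x. ?f x \<partial>lborel)" by (rule nn_integral_eq_integral[OF f f0])
      finally show "(\<integral>\<^sup>+x. indicator A x * ennreal (e \<bullet> x + d + L) \<partial>lborel)
        = ennreal (e \<bullet> (\<integral>x. indicator A x *\<^sub>R x \<partial>lborel) + (d + L) * V)" unfolding fe .
      show "0 \<le> e \<bullet> (\<integral>x. indicator A x *\<^sub>R x \<partial>lborel) + (d + L) * V"
        unfolding fe[symmetric] by (rule integral_nonneg_AE[OF f0])
    qed
    have nE: "AE x in lborel. x \<in> E \<longrightarrow> 0 \<le> e \<bullet> x + c e + L" using AE_E by eventually_elim auto
    have nW: "AE x in lborel. x \<in> W \<longrightarrow> 0 \<le> e \<bullet> x + 0 + L"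
    proof (rule AE_I2, rule impI)
      fix x assume "x \<in> W"
      then show "0 \<le> e \<bullet> x + 0 + L" using L[of x] by linarith
    qed
    have "(\<integral>\<^sup>+x. indicator E x * ennreal (e \<bullet> x + c e + L) \<partial>lborel) = (\<integral>\<^sup>+x. indicator W x * ennreal (e \<bullet> x + 0 + L) \<partial>lborel)"
      using c[OF e, of "\<lambda>t. ennreal (t + L)"] by simp
    then have "e \<bullet> (\<integral>x. indicator E x *\<^sub>R x \<partial>lborel) + (c e + L) * V = e \<bullet> (\<integral>x. indicator W x *\<^sub>R x \<partial>lborel) + (0 + L) * V"
      unfolding bochner(1)[OF E ivE nE] bochner(1)[OF Ws WV ivW nW]
      using bochner(2)[OF E ivE nE] bochner(2)[OF Ws WV ivW nW] by (simp only: ennreal_inj)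
    then have "c e * V = - (e \<bullet> ((\<integral>x. indicator E x *\<^sub>R x \<partial>lborel) - (\<integral>x. indicator W x *\<^sub>R x \<partial>lborel)))"
      by (simp add: inner_diff_right algebra_simps)
    also have "\<dots> = - (e \<bullet> p) * V" using V by (simp add: p_def)
    finally show ?thesis by (rule mult_right_cancel[THEN iffD1, rotated]) (use V in simp)
  qed
  \<comment> \<open>With the shift identified as a translation by \<open>p\<close>, every half-space
    containing \<open>W\<close> contains almost every \<open>x - p\<close> with \<open>x\<close> in
    \<open>E\<close>; restricting the measure to \<open>E\<close> puts this into the form of the
    half-space criterion.\<close>
  have "AE x in restrict_space lborel E. x - p \<in> W"
  proof (rule AE_in_closed_convexI)
    show "closed W" "convex W" using W by (simp_all add: compact_imp_closed)
    show "W \<noteq> {}" using W(3) interior_subset by blast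
    show "(\<lambda>x. x - p) \<in> borel_measurable (restrict_space lborel E)"
      by (rule measurable_restrict_space1) simp
    show "AE x in restrict_space lborel E. e \<bullet> (x - p) \<le> \<beta>" if "e \<noteq> 0" "W \<subseteq> {x. e \<bullet> x \<le> \<beta>}" for e \<beta>
    proof -
      have "AE x in lborel. x \<in> E \<longrightarrow> e \<bullet> x + c e \<in> {..\<beta>}" by (rule range[OF that(1)]) (use that(2) in auto)
      then have "AE x in lborel. x \<in> E \<longrightarrow> e \<bullet> (x - p) \<le> \<beta>"
        by eventually_elim (simp add: cp[OF that(1)] inner_diff_right)
      then show ?thesis using E(1) by (subst AE_restrict_space_iff) auto
    qed
  qed
  then have sub: "AE x in lborel. x \<in> E \<longrightarrow> x - p \<in> W"
    using E(1) by (subst (asm) AE_restrict_space_iff) auto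
  let ?W = "{x. x - p \<in> W}"
  have W's: "?W \<in> sets borel"
    using measurable_sets[of "\<lambda>x. x - p" borel borel W] Ws by (simp add: vimage_def)
  have "distr lborel borel (\<lambda>x. - p + x) = (lborel :: 'a measure)" by (rule lborel_distr_plus)
  then have W'V: "emeasure lborel ?W = ennreal V"
    using Ws WV emeasure_distr[of "\<lambda>x. - p + x" lborel borel W] by (simp add: vimage_def)
  \<comment> \<open>Containment up to a null set between sets of the same finite volume leaves no
    room for a difference.\<close>
  have "emeasure lborel (?W - E) = 0"
  proof -
    have "emeasure lborel (?W \<inter> E) = ennreal V"
    proof -
      have "emeasure lborel (?W \<inter> E) = emeasure lborel E"
      proof (rule emeasure_eq_AE)
        show "AE x in lborel. x \<in> ?W \<inter> E \<longleftrightarrow> x \<in> E" using sub by eventually_elim blast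
      qed (use E(1) W's in simp_all)
      then show ?thesis by (simp add: E(2))
    qed
    moreover have "emeasure lborel (?W - E) = emeasure lborel ?W - emeasure lborel (?W \<inter> E)"
    proof -
      have "?W - E = ?W - ?W \<inter> E" by blast
      then show ?thesis using emeasure_Diff[of lborel "?W \<inter> E" ?W] W's E(1) calculation by simp
    qed
    ultimately show ?thesis by (simp add: W'V)
  qed
  then have "?W - E \<in> null_sets lborel" using W's E(1) by auto
  then have "AE x in lborel. x \<notin> ?W - E" by (rule AE_not_in)
  with sub have "AE x in lborel. x \<in> E \<longleftrightarrow> x - p \<in> W" by eventually_elim auto
  then show thesis by (rule that)
qed

section \<open>Boundaries of the normalized representative and of affine images\<close>

lemma open_null_set_empty:
  fixes S :: "'a::euclidean_space set"
  assumes "open S" "emeasure lborel S = 0"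
  shows "S = {}"
proof (rule ccontr)
  assume "S \<noteq> {}"
  have "S \<in> null_sets lborel" using assms by auto
  then have "negligible S" unfolding negligible_iff_null_sets by (rule null_sets_completionI)
  with open_not_negligible[OF assms(1) \<open>S \<noteq> {}\<close>] show False by simp
qed

text \<open>The open null set \<open>E - W\<close> is empty, so \<open>E\<close> lies in the
  interior of \<open>W\<close>. A boundary point of \<open>E\<close> interior to \<open>W\<close>
  would have a ball filled by \<open>E\<close>, against the normalization. A boundary point of
  \<open>W\<close> away from the closure of \<open>E\<close> would leave a nonempty open piece of
  the interior of \<open>W\<close> uncovered, since a convex body is the closure of its
  interior.\<close>

lemma frontier_eq_of_AE_eq:
  fixes E W :: "'a::euclidean_space set"
  assumes norm: "normalized_set E" and W: "closed W" "convex W" "interior W \<noteq> {}"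
    and AE: "AE x in lborel. x \<in> E \<longleftrightarrow> x \<in> W"
  shows "frontier E = frontier W"
proof -
  have op: "open E" using norm by (simp add: normalized_set_def)
  have sets: "E \<in> sets lborel" "W \<in> sets lborel" using op W(1) by auto
  have "emeasure lborel (E - W) = 0"
  proof -
    have "emeasure lborel (E - W) = emeasure lborel ({}::'a set)"
    proof (rule emeasure_eq_AE)
      show "AE x in lborel. x \<in> E - W \<longleftrightarrow> x \<in> {}" using AE by eventually_elim blast
    qed (use sets in simp_all)
    then show ?thesis by simp
  qed
  moreover have "open (E - W)" using op W(1) by (rule open_Diff)
  ultimately have "E - W = {}" by (intro open_null_set_empty)
  then have EW: "E \<subseteq> interior W" using op by (intro interior_maximal) auto
  show ?thesis
  proof (intro equalityI subsetI)
    fix x assume x: "x \<in> frontier E"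
    have "x \<in> closure W"
      using x closure_mono[OF order.trans[OF EW interior_subset]] by (auto simp: frontier_def)
    moreover have "x \<notin> interior W"
    proof
      assume "x \<in> interior W"
      then obtain r where r: "r > 0" "ball x r \<subseteq> W" by (auto simp: mem_interior)
      have "emeasure lborel (E \<inter> ball x r) = emeasure lborel (ball x r)"
      proof (rule emeasure_eq_AE)
        show "AE y in lborel. y \<in> E \<inter> ball x r \<longleftrightarrow> y \<in> ball x r"
          using AE by eventually_elim (use r(2) in blast)
      qed (use sets in simp_all)
      moreover have "emeasure lborel (E \<inter> ball x r) < emeasure lborel (ball x r)"
        using norm x r unfolding normalized_set_def by blast
      ultimately show False by simp
    qed
    ultimately show "x \<in> frontier W" by (simp add: frontier_def)
  next
    fix x assume x: "x \<in> frontier W"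
    then have "x \<notin> E" using EW by (auto simp: frontier_def)
    moreover have "x \<in> closure E"
    proof (rule ccontr)
      assume nc: "x \<notin> closure E"
      have "x \<in> closure (interior W)"
        using x convex_closure_interior[OF W(2,3)] by (simp add: frontier_def)
      moreover have "open (- closure E)" "x \<in> - closure E" using nc by auto
      ultimately have "- closure E \<inter> interior W \<noteq> {}"
        using open_Int_closure_eq_empty[of "- closure E" "interior W"] by blast
      moreover have "emeasure lborel (- closure E \<inter> interior W) = emeasure lborel ({}::'a set)"
      proof (rule emeasure_eq_AE)
        show "AE x in lborel. x \<in> - closure E \<inter> interior W \<longleftrightarrow> x \<in> {}"
          using AE
        proof eventually_elim
          case (elim y)
          then show ?case using interior_subset[of W] closure_subset[of E] by blast
        qed
      qed simp_all
      ultimately show False using open_null_set_empty[of "- closure E \<inter> interior W"] by auto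
    qed
    ultimately show "x \<in> frontier E" using op by (simp add: frontier_def interior_open)
  qed
qed

lemma frontier_affine_image:
  fixes K :: "'a::euclidean_space set"
  assumes "l \<noteq> 0"
  shows "frontier ((\<lambda>x. p + l *\<^sub>R x) ` K) = (\<lambda>x. p + l *\<^sub>R x) ` frontier K"
proof -
  have lin: "linear (\<lambda>x::'a. l *\<^sub>R x)"
    by (rule bounded_linear.linear[OF bounded_linear_scaleR_right])
  have inj: "inj (\<lambda>x::'a. l *\<^sub>R x)" by (rule injI) (use assms in simp)
  have "frontier ((\<lambda>x. l *\<^sub>R x) ` K) = (\<lambda>x. l *\<^sub>R x) ` frontier K"
    unfolding frontier_def closure_injective_linear_image[OF lin inj, symmetric]
      interior_injective_linear_image[OF lin inj] image_set_diff[OF inj] ..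
  moreover have "(\<lambda>x. p + l *\<^sub>R x) ` A = (+) p ` (\<lambda>x. l *\<^sub>R x) ` A" for A by (simp add: image_image)
  ultimately show ?thesis by (simp add: frontier_translation)
qed

section \<open>Mollification and the perimeter\<close>

lemma Ck_on_SucI:
  assumes "\<And>x. (f has_derivative f' x) (at x)" "\<And>v. Ck_on k (\<lambda>x. f' x v) UNIV"
  shows "Ck_on (Suc k) f UNIV"
proof -
  have "frechet_derivative f (at x) = f' x" for x
    using frechet_derivative_at[OF assms(1)] by simp
  then show ?thesis using assms by (auto simp: differentiable_def)
qed

lemma Ck_on_SucD:
  assumes "Ck_on (Suc k) f UNIV"
  shows "(f has_derivative frechet_derivative f (at x)) (at x)" "Ck_on k (\<lambda>x. frechet_derivative f (at x) v) UNIV"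
  using assms frechet_derivative_works by auto

lemma Ck_on_Suc_imp: "Ck_on (Suc k) f UNIV \<Longrightarrow> Ck_on k f UNIV"
proof (induction k arbitrary: f)
  case 0
  then show ?case
    using differentiable_imp_continuous_within by (auto simp: continuous_on_eq_continuous_within)
next
  case (Suc k)
  show ?case
    by (rule Ck_on_SucI[OF Ck_on_SucD(1)[OF Suc.prems]]) (rule Suc.IH[OF Ck_on_SucD(2)[OF Suc.prems]])
qed

lemma Ck_on_const: "Ck_on k (\<lambda>x. c) UNIV"
proof (induction k arbitrary: c)
  case (Suc k)
  then show ?case by (intro Ck_on_SucI[where f'="\<lambda>_ _. 0"]) auto
qed simp

lemma Ck_on_linear: "bounded_linear f \<Longrightarrow> Ck_on k f UNIV"
proof (cases k)
  case 0
  assume "bounded_linear f"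
  then show ?thesis using 0 by (simp add: linear_continuous_on)
next
  case (Suc k')
  assume "bounded_linear f"
  then show ?thesis unfolding Suc
    by (intro Ck_on_SucI[where f'="\<lambda>_. f"] bounded_linear_imp_has_derivative Ck_on_const)
qed

lemma Ck_on_add: "Ck_on k f UNIV \<Longrightarrow> Ck_on k g UNIV \<Longrightarrow> Ck_on k (\<lambda>x. f x + g x) UNIV"
proof (induction k arbitrary: f g)
  case 0 then show ?case by (simp add: continuous_on_add)
next
  case (Suc k)
  show ?case
    by (rule Ck_on_SucI[OF has_derivative_add[OF Ck_on_SucD(1)[OF Suc.prems(1)] Ck_on_SucD(1)[OF Suc.prems(2)]]])
       (rule Suc.IH[OF Ck_on_SucD(2)[OF Suc.prems(1)] Ck_on_SucD(2)[OF Suc.prems(2)]])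
qed

text \<open>The product rule pairs a derivative with the undifferentiated other factor, which has to
  be lowered from order \<open>Suc k\<close> to \<open>k\<close> before the induction hypothesis
  applies.\<close>

lemma Ck_on_bilinear:
  assumes b: "bounded_bilinear p"
  shows "Ck_on k f UNIV \<Longrightarrow> Ck_on k g UNIV \<Longrightarrow> Ck_on k (\<lambda>x. p (f x) (g x)) UNIV"
proof (induction k arbitrary: f g)
  case 0 then show ?case by (simp add: bounded_bilinear.continuous_on[OF b])
next
  case (Suc k)
  note f = Suc.prems(1) and g = Suc.prems(2)
  show ?case
    by (rule Ck_on_SucI[OF bounded_bilinear.FDERIV[OF b Ck_on_SucD(1)[OF f] Ck_on_SucD(1)[OF g]]])
       (intro Ck_on_add Suc.IH Ck_on_SucD(2)[OF f] Ck_on_SucD(2)[OF g] Ck_on_Suc_imp[OF f] Ck_on_Suc_imp[OF g])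
qed

lemmas Ck_on_mult = Ck_on_bilinear[OF bounded_bilinear_mult]

section \<open>A smooth function vanishing on a half-line\<close>

text \<open>Dividing by all powers of \<open>t\<close> gives a family whose derivatives are linear
  combinations of its own members, so smoothness across 0 follows by one induction instead of a
  formula for all derivatives.\<close>

definition flat_exp :: "nat \<Rightarrow> real \<Rightarrow> real" where
  "flat_exp m t = (if t > 0 then exp (- 1 / t) / t ^ m else 0)"

lemma flat_exp_nonneg: "0 \<le> flat_exp m t" by (simp add: flat_exp_def)

text \<open>A single term of the exponential series, that of order \<open>m + 1\<close> at
  \<open>1 / t\<close>, beats the singular power and leaves one factor \<open>t\<close>. This
  provides continuity and differentiability at 0.\<close>

lemma flat_exp_bound: "flat_exp m t \<le> fact (Suc m) * \<bar>t\<bar>"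
proof (cases "t > 0")
  case True
  have "(1 / t) ^ Suc m / fact (Suc m) \<le> exp (1 / t)"
  proof -
    have "(1 / t) ^ Suc m / fact (Suc m) = (\<Sum>n\<in>{Suc m}. (1 / t) ^ n / fact n)" by simp
    also have "\<dots> \<le> (\<Sum>n. (1 / t) ^ n / fact n)"
      using True summable_exp_generic[of "1 / t"] by (intro sum_le_suminf) (auto simp: field_simps)
    also have "\<dots> = exp (1 / t)" by (simp add: exp_def field_simps)
    finally show ?thesis .
  qed
  then have "exp (- 1 / t) * ((1 / t) ^ Suc m / fact (Suc m)) \<le> exp (- 1 / t) * exp (1 / t)"
    by (intro mult_left_mono) simp_all
  also have "\<dots> = 1" by (simp add: exp_add[symmetric])
  finally have le: "exp (- 1 / t) * ((1 / t) ^ Suc m / fact (Suc m)) \<le> 1" .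
  define F :: real where "F = fact (Suc m)"
  have F: "F > 0" unfolding F_def by (rule fact_gt_zero)
  have "exp (- 1 / t) / t ^ m = (F * t) * (exp (- 1 / t) * ((1 / t) ^ Suc m / F))"
    using True F by (simp add: field_simps)
  also have "\<dots> \<le> F * t"
    using mult_left_mono[OF le[folded F_def], of "F * t"] True F by simp
  finally show ?thesis using True by (simp add: flat_exp_def F_def del: fact_Suc)
next
  case False
  have "0 \<le> fact (Suc m) * \<bar>t\<bar>" by (intro mult_nonneg_nonneg fact_ge_zero abs_ge_zero)
  then show ?thesis using False by (simp add: flat_exp_def del: fact_Suc)
qed

lemma flat_exp_derivative:
  "(flat_exp m has_real_derivative (flat_exp (m + 2) t - m * flat_exp (m + 1) t)) (at t)"
proof -
  consider "t > 0" | "t < 0" | "t = 0" by linarith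
  then show ?thesis
  proof cases
    case 1
    have "((\<lambda>t. exp (- 1 / t) / t ^ m) has_real_derivative (flat_exp (m + 2) t - m * flat_exp (m + 1) t)) (at t)"
      using 1 by (auto intro!: derivative_eq_intros simp: flat_exp_def field_simps power_add power2_eq_square)
         (cases m, simp_all add: field_simps)
    then show ?thesis
      by (rule has_field_derivative_transform_within_open[of _ _ _ "{0<..}"]) (use 1 in \<open>auto simp: flat_exp_def\<close>)
  next
    case 2
    have "((\<lambda>t. 0) has_real_derivative (flat_exp (m + 2) t - m * flat_exp (m + 1) t)) (at t)"
      using 2 by (simp add: flat_exp_def)
    then show ?thesis
      by (rule has_field_derivative_transform_within_open[of _ _ _ "{..<0}"]) (use 2 in \<open>auto simp: flat_exp_def\<close>)
  next
    case 3
    have "(\<lambda>h. (flat_exp m (0 + h) - flat_exp m 0) / h) \<midarrow>0\<rightarrow> 0"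
    proof (rule Lim_null_comparison)
      \<comment> \<open>The difference quotient at 0 is the next member of the family, which the
        linear bound sends to 0.\<close>
      have "(flat_exp m (0 + h) - flat_exp m 0) / h = flat_exp (Suc m) h" for h
        by (simp add: flat_exp_def)
      then show "\<forall>\<^sub>F h in at 0. norm ((flat_exp m (0 + h) - flat_exp m 0) / h) \<le> fact (Suc (Suc m)) * \<bar>h\<bar>"
        using flat_exp_bound[of "Suc m"] flat_exp_nonneg[of "Suc m"] by (intro always_eventually allI) (simp del: fact_Suc)
      show "(\<lambda>h::real. fact (Suc (Suc m)) * \<bar>h\<bar>) \<midarrow>0\<rightarrow> 0"
        by (rule tendsto_eq_intros refl)+ simp
    qed
    then show ?thesis using 3 by (simp add: DERIV_def flat_exp_def)
  qed
qed

lemma Ck_on_flat_exp: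
  assumes "\<And>k. Ck_on k g UNIV"
  shows "Ck_on k (\<lambda>x. flat_exp m (g x)) UNIV"
proof (induction k arbitrary: m)
  case 0
  have "continuous_on UNIV (flat_exp m)"
    by (intro continuous_at_imp_continuous_on ballI DERIV_isCont[OF flat_exp_derivative])
  moreover have "continuous_on UNIV g" using assms[of 0] by simp
  ultimately show ?case by (auto intro: continuous_on_compose2)
next
  case (Suc k)
  have d: "((\<lambda>x. flat_exp m (g x)) has_derivative
      (\<lambda>v. (flat_exp (m + 2) (g x) + (- real m) * flat_exp (m + 1) (g x)) * frechet_derivative g (at x) v)) (at x)" for x
  proof -
    have "(flat_exp m has_derivative (*) (flat_exp (m + 2) (g x) - m * flat_exp (m + 1) (g x))) (at (g x))"
      using flat_exp_derivative by (simp add: has_field_derivative_def)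
    from has_derivative_compose[OF Ck_on_SucD(1)[OF assms] this] show ?thesis by simp
  qed
  show ?case
    by (rule Ck_on_SucI[OF d]) (intro Ck_on_mult Ck_on_add Ck_on_const Suc.IH Ck_on_SucD(2)[OF assms])
qed

section \<open>Test functions and uniform differentiability\<close>

definition test_function :: "('a::euclidean_space \<Rightarrow> real) \<Rightarrow> bool" where
  "test_function \<rho> \<longleftrightarrow> smooth_on \<rho> UNIV \<and> (\<exists>R. \<forall>x. R \<le> norm x \<longrightarrow> \<rho> x = 0)"

abbreviation FD :: "('a::euclidean_space \<Rightarrow> 'b::real_normed_vector) \<Rightarrow> 'a \<Rightarrow> 'a \<Rightarrow> 'b" where
  "FD f x \<equiv> frechet_derivative f (at x)"

lemma smooth_on_has_derivative: "smooth_on f UNIV \<Longrightarrow> (f has_derivative FD f x) (at x)"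
  unfolding smooth_on_def using Ck_on_SucD(1) by blast

lemma smooth_on_FD: "smooth_on f UNIV \<Longrightarrow> smooth_on (\<lambda>x. FD f x v) UNIV"
  unfolding smooth_on_def using Ck_on_SucD(2) by blast

lemma smooth_on_continuous: "smooth_on f UNIV \<Longrightarrow> continuous_on UNIV f"
  unfolding smooth_on_def using Ck_on.simps(1) by blast

lemma FD_zero_outside:
  assumes "\<And>x. R \<le> norm x \<Longrightarrow> f x = 0" "norm x > R"
  shows "FD f x = (\<lambda>_. 0)"
proof -
  have "open {y::'a::euclidean_space. norm y > R}" by (intro open_Collect_less continuous_intros)
  then have "(f has_derivative (\<lambda>_. 0)) (at x)"
    by (rule has_derivative_transform_within_open[OF has_derivative_const[of 0]]) (use assms in auto)
  then show ?thesis using frechet_derivative_at by metis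
qed

lemma test_function_FD:
  assumes "test_function \<rho>"
  shows "test_function (\<lambda>x. FD \<rho> x v)"
proof -
  obtain R where "\<And>x. R \<le> norm x \<Longrightarrow> \<rho> x = 0" using assms by (auto simp: test_function_def)
  from FD_zero_outside[OF this] have "FD \<rho> x v = 0" if "R + 1 \<le> norm x" for x using that by force
  then show ?thesis using assms smooth_on_FD unfolding test_function_def by blast
qed

lemma compactly_supported_bounded:
  fixes f :: "'a::euclidean_space \<Rightarrow> 'b::real_normed_vector"
  assumes "continuous_on UNIV f" "\<And>x. R \<le> norm x \<Longrightarrow> f x = 0"
  obtains C where "\<And>x. norm (f x) \<le> C" "C > 0"
proof -
  have "compact (f ` cball 0 R)"
    by (intro compact_continuous_image continuous_on_subset[OF assms(1)]) auto
  then have "bounded (f ` cball 0 R)" by (rule compact_imp_bounded)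
  then obtain C where "\<forall>y\<in>f ` cball 0 R. norm y \<le> C" unfolding bounded_iff ..
  then have C: "norm (f x) \<le> C" if "x \<in> cball 0 R" for x using that by blast
  have "norm (f x) \<le> \<bar>C\<bar> + 1" for x
    using C[of x] assms(2)[of x] by (cases "R \<le> norm x") auto
  then show thesis by (intro that[of "\<bar>C\<bar> + 1"]) auto
qed

lemma test_function_bounded:
  assumes "test_function \<rho>"
  obtains C where "\<And>x. \<bar>\<rho> x\<bar> \<le> C" "C > 0"
proof -
  obtain R where R: "\<And>x. R \<le> norm x \<Longrightarrow> \<rho> x = 0" using assms by (auto simp: test_function_def)
  have c: "continuous_on UNIV \<rho>" using assms smooth_on_continuous by (auto simp: test_function_def)
  obtain C where "\<And>x. norm (\<rho> x) \<le> C" "C > 0" using compactly_supported_bounded[OF c R] by blast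
  then show thesis by (intro that[of C]) simp_all
qed

lemma test_function_uniformly_continuous:
  assumes "test_function \<rho>"
  shows "uniformly_continuous_on UNIV \<rho>"
  unfolding uniformly_continuous_on_def
proof (intro allI impI)
  fix e :: real assume e: "e > 0"
  obtain R where R: "\<And>x. R \<le> norm x \<Longrightarrow> \<rho> x = 0" using assms by (auto simp: test_function_def)
  have "uniformly_continuous_on (cball 0 (R + 1)) \<rho>"
    by (intro compact_uniformly_continuous continuous_on_subset[OF smooth_on_continuous])
       (use assms in \<open>auto simp: test_function_def\<close>)
  then obtain d where d: "d > 0" "\<And>x y. x \<in> cball 0 (R + 1) \<Longrightarrow> y \<in> cball 0 (R + 1) \<Longrightarrow> dist y x < d \<Longrightarrow> dist (\<rho> y) (\<rho> x) < e"
    using e unfolding uniformly_continuous_on_def by metis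
  show "\<exists>d>0. \<forall>x\<in>UNIV. \<forall>y\<in>UNIV. dist y x < d \<longrightarrow> dist (\<rho> y) (\<rho> x) < e"
  \<comment> \<open>For points closer than 1, if one of them leaves the ball of radius
    \<open>R + 1\<close>, then both lie outside radius \<open>R\<close>, where the function is
    0.\<close>
  proof (intro exI[of _ "min d 1"] conjI ballI impI)
    fix x y :: 'a assume xy: "dist y x < min d 1"
    show "dist (\<rho> y) (\<rho> x) < e"
    proof (cases "norm x \<le> R + 1 \<and> norm y \<le> R + 1")
      case True then show ?thesis using d(2)[of x y] xy by simp
    next
      case False
      have "\<bar>norm y - norm x\<bar> \<le> dist y x" by (simp add: dist_norm norm_triangle_ineq3)
      then have "R \<le> norm x" "R \<le> norm y" using False xy by auto
      then show ?thesis using R e by simp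
    qed
  qed (use d in simp)
qed

text \<open>The mean value theorem on the segment, combined with uniform continuity of the partial
  derivatives. Uniformity in the base point is what allows the first order expansion to be
  integrated, in convolutions and over balls.\<close>

lemma test_function_uniform_derivative:
  assumes \<rho>: "test_function \<rho>" and e: "e > 0"
  obtains d where "d > 0" "\<And>z h. norm h < d \<Longrightarrow> \<bar>\<rho> (z + h) - \<rho> z - FD \<rho> z h\<bar> \<le> e * norm h"
proof -
  let ?N = "real DIM('a)"
  have N: "?N > 0" by simp
  have "\<exists>d>0. \<forall>x y. dist y x < d \<longrightarrow> dist (FD \<rho> y b) (FD \<rho> x b) < e / ?N" for b
  proof -
    have "e / ?N > 0" using e N by simp
    with test_function_uniformly_continuous[OF test_function_FD[OF \<rho>, of b]]
    show ?thesis unfolding uniformly_continuous_on_def by simp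
  qed
  then have "\<exists>d. \<forall>b. d b > 0 \<and> (\<forall>x y. dist y x < d b \<longrightarrow> dist (FD \<rho> y b) (FD \<rho> x b) < e / ?N)"
    by (intro choice) simp
  then obtain d where d: "\<And>b. b \<in> Basis \<Longrightarrow> d b > 0"
    "\<And>b x y. b \<in> Basis \<Longrightarrow> dist y x < d b \<Longrightarrow> dist (FD \<rho> y b) (FD \<rho> x b) < e / ?N" by blast
  define d0 where "d0 = Min (d ` Basis)"
  have d0: "d0 > 0" "\<And>b. b \<in> Basis \<Longrightarrow> d0 \<le> d b" using d(1) by (auto simp: d0_def)
  have der: "(\<rho> has_derivative FD \<rho> x) (at x)" for x using \<rho> smooth_on_has_derivative by (auto simp: test_function_def)
  have "\<bar>\<rho> (z + h) - \<rho> z - FD \<rho> z h\<bar> \<le> e * norm h" if h: "norm h < d0" for z h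
  proof -
    have "\<exists>t\<in>{0<..<1}. \<rho> (z + 1 *\<^sub>R h) - \<rho> (z + 0 *\<^sub>R h) = FD \<rho> (z + t *\<^sub>R h) ((1 - 0) *\<^sub>R h)"
    proof -
      have "\<exists>t\<in>{0<..<1}. (\<lambda>t. \<rho> (z + t *\<^sub>R h)) 1 - (\<lambda>t. \<rho> (z + t *\<^sub>R h)) 0 = (\<lambda>s. FD \<rho> (z + t *\<^sub>R h) (s *\<^sub>R h)) (1 - 0)"
      proof (rule mvt_simple)
        fix t :: real
        have "((\<lambda>t. z + t *\<^sub>R h) has_derivative (\<lambda>s. s *\<^sub>R h)) (at t within {0..1})" by (auto intro!: derivative_eq_intros)
        from has_derivative_compose[OF this der] show "((\<lambda>t. \<rho> (z + t *\<^sub>R h)) has_derivative (\<lambda>s. FD \<rho> (z + t *\<^sub>R h) (s *\<^sub>R h))) (at t within {0..1})" .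
      qed simp
      then show ?thesis by simp
    qed
    then obtain t where t: "0 < t" "t < 1" "\<rho> (z + h) - \<rho> z = FD \<rho> (z + t *\<^sub>R h) h" by auto
    have lin: "FD \<rho> x h = (\<Sum>b\<in>Basis. (h \<bullet> b) * FD \<rho> x b)" for x
    proof -
      have l: "linear (FD \<rho> x)" by (rule has_derivative_linear[OF der])
      have "FD \<rho> x h = FD \<rho> x (\<Sum>b\<in>Basis. (h \<bullet> b) *\<^sub>R b)" by (simp add: euclidean_representation)
      also have "\<dots> = (\<Sum>b\<in>Basis. (h \<bullet> b) * FD \<rho> x b)" by (simp add: linear_sum[OF l] linear_scale[OF l])
      finally show ?thesis .
    qed
    have "\<bar>FD \<rho> (z + t *\<^sub>R h) h - FD \<rho> z h\<bar> = \<bar>\<Sum>b\<in>Basis. (h \<bullet> b) * (FD \<rho> (z + t *\<^sub>R h) b - FD \<rho> z b)\<bar>"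
      by (simp add: lin sum_subtractf right_diff_distrib)
    also have "\<dots> \<le> (\<Sum>b\<in>(Basis::'a set). norm h * (e / ?N))"
    proof (rule order.trans[OF sum_abs sum_mono])
      fix b :: 'a assume b: "b \<in> Basis"
      have "norm (t *\<^sub>R h) \<le> norm h" using t by (simp add: mult_left_le_one_le)
      then have "dist (z + t *\<^sub>R h) z < d b" using h d0(2)[OF b] by (simp add: dist_norm)
      then have "\<bar>FD \<rho> (z + t *\<^sub>R h) b - FD \<rho> z b\<bar> \<le> e / ?N" using d(2)[OF b] by (simp add: dist_real_def less_imp_le)
      then show "\<bar>(h \<bullet> b) * (FD \<rho> (z + t *\<^sub>R h) b - FD \<rho> z b)\<bar> \<le> norm h * (e / ?N)"
        unfolding abs_mult using Basis_le_norm[OF b, of h] by (intro mult_mono) auto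
    qed
    also have "\<dots> = e * norm h" by simp
    finally show ?thesis by (simp add: t(3))
  qed
  then show thesis using that d0(1) by blast
qed

section \<open>Convolution with test functions\<close>

definition conv :: "('a::euclidean_space \<Rightarrow> real) \<Rightarrow> ('a \<Rightarrow> 'b::euclidean_space) \<Rightarrow> 'a \<Rightarrow> 'b" where
  "conv \<rho> f x = (\<integral>y. \<rho> (x - y) *\<^sub>R f y \<partial>lborel)"

lemma test_function_continuous: "test_function \<rho> \<Longrightarrow> continuous_on UNIV \<rho>"
  using smooth_on_continuous by (auto simp: test_function_def)

lemma test_function_measurable: "test_function \<rho> \<Longrightarrow> \<rho> \<in> borel_measurable borel"
  by (rule borel_measurable_continuous_onI[OF test_function_continuous])

lemma test_function_has_derivative: "test_function \<rho> \<Longrightarrow> (\<rho> has_derivative FD \<rho> x) (at x)"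
  by (simp add: test_function_def smooth_on_has_derivative)

lemma FD_bounded:
  assumes "test_function \<rho>"
  obtains C where "\<And>x v. \<bar>FD \<rho> x v\<bar> \<le> C * norm v" "C > 0"
proof -
  have "\<exists>C. (\<forall>x. \<bar>FD \<rho> x b\<bar> \<le> C) \<and> C > 0" for b
    using test_function_bounded[OF test_function_FD[OF assms, of b]] by blast
  then have "\<exists>C. \<forall>b. (\<forall>x. \<bar>FD \<rho> x b\<bar> \<le> C b) \<and> C b > 0" by (intro choice) simp
  then obtain C where C: "\<And>b x. \<bar>FD \<rho> x b\<bar> \<le> C b" "\<And>b. C b > 0" by blast
  have "\<bar>FD \<rho> x v\<bar> \<le> (\<Sum>b\<in>Basis. C b) * norm v" for x v
  proof -
    have l: "linear (FD \<rho> x)" by (rule has_derivative_linear[OF test_function_has_derivative[OF assms]])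
    have "FD \<rho> x v = FD \<rho> x (\<Sum>b\<in>Basis. (v \<bullet> b) *\<^sub>R b)" by (simp add: euclidean_representation)
    also have "\<dots> = (\<Sum>b\<in>Basis. (v \<bullet> b) * FD \<rho> x b)" by (simp add: linear_sum[OF l] linear_scale[OF l])
    also have "\<bar>\<dots>\<bar> \<le> (\<Sum>b\<in>Basis. norm v * C b)"
    proof (rule order.trans[OF sum_abs sum_mono])
      fix b :: 'a assume b: "b \<in> Basis"
      show "\<bar>(v \<bullet> b) * FD \<rho> x b\<bar> \<le> norm v * C b"
        unfolding abs_mult using Basis_le_norm[OF b, of v] C(1)[of x b] by (intro mult_mono) auto
    qed
    finally show ?thesis by (simp add: sum_distrib_left mult.commute)
  qed
  moreover have "(\<Sum>b\<in>Basis. C b) > 0" by (rule sum_pos) (auto simp: C(2))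
  ultimately show thesis by (rule that)
qed

lemma conv_integrable:
  fixes f :: "'a::euclidean_space \<Rightarrow> 'b::euclidean_space"
  assumes \<rho>: "\<rho> \<in> borel_measurable borel" "\<And>x. \<bar>\<rho> x\<bar> \<le> C" and f: "integrable lborel f"
  shows "integrable lborel (\<lambda>y. \<rho> (x - y) *\<^sub>R f y)"
proof (rule Bochner_Integration.integrable_bound)
  show "integrable lborel (\<lambda>y. C *\<^sub>R f y)" using f by simp
  have "(\<lambda>y. \<rho> (x - y)) \<in> borel_measurable borel" using \<rho>(1) by measurable
  then show "(\<lambda>y. \<rho> (x - y) *\<^sub>R f y) \<in> borel_measurable lborel"
    using f by (intro borel_measurable_scaleR) simp_all
  show "AE y in lborel. norm (\<rho> (x - y) *\<^sub>R f y) \<le> norm (C *\<^sub>R f y)"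
    using order.trans[OF \<rho>(2) abs_ge_self] by (intro AE_I2) (simp add: mult_right_mono)
qed

lemma test_function_conv_integrable:
  fixes f :: "'a::euclidean_space \<Rightarrow> 'b::euclidean_space"
  assumes "test_function \<rho>" "integrable lborel f"
  shows "integrable lborel (\<lambda>y. \<rho> (x - y) *\<^sub>R f y)"
proof -
  obtain C where "\<And>x. \<bar>\<rho> x\<bar> \<le> C" using test_function_bounded[OF assms(1)] by blast
  then show ?thesis by (rule conv_integrable[OF test_function_measurable[OF assms(1)] _ assms(2)])
qed

lemma conv_uniform_derivative:
  fixes f :: "'a::euclidean_space \<Rightarrow> 'b::euclidean_space"
  assumes \<rho>: "test_function \<rho>" and f: "integrable lborel f" and e: "e > 0"
  obtains d where "d > 0"
    "\<And>x h. norm h < d \<Longrightarrow> norm (conv \<rho> f (x + h) - conv \<rho> f x - conv (\<lambda>z. FD \<rho> z h) f x) \<le> e * norm h"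
proof -
  \<comment> \<open>The summand 1 keeps the divisor positive when \<open>f\<close> vanishes almost
    everywhere.\<close>
  define L where "L = (\<integral>y. norm (f y) \<partial>lborel) + 1"
  have L: "L > 0" by (simp add: L_def add_nonneg_pos)
  obtain d where d: "d > 0" "\<And>z h. norm h < d \<Longrightarrow> \<bar>\<rho> (z + h) - \<rho> z - FD \<rho> z h\<bar> \<le> e / L * norm h"
    using test_function_uniform_derivative[OF \<rho> divide_pos_pos[OF e L]] by blast
  have "norm (conv \<rho> f (x + h) - conv \<rho> f x - conv (\<lambda>z. FD \<rho> z h) f x) \<le> e * norm h" if h: "norm h < d" for x h
  proof -
    note i1 = test_function_conv_integrable[OF \<rho> f]
    note i2 = test_function_conv_integrable[OF test_function_FD[OF \<rho>] f]
    have "conv \<rho> f (x + h) - conv \<rho> f x - conv (\<lambda>z. FD \<rho> z h) f x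
      = (\<integral>y. \<rho> (x + h - y) *\<^sub>R f y - \<rho> (x - y) *\<^sub>R f y - FD \<rho> (x - y) h *\<^sub>R f y \<partial>lborel)"
      unfolding conv_def using i1 i2 by simp
    also have "\<dots> = (\<integral>y. (\<rho> ((x - y) + h) - \<rho> (x - y) - FD \<rho> (x - y) h) *\<^sub>R f y \<partial>lborel)"
      by (rule Bochner_Integration.integral_cong) (simp_all add: algebra_simps)
    also have "norm \<dots> \<le> (\<integral>y. e / L * norm h * norm (f y) \<partial>lborel)"
    proof (rule Bochner_Integration.integral_norm_bound_integral)
      show "integrable lborel (\<lambda>y. (\<rho> ((x - y) + h) - \<rho> (x - y) - FD \<rho> (x - y) h) *\<^sub>R f y)"
      proof -
        have "integrable lborel (\<lambda>y. \<rho> (x + h - y) *\<^sub>R f y - \<rho> (x - y) *\<^sub>R f y - FD \<rho> (x - y) h *\<^sub>R f y)"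
          using i1 i2 by simp
        then show ?thesis by (simp add: algebra_simps)
      qed
      show "integrable lborel (\<lambda>y. e / L * norm h * norm (f y))" using f by simp
      show "norm ((\<rho> ((x - y) + h) - \<rho> (x - y) - FD \<rho> (x - y) h) *\<^sub>R f y) \<le> e / L * norm h * norm (f y)" for y
        using mult_right_mono[OF d(2)[OF h, of "x - y"] norm_ge_zero[of "f y"]] by simp
    qed
    also have "\<dots> = e * norm h * ((\<integral>y. norm (f y) \<partial>lborel) / L)" by simp
    also have "\<dots> \<le> e * norm h * 1"
    proof (rule mult_left_mono)
      show "(\<integral>y. norm (f y) \<partial>lborel) / L \<le> 1" using L by (simp add: L_def)
    qed (use e in simp)
    finally show ?thesis by simp
  qed
  then show thesis using that d(1) by blast
qed

lemma conv_has_derivative: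
  fixes f :: "'a::euclidean_space \<Rightarrow> 'b::euclidean_space"
  assumes \<rho>: "test_function \<rho>" and f: "integrable lborel f"
  shows "(conv \<rho> f has_derivative (\<lambda>h. conv (\<lambda>z. FD \<rho> z h) f x)) (at x)"
proof (rule has_derivativeI_sandwich[of 1])
  note i2 = test_function_conv_integrable[OF test_function_FD[OF \<rho>] f]
  obtain C where C: "\<And>x v. \<bar>FD \<rho> x v\<bar> \<le> C * norm v" "C > 0" using FD_bounded[OF \<rho>] by blast
  have l: "linear (FD \<rho> z)" for z by (rule has_derivative_linear[OF test_function_has_derivative[OF \<rho>]])
  show "bounded_linear (\<lambda>h. conv (\<lambda>z. FD \<rho> z h) f x)"
  proof (rule bounded_linear_intro)
    show "conv (\<lambda>z. FD \<rho> z (h + k)) f x = conv (\<lambda>z. FD \<rho> z h) f x + conv (\<lambda>z. FD \<rho> z k) f x" for h k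
      unfolding conv_def using i2 by (simp add: linear_add[OF l] scaleR_add_left)
    show "conv (\<lambda>z. FD \<rho> z (r *\<^sub>R h)) f x = r *\<^sub>R conv (\<lambda>z. FD \<rho> z h) f x" for r h
    proof -
      have "FD \<rho> z (r *\<^sub>R h) *\<^sub>R f y = r *\<^sub>R (FD \<rho> z h *\<^sub>R f y)" for z y by (simp add: linear_scale[OF l])
      then show ?thesis unfolding conv_def by (simp only: integral_scaleR_right)
    qed
    show "norm (conv (\<lambda>z. FD \<rho> z h) f x) \<le> norm h * (C * (\<integral>y. norm (f y) \<partial>lborel))" for h
    proof -
      have "norm (conv (\<lambda>z. FD \<rho> z h) f x) \<le> (\<integral>y. C * norm h * norm (f y) \<partial>lborel)"
        unfolding conv_def
      proof (rule Bochner_Integration.integral_norm_bound_integral[OF i2])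
        show "integrable lborel (\<lambda>y. C * norm h * norm (f y))" using f by simp
        show "norm (FD \<rho> (x - y) h *\<^sub>R f y) \<le> C * norm h * norm (f y)" for y
          using mult_right_mono[OF C(1)[of "x - y" h] norm_ge_zero[of "f y"]] by simp
      qed
      then show ?thesis by (simp add: ac_simps)
    qed
  qed
  let ?q = "\<lambda>y. norm (conv \<rho> f y - conv \<rho> f x - conv (\<lambda>z. FD \<rho> z (y - x)) f x) / norm (y - x)"
  show "(?q \<longlongrightarrow> 0) (at x)"
  proof (rule tendstoI)
    fix e :: real assume e: "e > 0"
    obtain d where d: "d > 0"
      "\<And>x h. norm h < d \<Longrightarrow> norm (conv \<rho> f (x + h) - conv \<rho> f x - conv (\<lambda>z. FD \<rho> z h) f x) \<le> e / 2 * norm h"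
      using conv_uniform_derivative[OF \<rho> f half_gt_zero[OF e]] by blast
    show "\<forall>\<^sub>F y in at x. dist (?q y) 0 < e"
      unfolding eventually_at
    proof (intro exI[of _ d] conjI ballI impI d(1))
      fix y assume y: "y \<noteq> x \<and> dist y x < d"
      then have n: "norm (y - x) > 0" "norm (y - x) < d" by (simp_all add: dist_norm)
      have "?q y \<le> e / 2" using d(2)[OF n(2), of x] n(1) by (simp add: divide_le_eq)
      then have "?q y < e" using e by linarith
      then show "dist (?q y) 0 < e" by simp
    qed
  qed
  show "norm (conv \<rho> f y - conv \<rho> f x - conv (\<lambda>z. FD \<rho> z (y - x)) f x) / norm (y - x) \<le> ?q y" for y by simp
qed simp

lemma FD_conv: "test_function \<rho> \<Longrightarrow> integrable lborel f \<Longrightarrow> FD (conv \<rho> f) x = (\<lambda>h. conv (\<lambda>z. FD \<rho> z h) f x)"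
  by (rule frechet_derivative_at[OF conv_has_derivative, symmetric])

text \<open>Every derivative falls on the kernel, and partial derivatives of test functions are test
  functions; hence the induction with the kernel left free.\<close>

lemma smooth_on_conv:
  fixes f :: "'a::euclidean_space \<Rightarrow> 'b::euclidean_space"
  assumes \<rho>: "test_function \<rho>" and f: "integrable lborel f"
  shows "smooth_on (conv \<rho> f) UNIV"
  unfolding smooth_on_def
proof
  fix k show "Ck_on k (conv \<rho> f) UNIV"
    using \<rho>
  proof (induction k arbitrary: \<rho>)
    case 0
    then show ?case
      using has_derivative_continuous[OF conv_has_derivative[OF 0 f]] by (simp add: continuous_at_imp_continuous_on)
  next
    case (Suc k)
    show ?case
      by (rule Ck_on_SucI[OF conv_has_derivative[OF Suc.prems f]]) (rule Suc.IH[OF test_function_FD[OF Suc.prems]])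
  qed
qed

lemma conv_zero_outside:
  assumes "\<And>x. R \<le> norm x \<Longrightarrow> \<rho> x = 0" "\<And>x. S < norm x \<Longrightarrow> f x = 0" "R + S \<le> norm x"
  shows "conv \<rho> f x = 0"
proof -
  have z: "\<rho> (x - y) *\<^sub>R f y = 0" for y
  proof (cases "norm y > S")
    case False
    have "norm x \<le> norm (x - y) + norm y" using norm_triangle_ineq[of "x - y" y] by simp
    then have "R \<le> norm (x - y)" using False assms(3) by linarith
    then show ?thesis using assms(1) by simp
  qed (use assms(2) in simp)
  show ?thesis unfolding conv_def z by simp
qed

lemma distr_reflect: "distr lborel borel (\<lambda>y. x - y) = (lborel :: 'a::euclidean_space measure)"
  using lborel_affine[of "-1" x] by (simp add: density_1)

lemma integral_reflect:
  fixes f :: "'a::euclidean_space \<Rightarrow> 'b::euclidean_space"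
  assumes "f \<in> borel_measurable borel"
  shows "(\<integral>y. f (x - y) \<partial>lborel) = (\<integral>y. f y \<partial>lborel)"
  by (subst (2) distr_reflect[of x, symmetric], subst integral_distr) (use assms in simp_all)

lemma integrable_reflect:
  fixes f :: "'a::euclidean_space \<Rightarrow> 'b::euclidean_space"
  assumes "integrable lborel f"
  shows "integrable lborel (\<lambda>y. f (x - y))"
  by (rule integrable_distr[of "\<lambda>y. x - y" lborel borel]) (simp_all add: distr_reflect assms)

lemma test_function_integrable:
  assumes "test_function \<rho>" shows "integrable lborel \<rho>"
proof -
  obtain R where R: "\<And>x. R \<le> norm x \<Longrightarrow> \<rho> x = 0" using assms by (auto simp: test_function_def)
  obtain C where C: "\<And>x. \<bar>\<rho> x\<bar> \<le> C" "C > 0" using test_function_bounded[OF assms] by blast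
  show ?thesis
  proof (rule Bochner_Integration.integrable_bound)
    show "integrable lborel (\<lambda>x::'a. C * indicator (cball 0 R) x)"
      using emeasure_lborel_cball_finite by (intro integrable_mult_right integrable_real_indicator) auto
    show "AE x in lborel. norm (\<rho> x) \<le> norm (C * indicator (cball 0 R) x)"
      using C R by (intro AE_I2) (auto simp: indicator_def)
  qed (simp add: test_function_measurable[OF assms])
qed

section \<open>Mollifiers, mollified fields and mollified indicators\<close>

text \<open>Evenness makes the derivative odd, which is what moves a mollification from a vector
  field to the indicator in \<open>integral_div_conv\<close>.\<close>

definition mollifier :: "real \<Rightarrow> ('a::euclidean_space \<Rightarrow> real) \<Rightarrow> bool" where
  "mollifier \<epsilon> \<rho> \<longleftrightarrow> test_function \<rho> \<and> (\<forall>x. 0 \<le> \<rho> x) \<and> (\<integral>x. \<rho> x \<partial>lborel) = 1 \<and>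
     (\<forall>x. \<rho> (- x) = \<rho> x) \<and> (\<forall>x. \<epsilon> \<le> norm x \<longrightarrow> \<rho> x = 0)"

lemma mollifier_exists:
  assumes "\<epsilon> > 0"
  obtains \<rho> :: "'a::euclidean_space \<Rightarrow> real" where "mollifier \<epsilon> \<rho>"
proof -
  \<comment> \<open>A polynomial that is positive exactly on the ball of radius \<epsilon>;
    composing it with \<open>flat_exp 0\<close> gives a smooth bump, then normalised by its integral
    \<open>c\<close>.\<close>
  define g :: "'a \<Rightarrow> real" where "g x = \<epsilon>\<^sup>2 + (- 1) * (x \<bullet> x)" for x
  have g: "Ck_on k g UNIV" for k
    unfolding g_def
    by (intro Ck_on_add Ck_on_mult Ck_on_const Ck_on_bilinear[OF bounded_bilinear_inner] Ck_on_linear bounded_linear_ident)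
  define b where "b x = flat_exp 0 (g x)" for x
  have b_pos: "b x > 0 \<longleftrightarrow> norm x < \<epsilon>" for x
  proof -
    have "g x > 0 \<longleftrightarrow> (norm x)\<^sup>2 < \<epsilon>\<^sup>2" by (simp add: g_def power2_norm_eq_inner)
    also have "\<dots> \<longleftrightarrow> norm x < \<epsilon>"
      using assms by (auto intro: power_strict_mono dest: power_less_imp_less_base)
    finally show ?thesis by (simp add: b_def flat_exp_def)
  qed
  have b0: "b x = 0" if "\<epsilon> \<le> norm x" for x
    using b_pos[of x] flat_exp_nonneg[of 0 "g x"] that by (simp add: b_def not_less)
  have tb: "test_function b"
    unfolding test_function_def smooth_on_def
    using Ck_on_flat_exp[OF g] b0 by (auto simp: b_def[abs_def])
  have ib: "integrable lborel b" by (rule test_function_integrable[OF tb])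
  define c where "c = (\<integral>x. b x \<partial>lborel)"
  have c: "c > 0"
  proof -
    have "c \<ge> 0" unfolding c_def by (rule Bochner_Integration.integral_nonneg) (simp add: b_def flat_exp_nonneg)
    moreover have "c \<noteq> 0"
    proof
      assume "c = 0"
      then have "AE x in lborel. b x = 0"
      proof (subst integral_nonneg_eq_0_iff_AE[OF ib, symmetric])
        show "AE x in lborel. 0 \<le> b x" by (simp add: b_def flat_exp_nonneg)
      qed (simp add: c_def)
      then have "AE x in lborel. x \<notin> ball (0::'a) \<epsilon>"
      proof eventually_elim
        case (elim x)
        then show ?case using b_pos[of x] by simp
      qed
      then have "ball (0::'a) \<epsilon> \<in> null_sets lborel" by (subst AE_iff_null_sets) simp_all
      then have "negligible (ball (0::'a) \<epsilon>)"
        unfolding negligible_iff_null_sets by (rule null_sets_completionI)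
      then show False using open_not_negligible[of "ball (0::'a) \<epsilon>"] assms by simp
    qed
    ultimately show ?thesis by simp
  qed
  have "mollifier \<epsilon> (\<lambda>x. 1 / c * b x)"
    unfolding mollifier_def
  proof (intro conjI allI impI)
    have "smooth_on (\<lambda>x. 1 / c * b x) UNIV"
      using tb unfolding test_function_def smooth_on_def by (intro allI Ck_on_mult Ck_on_const) simp
    then show "test_function (\<lambda>x. 1 / c * b x)" using b0 unfolding test_function_def by auto
    show "0 \<le> 1 / c * b x" for x using c by (simp add: b_def flat_exp_nonneg)
    show "(\<integral>x. 1 / c * b x \<partial>lborel) = 1" using c by (simp add: c_def[symmetric])
    show "1 / c * b (- x) = 1 / c * b x" for x by (simp add: b_def g_def)
    show "1 / c * b x = 0" if "\<epsilon> \<le> norm x" for x using b0[OF that] by simp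
  qed
  then show thesis by (rule that)
qed

text \<open>The mollified value is an average of values in \<open>K\<close>. Were it outside, a
  strictly separating functional integrated against the probability density would contradict
  itself.\<close>

lemma conv_mem_convex:
  fixes Y :: "'a::euclidean_space \<Rightarrow> 'a"
  assumes K: "closed K" "convex K" and Y: "\<And>y. Y y \<in> K" "integrable lborel Y" and \<rho>: "mollifier \<epsilon> \<rho>"
  shows "conv \<rho> Y x \<in> K"
proof (rule ccontr)
  assume "conv \<rho> Y x \<notin> K"
  then obtain a c where ac: "a \<bullet> conv \<rho> Y x < c" "\<forall>k\<in>K. c < a \<bullet> k"
    using separating_hyperplane_closed_point[OF K(2,1)] by blast
  have t: "test_function \<rho>" "\<And>z. 0 \<le> \<rho> z" "(\<integral>z. \<rho> z \<partial>lborel) = 1" using \<rho> by (auto simp: mollifier_def)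
  have i: "integrable lborel (\<lambda>y. \<rho> (x - y) *\<^sub>R Y y)" by (rule test_function_conv_integrable[OF t(1) Y(2)])
  have ir: "integrable lborel (\<lambda>y. \<rho> (x - y))" by (rule integrable_reflect[OF test_function_integrable[OF t(1)]])
  have "(\<integral>y. \<rho> (x - y) \<partial>lborel) = 1"
    using integral_reflect[OF test_function_measurable[OF t(1)]] t(3) by simp
  then have "c = (\<integral>y. \<rho> (x - y) * c \<partial>lborel)" by simp
  also have "\<dots> \<le> (\<integral>y. a \<bullet> (\<rho> (x - y) *\<^sub>R Y y) \<partial>lborel)"
  proof (rule integral_mono)
    show "\<rho> (x - y) * c \<le> a \<bullet> (\<rho> (x - y) *\<^sub>R Y y)" for y
      using mult_left_mono[OF less_imp_le[OF ac(2)[rule_format, OF Y(1)]] t(2)] by simp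
    show "integrable lborel (\<lambda>y. a \<bullet> (\<rho> (x - y) *\<^sub>R Y y))" by (rule integrable_inner_right) (rule i)
  qed (use ir in simp)
  also have "\<dots> = a \<bullet> conv \<rho> Y x" unfolding conv_def by (rule integral_inner_right) (rule i)
  finally show False using ac(1) by simp
qed

text \<open>Through this lemma the perimeter can be tested with fields that are only measurable,
  bounded and boundedly supported.\<close>

lemma admissible_conv:
  fixes Y :: "'a::euclidean_space \<Rightarrow> 'a"
  assumes K: "closed K" "convex K" and Y: "\<And>y. Y y \<in> K" "integrable lborel Y" and \<rho>: "mollifier \<epsilon> \<rho>"
    and S: "\<And>y. norm y > S \<Longrightarrow> Y y = 0"
  shows "admissible_field K (conv \<rho> Y)"
  unfolding admissible_field_def
proof (intro conjI)
  have t: "test_function \<rho>" "\<And>x. \<epsilon> \<le> norm x \<Longrightarrow> \<rho> x = 0" using \<rho> by (auto simp: mollifier_def)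
  show "smooth_on (conv \<rho> Y) UNIV" by (rule smooth_on_conv[OF t(1) Y(2)])
  have "{x. conv \<rho> Y x \<noteq> 0} \<subseteq> cball 0 (\<epsilon> + S)"
    using conv_zero_outside[of \<epsilon> \<rho> S Y] t(2) S by force
  then have "closure {x. conv \<rho> Y x \<noteq> 0} \<subseteq> cball 0 (\<epsilon> + S)" by (rule closure_minimal) simp
  then have "bounded (closure {x. conv \<rho> Y x \<noteq> 0})" using bounded_subset bounded_cball by blast
  then show "compact (closure {x. conv \<rho> Y x \<noteq> 0})" by (simp add: compact_eq_bounded_closed)
  show "range (conv \<rho> Y) \<subseteq> K" using conv_mem_convex[OF K Y \<rho>] by auto
qed

lemma FD_linear: "test_function \<rho> \<Longrightarrow> linear (FD \<rho> x)"
  by (rule has_derivative_linear[OF test_function_has_derivative])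

lemma FD_measurable: "test_function \<rho> \<Longrightarrow> (\<lambda>x. FD \<rho> x v) \<in> borel_measurable borel"
  by (rule test_function_measurable[OF test_function_FD])

lemma FD_expand: "test_function \<rho> \<Longrightarrow> FD \<rho> x v = (\<Sum>b\<in>Basis. (v \<bullet> b) * FD \<rho> x b)"
proof -
  assume t: "test_function \<rho>"
  have "FD \<rho> x v = FD \<rho> x (\<Sum>b\<in>Basis. (v \<bullet> b) *\<^sub>R b)" by (simp add: euclidean_representation)
  also have "\<dots> = (\<Sum>b\<in>Basis. (v \<bullet> b) * FD \<rho> x b)"
    by (simp add: linear_sum[OF FD_linear[OF t]] linear_scale[OF FD_linear[OF t]])
  finally show ?thesis .
qed

lemma div_conv:
  fixes Y :: "'a::euclidean_space \<Rightarrow> 'a"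
  assumes t: "test_function \<rho>" and Y: "integrable lborel Y"
  shows "div_field (conv \<rho> Y) x = (\<integral>y. FD \<rho> (x - y) (Y y) \<partial>lborel)"
proof -
  note i = test_function_conv_integrable[OF test_function_FD[OF t] Y]
  have "div_field (conv \<rho> Y) x = (\<Sum>b\<in>Basis. (\<integral>y. (FD \<rho> (x - y) b *\<^sub>R Y y) \<bullet> b \<partial>lborel))"
    unfolding div_field_def FD_conv[OF t Y] conv_def
    by (intro sum.cong refl integral_inner_left[symmetric]) (rule i)
  also have "\<dots> = (\<integral>y. (\<Sum>b\<in>Basis. (FD \<rho> (x - y) b *\<^sub>R Y y) \<bullet> b) \<partial>lborel)"
    by (intro Bochner_Integration.integral_sum[symmetric] integrable_inner_left) (rule i)
  also have "\<dots> = (\<integral>y. FD \<rho> (x - y) (Y y) \<partial>lborel)"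
    by (rule Bochner_Integration.integral_cong) (simp_all add: FD_expand[OF t, of _ "Y _"] mult.commute)
  finally show ?thesis .
qed

text \<open>Duality: the divergence of a mollified field is tested against the mollified indicator.\<close>

lemma integral_div_conv:
  fixes Y :: "'a::euclidean_space \<Rightarrow> 'a"
  assumes \<rho>: "mollifier \<epsilon> \<rho>" and Y: "integrable lborel Y"
    and E: "E \<in> sets borel" "emeasure lborel E < \<infinity>"
  shows "set_lebesgue_integral lborel E (div_field (conv \<rho> Y)) = - (\<integral>y. FD (conv \<rho> (indicator E :: 'a \<Rightarrow> real)) y (Y y) \<partial>lborel)"
proof -
  have t: "test_function \<rho>" and even: "\<And>x. \<rho> (- x) = \<rho> x" using \<rho> by (auto simp: mollifier_def)
  have iE: "integrable lborel (indicator E :: 'a \<Rightarrow> real)" using E by simp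
  obtain C where C: "\<And>x v. \<bar>FD \<rho> x v\<bar> \<le> C * norm v" "C > 0" using FD_bounded[OF t] by blast
  \<comment> \<open>Differentiating the symmetry of \<rho>; this produces the minus sign when
    \<open>x - y\<close> is turned into \<open>y - x\<close>.\<close>
  have odd: "FD \<rho> (- x) v = - FD \<rho> x v" for x v
  proof -
    have "(\<rho> has_derivative (\<lambda>v. FD \<rho> (- x) (- v))) (at x)"
    proof -
      have "((\<lambda>x. \<rho> (- x)) has_derivative (\<lambda>v. FD \<rho> (- x) (- v))) (at x)"
        by (rule has_derivative_compose[OF _ test_function_has_derivative[OF t]]) (auto intro!: derivative_eq_intros)
      then show ?thesis by (simp add: even)
    qed
    then have "(\<lambda>v. FD \<rho> (- x) (- v)) = FD \<rho> x" by (rule frechet_derivative_at)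
    from fun_cong[OF this, of v] show ?thesis using linear_neg[OF FD_linear[OF t]] by simp
  qed
  let ?h = "\<lambda>(x, y). indicator E x * FD \<rho> (x - y) (Y y)"
  have Ym: "Y \<in> borel_measurable borel" using Y by simp
  have h_meas: "?h \<in> borel_measurable (lborel \<Otimes>\<^sub>M lborel)"
  proof -
    have "(\<lambda>z. indicator E (fst z) * (\<Sum>b\<in>Basis. (Y (snd z) \<bullet> b) * FD \<rho> (fst z - snd z) b)) \<in> borel_measurable (borel \<Otimes>\<^sub>M borel)"
    proof (intro borel_measurable_times borel_measurable_sum)
      show "(\<lambda>z. indicator E (fst z) :: real) \<in> borel_measurable (borel \<Otimes>\<^sub>M borel)"
        using E(1) by (intro measurable_compose[OF measurable_fst]) simp
      fix b :: 'a
      show "(\<lambda>z. Y (snd z) \<bullet> b) \<in> borel_measurable (borel \<Otimes>\<^sub>M borel)"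
        using Ym by (intro measurable_compose[OF measurable_snd]) simp
      have "(\<lambda>z::'a\<times>'a. fst z - snd z) \<in> measurable (borel \<Otimes>\<^sub>M borel) borel"
        by (intro borel_measurable_diff measurable_fst measurable_snd)
      from measurable_compose[OF this FD_measurable[OF t, of b]]
      show "(\<lambda>z. FD \<rho> (fst z - snd z) b) \<in> borel_measurable (borel \<Otimes>\<^sub>M borel)" .
    qed
    moreover have "?h = (\<lambda>z. indicator E (fst z) * (\<Sum>b\<in>Basis. (Y (snd z) \<bullet> b) * FD \<rho> (fst z - snd z) b))"
      by (rule ext) (simp add: case_prod_beta FD_expand[OF t, of _ "Y _"])
    ultimately show ?thesis by simp
  qed
  have h_int: "integrable (lborel \<Otimes>\<^sub>M lborel) ?h"
  proof (rule lborel_pair.Fubini_integrable[OF h_meas])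
    have in1: "integrable lborel (\<lambda>y. ?h (x, y))" for x
    proof (rule Bochner_Integration.integrable_bound)
      show "integrable lborel (\<lambda>y. C * norm (Y y))" using Y by simp
      show "(\<lambda>y. ?h (x, y)) \<in> borel_measurable lborel" using measurable_compose[OF measurable_Pair1' h_meas] by simp
      show "AE y in lborel. norm (?h (x, y)) \<le> norm (C * norm (Y y))"
      proof (rule AE_I2)
        fix y show "norm (?h (x, y)) \<le> norm (C * norm (Y y))"
          using C(1)[of "x - y" "Y y"] C(2) by (cases "x \<in> E") simp_all
      qed
    qed
    then show "AE x in lborel. integrable lborel (\<lambda>y. ?h (x, y))" by simp
    show "integrable lborel (\<lambda>x. \<integral>y. norm (?h (x, y)) \<partial>lborel)"
    proof (rule Bochner_Integration.integrable_bound)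
      show "integrable lborel (\<lambda>x. indicator E x * (\<integral>y. C * norm (Y y) \<partial>lborel))" using iE by simp
      show "(\<lambda>x. \<integral>y. norm (?h (x, y)) \<partial>lborel) \<in> borel_measurable lborel"
        using h_meas by (intro lborel.borel_measurable_lebesgue_integral) (simp add: case_prod_beta)
      show "AE x in lborel. norm (\<integral>y. norm (?h (x, y)) \<partial>lborel) \<le> norm (indicator E x * (\<integral>y. C * norm (Y y) \<partial>lborel))"
      proof (rule AE_I2)
        fix x
        have "(\<integral>y. norm (?h (x, y)) \<partial>lborel) \<le> indicator E x * (\<integral>y. C * norm (Y y) \<partial>lborel)"
        proof (cases "x \<in> E")
          case True
          have "(\<integral>y. norm (?h (x, y)) \<partial>lborel) \<le> (\<integral>y. C * norm (Y y) \<partial>lborel)"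
            by (rule integral_mono[OF integrable_norm[OF in1]]) (use Y C(1) True in simp_all)
          then show ?thesis using True by simp
        qed simp
        from order.trans[OF this abs_ge_self]
        show "norm (\<integral>y. norm (?h (x, y)) \<partial>lborel) \<le> norm (indicator E x * (\<integral>y. C * norm (Y y) \<partial>lborel))"
          unfolding real_norm_def by (subst abs_of_nonneg) simp_all
      qed
    qed
  qed
  have "set_lebesgue_integral lborel E (div_field (conv \<rho> Y)) = (\<integral>x. \<integral>y. ?h (x, y) \<partial>lborel \<partial>lborel)"
    unfolding set_lebesgue_integral_def by (rule Bochner_Integration.integral_cong) (simp_all add: div_conv[OF t Y])
  also have "\<dots> = (\<integral>y. \<integral>x. ?h (x, y) \<partial>lborel \<partial>lborel)"
    using lborel_pair.Fubini_integral[of "\<lambda>x y. ?h (x, y)"] h_int by (simp add: case_prod_eta)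
  also have "\<dots> = (\<integral>y. - FD (conv \<rho> (indicator E)) y (Y y) \<partial>lborel)"
  proof (rule Bochner_Integration.integral_cong[OF refl])
    fix y
    have "FD (conv \<rho> (indicator E :: 'a \<Rightarrow> real)) y (Y y) = (\<integral>x. FD \<rho> (y - x) (Y y) * indicator E x \<partial>lborel)"
      unfolding FD_conv[OF t iE] by (simp add: conv_def)
    also have "\<dots> = (\<integral>x. - ?h (x, y) \<partial>lborel)"
    proof (rule Bochner_Integration.integral_cong[OF refl])
      fix x
      have "FD \<rho> (y - x) (Y y) = - FD \<rho> (x - y) (Y y)" using odd[of "x - y" "Y y"] by simp
      then show "FD \<rho> (y - x) (Y y) * indicator E x = - ?h (x, y)" by simp
    qed
    finally show "(\<integral>x. ?h (x, y) \<partial>lborel) = - FD (conv \<rho> (indicator E)) y (Y y)" by simp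
  qed
  finally show ?thesis by simp
qed

text \<open>All parts come from writing the convolution as an average of translates of
  \<open>E\<close>. By Fubini the mass over \<open>A\<close> is the average overlap of
  \<open>A\<close> with these translates, and \<open>A = UNIV\<close> gives the total mass.\<close>

lemma conv_indicator:
  fixes E :: "'a::euclidean_space set"
  assumes \<rho>: "mollifier \<epsilon> \<rho>" and E: "E \<in> sets borel" "emeasure lborel E < \<infinity>"
  shows "0 \<le> conv \<rho> (indicator E :: 'a \<Rightarrow> real) x" "conv \<rho> (indicator E :: 'a \<Rightarrow> real) x \<le> 1"
    and "conv \<rho> (indicator E) x = (\<integral>z. \<rho> z * indicator E (x - z) \<partial>lborel)"
    and "integrable lborel (conv \<rho> (indicator E :: 'a \<Rightarrow> real))"
    and "(\<integral>x. conv \<rho> (indicator E :: 'a \<Rightarrow> real) x \<partial>lborel) = measure lborel E"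
    and "A \<in> sets borel \<Longrightarrow> (\<integral>x. indicator A x * conv \<rho> (indicator E) x \<partial>lborel)
          = (\<integral>z. \<rho> z * measure lborel (A \<inter> {x. x - z \<in> E}) \<partial>lborel)"
    and "A \<in> sets borel \<Longrightarrow> integrable lborel (\<lambda>z. \<rho> z * measure lborel (A \<inter> {x. x - z \<in> E}))"
proof -
  have t: "test_function \<rho>" "\<And>z. 0 \<le> \<rho> z" "(\<integral>z. \<rho> z \<partial>lborel) = 1" using \<rho> by (auto simp: mollifier_def)
  have i\<rho>: "integrable lborel \<rho>" by (rule test_function_integrable[OF t(1)])
  have iE: "integrable lborel (indicator E :: 'a \<Rightarrow> real)" using E by simp
  have \<rho>m: "\<rho> \<in> borel_measurable borel" by (rule test_function_measurable[OF t(1)])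
  have indm: "(indicator E :: 'a \<Rightarrow> real) \<in> borel_measurable borel" using E(1) by simp
  have Es: "(\<lambda>z. indicator E (x - z) :: real) \<in> borel_measurable borel" for x
  proof -
    have "(\<lambda>z. x - z) \<in> measurable borel borel" by simp
    from measurable_compose[OF this indm] show ?thesis .
  qed
  show eq: "conv \<rho> (indicator E) x = (\<integral>z. \<rho> z * indicator E (x - z) \<partial>lborel)" for x
  proof -
    have "(\<integral>y. \<rho> (x - y) * indicator E (x - (x - y)) \<partial>lborel) = (\<integral>z. \<rho> z * indicator E (x - z) \<partial>lborel)"
      by (rule integral_reflect[of "\<lambda>z. \<rho> z * indicator E (x - z)"]) (intro borel_measurable_times \<rho>m Es)
    moreover have "x - (x - y) = y" for y by simp
    ultimately show ?thesis by (simp only: conv_def real_scaleR_def)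
  qed
  have ii: "integrable lborel (\<lambda>z. \<rho> z * indicator E (x - z))" for x
  proof (rule Bochner_Integration.integrable_bound[OF i\<rho>])
    show "AE z in lborel. norm (\<rho> z * indicator E (x - z)) \<le> norm (\<rho> z)"
      using t(2) by (intro AE_I2) (simp add: indicator_def)
  qed (use \<rho>m Es in simp)
  have "0 \<le> (\<integral>z. \<rho> z * indicator E (x - z) \<partial>lborel)"
    by (rule Bochner_Integration.integral_nonneg) (simp add: t(2))
  then show "0 \<le> conv \<rho> (indicator E :: 'a \<Rightarrow> real) x" by (simp only: eq)
  have "(\<integral>z. \<rho> z * indicator E (x - z) \<partial>lborel) \<le> (\<integral>z. \<rho> z \<partial>lborel)"
  proof (rule integral_mono[OF ii i\<rho>])
    fix z show "\<rho> z * indicator E (x - z) \<le> \<rho> z" using t(2)[of z] by (cases "x - z \<in> E") simp_all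
  qed
  then show "conv \<rho> (indicator E :: 'a \<Rightarrow> real) x \<le> 1" by (simp only: eq t(3))
  let ?h = "\<lambda>(x, z). \<rho> z * indicator E (x - z) :: real"
  have h_meas: "?h \<in> borel_measurable (lborel \<Otimes>\<^sub>M lborel)"
  proof -
    have "(\<lambda>p::'a\<times>'a. fst p - snd p) \<in> measurable (borel \<Otimes>\<^sub>M borel) borel"
      by (intro borel_measurable_diff measurable_fst measurable_snd)
    from measurable_compose[OF this indm]
    have "(\<lambda>p::'a\<times>'a. indicator E (fst p - snd p) :: real) \<in> borel_measurable (borel \<Otimes>\<^sub>M borel)" .
    moreover have "(\<lambda>p::'a\<times>'a. \<rho> (snd p)) \<in> borel_measurable (borel \<Otimes>\<^sub>M borel)"
      using \<rho>m by (intro measurable_compose[OF measurable_snd]) simp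
    ultimately show ?thesis by (simp add: case_prod_beta)
  qed
  have shift: "{x. x - z \<in> E} \<in> sets borel" "emeasure lborel {x. x - z \<in> E} = emeasure lborel E" for z
  proof -
    show "{x. x - z \<in> E} \<in> sets borel"
      using measurable_sets[of "\<lambda>x. x - z" borel borel E] E(1) by (simp add: vimage_def)
    have "distr lborel borel (\<lambda>x. - z + x) = (lborel :: 'a measure)" by (rule lborel_distr_plus)
    then show "emeasure lborel {x. x - z \<in> E} = emeasure lborel E"
      using emeasure_distr[of "\<lambda>x. - z + x" lborel borel E] E(1) by (simp add: vimage_def)
  qed
  have inner: "(\<integral>x. indicator A x * ?h (x, z) \<partial>lborel) = \<rho> z * measure lborel (A \<inter> {x. x - z \<in> E})" for A z
  proof -
    have "(\<integral>x. indicator A x * ?h (x, z) \<partial>lborel) = (\<integral>x. \<rho> z * indicator (A \<inter> {x. x - z \<in> E}) x \<partial>lborel)"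
      by (rule Bochner_Integration.integral_cong) (auto simp: indicator_def)
    then show ?thesis by simp
  qed
  have h_int: "integrable (lborel \<Otimes>\<^sub>M lborel) ?h"
  proof -
    have "(\<integral>\<^sup>+p. ennreal (norm (?h p)) \<partial>(lborel \<Otimes>\<^sub>M lborel)) = (\<integral>\<^sup>+z. \<integral>\<^sup>+x. ennreal (norm (?h (x, z))) \<partial>lborel \<partial>lborel)"
      using h_meas by (intro lborel_pair.nn_integral_snd[symmetric]) simp
    also have "\<dots> = (\<integral>\<^sup>+z. ennreal (\<rho> z) * emeasure lborel E \<partial>lborel)"
    proof (rule nn_integral_cong)
      fix z
      have "(\<integral>\<^sup>+x. ennreal (norm (?h (x, z))) \<partial>lborel) = (\<integral>\<^sup>+x. ennreal (\<rho> z) * indicator {x. x - z \<in> E} x \<partial>lborel)"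
        by (rule nn_integral_cong) (auto simp: indicator_def t(2))
      then show "(\<integral>\<^sup>+x. ennreal (norm (?h (x, z))) \<partial>lborel) = ennreal (\<rho> z) * emeasure lborel E"
        using shift[of z] by (simp add: nn_integral_cmult_indicator)
    qed
    also have "\<dots> = (\<integral>\<^sup>+z. ennreal (\<rho> z) \<partial>lborel) * emeasure lborel E"
      using \<rho>m by (intro nn_integral_multc) simp
    also have "\<dots> < \<infinity>"
      using E(2) nn_integral_eq_integral[OF i\<rho>] t(2) by (simp add: ennreal_mult_less_top)
    finally show ?thesis using h_meas by (intro integrableI_bounded)
  qed
  show "integrable lborel (conv \<rho> (indicator E :: 'a \<Rightarrow> real))"
    using lborel_pair.integrable_fst'[OF h_int] by (simp add: eq[abs_def])
  let ?k = "\<lambda>A (x, z). indicator A x * ?h (x, z)"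
  have k_int: "integrable (lborel \<Otimes>\<^sub>M lborel) (?k A)" if A: "A \<in> sets borel" for A
  proof (rule Bochner_Integration.integrable_bound[OF h_int])
    have "(\<lambda>p::'a\<times>'a. indicator A (fst p) :: real) \<in> borel_measurable (lborel \<Otimes>\<^sub>M lborel)"
      using A by (intro measurable_compose[OF measurable_fst]) simp
    then show "?k A \<in> borel_measurable (lborel \<Otimes>\<^sub>M lborel)" using h_meas by (simp add: case_prod_beta)
    show "AE p in lborel \<Otimes>\<^sub>M lborel. norm (?k A p) \<le> norm (?h p)"
      by (intro AE_I2) (auto simp: indicator_def)
  qed
  show ind: "(\<integral>x. indicator A x * conv \<rho> (indicator E) x \<partial>lborel)
          = (\<integral>z. \<rho> z * measure lborel (A \<inter> {x. x - z \<in> E}) \<partial>lborel)" if A: "A \<in> sets borel" for A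
  proof -
    have "(\<integral>x. indicator A x * conv \<rho> (indicator E) x \<partial>lborel) = (\<integral>x. \<integral>z. ?k A (x, z) \<partial>lborel \<partial>lborel)"
      by (rule Bochner_Integration.integral_cong) (simp_all add: eq)
    also have "\<dots> = (\<integral>z. \<integral>x. ?k A (x, z) \<partial>lborel \<partial>lborel)"
      using lborel_pair.Fubini_integral[of "\<lambda>x z. ?k A (x, z)"] k_int[OF A] by (simp add: case_prod_eta)
    also have "\<dots> = (\<integral>z. \<rho> z * measure lborel (A \<inter> {x. x - z \<in> E}) \<partial>lborel)"
      using inner by simp
    finally show ?thesis .
  qed
  show "integrable lborel (\<lambda>z. \<rho> z * measure lborel (A \<inter> {x. x - z \<in> E}))" if A: "A \<in> sets borel" for A
    using lborel_pair.integrable_snd[of "\<lambda>x z. ?k A (x, z)"] k_int[OF A] inner[of A] by (simp add: case_prod_eta)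
  show "(\<integral>x. conv \<rho> (indicator E :: 'a \<Rightarrow> real) x \<partial>lborel) = measure lborel E"
    using ind[of UNIV] shift t(3) by (simp add: measure_def)
qed

section \<open>Integration by parts for compactly supported fields\<close>

lemma integral_translate:
  fixes f :: "'a::euclidean_space \<Rightarrow> real"
  assumes "integrable lborel f"
  shows "integrable lborel (\<lambda>x. f (x + a))" "(\<integral>x. f (x + a) \<partial>lborel) = (\<integral>x. f x \<partial>lborel)"
proof -
  have d: "distr lborel borel (\<lambda>x. a + x) = (lborel :: 'a measure)" by (rule lborel_distr_plus)
  have "integrable lborel (\<lambda>x. f (a + x))"
    by (rule integrable_distr[of "\<lambda>x. a + x" lborel borel]) (simp_all add: d assms)
  then show "integrable lborel (\<lambda>x. f (x + a))" by (simp only: add.commute)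
  have "(\<integral>x. f x \<partial>distr lborel borel (\<lambda>x. a + x)) = (\<integral>x. f (a + x) \<partial>lborel)"
    by (rule integral_distr) (use assms in simp_all)
  then show "(\<integral>x. f (x + a) \<partial>lborel) = (\<integral>x. f x \<partial>lborel)" unfolding d by (simp only: add.commute)
qed

text \<open>Translation invariance makes the integral of \<open>f (x + t *\<^sub>R v) - f x\<close>
  vanish; the uniform first order expansion compares it with \<open>t\<close> times the integral of
  the derivative.\<close>

lemma integral_FD_zero:
  fixes f :: "'a::euclidean_space \<Rightarrow> real"
  assumes f: "test_function f"
  shows "(\<integral>x. FD f x v \<partial>lborel) = 0"
proof -
  obtain R where R: "\<And>x. R \<le> norm x \<Longrightarrow> f x = 0" using f by (auto simp: test_function_def)
  define m where "m = measure lborel (cball (0::'a) (R + 1)) + 1"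
  have m: "m > 0" by (simp add: m_def add_nonneg_pos)
  have fi: "integrable lborel f" by (rule test_function_integrable[OF f])
  have small: "\<bar>\<integral>x. FD f x v \<partial>lborel\<bar> \<le> e" if e: "e > 0" for e
  proof -
    define nv where "nv = norm v + 1"
    define e' where "e' = e / (nv * m)"
    have vp: "nv > 0" "norm v \<le> nv" by (simp_all add: nv_def add_nonneg_pos)
    have e': "e' > 0" using e m vp by (simp add: e'_def)
    obtain d where d: "d > 0" "\<And>z h. norm h < d \<Longrightarrow> \<bar>f (z + h) - f z - FD f z h\<bar> \<le> e' * norm h"
      using test_function_uniform_derivative[OF f e'] by blast
    \<comment> \<open>Small enough that \<open>t *\<^sub>R v\<close> is shorter than
      \<open>d\<close>, for the expansion, and shorter than 1, so that everything is supported in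
      the ball of radius \<open>R + 1\<close>.\<close>
    define t where "t = min 1 d / (2 * nv)"
    have t: "t > 0" using d vp by (simp add: t_def)
    have "norm (t *\<^sub>R v) \<le> t * nv" using t vp by (simp add: mult_left_mono)
    also have "\<dots> = min 1 d / 2" using vp by (simp add: t_def)
    finally have tv: "norm (t *\<^sub>R v) < d" "norm (t *\<^sub>R v) < 1" using d by auto
    have iF: "integrable lborel (\<lambda>x. FD f x v)" by (rule test_function_integrable[OF test_function_FD[OF f]])
    have sc: "FD f x (t *\<^sub>R v) = t * FD f x v" for x using linear_scale[OF FD_linear[OF f]] by simp
    note tr = integral_translate[OF fi, of "t *\<^sub>R v"]
    have eq: "(\<integral>x. f (x + t *\<^sub>R v) - f x - FD f x (t *\<^sub>R v) \<partial>lborel) = - (t * (\<integral>x. FD f x v \<partial>lborel))"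
      using tr fi iF by (simp add: sc)
    have "\<bar>\<integral>x. f (x + t *\<^sub>R v) - f x - FD f x (t *\<^sub>R v) \<partial>lborel\<bar>
       \<le> (\<integral>(x::'a). e' * (t * norm v) * indicator (cball 0 (R + 1)) x \<partial>lborel)"
      unfolding real_norm_def[symmetric]
    proof (rule Bochner_Integration.integral_norm_bound_integral)
      show "integrable lborel (\<lambda>x. f (x + t *\<^sub>R v) - f x - FD f x (t *\<^sub>R v))"
        using tr fi iF by (simp add: sc)
      show "integrable lborel (\<lambda>x::'a. e' * (t * norm v) * indicator (cball 0 (R + 1)) x)"
        using emeasure_lborel_cball_finite by (intro integrable_mult_right integrable_real_indicator) auto
      fix x
      show "norm (f (x + t *\<^sub>R v) - f x - FD f x (t *\<^sub>R v)) \<le> e' * (t * norm v) * indicator (cball 0 (R + 1)) x"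
      proof (cases "norm x \<le> R + 1")
        case True
        then show ?thesis using d(2)[OF tv(1), of x] t by simp
      next
        case False
        have "norm x \<le> norm (x + t *\<^sub>R v) + norm (t *\<^sub>R v)"
          using norm_triangle_ineq4[of "x + t *\<^sub>R v" "t *\<^sub>R v"] by simp
        then have "R \<le> norm (x + t *\<^sub>R v)" using False tv by linarith
        moreover have "FD f x = (\<lambda>_. 0)" by (rule FD_zero_outside[of R f, OF R]) (use False in auto)
        ultimately show ?thesis using R False by simp
      qed
    qed
    also have "\<dots> = e' * (t * norm v) * measure lborel (cball (0::'a) (R + 1))" by simp
    also have "\<dots> \<le> e' * (t * nv) * m"
      using e' t m vp by (intro mult_mono) (auto simp: m_def)
    also have "\<dots> = t * e" using vp m by (simp add: e'_def)
    finally have "t * \<bar>\<integral>x. FD f x v \<partial>lborel\<bar> \<le> t * e" unfolding eq using t by (simp add: abs_mult)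
    then show ?thesis using t by simp
  qed
  then have "\<bar>\<integral>x. FD f x v \<partial>lborel\<bar> \<le> 0" by (rule field_le_epsilon) simp
  then show ?thesis by simp
qed

definition compact_field :: "('a::euclidean_space \<Rightarrow> 'a) \<Rightarrow> bool" where
  "compact_field X \<longleftrightarrow> smooth_on X UNIV \<and> (\<exists>R. \<forall>x. R \<le> norm x \<longrightarrow> X x = 0)"

lemma admissible_compact_field:
  assumes "admissible_field K X" shows "compact_field X"
proof -
  have "bounded (closure {x. X x \<noteq> 0})" using assms by (simp add: admissible_field_def compact_imp_bounded)
  then obtain R where "\<forall>x\<in>closure {x. X x \<noteq> 0}. norm x \<le> R" unfolding bounded_iff ..
  then have "X x = 0" if "R + 1 \<le> norm x" for x
    using that closure_subset[of "{x. X x \<noteq> 0}"] by force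
  then show ?thesis using assms unfolding compact_field_def admissible_field_def by blast
qed

lemma test_function_mult:
  assumes "test_function w" "smooth_on g UNIV"
  shows "test_function (\<lambda>x. w x * g x)"
  using assms unfolding test_function_def smooth_on_def by (auto intro: Ck_on_mult)

lemma smooth_on_inner: "smooth_on X UNIV \<Longrightarrow> smooth_on (\<lambda>x. X x \<bullet> b) UNIV"
  unfolding smooth_on_def by (auto intro: Ck_on_bilinear[OF bounded_bilinear_inner] Ck_on_const)

lemma test_function_field_component:
  assumes "compact_field X" shows "test_function (\<lambda>x. X x \<bullet> b)"
  using assms smooth_on_inner unfolding compact_field_def test_function_def by fastforce

lemma test_function_smooth: "test_function w \<Longrightarrow> smooth_on w UNIV"
  by (simp add: test_function_def)

lemma FD_along_field_integrable:
  assumes w: "test_function w" and X: "compact_field X"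
  shows "integrable lborel (\<lambda>x. FD w x (X x))"
proof -
  have "(\<lambda>x. FD w x (X x)) = (\<lambda>x. \<Sum>b\<in>Basis. (X x \<bullet> b) * FD w x b)"
    by (rule ext) (rule FD_expand[OF w])
  moreover have "integrable lborel (\<lambda>x. (X x \<bullet> b) * FD w x b)" for b
    by (intro test_function_integrable test_function_mult test_function_field_component[OF X]
        test_function_smooth test_function_FD[OF w])
  ultimately show ?thesis by simp
qed

text \<open>Each product of \<open>w\<close> with a component of \<open>X\<close> is a test
  function, so its partial derivative integrates to 0; summing over the basis assembles the
  divergence.\<close>

lemma integration_by_parts:
  fixes w :: "'a::euclidean_space \<Rightarrow> real"
  assumes w: "test_function w" and X: "compact_field X"
  shows "(\<integral>x. w x * div_field X x \<partial>lborel) = - (\<integral>x. FD w x (X x) \<partial>lborel)"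
proof -
  have sX: "smooth_on X UNIV" using X by (simp add: compact_field_def)
  have i1: "integrable lborel (\<lambda>x. w x * (FD X x b \<bullet> b))" for b
    by (intro test_function_integrable test_function_mult[OF w] smooth_on_inner smooth_on_FD[OF sX])
  have i2: "integrable lborel (\<lambda>x. FD w x b * (X x \<bullet> b))" for b
    by (intro test_function_integrable test_function_mult[OF test_function_FD[OF w]] smooth_on_inner[OF sX])
  have zero: "(\<integral>x. w x * (FD X x b \<bullet> b) \<partial>lborel) + (\<integral>x. FD w x b * (X x \<bullet> b) \<partial>lborel) = 0" for b
  proof -
    have f: "test_function (\<lambda>x. w x * (X x \<bullet> b))" by (rule test_function_mult[OF w smooth_on_inner[OF sX]])
    have d: "((\<lambda>x. w x * (X x \<bullet> b)) has_derivative (\<lambda>v. w x * (FD X x v \<bullet> b) + FD w x v * (X x \<bullet> b))) (at x)" for x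
      by (rule has_derivative_mult[OF test_function_has_derivative[OF w] has_derivative_inner_left[OF smooth_on_has_derivative[OF sX]]])
    have "FD (\<lambda>x. w x * (X x \<bullet> b)) x b = w x * (FD X x b \<bullet> b) + FD w x b * (X x \<bullet> b)" for x
      by (rule fun_cong[OF frechet_derivative_at[OF d], symmetric])
    then show ?thesis using integral_FD_zero[OF f, of b] i1 i2 by simp
  qed
  have "(\<integral>x. w x * div_field X x \<partial>lborel) = (\<Sum>b\<in>Basis. \<integral>x. w x * (FD X x b \<bullet> b) \<partial>lborel)"
    unfolding div_field_def sum_distrib_left by (rule Bochner_Integration.integral_sum) (rule i1)
  also have "\<dots> = (\<Sum>b\<in>Basis. - (\<integral>x. FD w x b * (X x \<bullet> b) \<partial>lborel))"
  proof (rule sum.cong[OF refl])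
    fix b show "(\<integral>x. w x * (FD X x b \<bullet> b) \<partial>lborel) = - (\<integral>x. FD w x b * (X x \<bullet> b) \<partial>lborel)"
      using zero[of b] by linarith
  qed
  also have "\<dots> = - (\<integral>x. (\<Sum>b\<in>Basis. FD w x b * (X x \<bullet> b)) \<partial>lborel)"
    by (simp only: sum_negf Bochner_Integration.integral_sum[OF i2])
  also have "(\<lambda>x. \<Sum>b\<in>Basis. FD w x b * (X x \<bullet> b)) = (\<lambda>x. FD w x (X x))"
    by (rule ext) (simp add: FD_expand[OF w, of _ "X _"] mult.commute)
  finally show ?thesis .
qed

section \<open>Convergence of mollified indicators in L1\<close>

text \<open>Since the mollified indicator \<open>w\<close> lies between 0 and 1 and has the mass of
  \<open>E\<close>, its L1 distance from the indicator is twice the volume of \<open>E\<close> minus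
  twice the integral of \<open>w\<close> over \<open>E\<close>. That integral is an average overlap
  of \<open>E\<close> with its small translates, estimated by regularity of the measure.\<close>

lemma conv_indicator_L1:
  fixes E :: "'a::euclidean_space set" and \<eta> :: real
  assumes E: "E \<in> sets borel" "emeasure lborel E < \<infinity>" and \<eta>: "\<eta> > 0"
  obtains \<epsilon> where "\<epsilon> > 0" "\<And>\<rho>. mollifier \<epsilon> \<rho> \<Longrightarrow> (\<integral>x. \<bar>conv \<rho> (indicator E) x - indicat_real E x\<bar> \<partial>lborel) \<le> \<eta>"
proof -
  \<comment> \<open>The overlap will lose at most \<open>2 * \<delta>\<close>, and the loss is
    counted twice in the L1 distance.\<close>
  define \<delta> where "\<delta> = \<eta> / 4"
  have \<delta>: "\<delta> > 0" using \<eta> by (simp add: \<delta>_def)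
  have Ef: "E \<in> fmeasurable lborel" using E by (intro fmeasurableI) auto
  have "\<exists>C. compact C \<and> C \<subseteq> E \<and> measure lborel E - \<delta> < measure lborel C"
  proof -
    obtain F where F: "closed F" "F \<subseteq> E" "emeasure lebesgue (E - F) < ennreal (\<delta> / 2)"
      using sets_lebesgue_inner_closed[of E "\<delta> / 2"] E(1) \<delta> by (metis half_gt_zero sets_completionI_sets sets_lborel)
    have Ff: "F \<in> fmeasurable lborel" by (rule fmeasurableI2[OF Ef F(2)]) (use F(1) in simp)
    have mEF: "measure lborel E - measure lborel F < \<delta> / 2"
    proof -
      have "E - F \<in> sets lborel" using Ff Ef by (intro sets.Diff fmeasurableD)
      then have "emeasure lborel (E - F) < ennreal (\<delta> / 2)" using F(3) by simp
      moreover have "E - F \<in> fmeasurable lborel" using Ef Ff by (rule fmeasurable.Diff)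
      ultimately have "measure lborel (E - F) < \<delta> / 2"
        by (simp only: emeasure_eq_measure2 ennreal_less_iff measure_nonneg)
      then show ?thesis using measurable_measure_Diff[OF Ef fmeasurableD[OF Ff] F(2)] by linarith
    qed
    have "(\<lambda>n. measure lborel (F \<inter> cball 0 (real n))) \<longlonglongrightarrow> measure lborel (\<Union>n. F \<inter> cball 0 (real n))"
    proof (rule Lim_measure_incseq)
      show "range (\<lambda>n. F \<inter> cball 0 (real n)) \<subseteq> sets lborel" using F(1) by auto
      show "incseq (\<lambda>n. F \<inter> cball 0 (real n))" by (auto simp: incseq_def)
      have "(\<Union>n. F \<inter> cball 0 (real n)) = F" using real_arch_simple by fastforce
      then show "emeasure lborel (\<Union>n. F \<inter> cball 0 (real n)) \<noteq> \<infinity>" using fmeasurableD2[OF Ff] by simp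
    qed
    moreover have "(\<Union>n. F \<inter> cball 0 (real n)) = F" using real_arch_simple by fastforce
    ultimately have "(\<lambda>n. measure lborel (F \<inter> cball 0 (real n))) \<longlonglongrightarrow> measure lborel F" by simp
    then have "\<forall>\<^sub>F n in sequentially. measure lborel F - \<delta> / 2 < measure lborel (F \<inter> cball 0 (real n))"
      by (rule order_tendstoD(1)) (use \<delta> in simp)
    then obtain n where n: "measure lborel F - \<delta> / 2 < measure lborel (F \<inter> cball 0 (real n))"
      unfolding eventually_sequentially by blast
    have "compact (F \<inter> cball 0 (real n))" using F(1) by (intro closed_Int_compact compact_cball)
    moreover have "F \<inter> cball 0 (real n) \<subseteq> E" using F(2) by blast
    moreover have "measure lborel E - \<delta> < measure lborel (F \<inter> cball 0 (real n))" using n mEF by linarith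
    ultimately show ?thesis by blast
  qed
  then obtain C where C: "compact C" "C \<subseteq> E" "measure lborel E - \<delta> < measure lborel C" by blast
  have Cf: "C \<in> fmeasurable lborel" by (rule fmeasurable_compact[OF C(1)])
  obtain U where U: "open U" "C \<subseteq> U" "emeasure lborel (U - C) < ennreal \<delta>"
    using outer_regular_lborel[of C \<delta>] \<delta> C(1) by (auto simp: borel_compact)
  have Uf: "U \<in> fmeasurable lborel"
  proof (rule fmeasurableI)
    have "emeasure lborel U \<le> emeasure lborel C + emeasure lborel (U - C)"
      using emeasure_subadditive[of C lborel "U - C"] U(1,2) borel_compact[OF C(1)] by (simp add: Un_absorb1 sets.Diff)
    also have "\<dots> < \<infinity>"
    proof -
      have "emeasure lborel (U - C) < \<infinity>" using order.strict_trans[OF U(3) ennreal_less_top] by simp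
      then show ?thesis using emeasure_compact_finite[OF C(1)] by (simp add: ennreal_add_less_top)
    qed
    finally show "emeasure lborel U < \<infinity>" .
  qed (use U in simp)
  have mU: "measure lborel U < measure lborel C + \<delta>"
  proof -
    have "U - C \<in> fmeasurable lborel" using Uf Cf by (rule fmeasurable.Diff)
    then have "measure lborel (U - C) < \<delta>"
      using U(3) by (simp only: emeasure_eq_measure2 ennreal_less_iff measure_nonneg)
    then show ?thesis using measurable_measure_Diff[OF Uf fmeasurableD[OF Cf] U(2)] by linarith
  qed
  obtain \<epsilon> where \<epsilon>: "\<epsilon> > 0" "(\<Union>x\<in>C. ball x \<epsilon>) \<subseteq> U"
    using compact_subset_open_imp_ball_epsilon_subset[OF C(1) U(1,2)] by blast
  \<comment> \<open>The compact \<open>C\<close> and its small translate both lie in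
    \<open>U\<close>, whose volume exceeds that of \<open>C\<close> by less than \<delta>; hence
    they overlap up to \<delta>, and \<open>C\<close> itself falls short of \<open>E\<close> by less
    than \<delta>.\<close>
  have overlap: "measure lborel E - 2 * \<delta> \<le> measure lborel (E \<inter> {x. x - z \<in> E})" if z: "norm z < \<epsilon>" for z
  proof -
    let ?C = "(\<lambda>x. z + x) ` C"
    have zC: "compact ?C" by (rule compact_translation[OF C(1)])
    have zCf: "?C \<in> fmeasurable lborel" by (rule fmeasurable_compact[OF zC])
    have mz: "measure lborel ?C = measure lborel C"
      using measure_translation[of z C] C(1) zC by (simp add: borel_compact measure_completion)
    have "?C \<subseteq> U"
    proof
      fix y assume "y \<in> ?C"
      then obtain x where "x \<in> C" "y = z + x" by blast
      then have "y \<in> ball x \<epsilon>" using z by (simp add: dist_norm)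
      then show "y \<in> U" using \<epsilon>(2) \<open>x \<in> C\<close> by blast
    qed
    then have "C \<union> ?C \<subseteq> U" using U(2) by blast
    moreover have "C \<union> ?C \<in> sets lborel" using borel_compact[OF C(1)] borel_compact[OF zC] by simp
    ultimately have "measure lborel (C \<union> ?C) \<le> measure lborel U"
      using Uf by (rule measure_mono_fmeasurable)
    then have "measure lborel C - \<delta> \<le> measure lborel (C \<inter> ?C)"
      using measure_Un3[OF Cf zCf] mz mU by linarith
    also have "\<dots> \<le> measure lborel (E \<inter> {x. x - z \<in> E})"
    proof (rule measure_mono_fmeasurable)
      show "C \<inter> ?C \<subseteq> E \<inter> {x. x - z \<in> E}" using C(2) by auto
      show "C \<inter> ?C \<in> sets lborel" using borel_compact[OF C(1)] borel_compact[OF zC] by simp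
      have "{x. x - z \<in> E} \<in> sets borel"
        using measurable_sets[of "\<lambda>x. x - z" borel borel E] E(1) by (simp add: vimage_def)
      then show "E \<inter> {x. x - z \<in> E} \<in> fmeasurable lborel"
        using Ef by (intro fmeasurable_Int_fmeasurable) simp_all
    qed
    finally show ?thesis using C(3) by linarith
  qed
  show thesis
  proof (rule that[OF \<epsilon>(1)])
    fix \<rho> :: "'a \<Rightarrow> real" assume \<rho>: "mollifier \<epsilon> \<rho>"
    let ?w = "conv \<rho> (indicator E :: 'a \<Rightarrow> real)"
    note ci = conv_indicator[OF \<rho> E]
    have t: "test_function \<rho>" "\<And>z. 0 \<le> \<rho> z" "(\<integral>z. \<rho> z \<partial>lborel) = 1" "\<And>z. \<epsilon> \<le> norm z \<Longrightarrow> \<rho> z = 0"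
      using \<rho> by (auto simp: mollifier_def)
    have i\<rho>: "integrable lborel \<rho>" by (rule test_function_integrable[OF t(1)])
    have iE: "integrable lborel (indicator E :: 'a \<Rightarrow> real)" using E by simp
    have iEw: "integrable lborel (\<lambda>x. indicator E x * ?w x)"
    proof (rule Bochner_Integration.integrable_bound[OF ci(4)])
      show "(\<lambda>x. indicator E x * ?w x) \<in> borel_measurable lborel"
        using E(1) borel_measurable_integrable[OF ci(4)] by (intro borel_measurable_times borel_measurable_indicator) auto
      show "AE x in lborel. norm (indicator E x * ?w x) \<le> norm (?w x)"
      proof (rule AE_I2)
        fix x show "norm (indicator E x * ?w x) \<le> norm (?w x)" by (cases "x \<in> E") simp_all
      qed
    qed
    have Ew: "(\<integral>x. indicator E x * ?w x \<partial>lborel) = (\<integral>z. \<rho> z * measure lborel (E \<inter> {x. x - z \<in> E}) \<partial>lborel)"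
      by (rule ci(6)[OF E(1)])
    have "measure lborel E - 2 * \<delta> = (\<integral>z. \<rho> z * (measure lborel E - 2 * \<delta>) \<partial>lborel)" using t(3) by simp
    also have "\<dots> \<le> (\<integral>x. indicator E x * ?w x \<partial>lborel)"
      unfolding Ew
    proof (rule integral_mono)
      show "integrable lborel (\<lambda>z. \<rho> z * (measure lborel E - 2 * \<delta>))" using i\<rho> by simp
      show "\<rho> z * (measure lborel E - 2 * \<delta>) \<le> \<rho> z * measure lborel (E \<inter> {x. x - z \<in> E})" for z
      proof (cases "norm z < \<epsilon>")
        case True then show ?thesis using overlap t(2) by (intro mult_left_mono) auto
      qed (use t(4) in simp)
      show "integrable lborel (\<lambda>z. \<rho> z * measure lborel (E \<inter> {x. x - z \<in> E}))"
        by (rule ci(7)[OF E(1)])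
    qed
    finally have low: "measure lborel E - 2 * \<delta> \<le> (\<integral>x. indicator E x * ?w x \<partial>lborel)" .
    have "(\<integral>x. \<bar>?w x - indicator E x\<bar> \<partial>lborel) = (\<integral>x. indicator E x + ?w x - 2 * (indicator E x * ?w x) \<partial>lborel)"
    proof (rule Bochner_Integration.integral_cong[OF refl])
      fix x show "\<bar>?w x - indicator E x\<bar> = indicator E x + ?w x - 2 * (indicator E x * ?w x)"
        using ci(1)[of x] ci(2)[of x] by (cases "x \<in> E") simp_all
    qed
    also have "\<dots> = measure lborel E + measure lborel E - 2 * (\<integral>x. indicator E x * ?w x \<partial>lborel)"
      using iE ci(4,5) iEw E by simp
    also have "\<dots> \<le> 4 * \<delta>" using low by simp
    finally show "(\<integral>x. \<bar>?w x - indicator E x\<bar> \<partial>lborel) \<le> \<eta>" by (simp add: \<delta>_def)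
  qed
qed

section \<open>The perimeter of dilates of the body\<close>

lemma measure_dilation:
  fixes K :: "'a::euclidean_space set"
  assumes "compact K" "r \<ge> 0"
  shows "measure lborel ((\<lambda>x. r *\<^sub>R x) ` K) = r ^ DIM('a) * measure lborel K"
proof -
  have "(\<lambda>x. r *\<^sub>R x) ` K \<in> sets borel" using assms(1) by (intro borel_compact compact_scaling)
  then have "measure lborel ((\<lambda>x. r *\<^sub>R x) ` K) = measure lebesgue ((\<lambda>x. r *\<^sub>R x + 0) ` K)"
    by (simp add: measure_completion)
  also have "\<dots> = \<bar>r\<bar> ^ DIM('a) * measure lebesgue K" by (rule measure_lebesgue_affine)
  finally show ?thesis using assms borel_compact[OF assms(1)] by (simp add: measure_completion)
qed

text \<open>Convexity in the form \<open>(l - t) K + t K \<subseteq> l K\<close>, through the convex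
  weights \<open>(l - t) / l\<close> and \<open>t / l\<close>.\<close>

lemma dilation_absorbs:
  assumes K: "convex K" and t: "0 \<le> t" "t \<le> l" "l > 0"
    and y: "y \<in> (\<lambda>x. (l - t) *\<^sub>R x) ` K" and k: "k \<in> K"
  shows "y + t *\<^sub>R k \<in> (\<lambda>x. l *\<^sub>R x) ` K"
proof -
  obtain a where a: "a \<in> K" "y = (l - t) *\<^sub>R a" using y by blast
  have "((l - t) / l) *\<^sub>R a + (t / l) *\<^sub>R k \<in> K"
  proof (rule convexD[OF K a(1) k])
    show "(l - t) / l + t / l = 1" using t by (simp add: field_simps)
  qed (use t in auto)
  moreover have "y + t *\<^sub>R k = l *\<^sub>R (((l - t) / l) *\<^sub>R a + (t / l) *\<^sub>R k)"
    using t a by (simp add: scaleR_right_distrib)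
  ultimately show ?thesis by blast
qed

lemma test_function_conv:
  fixes f :: "'a::euclidean_space \<Rightarrow> real"
  assumes \<rho>: "test_function \<rho>" and f: "integrable lborel f" "\<And>x. S < norm x \<Longrightarrow> f x = 0"
  shows "test_function (conv \<rho> f)"
proof -
  obtain R where R: "\<And>x. R \<le> norm x \<Longrightarrow> \<rho> x = 0" using \<rho> by (auto simp: test_function_def)
  have "\<forall>x. R + S \<le> norm x \<longrightarrow> conv \<rho> f x = 0" using conv_zero_outside[of R \<rho> S f, OF R f(2)] by blast
  then show ?thesis using smooth_on_conv[OF \<rho> f(1)] unfolding test_function_def by blast
qed

lemma conv_indicator_integrand:
  fixes E :: "'a::euclidean_space set"
  assumes \<rho>: "mollifier \<epsilon> \<rho>" and E: "E \<in> sets borel" "emeasure lborel E < \<infinity>"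
  shows "integrable lborel (\<lambda>z. \<rho> z * indicator E (x - z))"
proof -
  have t: "test_function \<rho>" using \<rho> by (simp add: mollifier_def)
  have "integrable lborel (indicat_real E)" using E by simp
  from integrable_reflect[OF test_function_conv_integrable[OF t this, of x], of x]
  show ?thesis by simp
qed

text \<open>Bernoulli's inequality for the base \<open>1 - t / l\<close>, multiplied by the
  \<open>n\<close>-th power of \<open>l\<close>.\<close>

lemma power_difference_le:
  fixes l t :: real
  assumes "0 \<le> t" "t \<le> l" "l > 0"
  shows "l ^ n - (l - t) ^ n \<le> t * (real n * l ^ (n - 1))"
proof (cases n)
  case (Suc m)
  have "1 + real n * (- (t / l)) \<le> (1 + (- (t / l))) ^ n"
    by (rule Bernoulli_inequality) (use assms in simp)
  then have "l ^ n * (1 - real n * (t / l)) \<le> l ^ n * (1 - t / l) ^ n"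
    using assms by (intro mult_left_mono) auto
  also have "\<dots> = (l - t) ^ n"
    using assms by (simp add: power_mult_distrib[symmetric] right_diff_distrib)
  finally show ?thesis using assms Suc by (simp add: algebra_simps)
qed simp

text \<open>A one-sided Minkowski content argument. Moving by \<open>t *\<^sub>R X x\<close> cannot
  take a point of \<open>(l - t) K\<close> out of \<open>l K\<close>, so along the field the
  mollified indicator drops by at most the mollified indicator of the shell between the two. The
  shell volume is at most \<open>t\<close> times the claimed bound, and division by \<open>t\<close>
  gives the flux.\<close>

lemma mollified_dilation_flux:
  fixes K :: "'a::euclidean_space set"
  assumes K: "compact K" "convex K" "0 \<in> K" and l: "l > 0" and X: "compact_field X" "\<And>x. X x \<in> K"
    and \<rho>: "mollifier \<epsilon> \<rho>"
  defines "w \<equiv> conv \<rho> (indicat_real ((\<lambda>x. l *\<^sub>R x) ` K))"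
  shows "test_function w"
    and "- (\<integral>x. FD w x (X x) \<partial>lborel) \<le> real DIM('a) * l ^ (DIM('a) - 1) * measure lborel K"
proof -
  let ?W = "(\<lambda>x. l *\<^sub>R x) ` K"
  have cW: "compact ((\<lambda>x. r *\<^sub>R x) ` K)" for r using K(1) by (intro compact_scaling)
  have fW: "(\<lambda>x. r *\<^sub>R x) ` K \<in> sets borel" "emeasure lborel ((\<lambda>x. r *\<^sub>R x) ` K) < \<infinity>" for r
    using borel_compact[OF cW] emeasure_compact_finite[OF cW] by auto
  have t\<rho>: "test_function \<rho>" "\<And>z. 0 \<le> \<rho> z" using \<rho> by (auto simp: mollifier_def)
  obtain S where S: "\<forall>x\<in>?W. norm x \<le> S" using compact_imp_bounded[OF cW, of l] unfolding bounded_iff ..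
  show w: "test_function w"
    unfolding w_def
  proof (rule test_function_conv[OF t\<rho>(1)])
    show "integrable lborel (indicat_real ?W)" using fW by simp
    show "indicat_real ?W x = 0" if "S < norm x" for x
    proof -
      have "x \<notin> ?W" using S that by (meson not_less)
      then show ?thesis by simp
    qed
  qed
  obtain R where R: "\<And>x. R \<le> norm x \<Longrightarrow> X x = 0" using X(1) by (auto simp: compact_field_def)
  obtain B0 where B0: "\<forall>x\<in>K. norm x \<le> B0" using compact_imp_bounded[OF K(1)] unfolding bounded_iff ..
  define B where "B = \<bar>B0\<bar> + 1"
  have B: "B > 0" "norm (X x) \<le> B" for x using B0 X(2)[of x] by (auto simp: B_def)
  define m where "m = measure lborel (cball (0::'a) R)"
  have m: "m \<ge> 0" by (simp add: m_def)
  let ?I = "\<integral>x. FD w x (X x) \<partial>lborel"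
  have iF: "integrable lborel (\<lambda>x. FD w x (X x))" by (rule FD_along_field_integrable[OF w X(1)])
  have bound: "- ?I \<le> real DIM('a) * l ^ (DIM('a) - 1) * measure lborel K + e * (B * m)" if e: "e > 0" for e
  proof -
    obtain d where d: "d > 0" "\<And>z h. norm h < d \<Longrightarrow> \<bar>w (z + h) - w z - FD w z h\<bar> \<le> e * norm h"
      using test_function_uniform_derivative[OF w e] by blast
    \<comment> \<open>Bounded by \<open>l\<close> so that the inner dilate makes sense, and by
      \<open>d / (2 * B)\<close> so that displacements \<open>t *\<^sub>R X x\<close> stay within
      the range \<open>d\<close> of the uniform expansion.\<close>
    define t where "t = min l (d / (2 * B))"
    have t: "t > 0" "t \<le> l" using l d B by (auto simp: t_def)
    have "t * B \<le> d / (2 * B) * B" using B by (intro mult_right_mono) (auto simp: t_def)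
    then have tB: "t * B < d" using B d by simp
    let ?V = "(\<lambda>x. (l - t) *\<^sub>R x) ` K"
    let ?D = "?W - ?V"
    have VW: "?V \<subseteq> ?W"
    proof
      fix y assume "y \<in> ?V"
      from dilation_absorbs[OF K(2) _ t(2) l this K(3)] t(1) show "y \<in> ?W" by simp
    qed
    have fm: "?W \<in> fmeasurable lborel" "?V \<in> fmeasurable lborel" using fW by (auto intro: fmeasurableI)
    have Dm: "?D \<in> sets borel" using fW by (intro sets.Diff)
    have Df: "emeasure lborel ?D < \<infinity>" using fmeasurableD2[OF fmeasurable.Diff[OF fm]] by (simp add: top.not_eq_extremum)
    have mD: "measure lborel ?D \<le> t * (real DIM('a) * l ^ (DIM('a) - 1)) * measure lborel K"
    proof -
      have "measure lborel ?D = measure lborel ?W - measure lborel ?V"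
        by (rule measurable_measure_Diff[OF fm(1) fmeasurableD[OF fm(2)] VW])
      also have "\<dots> = (l ^ DIM('a) - (l - t) ^ DIM('a)) * measure lborel K"
        using measure_dilation[OF K(1), of l] measure_dilation[OF K(1), of "l - t"] l t by (simp add: left_diff_distrib)
      also have "\<dots> \<le> t * (real DIM('a) * l ^ (DIM('a) - 1)) * measure lborel K"
        using power_difference_le[of t l "DIM('a)"] t l by (intro mult_right_mono) auto
      finally show ?thesis .
    qed
    have drop: "w x - w (x + t *\<^sub>R X x) \<le> conv \<rho> (indicat_real ?D) x" for x
    proof -
      note iW = conv_indicator_integrand[OF \<rho> fW]
      have "w x - w (x + t *\<^sub>R X x) = (\<integral>z. \<rho> z * indicat_real ?W (x - z) - \<rho> z * indicat_real ?W (x + t *\<^sub>R X x - z) \<partial>lborel)"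
        unfolding w_def conv_indicator(3)[OF \<rho> fW] using iW by simp
      also have "\<dots> \<le> (\<integral>z. \<rho> z * indicat_real ?D (x - z) \<partial>lborel)"
      proof (rule integral_mono)
        show "integrable lborel (\<lambda>z. \<rho> z * indicat_real ?W (x - z) - \<rho> z * indicat_real ?W (x + t *\<^sub>R X x - z))"
          using iW by simp
        show "integrable lborel (\<lambda>z. \<rho> z * indicat_real ?D (x - z))" by (rule conv_indicator_integrand[OF \<rho> Dm Df])
        fix z
        have "x + t *\<^sub>R X x - z \<in> ?W" if "x - z \<in> ?V"
          using dilation_absorbs[OF K(2) _ t(2) l that X(2)[of x]] t(1) by (simp add: algebra_simps)
        then have "indicat_real ?W (x - z) - indicat_real ?W (x + t *\<^sub>R X x - z) \<le> indicat_real ?D (x - z)"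
          unfolding indicator_def by (cases "x - z \<in> ?V") auto
        from mult_left_mono[OF this t\<rho>(2)[of z]]
        show "\<rho> z * indicat_real ?W (x - z) - \<rho> z * indicat_real ?W (x + t *\<^sub>R X x - z) \<le> \<rho> z * indicat_real ?D (x - z)"
          by (simp only: right_diff_distrib)
      qed
      finally show ?thesis unfolding conv_indicator(3)[OF \<rho> Dm Df] .
    qed
    have "(\<integral>x. - (t * FD w x (X x)) \<partial>lborel)
       \<le> (\<integral>x. conv \<rho> (indicat_real ?D) x + e * (t * B) * indicator (cball 0 R) x \<partial>lborel)"
    proof (rule integral_mono)
      show "integrable lborel (\<lambda>x. - (t * FD w x (X x)))" using iF by simp
      have "integrable lborel (\<lambda>x::'a. e * (t * B) * indicator (cball 0 R) x)"
        using emeasure_lborel_cball_finite by (intro integrable_mult_right integrable_real_indicator) auto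
      then show "integrable lborel (\<lambda>x. conv \<rho> (indicat_real ?D) x + e * (t * B) * indicator (cball 0 R) x)"
        using conv_indicator(4)[OF \<rho> Dm Df] by (intro Bochner_Integration.integrable_add)
      fix x
      show "- (t * FD w x (X x)) \<le> conv \<rho> (indicat_real ?D) x + e * (t * B) * indicator (cball 0 R) x"
      proof (cases "norm x \<le> R")
        case True
        have nh: "norm (t *\<^sub>R X x) \<le> t * B" using B(2)[of x] t by (simp add: mult_left_mono)
        have "FD w x (t *\<^sub>R X x) = t * FD w x (X x)" using linear_scale[OF FD_linear[OF w]] by simp
        then have "\<bar>w (x + t *\<^sub>R X x) - w x - t * FD w x (X x)\<bar> \<le> e * norm (t *\<^sub>R X x)"
          using d(2)[of "t *\<^sub>R X x" x] nh tB by simp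
        also have "\<dots> \<le> e * (t * B)" using nh e by (intro mult_left_mono) auto
        finally show ?thesis using drop[of x] True by simp
      next
        case False
        then have "FD w x (X x) = 0" using R[of x] linear_0[OF FD_linear[OF w]] by simp
        then show ?thesis using conv_indicator(1)[OF \<rho> Dm Df, of x] False by simp
      qed
    qed
    also have "\<dots> = measure lborel ?D + e * (t * B) * m"
    proof -
      have "integrable lborel (\<lambda>x::'a. e * (t * B) * indicator (cball 0 R) x)"
        using emeasure_lborel_cball_finite by (intro integrable_mult_right integrable_real_indicator) auto
      from Bochner_Integration.integral_add[OF conv_indicator(4)[OF \<rho> Dm Df] this]
      show ?thesis by (simp add: conv_indicator(5)[OF \<rho> Dm Df] m_def)
    qed
    also have "\<dots> \<le> t * (real DIM('a) * l ^ (DIM('a) - 1)) * measure lborel K + e * (t * B) * m"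
      using mD by simp
    also have "\<dots> = t * (real DIM('a) * l ^ (DIM('a) - 1) * measure lborel K + e * (B * m))"
      by (simp add: algebra_simps)
    finally have "t * (- ?I) \<le> t * (real DIM('a) * l ^ (DIM('a) - 1) * measure lborel K + e * (B * m))" by simp
    then show ?thesis using t(1) by (simp only: mult_le_cancel_left_pos)
  qed
  show "- ?I \<le> real DIM('a) * l ^ (DIM('a) - 1) * measure lborel K"
  proof (rule field_le_epsilon)
    fix e :: real assume e: "e > 0"
    have pos: "B * m + 1 > 0" using B m by (simp add: add_nonneg_pos)
    have "e / (B * m + 1) * (B * m) \<le> e"
    proof -
      have "e * (B * m) \<le> e * (B * m + 1)" using e by (intro mult_left_mono) auto
      then show ?thesis using pos by (simp add: pos_divide_le_eq)
    qed
    then show "- ?I \<le> real DIM('a) * l ^ (DIM('a) - 1) * measure lborel K + e"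
      using bound[of "e / (B * m + 1)"] e pos by simp
  qed
qed

lemma div_field_bounded_integrable:
  assumes X: "compact_field X"
  obtains M where "M > 0" "\<And>x. \<bar>div_field X x\<bar> \<le> M" "integrable lborel (div_field X)"
proof -
  have h: "test_function (\<lambda>x. FD X x b \<bullet> b)" for b
  proof -
    have sX: "smooth_on X UNIV" and "\<exists>R. \<forall>x. R \<le> norm x \<longrightarrow> X x = 0" using X by (auto simp: compact_field_def)
    then obtain R where R: "\<And>x. R \<le> norm x \<Longrightarrow> X x = 0" by blast
    have "FD X x b \<bullet> b = 0" if "R + 1 \<le> norm x" for x
    proof -
      have "FD X x = (\<lambda>_. 0)" by (rule FD_zero_outside[of R X, OF R]) (use that in auto)
      then show ?thesis by simp
    qed
    then show ?thesis
      using smooth_on_inner[OF smooth_on_FD[OF sX]] unfolding test_function_def by blast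
  qed
  have "\<forall>b. \<exists>C. \<forall>x. \<bar>FD X x b \<bullet> b\<bar> \<le> C"
  proof
    fix b
    obtain C where "\<And>x. \<bar>FD X x b \<bullet> b\<bar> \<le> C" by (rule test_function_bounded[OF h, of b]) blast
    then show "\<exists>C. \<forall>x. \<bar>FD X x b \<bullet> b\<bar> \<le> C" by blast
  qed
  then obtain C where C: "\<And>b x. \<bar>FD X x b \<bullet> b\<bar> \<le> C b" by metis
  have "\<bar>div_field X x\<bar> \<le> (\<Sum>b\<in>Basis. C b)" for x
    unfolding div_field_def by (rule order_trans[OF sum_abs]) (intro sum_mono C)
  then have "\<bar>div_field X x\<bar> \<le> \<bar>\<Sum>b\<in>Basis. C b\<bar> + 1" for x
    using abs_ge_self[of "\<Sum>b\<in>Basis. C b"] add_increasing2[OF zero_le_one] order_trans by blast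
  moreover have "integrable lborel (div_field X)"
    unfolding div_field_def[abs_def] by (intro Bochner_Integration.integrable_sum test_function_integrable[OF h])
  moreover have "\<bar>\<Sum>b\<in>Basis. C b\<bar> + 1 > 0" by simp
  ultimately show thesis by (rule that[rotated 1])
qed

text \<open>The mollification is removed at the cost of its L1 error times a bound \<open>M\<close>
  for the divergence, and that error can be made as small as \<open>e / M\<close>.\<close>

lemma dilation_flux_le:
  fixes K :: "'a::euclidean_space set"
  assumes K: "compact K" "convex K" "0 \<in> K" and l: "l > 0" and X: "admissible_field K X"
  shows "set_lebesgue_integral lborel ((\<lambda>x. l *\<^sub>R x) ` K) (div_field X)
    \<le> real DIM('a) * l ^ (DIM('a) - 1) * measure lborel K"
proof (rule field_le_epsilon)
  fix e :: real assume e: "e > 0"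
  let ?W = "(\<lambda>x. l *\<^sub>R x) ` K"
  have cf: "compact_field X" by (rule admissible_compact_field[OF X])
  have XK: "X x \<in> K" for x using X by (auto simp: admissible_field_def)
  have cW: "compact ?W" using K(1) by (intro compact_scaling)
  have fW: "?W \<in> sets borel" "emeasure lborel ?W < \<infinity>"
    using borel_compact[OF cW] emeasure_compact_finite[OF cW] by auto
  obtain M where M: "M > 0" "\<And>x. \<bar>div_field X x\<bar> \<le> M" "integrable lborel (div_field X)"
    by (rule div_field_bounded_integrable[OF cf]) blast
  have "e / M > 0" using e M by simp
  then obtain \<epsilon> where \<epsilon>: "\<epsilon> > 0"
    "\<And>\<rho>. mollifier \<epsilon> \<rho> \<Longrightarrow> (\<integral>x. \<bar>conv \<rho> (indicator ?W) x - indicat_real ?W x\<bar> \<partial>lborel) \<le> e / M"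
    using conv_indicator_L1[OF fW] by metis
  obtain \<rho> :: "'a \<Rightarrow> real" where \<rho>: "mollifier \<epsilon> \<rho>" using mollifier_exists[OF \<epsilon>(1)] by blast
  let ?w = "conv \<rho> (indicat_real ?W)"
  note flux = mollified_dilation_flux[OF K l cf XK \<rho>]
  have iw: "integrable lborel ?w" by (rule conv_indicator(4)[OF \<rho> fW])
  have iE: "integrable lborel (indicat_real ?W)" using fW by simp
  have mult: "integrable lborel (\<lambda>x. g x * div_field X x)" if g: "integrable lborel g" for g :: "'a \<Rightarrow> real"
  proof (rule Bochner_Integration.integrable_bound)
    show "integrable lborel (\<lambda>x. M * g x)" using g by simp
    show "(\<lambda>x. g x * div_field X x) \<in> borel_measurable lborel"
      using borel_measurable_integrable[OF g] borel_measurable_integrable[OF M(3)] by (rule borel_measurable_times)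
    show "AE x in lborel. norm (g x * div_field X x) \<le> norm (M * g x)"
    proof (rule AE_I2)
      fix x
      have "\<bar>g x\<bar> * \<bar>div_field X x\<bar> \<le> \<bar>g x\<bar> * M" using M(2)[of x] by (intro mult_left_mono) auto
      then show "norm (g x * div_field X x) \<le> norm (M * g x)" using M(1) by (simp add: abs_mult mult.commute)
    qed
  qed
  have "set_lebesgue_integral lborel ?W (div_field X) = (\<integral>x. indicat_real ?W x * div_field X x \<partial>lborel)"
    unfolding set_lebesgue_integral_def by simp
  also have "\<dots> \<le> (\<integral>x. ?w x * div_field X x + M * \<bar>?w x - indicat_real ?W x\<bar> \<partial>lborel)"
  proof (rule integral_mono)
    show "integrable lborel (\<lambda>x. indicat_real ?W x * div_field X x)" by (rule mult[OF iE])
    show "integrable lborel (\<lambda>x. ?w x * div_field X x + M * \<bar>?w x - indicat_real ?W x\<bar>)"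
      using mult[OF iw] iw iE by simp
    fix x
    have "(indicat_real ?W x - ?w x) * div_field X x \<le> \<bar>indicat_real ?W x - ?w x\<bar> * \<bar>div_field X x\<bar>"
      unfolding abs_mult[symmetric] by (rule abs_ge_self)
    also have "\<dots> \<le> \<bar>indicat_real ?W x - ?w x\<bar> * M" using M(2)[of x] by (intro mult_left_mono) auto
    finally show "indicat_real ?W x * div_field X x \<le> ?w x * div_field X x + M * \<bar>?w x - indicat_real ?W x\<bar>"
      by (simp only: left_diff_distrib abs_minus_commute[of "?w x"] mult.commute[of M])
  qed
  also have "\<dots> = (\<integral>x. ?w x * div_field X x \<partial>lborel) + M * (\<integral>x. \<bar>?w x - indicat_real ?W x\<bar> \<partial>lborel)"
    using mult[OF iw] iw iE by simp
  also have "\<dots> \<le> real DIM('a) * l ^ (DIM('a) - 1) * measure lborel K + M * (e / M)"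
  proof (rule add_mono)
    show "(\<integral>x. ?w x * div_field X x \<partial>lborel) \<le> real DIM('a) * l ^ (DIM('a) - 1) * measure lborel K"
      using flux(2) integration_by_parts[OF flux(1) cf] by simp
    show "M * (\<integral>x. \<bar>?w x - indicat_real ?W x\<bar> \<partial>lborel) \<le> M * (e / M)"
      using \<epsilon>(2)[OF \<rho>] M(1) by (intro mult_left_mono) auto
  qed
  finally show "set_lebesgue_integral lborel ?W (div_field X) \<le> real DIM('a) * l ^ (DIM('a) - 1) * measure lborel K + e"
    using M(1) by simp
qed

section \<open>Cutoff at infinity\<close>

lemma DERIV_max_zero_square: "((\<lambda>s::real. (max 0 s)\<^sup>2) has_real_derivative 2 * max 0 s) (at s)"
proof (cases s "0 :: real" rule: linorder_cases)
  case less
  have "((\<lambda>s::real. 0) has_real_derivative 0) (at s)" by simp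
  then have "((\<lambda>s::real. (max 0 s)\<^sup>2) has_real_derivative 0) (at s)"
    by (rule has_field_derivative_transform_within_open[where S = "{..<0}"]) (use less in auto)
  then show ?thesis using less by simp
next
  case equal
  have "((\<lambda>h::real. (max 0 h)\<^sup>2 / h) \<longlongrightarrow> 0) (at 0)"
  proof (rule Lim_null_comparison)
    show "\<forall>\<^sub>F h in at 0. norm ((max 0 h)\<^sup>2 / h) \<le> \<bar>h :: real\<bar>"
      by (rule always_eventually) (auto simp: max_def power2_eq_square)
    show "((\<lambda>h::real. \<bar>h\<bar>) \<longlongrightarrow> 0) (at 0)" by (rule tendsto_rabs_zero) simp
  qed
  then show ?thesis unfolding equal by (simp add: DERIV_def)
next
  case greater
  have "((\<lambda>s::real. s\<^sup>2) has_real_derivative 2 * s) (at s)" by (auto intro!: derivative_eq_intros)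
  then have "((\<lambda>s::real. (max 0 s)\<^sup>2) has_real_derivative 2 * s) (at s)"
    by (rule has_field_derivative_transform_within_open[where S = "{0<..}"]) (use greater in auto)
  then show ?thesis using greater by simp
qed

text \<open>Squaring the positive part gives a once differentiable function with explicit derivative
  of order \<open>1 / R\<close>, which is all that \<open>approximable\<close> asks for. It is the
  remedy for \<open>E\<close> being possibly unbounded.\<close>

definition cutoff :: "real \<Rightarrow> 'a::euclidean_space \<Rightarrow> real" where
  "cutoff R x = (max 0 (1 - (x \<bullet> x) / R\<^sup>2))\<^sup>2"

definition cutoff_deriv :: "real \<Rightarrow> 'a::euclidean_space \<Rightarrow> 'a \<Rightarrow> real" where
  "cutoff_deriv R x v = 2 * max 0 (1 - (x \<bullet> x) / R\<^sup>2) * (- (2 * (x \<bullet> v) / R\<^sup>2))"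

lemma cutoff_has_derivative: "(cutoff R has_derivative cutoff_deriv R x) (at x)"
proof -
  have "((\<lambda>x. 1 - (x \<bullet> x) / R\<^sup>2) has_derivative (\<lambda>v. - (2 * (x \<bullet> v) / R\<^sup>2))) (at x)"
    by (auto intro!: derivative_eq_intros simp: inner_commute divide_inverse)
  from DERIV_compose_FDERIV[OF DERIV_max_zero_square this]
  show ?thesis unfolding cutoff_def[abs_def] cutoff_deriv_def[abs_def] by (simp add: mult.commute)
qed

lemma cutoff_measurable:
  "cutoff R \<in> borel_measurable borel" "(\<lambda>x. cutoff_deriv R x v) \<in> borel_measurable borel"
  unfolding cutoff_def[abs_def] cutoff_deriv_def[abs_def] divide_inverse
  by (intro borel_measurable_continuous_onI continuous_intros)+

lemma cutoff_range: "0 \<le> cutoff R x" "cutoff R x \<le> 1"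
proof -
  have "max 0 (1 - (x \<bullet> x) / R\<^sup>2) \<le> 1" by simp
  then show "0 \<le> cutoff R x" "cutoff R x \<le> 1" unfolding cutoff_def by (simp_all add: power_le_one)
qed

lemma cutoff_zero:
  assumes "0 < R" "R \<le> norm x"
  shows "cutoff R x = 0" "cutoff_deriv R x v = 0"
proof -
  have "R\<^sup>2 \<le> x \<bullet> x" using assms by (simp add: power2_norm_eq_inner[symmetric] power_mono)
  then have "max 0 (1 - (x \<bullet> x) / R\<^sup>2) = 0" using assms(1) by simp
  then show "cutoff R x = 0" "cutoff_deriv R x v = 0" unfolding cutoff_def cutoff_deriv_def by simp_all
qed

lemma cutoff_deriv_le:
  assumes R: "0 < R"
  shows "\<bar>cutoff_deriv R x v\<bar> \<le> 4 / R * norm v"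
proof (cases "norm x < R")
  case True
  define m where "m = max 0 (1 - (x \<bullet> x) / R\<^sup>2)"
  have m: "0 \<le> m" "m \<le> 1" by (simp_all add: m_def)
  have "\<bar>cutoff_deriv R x v\<bar> = m * (4 * \<bar>x \<bullet> v\<bar> / R\<^sup>2)"
    unfolding cutoff_deriv_def m_def[symmetric] using m by (simp add: abs_mult)
  also have "\<dots> \<le> 1 * (4 * (R * norm v) / R\<^sup>2)"
  proof (rule mult_mono)
    have "\<bar>x \<bullet> v\<bar> \<le> norm x * norm v" by (rule Cauchy_Schwarz_ineq2)
    also have "\<dots> \<le> R * norm v" using True by (intro mult_right_mono) auto
    finally show "4 * \<bar>x \<bullet> v\<bar> / R\<^sup>2 \<le> 4 * (R * norm v) / R\<^sup>2" using R by (intro divide_right_mono) auto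
  qed (use m in auto)
  also have "\<dots> = 4 / R * norm v" using R by (simp add: power2_eq_square)
  finally show ?thesis .
next
  case False
  then show ?thesis using cutoff_zero(2)[OF R, of x v] R by simp
qed

lemma cutoff_tendsto: "(\<lambda>n. cutoff (real (Suc n)) x) \<longlonglongrightarrow> 1"
proof -
  have "(\<lambda>n. (x \<bullet> x) * (inverse (real (Suc n)))\<^sup>2) \<longlonglongrightarrow> (x \<bullet> x) * 0\<^sup>2"
    by (intro tendsto_intros LIMSEQ_inverse_real_of_nat)
  then have "(\<lambda>n. (x \<bullet> x) / (real (Suc n))\<^sup>2) \<longlonglongrightarrow> 0"
    by (simp add: divide_inverse power_inverse del: of_nat_Suc)
  then have "(\<lambda>n. (max 0 (1 - (x \<bullet> x) / (real (Suc n))\<^sup>2))\<^sup>2) \<longlonglongrightarrow> (max 0 (1 - 0))\<^sup>2"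
    by (intro tendsto_intros)
  then show ?thesis unfolding cutoff_def by simp
qed

text \<open>Dominated convergence along integer radii; the condition on \<open>c / R\<close> is met
  at the same time and will control the derivative of the cutoff.\<close>

lemma cutoff_error_small:
  fixes w :: "'a::euclidean_space \<Rightarrow> real"
  assumes w: "integrable lborel w" and e: "e > 0" "e' > 0"
  obtains R where "R > 0" "(\<integral>x. (1 - cutoff R x) * \<bar>w x\<bar> \<partial>lborel) \<le> e" "c / R \<le> e'"
proof -
  have "(\<lambda>n. \<integral>x. (1 - cutoff (real (Suc n)) x) * \<bar>w x\<bar> \<partial>lborel) \<longlonglongrightarrow> (\<integral>x. (1 - 1) * \<bar>w x\<bar> \<partial>lborel)"
  proof (rule integral_dominated_convergence[where w = "\<lambda>x. \<bar>w x\<bar>"])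
    have "w \<in> borel_measurable borel" using borel_measurable_integrable[OF w] by simp
    then have "(\<lambda>x. (1 - cutoff (real (Suc n)) x) * \<bar>w x\<bar>) \<in> borel_measurable borel" for n
      by (intro borel_measurable_times borel_measurable_diff borel_measurable_abs borel_measurable_const cutoff_measurable(1))
    then show "(\<lambda>x. (1 - cutoff (real (Suc n)) x) * \<bar>w x\<bar>) \<in> borel_measurable lborel" for n
      by simp
    show "(\<lambda>x. (1 - 1) * \<bar>w x\<bar>) \<in> borel_measurable lborel" by simp
    show "integrable lborel (\<lambda>x. \<bar>w x\<bar>)" using w by simp
    show "AE x in lborel. (\<lambda>n. (1 - cutoff (real (Suc n)) x) * \<bar>w x\<bar>) \<longlonglongrightarrow> (1 - 1) * \<bar>w x\<bar>"
      by (intro AE_I2 tendsto_intros cutoff_tendsto)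
    show "AE x in lborel. norm ((1 - cutoff (real (Suc n)) x) * \<bar>w x\<bar>) \<le> \<bar>w x\<bar>" for n
    proof (rule AE_I2)
      fix x
      have "(1 - cutoff (real (Suc n)) x) * \<bar>w x\<bar> \<le> 1 * \<bar>w x\<bar>"
        using cutoff_range(1)[of "real (Suc n)" x] by (intro mult_right_mono) auto
      then show "norm ((1 - cutoff (real (Suc n)) x) * \<bar>w x\<bar>) \<le> \<bar>w x\<bar>"
        using cutoff_range(2)[of "real (Suc n)" x] by (simp add: abs_mult)
    qed
  qed
  then have "\<forall>\<^sub>F n in sequentially. (\<integral>x. (1 - cutoff (real (Suc n)) x) * \<bar>w x\<bar> \<partial>lborel) < e"
    by (rule order_tendstoD(2)) (use e in simp)
  moreover have "(\<lambda>n. c * inverse (real (Suc n))) \<longlonglongrightarrow> c * 0"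
    by (intro tendsto_intros LIMSEQ_inverse_real_of_nat)
  then have "\<forall>\<^sub>F n in sequentially. c * inverse (real (Suc n)) < e'"
    by (rule order_tendstoD(2)) (use e in simp)
  ultimately have "\<forall>\<^sub>F n in sequentially. (\<integral>x. (1 - cutoff (real (Suc n)) x) * \<bar>w x\<bar> \<partial>lborel) < e \<and> c * inverse (real (Suc n)) < e'"
    by (rule eventually_conj)
  then obtain n where n: "(\<integral>x. (1 - cutoff (real (Suc n)) x) * \<bar>w x\<bar> \<partial>lborel) < e" "c * inverse (real (Suc n)) < e'"
    unfolding eventually_sequentially by blast
  show thesis
    by (rule that[of "real (Suc n)"]) (use n in \<open>auto simp only: divide_inverse of_nat_0_less_iff zero_less_Suc less_imp_le\<close>)
qed

section \<open>A measurable choice of nearly optimal vectors\<close>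

text \<open>The maximiser among the first \<open>n + 1\<close> candidates, ties going to the earlier
  one. Finitely many comparisons keep it measurable in \<open>x\<close>, so it replaces a measurable
  selection theorem.\<close>

primrec best_choice :: "('a \<Rightarrow> 'b \<Rightarrow> real) \<Rightarrow> (nat \<Rightarrow> 'b) \<Rightarrow> nat \<Rightarrow> 'a \<Rightarrow> 'b" where
  "best_choice g k 0 x = k 0"
| "best_choice g k (Suc n) x =
    (if g x (k (Suc n)) > g x (best_choice g k n x) then k (Suc n) else best_choice g k n x)"

lemma best_choice_range: "best_choice g k n x \<in> range k"
  by (induction n) auto

lemma best_choice_incseq: "incseq (\<lambda>n. g x (best_choice g k n x))"
  by (rule incseq_SucI) simp

lemma best_choice_ge: "g x (k n) \<le> g x (best_choice g k n x)"
  by (cases n) auto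

lemma best_choice_measurable:
  fixes g :: "'a::euclidean_space \<Rightarrow> 'b::euclidean_space \<Rightarrow> real"
  assumes g: "\<And>j. (\<lambda>x. g x (k j)) \<in> borel_measurable borel"
  shows "(\<lambda>x. best_choice g k n x) \<in> borel_measurable borel"
    "(\<lambda>x. g x (best_choice g k n x)) \<in> borel_measurable borel"
proof (induction n)
  case 0
  { case 1 show ?case by simp next case 2 show ?case using g by simp }
next
  case (Suc n)
  have s: "Measurable.pred borel (\<lambda>x. g x (best_choice g k n x) < g x (k (Suc n)))"
    using Suc(2) g[of "Suc n"] by measurable
  { case 1 show ?case unfolding best_choice.simps using Suc(1) s by (intro measurable_If) auto
  next
    case 2
    have "(\<lambda>x. g x (best_choice g k (Suc n) x))
      = (\<lambda>x. if g x (best_choice g k n x) < g x (k (Suc n)) then g x (k (Suc n)) else g x (best_choice g k n x))"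
      by auto
    also have "\<dots> \<in> borel_measurable borel" using Suc(2) g[of "Suc n"] s by (intro measurable_If) auto
    finally show ?case . }
qed

lemma integrable_bounded_support:
  fixes f :: "'a::euclidean_space \<Rightarrow> 'b::euclidean_space"
  assumes "f \<in> borel_measurable borel" "\<And>x. norm (f x) \<le> c" "\<And>x. norm x > R \<Longrightarrow> f x = 0"
  shows "integrable lborel f"
proof (rule Bochner_Integration.integrable_bound)
  show "integrable lborel (\<lambda>x::'a. c * indicat_real (cball 0 R) x)"
    using emeasure_lborel_cball_finite by (intro integrable_mult_right integrable_real_indicator) auto
  show "f \<in> borel_measurable lborel" using assms(1) by simp
  show "AE x in lborel. norm (f x) \<le> norm (c * indicat_real (cball 0 R) x)"
  proof (rule AE_I2)
    fix x show "norm (f x) \<le> norm (c * indicat_real (cball 0 R) x)"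
    proof (cases "norm x \<le> R")
      case True
      then show ?thesis using order_trans[OF assms(2)[of x] abs_ge_self] by simp
    qed (use assms(3) in simp)
  qed
qed

lemma linear_along_measurable:
  fixes L :: "'a::euclidean_space \<Rightarrow> 'b::euclidean_space \<Rightarrow> real"
  assumes L: "\<And>x. linear (L x)" "\<And>b. (\<lambda>x. L x b) \<in> borel_measurable borel"
    and Y: "Y \<in> borel_measurable borel"
  shows "(\<lambda>x. L x (Y x)) \<in> borel_measurable borel"
proof -
  have "L x (Y x) = (\<Sum>b\<in>Basis. (Y x \<bullet> b) * L x b)" for x
  proof -
    have "L x (Y x) = L x (\<Sum>b\<in>Basis. (Y x \<bullet> b) *\<^sub>R b)" by (simp add: euclidean_representation)
    also have "\<dots> = (\<Sum>b\<in>Basis. (Y x \<bullet> b) * L x b)"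
      by (simp add: linear_sum[OF L(1)] linear_scale[OF L(1)])
    finally show ?thesis .
  qed
  moreover have "(\<lambda>x. \<Sum>b\<in>Basis. (Y x \<bullet> b) * L x b) \<in> borel_measurable borel"
    using L(2) Y by (intro borel_measurable_sum borel_measurable_times borel_measurable_inner) auto
  ultimately show ?thesis by simp
qed

text \<open>\<open>H\<close> is the increasing limit of the running maxima over a countable dense
  subset of \<open>W\<close>. Each running maximum is attained by a measurable field with values in
  \<open>W\<close>, to which the hypothesis applies; dominated convergence transfers the bound to
  \<open>H\<close>, and continuity of \<open>L x\<close> transfers domination from the dense set to
  \<open>W\<close>.\<close>

lemma dominating_density:
  fixes L :: "'a::euclidean_space \<Rightarrow> 'a \<Rightarrow> real" and A :: real
  assumes L: "\<And>x. linear (L x)" "\<And>b. (\<lambda>x. L x b) \<in> borel_measurable borel"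
    and C: "\<And>x b. \<bar>L x b\<bar> \<le> C * norm b" and R: "\<And>x b. norm x > R \<Longrightarrow> L x b = 0"
    and W: "bounded W" "W \<noteq> {}"
    and le: "\<And>Y. Y \<in> borel_measurable borel \<Longrightarrow> (\<And>x. Y x \<in> W) \<Longrightarrow> (\<integral>x. L x (Y x) \<partial>lborel) \<le> A"
  obtains H where "integrable lborel H" "\<And>x k. k \<in> W \<Longrightarrow> L x k \<le> H x" "(\<integral>x. H x \<partial>lborel) \<le> A"
proof -
  obtain T where T: "countable T" "T \<subseteq> W" "W \<subseteq> closure T" using separable[of W] by blast
  have T0: "T \<noteq> {}" using T(3) W(2) by auto
  define k where "k = from_nat_into T"
  have kT: "range k = T" unfolding k_def using T0 T(1) by (rule range_from_nat_into)
  define Y where "Y = best_choice L k"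
  define G where "G n x = L x (Y n x)" for n x
  have YW: "Y n x \<in> W" for n x using best_choice_range[of L k n x] kT T(2) unfolding Y_def by blast
  have Ym: "Y n \<in> borel_measurable borel" and Gm: "G n \<in> borel_measurable borel" for n
    using best_choice_measurable[of L k n, OF L(2)] unfolding Y_def G_def by auto
  obtain B where B: "B > 0" "\<And>x. x \<in> W \<Longrightarrow> norm x \<le> B" using bounded_pos[THEN iffD1, OF W(1)] by blast
  define c where "c = \<bar>C\<bar> * B"
  have Gc: "\<bar>G n x\<bar> \<le> c" for n x
  proof -
    have "\<bar>G n x\<bar> \<le> \<bar>C\<bar> * norm (Y n x)" unfolding G_def
      by (rule order_trans[OF C]) (intro mult_right_mono, auto)
    also have "\<dots> \<le> c" unfolding c_def by (intro mult_left_mono B(2) YW) simp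
    finally show ?thesis .
  qed
  have G0: "G n x = 0" if "norm x > R" for n x unfolding G_def by (rule R[OF that])
  have inc: "incseq (\<lambda>n. G n x)" for x unfolding G_def Y_def by (rule best_choice_incseq)
  define H where "H x = (SUP n. G n x)" for x
  have bdd: "bdd_above (range (\<lambda>n. G n x))" for x
    by (rule bdd_aboveI2[of _ _ c]) (use Gc[of _ x] in \<open>simp add: abs_le_iff\<close>)
  have lim: "(\<lambda>n. G n x) \<longlonglongrightarrow> H x" for x unfolding H_def by (rule LIMSEQ_incseq_SUP[OF bdd inc])
  have iG: "integrable lborel (G n)" for n
    by (rule integrable_bounded_support[OF Gm, of _ c R]) (use Gc G0 in auto)
  have Hm: "H \<in> borel_measurable borel" by (rule borel_measurable_LIMSEQ_metric[OF Gm lim])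
  have dom: "integrable lborel (\<lambda>x::'a. c * indicat_real (cball 0 R) x)"
    using emeasure_lborel_cball_finite by (intro integrable_mult_right integrable_real_indicator) auto
  have bnd: "AE x in lborel. norm (G n x) \<le> c * indicat_real (cball 0 R) x" for n
  proof (rule AE_I2)
    fix x show "norm (G n x) \<le> c * indicat_real (cball 0 R) x"
      using Gc[of n x] G0[of x n] by (cases "norm x \<le> R") simp_all
  qed
  have limAE: "AE x in lborel. (\<lambda>n. G n x) \<longlonglongrightarrow> H x" by (rule AE_I2) (rule lim)
  have m: "H \<in> borel_measurable lborel" "\<And>n. G n \<in> borel_measurable lborel" using Hm Gm by simp_all
  have iH: "integrable lborel H" by (rule integrable_dominated_convergence[OF m dom limAE bnd])
  have "(\<lambda>n. \<integral>x. G n x \<partial>lborel) \<longlonglongrightarrow> (\<integral>x. H x \<partial>lborel)"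
    by (rule integral_dominated_convergence[OF m dom limAE bnd])
  then have "(\<integral>x. H x \<partial>lborel) \<le> A"
  proof (rule LIMSEQ_le_const2)
    show "\<exists>N. \<forall>n\<ge>N. (\<integral>x. G n x \<partial>lborel) \<le> A" unfolding G_def using le[OF Ym YW] by blast
  qed
  moreover have "L x v \<le> H x" if v: "v \<in> W" for x v
  proof -
    have "continuous_on UNIV (L x)" using L(1)[of x] by (intro linear_continuous_on) (simp add: linear_conv_bounded_linear)
    then have "closed {v. L x v \<le> H x}" by (intro closed_Collect_le continuous_on_const)
    moreover have "T \<subseteq> {v. L x v \<le> H x}"
    proof
      fix v assume "v \<in> T"
      then obtain j where j: "v = k j" using kT by blast
      have "L x v \<le> G j x" unfolding j G_def Y_def by (rule best_choice_ge)
      also have "\<dots> \<le> H x" unfolding H_def by (rule cSUP_upper[OF UNIV_I bdd])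
      finally show "v \<in> {v. L x v \<le> H x}" by simp
    qed
    ultimately have "closure T \<subseteq> {v. L x v \<le> H x}" by (intro closure_minimal)
    then show ?thesis using T(3) v by blast
  qed
  ultimately show thesis using iH that by blast
qed

section \<open>Approximants obtained from a perimeter bound\<close>

text \<open>The approximant is the mollified indicator times a cutoff, and \<open>H\<close> comes
  from \<open>dominating_density\<close>. The bound required there for a measurable field
  \<open>Y\<close> in \<open>W\<close> follows by mollifying \<open>Y\<close>, which makes it
  admissible, and moving the mollification onto the indicator.\<close>

lemma approximable_of_perimeter:
  fixes W E :: "'a::euclidean_space set"
  assumes W: "compact W" "convex W" "0 \<in> W" and E: "E \<in> sets borel" "emeasure lborel E < \<infinity>"
    and A: "\<And>X. admissible_field W X \<Longrightarrow> set_lebesgue_integral lborel E (div_field X) \<le> A"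
  shows "approximable W E A"
  unfolding approximable_def
proof (intro allI impI)
  fix \<eta> :: real assume \<eta>: "\<eta> > 0"
  have "\<eta> / 2 > 0" using \<eta> by simp
  then obtain \<epsilon> where \<epsilon>: "\<epsilon> > 0"
    "\<And>\<rho>. mollifier \<epsilon> \<rho> \<Longrightarrow> (\<integral>x. \<bar>conv \<rho> (indicator E) x - indicat_real E x\<bar> \<partial>lborel) \<le> \<eta> / 2"
    using conv_indicator_L1[OF E] by metis
  obtain \<rho> :: "'a \<Rightarrow> real" where \<rho>: "mollifier \<epsilon> \<rho>" using mollifier_exists[OF \<epsilon>(1)] by blast
  have t: "test_function \<rho>" using \<rho> by (simp add: mollifier_def)
  define w where "w = conv \<rho> (indicat_real E)"
  note ci = conv_indicator[OF \<rho> E, folded w_def]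
  have iE: "integrable lborel (indicat_real E)" using E by simp
  have sw: "smooth_on w UNIV" unfolding w_def by (rule smooth_on_conv[OF t iE])
  have dw: "(w has_derivative FD w x) (at x)" for x by (rule smooth_on_has_derivative[OF sw])
  have wl: "linear (FD w x)" for x by (rule has_derivative_linear[OF dw])
  have wm: "w \<in> borel_measurable borel" "(\<lambda>x. FD w x b) \<in> borel_measurable borel" for b
    using smooth_on_continuous[OF sw] smooth_on_continuous[OF smooth_on_FD[OF sw]]
    by (auto intro: borel_measurable_continuous_onI)
  obtain C where C: "\<And>x v. \<bar>FD \<rho> x v\<bar> \<le> C * norm v" "C > 0" using FD_bounded[OF t] by blast
  define V where "V = measure lborel E"
  have V: "V \<ge> 0" by (simp add: V_def)
  have FDw: "\<bar>FD w x v\<bar> \<le> C * V * norm v" for x v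
  proof -
    have i: "integrable lborel (\<lambda>y. FD \<rho> (x - y) v *\<^sub>R indicat_real E y)"
      by (rule test_function_conv_integrable[OF test_function_FD[OF t] iE])
    have "\<bar>FD w x v\<bar> = norm (\<integral>y. FD \<rho> (x - y) v *\<^sub>R indicat_real E y \<partial>lborel)"
      unfolding w_def FD_conv[OF t iE] conv_def by simp
    also have "\<dots> \<le> (\<integral>y. C * norm v * indicat_real E y \<partial>lborel)"
    proof (rule Bochner_Integration.integral_norm_bound_integral[OF i])
      show "integrable lborel (\<lambda>y. C * norm v * indicat_real E y)" using iE by simp
      fix y show "norm (FD \<rho> (x - y) v *\<^sub>R indicat_real E y) \<le> C * norm v * indicat_real E y"
        using C(1)[of "x - y" v] by (cases "y \<in> E") simp_all
    qed
    also have "\<dots> = C * V * norm v" using E by (simp add: V_def)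
    finally show ?thesis .
  qed
  obtain B where B: "B > 0" "\<And>x. x \<in> W \<Longrightarrow> norm x \<le> B"
    using bounded_pos[THEN iffD1, OF compact_imp_bounded[OF W(1)]] by blast
  \<comment> \<open>Half of \<eta> is left for the L1 error of the cutoff, the other half having
    gone to the mollification. The second condition bounds the derivative of the cutoff, at most
    \<open>4 / R\<close> in norm, tested with vectors of length at most \<open>B\<close> against a
    function of mass \<open>V\<close>.\<close>
  obtain R where R: "R > 0" "(\<integral>x. (1 - cutoff R x) * \<bar>w x\<bar> \<partial>lborel) \<le> \<eta> / 2" "4 * B * V / R \<le> \<eta>"
    using cutoff_error_small[OF ci(4) \<open>\<eta> / 2 > 0\<close> \<eta>] by blast
  define u where "u x = cutoff R x * w x" for x
  define Du where "Du x v = cutoff R x * FD w x v + cutoff_deriv R x v * w x" for x v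
  have du: "(u has_derivative Du x) (at x)" for x
    unfolding u_def[abs_def] Du_def[abs_def] by (rule has_derivative_mult[OF cutoff_has_derivative dw])
  have Dl: "linear (Du x)" for x by (rule has_derivative_linear[OF du])
  have Dm: "(\<lambda>x. Du x b) \<in> borel_measurable borel" for b
    unfolding Du_def using wm cutoff_measurable by (intro borel_measurable_add borel_measurable_times) auto
  have u01: "0 \<le> u x" "u x \<le> 1" for x
    unfolding u_def using cutoff_range[of R x] ci(1,2)[of x] by (simp_all add: mult_le_one)
  define D where "D = C * V + 4 / R"
  have D: "\<bar>Du x b\<bar> \<le> D * norm b" for x b
  proof -
    have "\<bar>Du x b\<bar> \<le> \<bar>cutoff R x\<bar> * \<bar>FD w x b\<bar> + \<bar>cutoff_deriv R x b\<bar> * \<bar>w x\<bar>"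
      unfolding Du_def abs_mult[symmetric] by (rule abs_triangle_ineq)
    also have "\<dots> \<le> 1 * (C * V * norm b) + (4 / R * norm b) * 1"
      using cutoff_range[of R x] ci(1,2)[of x] FDw[of x b] cutoff_deriv_le[OF R(1), of x b] R(1)
      by (intro add_mono mult_mono) auto
    finally show ?thesis by (simp add: D_def algebra_simps)
  qed
  have out: "u x = 0" "Du x b = 0" if "norm x > R" for x b
    unfolding u_def Du_def using cutoff_zero[OF R(1), of x] that by simp_all
  have flux: "(\<integral>x. - Du x (Y x) \<partial>lborel) \<le> A + \<eta>"
    if Ym: "Y \<in> borel_measurable borel" and YW: "\<And>x. Y x \<in> W" for Y
  proof -
    \<comment> \<open>The cutoff is shifted from the function to the field. Since
      \<open>0 \<in> W\<close> and \<open>W\<close> is convex, the shortened field still takes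
      values in \<open>W\<close>, and it now has bounded support.\<close>
    define Z where "Z x = cutoff R x *\<^sub>R Y x" for x
    have Zm: "Z \<in> borel_measurable borel" unfolding Z_def[abs_def] using cutoff_measurable(1) Ym by (intro borel_measurable_scaleR)
    have ZW: "Z x \<in> W" for x
      using convexD_alt[OF W(2,3) YW[of x], of "cutoff R x"] cutoff_range[of R x] by (simp add: Z_def)
    have Z0: "Z x = 0" if "norm x > R" for x unfolding Z_def using cutoff_zero(1)[OF R(1), of x] that by simp
    have iZ: "integrable lborel Z"
      by (rule integrable_bounded_support[OF Zm, of B R]) (use B(2)[OF ZW] Z0 in auto)
    have "admissible_field W (conv \<rho> Z)"
      by (rule admissible_conv[OF compact_imp_closed[OF W(1)] W(2) ZW iZ \<rho>, of R]) (rule Z0)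
    from A[OF this] have first: "- (\<integral>x. FD w x (Z x) \<partial>lborel) \<le> A"
      unfolding integral_div_conv[OF \<rho> iZ E] w_def .
    have i1: "integrable lborel (\<lambda>x. FD w x (Z x))"
    proof (rule integrable_bounded_support)
      show "(\<lambda>x. FD w x (Z x)) \<in> borel_measurable borel" by (rule linear_along_measurable[OF wl wm(2) Zm])
      show "norm (FD w x (Z x)) \<le> C * V * B" for x
      proof -
        have "C * V * norm (Z x) \<le> C * V * B" using C(2) V by (intro mult_left_mono B(2) ZW) simp
        then show ?thesis using FDw[of x "Z x"] by simp
      qed
      show "FD w x (Z x) = 0" if "norm x > R" for x using Z0[OF that] linear_0[OF wl] by simp
    qed
    have cl: "linear (cutoff_deriv R x)" for x :: 'a by (rule has_derivative_linear[OF cutoff_has_derivative])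
    have second: "\<bar>cutoff_deriv R x (Y x) * w x\<bar> \<le> 4 * B / R * w x" for x
    proof -
      have "\<bar>cutoff_deriv R x (Y x)\<bar> \<le> 4 / R * norm (Y x)" by (rule cutoff_deriv_le[OF R(1)])
      also have "\<dots> \<le> 4 / R * B" using R(1) by (intro mult_left_mono B(2) YW) simp
      finally have "\<bar>cutoff_deriv R x (Y x)\<bar> * w x \<le> 4 / R * B * w x" using ci(1) by (rule mult_right_mono)
      then show ?thesis using ci(1)[of x] by (simp add: abs_mult)
    qed
    have i2: "integrable lborel (\<lambda>x. cutoff_deriv R x (Y x) * w x)"
    proof (rule Bochner_Integration.integrable_bound)
      show "integrable lborel (\<lambda>x. 4 * B / R * w x)" using ci(4) by simp
      show "(\<lambda>x. cutoff_deriv R x (Y x) * w x) \<in> borel_measurable lborel"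
        using linear_along_measurable[OF cl cutoff_measurable(2) Ym] wm(1) by simp
      show "AE x in lborel. norm (cutoff_deriv R x (Y x) * w x) \<le> norm (4 * B / R * w x)"
      proof (rule AE_I2)
        fix x show "norm (cutoff_deriv R x (Y x) * w x) \<le> norm (4 * B / R * w x)"
          using order_trans[OF second abs_ge_self] by simp
      qed
    qed
    have eq: "- Du x (Y x) = - FD w x (Z x) - cutoff_deriv R x (Y x) * w x" for x
      using linear_scale[OF wl, of x "cutoff R x" "Y x"] by (simp add: Du_def Z_def)
    have "(\<integral>x. - Du x (Y x) \<partial>lborel) = - (\<integral>x. FD w x (Z x) \<partial>lborel) - (\<integral>x. cutoff_deriv R x (Y x) * w x \<partial>lborel)"
      unfolding eq using i1 i2 by simp
    moreover have "- (\<integral>x. cutoff_deriv R x (Y x) * w x \<partial>lborel) \<le> \<eta>"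
    proof -
      have "\<bar>\<integral>x. cutoff_deriv R x (Y x) * w x \<partial>lborel\<bar> \<le> (\<integral>x. 4 * B / R * w x \<partial>lborel)"
        unfolding real_norm_def[symmetric]
        by (rule Bochner_Integration.integral_norm_bound_integral[OF i2]) (use ci(4) second in auto)
      also have "\<dots> = 4 * B * V / R" using ci(5) by (simp add: V_def)
      finally show ?thesis using R(3) by linarith
    qed
    ultimately show ?thesis using first by linarith
  qed
  have "linear (\<lambda>b. - Du x b)" for x using Dl by (rule linear_compose_neg)
  moreover have "(\<lambda>x. - Du x b) \<in> borel_measurable borel" for b using Dm by simp
  moreover have "\<bar>- Du x b\<bar> \<le> D * norm b" for x b using D by simp
  moreover have "- Du x b = 0" if "norm x > R" for x b using out(2)[OF that] by simp
  ultimately obtain H where H: "integrable lborel H" "\<And>x k. k \<in> W \<Longrightarrow> - Du x k \<le> H x" "(\<integral>x. H x \<partial>lborel) \<le> A + \<eta>"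
    using dominating_density[of "\<lambda>x b. - Du x b" D R W "A + \<eta>"] compact_imp_bounded[OF W(1)] W(3) flux by blast
  have L1: "(\<integral>x. \<bar>u x - indicator E x\<bar> \<partial>lborel) \<le> \<eta>"
  proof -
    have i3: "integrable lborel (\<lambda>x. (1 - cutoff R x) * \<bar>w x\<bar>)"
    proof (rule Bochner_Integration.integrable_bound[OF ci(4)])
      have "(\<lambda>x. (1 - cutoff R x) * \<bar>w x\<bar>) \<in> borel_measurable borel"
        using wm(1)
        by (intro borel_measurable_times borel_measurable_diff borel_measurable_abs borel_measurable_const cutoff_measurable(1))
      then show "(\<lambda>x. (1 - cutoff R x) * \<bar>w x\<bar>) \<in> borel_measurable lborel" by simp
      show "AE x in lborel. norm ((1 - cutoff R x) * \<bar>w x\<bar>) \<le> norm (w x)"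
      proof (rule AE_I2)
        fix x show "norm ((1 - cutoff R x) * \<bar>w x\<bar>) \<le> norm (w x)"
          using cutoff_range[of R x] by (simp add: abs_mult mult_left_le_one_le)
      qed
    qed
    have i4: "integrable lborel (\<lambda>x. \<bar>w x - indicator E x\<bar>)" using ci(4) iE by simp
    have "(\<integral>x. \<bar>u x - indicator E x\<bar> \<partial>lborel) \<le> (\<integral>x. (1 - cutoff R x) * \<bar>w x\<bar> + \<bar>w x - indicator E x\<bar> \<partial>lborel)"
    proof (rule integral_mono)
      have "u \<in> borel_measurable borel"
        unfolding u_def[abs_def] by (intro borel_measurable_times cutoff_measurable(1) wm(1))
      then have "integrable lborel u" by (rule integrable_bounded_support[of _ 1 R]) (use u01 out(1) in auto)
      then show "integrable lborel (\<lambda>x. \<bar>u x - indicator E x\<bar>)" using iE by simp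
      show "integrable lborel (\<lambda>x. (1 - cutoff R x) * \<bar>w x\<bar> + \<bar>w x - indicator E x\<bar>)" using i3 i4 by simp
      fix x
      have "w x - u x = (1 - cutoff R x) * \<bar>w x\<bar>" using ci(1)[of x] by (simp add: u_def algebra_simps)
      moreover have "0 \<le> (1 - cutoff R x) * \<bar>w x\<bar>" using cutoff_range(2)[of R x] by simp
      ultimately show "\<bar>u x - indicator E x\<bar> \<le> (1 - cutoff R x) * \<bar>w x\<bar> + \<bar>w x - indicator E x\<bar>" by linarith
    qed
    also have "\<dots> = (\<integral>x. (1 - cutoff R x) * \<bar>w x\<bar> \<partial>lborel) + (\<integral>x. \<bar>w x - indicator E x\<bar> \<partial>lborel)"
      using i3 i4 by (rule Bochner_Integration.integral_add)
    also have "\<dots> \<le> \<eta>" using R(2) \<epsilon>(2)[OF \<rho>] unfolding w_def by linarith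
    finally show ?thesis .
  qed
  show "\<exists>u Du H C R.
     (\<forall>x. (u has_derivative Du x) (at x)) \<and> (\<forall>b. (\<lambda>x. Du x b) \<in> borel_measurable borel) \<and>
     (\<forall>x. 0 \<le> u x \<and> u x \<le> 1) \<and> (\<forall>x b. \<bar>Du x b\<bar> \<le> C * norm b) \<and>
     (\<forall>x. norm x > R \<longrightarrow> u x = 0 \<and> (\<forall>b. Du x b = 0)) \<and>
     (\<integral>x. \<bar>u x - indicator E x\<bar> \<partial>lborel) \<le> \<eta> \<and>
     integrable lborel H \<and> (\<forall>x. \<forall>k\<in>W. - Du x k \<le> H x) \<and> (\<integral>x. H x \<partial>lborel) \<le> A + \<eta>"
    by (rule exI[of _ u], rule exI[of _ Du], rule exI[of _ H], rule exI[of _ D], rule exI[of _ R])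
       (use du Dm u01 D out L1 H in blast)
qed

section \<open>Conclusion for minimizers\<close>

text \<open>Homogeneity of the perimeter in the body: it passes from the perimeter with respect to
  \<open>K\<close>, in which \<open>E\<close> is minimal, to that with respect to the dilate of the
  same volume as \<open>E\<close>.\<close>

lemma admissible_field_scaleR:
  fixes X :: "'a::euclidean_space \<Rightarrow> 'a"
  assumes X: "admissible_field ((\<lambda>x. l *\<^sub>R x) ` K) X" and l: "l > 0"
  shows "admissible_field K (\<lambda>x. (1 / l) *\<^sub>R X x)"
    "set_lebesgue_integral lborel E (div_field X) = l * set_lebesgue_integral lborel E (div_field (\<lambda>x. (1 / l) *\<^sub>R X x))"
proof -
  have sX: "smooth_on X UNIV" using X by (simp add: admissible_field_def)
  have "smooth_on (\<lambda>x. (1 / l) *\<^sub>R X x) UNIV"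
    using sX unfolding smooth_on_def by (auto intro: Ck_on_bilinear[OF bounded_bilinear_scaleR] Ck_on_const)
  moreover have "{x. (1 / l) *\<^sub>R X x \<noteq> 0} = {x. X x \<noteq> 0}" using l by simp
  moreover have "(1 / l) *\<^sub>R X x \<in> K" for x
  proof -
    have "X x \<in> (\<lambda>x. l *\<^sub>R x) ` K" using X unfolding admissible_field_def by blast
    then obtain a where "a \<in> K" "X x = l *\<^sub>R a" by blast
    then show ?thesis using l by simp
  qed
  ultimately show "admissible_field K (\<lambda>x. (1 / l) *\<^sub>R X x)"
    using X unfolding admissible_field_def by auto
  have "FD (\<lambda>x. (1 / l) *\<^sub>R X x) x = (\<lambda>v. (1 / l) *\<^sub>R FD X x v)" for x
    by (rule frechet_derivative_at[OF has_derivative_scaleR_right[OF smooth_on_has_derivative[OF sX]], symmetric])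
  then have "div_field X x = l * div_field (\<lambda>x. (1 / l) *\<^sub>R X x) x" for x
    unfolding div_field_def sum_distrib_left using l by simp
  then have "div_field X = (\<lambda>x. l * div_field (\<lambda>x. (1 / l) *\<^sub>R X x) x)" by (rule ext)
  then show "set_lebesgue_integral lborel E (div_field X) = l * set_lebesgue_integral lborel E (div_field (\<lambda>x. (1 / l) *\<^sub>R X x))"
    by (metis set_integral_mult_right)
qed

text \<open>Minimality is used only once, against the dilate of \<open>K\<close> with the volume of
  \<open>E\<close>. Everything else is the rigidity of sets attaining the sharp bound, followed by
  the passage from equality up to null sets to equality of boundaries.\<close>

lemma minimizer_frontier:
  fixes K E :: "'a::euclidean_space set"
  assumes dim: "2 \<le> DIM('a)" and K: "convex_body K" and min: "aniso_minimizer K E" and norm: "normalized_set E"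
  shows "\<exists>p l. l > 0 \<and> frontier E = (\<lambda>x. p + l *\<^sub>R x) ` frontier K"
proof -
  have cK: "compact K" "convex K" "0 \<in> interior K" using K by (simp_all add: convex_body_def)
  have K0: "0 \<in> K" using cK(3) interior_subset by blast
  have E: "E \<in> sets borel" "emeasure lborel E > 0" "emeasure lborel E < \<infinity>"
    using min by (simp_all add: aniso_minimizer_def)
  define V where "V = measure lborel E"
  have EV: "emeasure lborel E = ennreal V" unfolding V_def using E(3) by (intro emeasure_eq_ennreal_measure) auto
  have V: "V > 0" using E(2) unfolding EV by simp
  define \<kappa> where "\<kappa> = measure lborel K"
  have eK: "emeasure lborel K = ennreal \<kappa>"
    unfolding \<kappa>_def using emeasure_compact_finite[OF cK(1)] by (intro emeasure_eq_ennreal_measure) auto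
  have "emeasure lborel (interior K) \<noteq> 0" using open_null_set_empty[OF open_interior] cK(3) by blast
  then have "emeasure lborel K > 0"
    using emeasure_mono[OF interior_subset, of K lborel] borel_compact[OF cK(1)] by (simp add: zero_less_iff_neq_zero) (metis le_zero_eq)
  then have \<kappa>: "\<kappa> > 0" unfolding eK by simp
  define N where "N = DIM('a)"
  have N: "N > 0" "2 \<le> N" using dim by (auto simp: N_def)
  \<comment> \<open>The factor for which the dilate of \<open>K\<close> has volume \<open>V\<close>;
    \<kappa> is positive because \<open>K\<close> has interior points.\<close>
  define l where "l = root N (V / \<kappa>)"
  have l: "l > 0" unfolding l_def using V \<kappa> N by (simp add: real_root_gt_zero)
  have lN: "l ^ N * \<kappa> = V" unfolding l_def using V \<kappa> N by (simp add: real_root_pow_pos2)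
  let ?W = "(\<lambda>x. l *\<^sub>R x) ` K"
  have cW: "compact ?W" using cK(1) by (intro compact_scaling)
  have Wb: "?W \<in> sets borel" by (rule borel_compact[OF cW])
  have W: "convex ?W" using cK(2) by (intro convex_scaling)
  have W0: "0 \<in> ?W" using K0 by force
  have WV: "emeasure lborel ?W = ennreal V"
  proof -
    have "measure lborel ?W = V" using measure_dilation[OF cK(1), of l] l lN by (simp add: N_def \<kappa>_def)
    moreover have "emeasure lborel ?W \<noteq> \<infinity>" using emeasure_compact_finite[OF cW] by simp
    ultimately show ?thesis using emeasure_eq_ennreal_measure[of lborel ?W] by simp
  qed
  have flux: "set_lebesgue_integral lborel E (div_field X) \<le> real N * l ^ (N - 1) * \<kappa>" if X: "admissible_field K X" for X
  proof -
    have "ereal (set_lebesgue_integral lborel E (div_field X)) \<le> aniso_perimeter K E"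
      unfolding aniso_perimeter_def by (rule SUP_upper) (simp add: X)
    also have "\<dots> \<le> aniso_perimeter K ?W"
      using min Wb WV EV unfolding aniso_minimizer_def by metis
    also have "\<dots> \<le> ereal (real N * l ^ (N - 1) * \<kappa>)"
      unfolding aniso_perimeter_def
    proof (rule SUP_least)
      fix X assume "X \<in> {X. admissible_field K X}"
      then show "ereal (set_lebesgue_integral lborel ?W (div_field X)) \<le> ereal (real N * l ^ (N - 1) * \<kappa>)"
        using dilation_flux_le[OF cK(1,2) K0 l, of X] by (simp add: N_def \<kappa>_def)
    qed
    finally show ?thesis by simp
  qed
  have app: "approximable ?W E (real N * V)"
  proof (rule approximable_of_perimeter[OF cW W W0 E(1,3)])
    fix X assume X: "admissible_field ?W X"
    \<comment> \<open>The factor \<open>l\<close> from rescaling the field completes the power of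
      \<open>l\<close> to \<open>N\<close>, and the bound becomes \<open>N\<close> times the volume
      of the dilate, which is exactly the sharp value that \<open>rigidity\<close> requires.\<close>
    have "set_lebesgue_integral lborel E (div_field X) \<le> l * (real N * l ^ (N - 1) * \<kappa>)"
      unfolding admissible_field_scaleR(2)[OF X l] using flux[OF admissible_field_scaleR(1)[OF X l]] l by simp
    also have "\<dots> = real N * (l ^ N * \<kappa>)" using N by (cases N) simp_all
    finally show "set_lebesgue_integral lborel E (div_field X) \<le> real N * V" unfolding lN .
  qed
  have image: "(\<lambda>x. p + l *\<^sub>R x) ` interior K \<subseteq> interior ((\<lambda>x. p + l *\<^sub>R x) ` K)" for p
  proof (rule interior_maximal)
    have "(\<lambda>x. p + l *\<^sub>R x) ` interior K = (+) p ` ((\<lambda>x. l *\<^sub>R x) ` interior K)" by (simp add: image_image)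
    then show "open ((\<lambda>x. p + l *\<^sub>R x) ` interior K)"
      using l by (simp add: open_translation open_scaling)
  qed (use interior_subset in blast)
  have ne: "interior ((\<lambda>x. p + l *\<^sub>R x) ` K) \<noteq> {}" for p using image[of p] cK(3) by blast
  have neW: "interior ?W \<noteq> {}" using ne[of 0] by simp
  obtain p where p: "AE x in lborel. x \<in> E \<longleftrightarrow> x - p \<in> ?W"
    using rigidity[OF dim cW W neW E(1) EV WV V app[unfolded N_def]] by blast
  let ?P = "(\<lambda>x. p + l *\<^sub>R x) ` K"
  have P: "?P = (+) p ` ?W" by (simp add: image_image)
  have "x - p \<in> ?W \<longleftrightarrow> x \<in> ?P" for x
  proof
    assume "x - p \<in> ?W"
    then have "p + (x - p) \<in> (+) p ` ?W" by (rule imageI)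
    then show "x \<in> ?P" unfolding P by simp
  next
    assume "x \<in> ?P"
    then show "x - p \<in> ?W" by auto
  qed
  then have "AE x in lborel. x \<in> E \<longleftrightarrow> x \<in> ?P" using p by simp
  moreover have "closed ?P" "convex ?P"
    unfolding P using compact_imp_closed[OF compact_translation[OF cW]] convex_translation[OF W] by auto
  ultimately have "frontier E = frontier ?P"
    using frontier_eq_of_AE_eq[OF norm _ _ ne] by blast
  also have "\<dots> = (\<lambda>x. p + l *\<^sub>R x) ` frontier K" using l by (intro frontier_affine_image) simp
  finally show ?thesis using l by blast
qed

theorem corollary5p14:
  fixes K E :: "(real ^ 'd) set" and n :: nat
  assumes "n \<ge> 1" and "CARD('d) = n + 1"
    and "smooth_strictly_convex_body K"
    and "aniso_minimizer K E"
    and "normalized_set E"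
  shows "\<exists>(p0 :: real ^ 'd) (l :: real). l > 0 \<and>
           frontier E = (\<lambda>x. p0 + l *\<^sub>R x) ` frontier K"
proof (rule minimizer_frontier)
  show "2 \<le> DIM(real ^ 'd)" using assms(1,2) by simp
  show "convex_body K" using assms(3) by (simp add: smooth_strictly_convex_body_def)
qed (fact assms(4,5))+

end
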